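(* For each $c\in\{-1,0,1\}$, let $$\phi(x)=\phi_{\frac14,c}(x)=\sqrt{c+\sqrt{1+c^2}\cos(\sqrt2\,x)},\qquad x\in I=(-x_{\frac14,c},x_{\frac14,c}),$$ where $x_{\frac14,c}$ is the least positive solution of $\cos(\sqrt2\,x)=-\frac{c}{\sqrt{1+c^2}}$, and let $\mathcal{L}_\phi=-\phi(\partial_x^2+2)\phi$. Then: 1. The operator $\mathcal{L}_\phi$ is limit point at $x=\pm x_{\frac14,c}$. 2. The operator has discrete spectrum and there exists an orthogonal basis of $L^2(I)$ consisting of simple eigenfunctions of $\mathcal{L}_\phi$. 3. The ground state is given by $\phi$, with corresponding ground state energy (lowest eigenvalue) $\lambda_0=-2c$. 4. The first eigenvalue $\lambda_1>\lambda_0$ (the second-lowest eigenvalue) is positive.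
   Context: $\mathcal{L}_\phi w=-\phi\,(\partial_x^2+2)(\phi w)$ is regarded as a singular Sturm–Liouville operator, i.e. a symmetric unbounded operator on $L^2(I)$ with domain $C_0^\infty(I)$; it is bounded below, and $\mathcal{L}_\phi$ also denotes its Friedrichs extension. Limit point at an endpoint means that for some (equivalently every) $\lambda\in\mathbb{C}$ not all solutions of $\mathcal{L}_\phi u=\lambda u$ are square integrable near that endpoint. A simple eigenfunction is an eigenfunction whose eigenvalue has a one-dimensional eigenspace. *)

theory Defs
  imports "HOL-Analysis.Analysis"
begin

section \<open>Unbounded operators on complex \<open>L\<^sup>2\<close> spaces\<close>

text \<open>
  Elements of \<open>L\<^sup>2(M)\<close> are represented by square integrable functions, and two representatives
  stand for the same element iff they agree almost everywhere. An operator is given by its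
  graph: \<open>(u, f) \<in> T\<close> means that \<open>u\<close> lies in the domain of \<open>T\<close> and \<open>T u = f\<close>.
\<close>

definition L2 :: "'a measure \<Rightarrow> ('a \<Rightarrow> complex) set" where
  "L2 M = {f \<in> borel_measurable M. integrable M (\<lambda>x. (cmod (f x))\<^sup>2)}"

definition L2_inner :: "'a measure \<Rightarrow> ('a \<Rightarrow> complex) \<Rightarrow> ('a \<Rightarrow> complex) \<Rightarrow> complex" where
  "L2_inner M f g = (LINT x|M. f x * cnj (g x))"

definition L2_norm :: "'a measure \<Rightarrow> ('a \<Rightarrow> complex) \<Rightarrow> real" where
  "L2_norm M f = sqrt (LINT x|M. (cmod (f x))\<^sup>2)"

type_synonym 'a op = "(('a \<Rightarrow> complex) \<times> ('a \<Rightarrow> complex)) set"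

definition adjoint_op :: "'a measure \<Rightarrow> 'a op \<Rightarrow> 'a op" where
  "adjoint_op M T = {(u, f). u \<in> L2 M \<and> f \<in> L2 M \<and>
     (\<forall>(v, g) \<in> T. L2_inner M g u = L2_inner M v f)}"

text \<open>
  The domain of the closure of the quadratic form \<open>q(w) = \<langle>T w, w\<rangle>\<close> of a semibounded symmetric
  operator \<open>T\<close>: all \<open>L\<^sup>2\<close>-limits of sequences \<open>w\<^sub>n\<close> in the domain of \<open>T\<close> for which
  \<open>q(w\<^sub>n - w\<^sub>m)\<close> tends to 0. As the sequence converges in \<open>L\<^sup>2\<close>, it makes no difference whether a
  multiple of the \<open>L\<^sup>2\<close> norm is added to \<open>q\<close> in order to make it positive.
\<close>

definition form_domain :: "'a measure \<Rightarrow> 'a op \<Rightarrow> ('a \<Rightarrow> complex) set" where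
  "form_domain M T = {u \<in> L2 M. \<exists>w g :: nat \<Rightarrow> 'a \<Rightarrow> complex.
     (\<forall>n. (w n, g n) \<in> T) \<and>
     (\<lambda>n. L2_norm M (\<lambda>x. w n x - u x)) \<longlonglongrightarrow> 0 \<and>
     (\<forall>\<epsilon>>0. \<exists>N. \<forall>m\<ge>N. \<forall>n\<ge>N.
        cmod (L2_inner M (\<lambda>x. g n x - g m x) (\<lambda>x. w n x - w m x)) < \<epsilon>)}"

text \<open>
  The Friedrichs extension of a densely defined semibounded symmetric operator: the restriction
  of the adjoint to those elements of its domain that lie in the form domain.
\<close>

definition friedrichs_extension :: "'a measure \<Rightarrow> 'a op \<Rightarrow> 'a op" where
  "friedrichs_extension M T = {(u, f) \<in> adjoint_op M T. u \<in> form_domain M T}"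

definition eigenspace :: "'a op \<Rightarrow> complex \<Rightarrow> ('a \<Rightarrow> complex) set" where
  "eigenspace T \<mu> = {u. (u, \<lambda>x. \<mu> * u x) \<in> T}"

definition eigenfunction :: "'a measure \<Rightarrow> 'a op \<Rightarrow> complex \<Rightarrow> ('a \<Rightarrow> complex) \<Rightarrow> bool" where
  "eigenfunction M T \<mu> u \<longleftrightarrow> u \<in> eigenspace T \<mu> \<and> \<not> (AE x in M. u x = 0)"

definition simple_eigenfunction ::
    "'a measure \<Rightarrow> 'a op \<Rightarrow> complex \<Rightarrow> ('a \<Rightarrow> complex) \<Rightarrow> bool" where
  "simple_eigenfunction M T \<mu> u \<longleftrightarrow> eigenfunction M T \<mu> u \<and>
     (\<forall>v \<in> eigenspace T \<mu>. \<exists>k. AE x in M. v x = k * u x)"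

definition eigenvalues :: "'a measure \<Rightarrow> 'a op \<Rightarrow> complex set" where
  "eigenvalues M T = {\<mu>. \<exists>u. eigenfunction M T \<mu> u}"

definition finite_multiplicity :: "'a measure \<Rightarrow> 'a op \<Rightarrow> complex \<Rightarrow> bool" where
  "finite_multiplicity M T \<mu> \<longleftrightarrow>
     (\<exists>B. finite B \<and> B \<subseteq> eigenspace T \<mu> \<and>
        (\<forall>v \<in> eigenspace T \<mu>. \<exists>a. AE x in M. v x = (\<Sum>b\<in>B. a b * b x)))"

text \<open>
  \<open>\<mu>\<close> is in the resolvent set iff \<open>T - \<mu>\<close> is onto \<open>L\<^sup>2(M)\<close> and has a bounded inverse; the
  estimate contains the injectivity of \<open>T - \<mu>\<close>.
\<close>

definition resolvent_set :: "'a measure \<Rightarrow> 'a op \<Rightarrow> complex set" where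
  "resolvent_set M T = {\<mu>.
     (\<forall>f \<in> L2 M. \<exists>(u, g) \<in> T. AE x in M. g x - \<mu> * u x = f x) \<and>
     (\<exists>C. \<forall>(u, g) \<in> T. L2_norm M u \<le> C * L2_norm M (\<lambda>x. g x - \<mu> * u x))}"

definition op_spectrum :: "'a measure \<Rightarrow> 'a op \<Rightarrow> complex set" where
  "op_spectrum M T = - resolvent_set M T"

text \<open>
  For self-adjoint \<open>T\<close>: the spectrum is purely discrete, i.e. the essential spectrum is empty.
\<close>

definition has_discrete_spectrum :: "'a measure \<Rightarrow> 'a op \<Rightarrow> bool" where
  "has_discrete_spectrum M T \<longleftrightarrow>
     (\<forall>\<mu> \<in> op_spectrum M T. \<mu> isolated_in op_spectrum M T \<and>
        \<mu> \<in> eigenvalues M T \<and> finite_multiplicity M T \<mu>)"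

definition orthogonal_basis :: "'a measure \<Rightarrow> ('a \<Rightarrow> complex) set \<Rightarrow> bool" where
  "orthogonal_basis M B \<longleftrightarrow> B \<subseteq> L2 M \<and>
     (\<forall>e \<in> B. \<not> (AE x in M. e x = 0)) \<and>
     (\<forall>e \<in> B. \<forall>e' \<in> B. e \<noteq> e' \<longrightarrow> L2_inner M e e' = 0) \<and>
     (\<forall>f \<in> L2 M. \<forall>\<epsilon>>0. \<exists>S a. finite S \<and> S \<subseteq> B \<and>
        L2_norm M (\<lambda>x. f x - (\<Sum>e\<in>S. a e * e x)) < \<epsilon>)"

definition is_lowest :: "complex set \<Rightarrow> real \<Rightarrow> bool" where
  "is_lowest S t \<longleftrightarrow> complex_of_real t \<in> S \<and> (\<forall>z \<in> S. z \<in> \<real> \<and> t \<le> Re z)"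


section \<open>The Sturm--Liouville operator\<close>

definition vderiv :: "(real \<Rightarrow> complex) \<Rightarrow> real \<Rightarrow> complex" where
  "vderiv f x = vector_derivative f (at x)"

definition test_functions :: "real set \<Rightarrow> (real \<Rightarrow> complex) set" where
  "test_functions I = {w. (\<forall>n x. (vderiv ^^ n) w differentiable (at x)) \<and>
     compact (closure {x. w x \<noteq> 0}) \<and> closure {x. w x \<noteq> 0} \<subseteq> I}"

text \<open>The differential expression \<open>w \<mapsto> -\<phi> (\<partial>\<^sub>x\<^sup>2 + 2) (\<phi> w)\<close>.\<close>

definition SL_expr :: "(real \<Rightarrow> real) \<Rightarrow> (real \<Rightarrow> complex) \<Rightarrow> real \<Rightarrow> complex" where
  "SL_expr \<phi> w x = - of_real (\<phi> x) *
     (vderiv (vderiv (\<lambda>y. of_real (\<phi> y) * w y)) x + 2 * (of_real (\<phi> x) * w x))"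

definition SL_minimal :: "(real \<Rightarrow> real) \<Rightarrow> real set \<Rightarrow> real op" where
  "SL_minimal \<phi> I = {(w, SL_expr \<phi> w) | w. w \<in> test_functions I}"

definition SL_friedrichs :: "(real \<Rightarrow> real) \<Rightarrow> real set \<Rightarrow> real op" where
  "SL_friedrichs \<phi> I = friedrichs_extension (lebesgue_on I) (SL_minimal \<phi> I)"

definition SL_solution :: "(real \<Rightarrow> real) \<Rightarrow> real set \<Rightarrow> complex \<Rightarrow> (real \<Rightarrow> complex) \<Rightarrow> bool" where
  "SL_solution \<phi> I \<mu> u \<longleftrightarrow> (\<forall>x \<in> I. u differentiable (at x) \<and>
     vderiv u differentiable (at x) \<and> SL_expr \<phi> u x = \<mu> * u x)"

definition square_integrable_near :: "real set \<Rightarrow> real \<Rightarrow> (real \<Rightarrow> complex) \<Rightarrow> bool" where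
  "square_integrable_near I e u \<longleftrightarrow> (\<exists>\<delta>>0. u \<in> L2 (lebesgue_on (I \<inter> ball e \<delta>)))"

definition limit_point_at :: "(real \<Rightarrow> real) \<Rightarrow> real set \<Rightarrow> real \<Rightarrow> bool" where
  "limit_point_at \<phi> I e \<longleftrightarrow>
     (\<exists>\<mu>. \<not> (\<forall>u. SL_solution \<phi> I \<mu> u \<longrightarrow> square_integrable_near I e u))"


section \<open>The profile \<open>\<phi>\<close>\<close>

definition x_end :: "real \<Rightarrow> real" where
  "x_end c = (LEAST x. 0 < x \<and> cos (sqrt 2 * x) = - c / sqrt (1 + c\<^sup>2))"

text \<open>The set of positive solutions does have a least element.\<close>

lemma x_end_eq: "x_end c = arccos (- c / sqrt (1 + c\<^sup>2)) / sqrt 2"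
proof -
  let ?r = "- c / sqrt (1 + c\<^sup>2)"
  have "\<bar>c\<bar> < sqrt (1 + c\<^sup>2)"
    by (rule real_less_rsqrt) simp
  moreover have "0 < sqrt (1 + c\<^sup>2)"
    by (simp add: add_pos_nonneg)
  ultimately have r: "-1 < ?r" "?r < 1"
    by (auto simp: pos_divide_less_eq pos_less_divide_eq)
  show ?thesis
    unfolding x_end_def
  proof (rule Least_equality)
    show "0 < arccos ?r / sqrt 2 \<and> cos (sqrt 2 * (arccos ?r / sqrt 2)) = ?r"
      using r arccos_lt_bounded[of ?r] by (simp add: cos_arccos)
  next
    fix y assume y: "0 < y \<and> cos (sqrt 2 * y) = ?r"
    show "arccos ?r / sqrt 2 \<le> y"
    proof (rule ccontr)
      assume "\<not> arccos ?r / sqrt 2 \<le> y"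
      then have less: "sqrt 2 * y < arccos ?r"
        by (simp add: field_simps)
      moreover have "arccos ?r \<le> pi"
        using r by (intro arccos_ubound) auto
      ultimately have "arccos (cos (sqrt 2 * y)) = sqrt 2 * y"
        using y by (intro arccos_cos) auto
      with less y show False by simp
    qed
  qed
qed

definition I_phi :: "real \<Rightarrow> real set" where
  "I_phi c = {- x_end c <..< x_end c}"

definition phi :: "real \<Rightarrow> real \<Rightarrow> real" where
  "phi c x = sqrt (c + sqrt (1 + c\<^sup>2) * cos (sqrt 2 * x))"

end

theory Submission
  imports Defs "HOL-Complex_Analysis.Great_Picard" "HOL-Real_Asymp.Real_Asymp"
begin

text \<open>
  Write \<open>\<psi> = \<phi>\<^sup>2\<close>; it satisfies \<open>\<psi>'' = 2 c - 2 \<psi>\<close> and is comparable to \<open>\<tau> = a\<^sup>2 - x\<^sup>2\<close>, where \<open>a\<close>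
  is the right endpoint. With \<open>w = \<phi> v\<close> one finds \<open>(L + 2 c) w = - \<phi>\<^sup>-\<^sup>1 (\<psi>\<^sup>2 v')'\<close>, so that \<open>\<phi>\<close> is
  an eigenfunction for \<open>- 2 c\<close> and \<open>L + 2 c\<close> is inverted by integrating twice:
  \<open>w = \<phi> (\<alpha> - \<integral> \<psi>\<^sup>-\<^sup>2 \<integral> \<phi> h)\<close> with \<open>h = (L + 2 c) w\<close>. If \<open>\<psi>\<^sup>2 v'\<close> had a nonzero limit at an
  endpoint, \<open>w\<close> would not be square integrable there. Hence the inner primitive vanishes at both
  endpoints, \<open>h\<close> is orthogonal to \<open>\<phi>\<close>, and on the orthogonal complement of \<open>\<phi>\<close> the inverse of
  \<open>L + 2 c\<close> is a compact symmetric operator. This gives the discrete spectrum and the completeness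
  of the eigenfunctions. Eigenvalues are simple because the Wronskian of two eigenfunctions tends
  to 0 at the endpoints. An eigenfunction of an eigenvalue \<open>\<mu> > - 2 c\<close> has a zero \<open>x0\<close>; comparing
  \<open>\<psi> v\<close>, which solves \<open>W'' + 2 W = - \<mu> v\<close>, with \<open>sin (sqrt 2 * (x - x0))\<close> shows \<open>\<mu> > 0\<close>.
\<close>

subsection \<open>Compact symmetric operators on inner product spaces\<close>

text \<open>The Friedrichs domain is given only through weak equations and form limits, while the
  spectral argument needs an explicit description. The limit point property provides it:
  \<open>canonical\<close> is shown to hold on the whole adjoint domain, and \<open>T_iff\<close>
  follows once each canonical element is also a form limit of test functions. For that part the
  variable is \<open>P = \<psi> v'\<close>: the form of \<open>\<phi> v\<close>, shifted by
  \<open>2 c\<close>, is the squared L2 norm of \<open>P\<close>, so form approximation becomes L2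
  approximation of \<open>P\<close> under two linear constraints (compact support of
  \<open>v\<close> and its value at 0).

  The exponents of \<tau> decide the rest. For \<open>h\<close> orthogonal to \<open>\<phi>\<close>
  the inner primitive is of order \<tau> and the outer integrand of order 1/\<tau>; its primitive is
  logarithmic, hence below a multiple of \<tau>^(-1/4), and the factor \<open>\<phi>\<close>, of
  order \<tau>^(1/2), leaves \<tau>^(1/4). This surplus yields uniform bounds, compactness and
  vanishing boundary terms.

  The Hilbert space arguments live in the class \<open>real_inner\<close>: each limit is supplied by
  compactness of \<open>K\<close>, and complex scalars act as bounded real-linear maps.\<close>

locale compact_symmetric =
  fixes K :: "'a::real_inner \<Rightarrow> 'a"
  assumes linear_K: "linear K"
    and sym: "inner (K x) y = inner x (K y)"
    and compact_K: "(\<And>n::nat. norm (s n) \<le> 1) \<Longrightarrow> \<exists>l r. strict_mono r \<and> (\<lambda>n. K (s (r n))) \<longlonglongrightarrow> l"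
begin

text \<open>Otherwise there are normalized vectors whose images have norms exceeding every integer,
  whereas compactness makes a subsequence of the images converge and hence stay bounded.\<close>

lemma norm_bound: "\<exists>C>0. \<forall>x. norm (K x) \<le> C * norm x"
proof (rule ccontr)
  assume neg: "\<not> ?thesis"
  have "\<exists>x. norm (K x) > (real n + 1) * norm x" for n
  proof -
    have "real n + 1 > 0" by simp
    with neg show ?thesis by (meson not_le)
  qed
  then obtain x where x: "norm (K (x n)) > (real n + 1) * norm (x n)" for n by metis
  have nz: "x n \<noteq> 0" for n using x[of n] linear_0[OF linear_K] by auto
  define y where "y n = x n /\<^sub>R norm (x n)" for n
  have "norm (y n) \<le> 1" for n by (simp add: y_def nz)
  from compact_K[of y, OF this] obtain l r where r: "strict_mono r" "(\<lambda>n. K (y (r n))) \<longlonglongrightarrow> l" by blast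
  have big: "norm (K (y n)) \<ge> real n" for n
  proof -
    have "real n * norm (x n) \<le> norm (K (x n))" using x[of n] norm_ge_zero[of "x n"]
      by (simp add: algebra_simps del: norm_ge_zero)
    then show ?thesis using nz[of n] by (simp add: y_def linear_scale[OF linear_K] field_simps)
  qed
  obtain B where B: "norm (K (y (r n))) \<le> B" for n
    using convergent_imp_Bseq[of "\<lambda>n. K (y (r n))"] r(2) by (auto simp: convergent_def Bseq_def)
  obtain n where "real n > B" using reals_Archimedean2 by blast
  with big[of "r n"] B[of n] seq_suble[OF r(1), of n] show False by linarith
qed

lemma bounded_linear_K: "bounded_linear K"
proof -
  obtain C where "\<forall>x. norm (K x) \<le> C * norm x" using norm_bound by blast
  then show ?thesis using linear_K
    by (intro bounded_linear_intro[where K = C]) (auto simp: linear_add linear_scale mult.commute)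
qed

lemma compact_bounded:
  assumes "\<And>n::nat. norm (x n) \<le> B"
  shows "\<exists>l r. strict_mono r \<and> (\<lambda>n. K (x (r n))) \<longlonglongrightarrow> l"
proof -
  define C where "C = max B 1"
  have C: "C > 0" "norm (x n) \<le> C" for n using assms[of n] by (auto simp: C_def)
  have "norm (x n /\<^sub>R C) \<le> 1" for n using C by (simp add: field_simps)
  from compact_K[of "\<lambda>n. x n /\<^sub>R C", OF this] obtain l r where r: "strict_mono r" "(\<lambda>n. K (x (r n) /\<^sub>R C)) \<longlonglongrightarrow> l" by blast
  from tendsto_scaleR[OF tendsto_const[of C] r(2)] C have "(\<lambda>n. K (x (r n))) \<longlonglongrightarrow> C *\<^sub>R l"
    by (simp add: linear_scale[OF linear_K])
  with r(1) show ?thesis by blast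
qed

text \<open>The eigenvector is obtained from a maximizing sequence for \<open>norm (K x)\<close> on the unit sphere
  of \<open>F\<close>: along it \<open>K\<^sup>2 x - m\<^sup>2 x\<close> tends to 0, and \<open>K\<^sup>2 - m\<^sup>2 = (K - m) (K + m)\<close>.\<close>

lemma max_eigenvector:
  assumes F: "subspace F" "closed F" "\<And>x. x \<in> F \<Longrightarrow> K x \<in> F" and nz: "x0 \<in> F" "K x0 \<noteq> 0"
  shows "\<exists>h \<nu>. h \<in> F \<and> h \<noteq> 0 \<and> K h = \<nu> *\<^sub>R h \<and> (\<forall>x\<in>F. norm (K x) \<le> \<bar>\<nu>\<bar> * norm x)"
proof -
  interpret bounded_linear K by (rule bounded_linear_K)
  define A where "A = {norm (K x) | x. x \<in> F \<and> norm x = 1}"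
  define m where "m = Sup A"
  obtain C where C: "\<And>x. norm (K x) \<le> C * norm x" using norm_bound by blast
  have bdd: "bdd_above A" 
    unfolding A_def by (rule bdd_aboveI[of _ C]) (use C in \<open>auto, metis mult.right_neutral\<close>)
  have unit: "norm (K x) \<le> m * norm x" if "x \<in> F" for x
  proof (cases "x = 0")
    case False
    have "norm (K (x /\<^sub>R norm x)) \<in> A"
      unfolding A_def using False that F(1) by (auto intro!: exI[of _ "x /\<^sub>R norm x"] simp: subspace_scale)
    from cSup_upper[OF this bdd] show ?thesis using False by (simp add: m_def scaleR field_simps)
  qed (simp add: zero)
  have m0: "m > 0" 
  proof -
    have "0 < m * norm x0" using unit[OF nz(1)] nz(2) by (metis order_less_le_trans zero_less_norm_iff)
    then show ?thesis by (simp add: zero_less_mult_iff)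
  qed
  have Ane: "A \<noteq> {}"
  proof -
    have "x0 \<noteq> 0" using nz(2) zero by auto
    then have "norm (K (x0 /\<^sub>R norm x0)) \<in> A"
      unfolding A_def using F(1) nz(1) by (auto intro!: exI[of _ "x0 /\<^sub>R norm x0"] simp: subspace_scale)
    then show ?thesis by auto
  qed
  have "\<exists>x. x \<in> F \<and> norm x = 1 \<and> norm (K x) > m - 1 / (real n + 1)" for n
  proof -
    have "\<exists>t\<in>A. t > m - 1 / (real n + 1)"
      using less_cSup_iff[OF Ane bdd, of "m - 1 / (real n + 1)"] by (simp add: m_def)
    then show ?thesis by (auto simp: A_def)
  qed
  then obtain x where x: "\<And>n. x n \<in> F" "\<And>n. norm (x n) = 1"
    "\<And>n::nat. norm (K (x n)) > m - 1 / (real n + 1)" by metis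
  obtain l r where r: "strict_mono r" "(\<lambda>n. K (x (r n))) \<longlonglongrightarrow> l" using compact_K[of x] x(2) by auto
  have lF: "l \<in> F"
    by (rule closed_sequentially[OF F(2) _ r(2)]) (use x F(3) in auto)
  have lim1: "(\<lambda>n. norm (K (x n))) \<longlonglongrightarrow> m"
  proof (rule real_tendsto_sandwich)
    show "(\<lambda>n. m - 1 / (real n + 1)) \<longlonglongrightarrow> m"
      using tendsto_diff[OF tendsto_const[of m] LIMSEQ_inverse_real_of_nat] by (simp add: inverse_eq_divide add.commute)
    show "\<forall>\<^sub>F n in sequentially. m - 1 / (real n + 1) \<le> norm (K (x n))"
      using x(3) by (simp add: less_imp_le)
    show "\<forall>\<^sub>F n in sequentially. norm (K (x n)) \<le> m" using unit[OF x(1)] x(2) by simp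
  qed simp
  have nl: "norm l = m"
    using LIMSEQ_unique[OF tendsto_norm[OF r(2)] LIMSEQ_subseq_LIMSEQ[OF lim1 r(1), unfolded o_def]] .
  \<comment> \<open>In the expansion of the square, symmetry turns the cross term into
    \<open>(norm (K (x n)))\<^sup>2\<close>, and the supremum \<open>m\<close> on the invariant
    space \<open>F\<close> bounds \<open>K (K (x n))\<close>.\<close>
  have sq: "(norm (K (K (x n)) - m\<^sup>2 *\<^sub>R x n))\<^sup>2 \<le> m\<^sup>2 * (m\<^sup>2 - (norm (K (x n)))\<^sup>2)" for n
  proof -
    have "norm (K (K (x n))) \<le> m * norm (K (x n))" using unit[OF F(3)[OF x(1)]] .
    then have "(norm (K (K (x n))))\<^sup>2 \<le> m\<^sup>2 * (norm (K (x n)))\<^sup>2"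
      by (metis norm_ge_zero power_mono power_mult_distrib)
    moreover have "inner (K (K (x n))) (x n) = (norm (K (x n)))\<^sup>2"
      by (simp add: sym power2_norm_eq_inner)
    moreover have "(norm (K (K (x n)) - m\<^sup>2 *\<^sub>R x n))\<^sup>2
        = (norm (K (K (x n))))\<^sup>2 - 2 * m\<^sup>2 * inner (K (K (x n))) (x n) + m^4 * (norm (x n))\<^sup>2"
      unfolding power2_norm_eq_inner by (simp add: inner_diff inner_commute algebra_simps power2_eq_square power4_eq_xxxx)
    ultimately show ?thesis using x(2)[of n] by (simp add: algebra_simps power2_eq_square power4_eq_xxxx)
  qed
  have "(\<lambda>n. m\<^sup>2 * (m\<^sup>2 - (norm (K (x n)))\<^sup>2)) \<longlonglongrightarrow> m\<^sup>2 * (m\<^sup>2 - m\<^sup>2)"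
    by (intro tendsto_intros lim1)
  then have "(\<lambda>n. m\<^sup>2 * (m\<^sup>2 - (norm (K (x n)))\<^sup>2)) \<longlonglongrightarrow> 0" by simp
  moreover have "\<forall>\<^sub>F n in sequentially. norm ((norm (K (K (x n)) - m\<^sup>2 *\<^sub>R x n))\<^sup>2) \<le> m\<^sup>2 * (m\<^sup>2 - (norm (K (x n)))\<^sup>2)"
    by (rule always_eventually) (metis abs_power2 real_norm_def sq)
  ultimately have "(\<lambda>n. (norm (K (K (x n)) - m\<^sup>2 *\<^sub>R x n))\<^sup>2) \<longlonglongrightarrow> 0"
    by (rule Lim_null_comparison[rotated])
  then have "(\<lambda>n. sqrt ((norm (K (K (x n)) - m\<^sup>2 *\<^sub>R x n))\<^sup>2)) \<longlonglongrightarrow> sqrt 0"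
    by (rule tendsto_real_sqrt)
  then have d0: "(\<lambda>n. K (K (x n)) - m\<^sup>2 *\<^sub>R x n) \<longlonglongrightarrow> 0" by (simp add: tendsto_norm_zero_iff)
  have "(\<lambda>n. K (K (K (x (r n)) - 0)) - K (K (K (x (r n))) - m\<^sup>2 *\<^sub>R x (r n))) \<longlonglongrightarrow> K (K (l - 0)) - K 0"
    by (intro tendsto_intros tendsto r(2) LIMSEQ_subseq_LIMSEQ[OF d0 r(1), unfolded o_def])
  then have "(\<lambda>n. m\<^sup>2 *\<^sub>R K (x (r n))) \<longlonglongrightarrow> K (K l)" by (simp add: diff scaleR zero)
  from LIMSEQ_unique[OF this tendsto_scaleR[OF tendsto_const r(2)]]
  have KK: "K (K l) = m\<^sup>2 *\<^sub>R l" .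
  have l0: "l \<noteq> 0" using nl m0 by auto
  show ?thesis
  \<comment> \<open>\<open>K - m\<close> annihilates \<open>K l + m *\<^sub>R l\<close>. If this
    vector is zero, \<open>l\<close> belongs to the eigenvalue \<open>- m\<close>; otherwise the
    vector itself belongs to \<open>m\<close>.\<close>
  proof (cases "K l + m *\<^sub>R l = 0")
    case True
    then have "K l = (- m) *\<^sub>R l" by (simp add: add_eq_0_iff2)
    then show ?thesis using lF l0 unit m0 by (metis abs_minus abs_of_pos)
  next
    case False
    have "K (K l + m *\<^sub>R l) = m *\<^sub>R (K l + m *\<^sub>R l)"
      by (simp add: add scaleR KK scaleR_add_right power2_eq_square)
    moreover have "K l + m *\<^sub>R l \<in> F" using lF F by (auto intro: subspace_add subspace_scale)
    ultimately show ?thesis using False unit m0 by (metis abs_of_pos)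
  qed
qed

text \<open>By Pythagoras the images of two distinct members are at distance at least \<epsilon>, so
  the images of an infinite sequence of members have no Cauchy subsequence.\<close>

lemma finite_orthonormal_eigenvectors:
  assumes "\<epsilon> > 0" and orth: "pairwise (\<lambda>x y. inner x y = 0) S"
    and S: "\<And>e. e \<in> S \<Longrightarrow> norm e = 1 \<and> (\<exists>\<nu>. \<bar>\<nu>\<bar> \<ge> \<epsilon> \<and> K e = \<nu> *\<^sub>R e)"
  shows "finite S"
proof (rule ccontr)
  assume "infinite S"
  then obtain e :: "nat \<Rightarrow> 'a" where e: "inj e" "range e \<subseteq> S" using infinite_countable_subset by blast
  obtain \<nu> where \<nu>: "\<And>n. \<bar>\<nu> n\<bar> \<ge> \<epsilon>" "\<And>n. K (e n) = \<nu> n *\<^sub>R e n" proof -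
    have "\<forall>n. \<exists>\<nu>. \<bar>\<nu>\<bar> \<ge> \<epsilon> \<and> K (e n) = \<nu> *\<^sub>R e n" using S e(2) by blast
    then show ?thesis using that by metis
  qed
  have n1: "norm (e n) = 1" for n using S e(2) by auto
  then have "norm (e n) \<le> 1" for n by simp
  from compact_K[of e, OF this] obtain l r where r: "strict_mono r" "(\<lambda>n. K (e (r n))) \<longlonglongrightarrow> l" by blast
  from LIMSEQ_imp_Cauchy[OF r(2)] assms(1) obtain N
    where N: "\<And>i j. i \<ge> N \<Longrightarrow> j \<ge> N \<Longrightarrow> dist (K (e (r i))) (K (e (r j))) < \<epsilon>"
    unfolding Cauchy_def by blast
  define i j where "i = r N" and "j = r (Suc N)"
  have "e i \<noteq> e j" using e(1) r(1) unfolding i_def j_def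
    by (metis injD n_not_Suc_n strict_mono_eq)
  with orth e(2) have o: "inner (e i) (e j) = 0" unfolding pairwise_def by blast
  have "(norm (K (e i) - K (e j)))\<^sup>2 = (\<nu> i)\<^sup>2 * (norm (e i))\<^sup>2 + (\<nu> j)\<^sup>2 * (norm (e j))\<^sup>2"
    unfolding power2_norm_eq_inner using o by (simp add: \<nu> inner_diff inner_commute algebra_simps power2_eq_square)
  then have "(norm (K (e i) - K (e j)))\<^sup>2 \<ge> (\<nu> i)\<^sup>2" by (simp add: n1)
  moreover have "(\<nu> i)\<^sup>2 \<ge> \<epsilon>\<^sup>2" using \<nu>(1)[of i] assms(1) by (metis abs_le_square_iff abs_of_pos)
  ultimately have "norm (K (e i) - K (e j)) \<ge> \<epsilon>"
    by (meson norm_ge_zero order_trans power2_le_imp_le)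
  with N[of N "Suc N"] show False by (simp add: i_def j_def dist_norm)
qed

text \<open>\<open>S\<close> is a maximal orthonormal family of eigenvectors with
  \<open>\<bar>\<nu>\<bar> \<ge> \<epsilon>\<close>. Its orthogonal complement is invariant by
  symmetry of \<open>K\<close>; if \<open>K\<close> exceeded \<epsilon> somewhere on it,
  \<open>max_eigenvector\<close> would supply a further member of the family.\<close>

lemma spectral_truncation:
  assumes "\<epsilon> > 0"
  obtains S where "finite S" "pairwise (\<lambda>x y. inner x y = 0) S"
    "\<And>e. e \<in> S \<Longrightarrow> norm e = 1 \<and> (\<exists>\<nu>. \<bar>\<nu>\<bar> \<ge> \<epsilon> \<and> K e = \<nu> *\<^sub>R e)"
    "\<And>x. (\<And>e. e \<in> S \<Longrightarrow> inner e x = 0) \<Longrightarrow> norm (K x) \<le> \<epsilon> * norm x"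
proof -
  interpret bounded_linear K by (rule bounded_linear_K)
  define E where "E = {e. norm e = 1 \<and> (\<exists>\<nu>. \<bar>\<nu>\<bar> \<ge> \<epsilon> \<and> K e = \<nu> *\<^sub>R e)}"
  define \<A> where "\<A> = {S. S \<subseteq> E \<and> pairwise (\<lambda>x y. inner x y = 0) S}"
  have "\<exists>M\<in>\<A>. \<forall>X\<in>\<A>. M \<subseteq> X \<longrightarrow> X = M"
  proof (rule subset_Zorn)
    fix C assume C: "subset.chain \<A> C"
    have "inner x y = 0" if xy: "x \<in> \<Union>C" "y \<in> \<Union>C" "x \<noteq> y" for x y
    proof -
      obtain A B where AB: "A \<in> C" "x \<in> A" "B \<in> C" "y \<in> B" using xy by blast
      have "A \<subseteq> B \<or> B \<subseteq> A" using C AB unfolding subset.chain_def by blast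
      then obtain D where "D \<in> C" "x \<in> D" "y \<in> D" using AB by blast
      moreover from this have "pairwise (\<lambda>x y. inner x y = 0) D" using C by (auto simp: \<A>_def subset.chain_def)
      ultimately show ?thesis using xy(3) by (simp add: pairwise_def)
    qed
    moreover have "\<Union>C \<subseteq> E" using C by (auto simp: \<A>_def subset.chain_def)
    ultimately have "\<Union>C \<in> \<A>" by (auto simp: \<A>_def pairwise_def)
    then show "\<exists>U\<in>\<A>. \<forall>X\<in>C. X \<subseteq> U" by auto
  qed
  then obtain S where "S \<in> \<A>" and max: "\<And>X. X \<in> \<A> \<Longrightarrow> S \<subseteq> X \<Longrightarrow> X = S" by auto
  then have S: "S \<subseteq> E" "pairwise (\<lambda>x y. inner x y = 0) S" by (auto simp: \<A>_def)
  have fin: "finite S" using finite_orthonormal_eigenvectors[OF assms S(2)] S(1) by (auto simp: E_def)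
  have "norm (K x) \<le> \<epsilon> * norm x" if "\<And>e. e \<in> S \<Longrightarrow> inner e x = 0" for x
  proof (rule ccontr)
    assume big: "\<not> norm (K x) \<le> \<epsilon> * norm x"
    define F where "F = {x. \<forall>e\<in>S. inner e x = 0}"
    have "subspace F" by (auto simp: F_def subspace_def inner_add_right)
    moreover have "closed F"
    proof -
      have "F = (\<Inter>e\<in>S. {x. inner e x = 0})" by (auto simp: F_def)
      then show ?thesis by (simp only:) (intro closed_INT ballI closed_Collect_eq continuous_intros)
    qed
    moreover have "K y \<in> F" if "y \<in> F" for y
    proof -
      have "inner e (K y) = 0" if e: "e \<in> S" for e
      proof -
        obtain \<nu> where "K e = \<nu> *\<^sub>R e" using e S(1) by (auto simp: E_def)
        then show ?thesis using \<open>y \<in> F\<close> e by (simp add: sym[symmetric] F_def)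
      qed
      then show ?thesis by (simp add: F_def)
    qed
    moreover have x: "x \<in> F" using that by (auto simp: F_def)
    moreover have "K x \<noteq> 0" using big assms by auto
    ultimately obtain h \<nu> where h: "h \<in> F" "h \<noteq> 0" "K h = \<nu> *\<^sub>R h" "\<And>x. x\<in>F \<Longrightarrow> norm (K x) \<le> \<bar>\<nu>\<bar> * norm x"
      using max_eigenvector[of F x] by auto
    have "\<bar>\<nu>\<bar> \<ge> \<epsilon>" using h(4)[OF x] big
      by (smt (verit) mult_right_mono norm_ge_zero)
    then have hE: "h /\<^sub>R norm h \<in> E" using h by (auto simp: E_def scaleR)
    have "insert (h /\<^sub>R norm h) S \<in> \<A>" using hE S h(1)
      by (auto simp: \<A>_def pairwise_insert F_def inner_commute)
    from max[OF this] have "h /\<^sub>R norm h \<in> S" by auto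
    with h(1) have "inner (h /\<^sub>R norm h) h = 0" unfolding F_def by blast
    with h(2) show False by (simp add: power2_norm_eq_inner[symmetric])
  qed
  moreover have "norm e = 1 \<and> (\<exists>\<nu>. \<bar>\<nu>\<bar> \<ge> \<epsilon> \<and> K e = \<nu> *\<^sub>R e)" if "e \<in> S" for e
    using S(1) that by (auto simp: E_def)
  ultimately show ?thesis using that[OF fin S(2)] by blast
qed

text \<open>Subtract from \<open>x\<close> its projection \<open>p\<close> onto a truncation for a
  small level \<delta>: \<open>K p\<close> is a combination of eigenvectors, and \<open>K\<close> is
  at most \<delta> on the remainder, whose norm does not exceed that of \<open>x\<close>.\<close>

lemma range_in_closure_span_eigenvectors:
  "K x \<in> closure (span {e. \<exists>\<nu>. \<nu> \<noteq> 0 \<and> K e = \<nu> *\<^sub>R e})"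
proof (subst closure_approachable, intro allI impI)
  interpret bounded_linear K by (rule bounded_linear_K)
  fix \<epsilon> :: real assume \<epsilon>: "\<epsilon> > 0"
  define \<delta> where "\<delta> = \<epsilon> / (2 * (norm x + 1))"
  have \<delta>: "\<delta> > 0" using \<epsilon> by (simp add: \<delta>_def add_nonneg_pos)
  from spectral_truncation[OF \<delta>] obtain S where S: "finite S" "pairwise (\<lambda>x y. inner x y = 0) S"
    "\<And>e. e \<in> S \<Longrightarrow> norm e = 1 \<and> (\<exists>\<nu>. \<bar>\<nu>\<bar> \<ge> \<delta> \<and> K e = \<nu> *\<^sub>R e)"
    "\<And>x. (\<And>e. e \<in> S \<Longrightarrow> inner e x = 0) \<Longrightarrow> norm (K x) \<le> \<delta> * norm x" by blast
  define p where "p = (\<Sum>e\<in>S. inner e x *\<^sub>R e)"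
  have ip: "inner e p = inner e x" if "e \<in> S" for e
  proof -
    have "inner e p = (\<Sum>e'\<in>S. if e' = e then inner e x else 0)"
      unfolding p_def inner_sum_right
      by (rule sum.cong) (use S(2,3) that in \<open>auto simp: pairwise_def norm_eq_1\<close>)
    then show ?thesis using S(1) that by simp
  qed
  have "inner p (x - p) = 0" unfolding p_def inner_sum_left
    by (rule sum.neutral) (use ip in \<open>auto simp: inner_diff_right p_def\<close>)
  then have "(norm x)\<^sup>2 = (norm p)\<^sup>2 + (norm (x - p))\<^sup>2"
    unfolding power2_norm_eq_inner by (simp add: inner_diff inner_commute)
  then have "norm (x - p) \<le> norm x"
    by (metis add_0 add_le_same_cancel2 le_add_same_cancel2 norm_ge_zero power2_le_imp_le zero_le_power2)
  moreover have "norm (K (x - p)) \<le> \<delta> * norm (x - p)" by (rule S(4)) (simp add: inner_diff_right ip)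
  ultimately have "norm (K (x - p)) \<le> \<delta> * norm x" using \<delta> by (meson less_imp_le mult_left_mono order_trans)
  also have "\<dots> < \<epsilon>" using \<epsilon> 
  proof -
    have "\<epsilon> * norm x < \<epsilon> * (2 * (norm x + 1))"
      using \<epsilon> by (intro mult_strict_left_mono) (auto simp: add.commute add_strict_increasing2)
    then show ?thesis by (simp add: \<delta>_def divide_simps add_nonneg_pos)
  qed
  finally have "dist (K p) (K x) < \<epsilon>" by (simp add: dist_norm diff norm_minus_commute)
  moreover have "K p \<in> span {e. \<exists>\<nu>. \<nu> \<noteq> 0 \<and> K e = \<nu> *\<^sub>R e}"
  proof -
    have "inner e x *\<^sub>R K e \<in> span {e. \<exists>\<nu>. \<nu> \<noteq> 0 \<and> K e = \<nu> *\<^sub>R e}" if "e \<in> S" for e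
    proof -
      obtain \<nu> where "\<bar>\<nu>\<bar> \<ge> \<delta>" "K e = \<nu> *\<^sub>R e" using S(3) \<open>e \<in> S\<close> by blast
      moreover from this \<delta> have "e \<in> {e. \<exists>\<nu>. \<nu> \<noteq> 0 \<and> K e = \<nu> *\<^sub>R e}"
        by (intro CollectI exI[of _ \<nu>]) auto
      ultimately show ?thesis by (simp add: span_scale span_base)
    qed
    then show ?thesis by (simp add: p_def sum scaleR span_sum)
  qed
  ultimately show "\<exists>y\<in>span {e. \<exists>\<nu>. \<nu> \<noteq> 0 \<and> K e = \<nu> *\<^sub>R e}. dist y (K x) < \<epsilon>" by blast
qed

text \<open>\<open>Z\<close> will be multiplication by a complex spectral parameter, which is only a
  real-linear map in this setting. A normalized sequence along which \<open>u - Z (K u)\<close>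
  tends to 0 has a subsequence converging to some \<open>Z l\<close> with
  \<open>K (Z l) = l\<close>; injectivity makes this limit 0, although its norm is 1.\<close>

lemma fredholm_bounded_below:
  assumes Z: "bounded_linear Z" and inj: "\<And>u. u = Z (K u) \<Longrightarrow> u = 0"
  shows "\<exists>C>0. \<forall>u. norm u \<le> C * norm (u - Z (K u))"
proof (rule ccontr)
  interpret bounded_linear K by (rule bounded_linear_K)
  interpret Z: bounded_linear Z by (rule Z)
  assume neg: "\<not> ?thesis"
  have "\<exists>u. norm u > (real n + 1) * norm (u - Z (K u))" for n
  proof -
    have "real n + 1 > 0" by simp
    with neg show ?thesis by (meson not_le)
  qed
  then obtain u where u: "norm (u n) > (real n + 1) * norm (u n - Z (K (u n)))" for n by metis
  have nz: "u n \<noteq> 0" for n using u[of n] by (auto simp: zero Z.zero)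
  define y where "y n = u n /\<^sub>R norm (u n)" for n
  have y1: "norm (y n) = 1" for n by (simp add: y_def nz)
  then have "norm (y n) \<le> 1" for n by simp
  from compact_K[of y, OF this] obtain l r where r: "strict_mono r" "(\<lambda>n. K (y (r n))) \<longlonglongrightarrow> l" by blast
  have "norm (y n - Z (K (y n))) \<le> inverse (real (Suc n))" for n
  proof -
    have "y n - Z (K (y n)) = (u n - Z (K (u n))) /\<^sub>R norm (u n)"
      by (simp add: y_def scaleR Z.scaleR scaleR_diff_right)
    then have "norm (y n - Z (K (y n))) = norm (u n - Z (K (u n))) / norm (u n)"
      by (simp add: divide_inverse_commute)
    moreover have "(real n + 1) * (norm (u n - Z (K (u n))) / norm (u n)) < 1"
      using u[of n] nz[of n] by (simp add: pos_divide_less_eq)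
    ultimately have "(real n + 1) * norm (y n - Z (K (y n))) < 1" by simp
    then show ?thesis by (simp add: inverse_eq_divide pos_le_divide_eq mult.commute add.commute)
  qed
  then have "(\<lambda>n. y n - Z (K (y n))) \<longlonglongrightarrow> 0"
    by (intro Lim_null_comparison[OF _ LIMSEQ_inverse_real_of_nat]) auto
  from tendsto_add[OF LIMSEQ_subseq_LIMSEQ[OF this r(1)] Z.tendsto[OF r(2)]]
  have ly: "(\<lambda>n. y (r n)) \<longlonglongrightarrow> Z l" by (simp add: o_def)
  from LIMSEQ_unique[OF tendsto[OF ly] r(2)] have "K (Z l) = l" .
  then have "Z l = 0" by (intro inj) simp
  with LIMSEQ_unique[OF tendsto_norm[OF ly], of 1] y1 show False by simp
qed

text \<open>The lower bound keeps the preimages \<open>u n\<close> bounded, so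
  \<open>K (u n)\<close> converges along a subsequence to some \<open>l\<close>; then
  \<open>u n\<close> itself converges to \<open>r + Z l\<close>, the required preimage.\<close>

lemma fredholm_closed_range:
  assumes Z: "bounded_linear Z" and inj: "\<And>u. u = Z (K u) \<Longrightarrow> u = 0"
    and r: "r \<in> closure (range (\<lambda>u. u - Z (K u)))"
  shows "\<exists>u. r = u - Z (K u)"
proof -
  interpret bounded_linear K by (rule bounded_linear_K)
  interpret Z: bounded_linear Z by (rule Z)
  obtain C where C: "C > 0" "\<And>u. norm u \<le> C * norm (u - Z (K u))"
    using fredholm_bounded_below[OF Z inj] by blast
  obtain f where f: "\<And>n. f n \<in> range (\<lambda>u. u - Z (K u))" "f \<longlonglongrightarrow> r"
    using r unfolding closure_sequential by blast
  have "\<forall>n. \<exists>u. f n = u - Z (K u)" using f(1) by blast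
  then obtain u where u: "\<And>n. f n = u n - Z (K (u n))" by metis
  obtain B where B: "norm (f n) \<le> B" for n
    using convergent_imp_Bseq[of f] f(2) by (auto simp: convergent_def Bseq_def)
  have "norm (u n) \<le> C * B" for n
    using C(2)[of "u n"] B[of n] C(1) by (metis u mult_left_mono less_imp_le order_trans)
  from compact_bounded[of u, OF this] obtain l k where k: "strict_mono k" "(\<lambda>n. K (u (k n))) \<longlonglongrightarrow> l" by blast
  from tendsto_add[OF LIMSEQ_subseq_LIMSEQ[OF f(2) k(1)] Z.tendsto[OF k(2)]]
  have lu: "(\<lambda>n. u (k n)) \<longlonglongrightarrow> r + Z l" by (simp add: o_def u)
  from LIMSEQ_unique[OF tendsto[OF lu] k(2)] have "K (r + Z l) = l" .
  then show ?thesis by (metis add_diff_cancel_right')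
qed

end

section \<open>Linear structure and inner product of square integrable functions\<close>

lemma borel_measurable_cnj' [measurable]: "cnj \<in> borel_measurable borel"
  by (intro borel_measurable_continuous_onI continuous_intros)

lemma L2_I: "f \<in> borel_measurable M \<Longrightarrow> integrable M (\<lambda>x. (cmod (f x))\<^sup>2) \<Longrightarrow> f \<in> L2 M"
  by (simp add: L2_def)

lemma L2_measurable: "f \<in> L2 M \<Longrightarrow> f \<in> borel_measurable M"
  by (simp add: L2_def)

lemma L2_integrable: "f \<in> L2 M \<Longrightarrow> integrable M (\<lambda>x. (cmod (f x))\<^sup>2)"
  by (simp add: L2_def)

lemma L2_integrable_mult:
  assumes f: "f \<in> L2 M" and g: "g \<in> L2 M"
  shows "integrable M (\<lambda>x. f x * g x)"
proof (rule Bochner_Integration.integrable_bound)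
  note [measurable] = L2_measurable[OF f] L2_measurable[OF g]
  show "integrable M (\<lambda>x. (cmod (f x))\<^sup>2 + (cmod (g x))\<^sup>2)"
    by (intro Bochner_Integration.integrable_add L2_integrable f g)
  show "(\<lambda>x. f x * g x) \<in> borel_measurable M" by measurable
  have "cmod (f x * g x) \<le> norm ((cmod (f x))\<^sup>2 + (cmod (g x))\<^sup>2)" for x
  proof -
    have "0 \<le> cmod (f x) * cmod (g x)" by simp
    then have "cmod (f x) * cmod (g x) \<le> (cmod (f x))\<^sup>2 + (cmod (g x))\<^sup>2"
      using sum_squares_bound[of "cmod (f x)" "cmod (g x)"] by linarith
    then show ?thesis by (simp add: norm_mult)
  qed
  then show "AE x in M. cmod (f x * g x) \<le> norm ((cmod (f x))\<^sup>2 + (cmod (g x))\<^sup>2)" by simp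
qed

lemma L2_cnj: "f \<in> L2 M \<Longrightarrow> (\<lambda>x. cnj (f x)) \<in> L2 M"
  by (auto simp: L2_def)

lemma L2_of_cmod: "f \<in> L2 M \<Longrightarrow> (\<lambda>x. of_real (cmod (f x))) \<in> L2 M"
  by (auto simp: L2_def)

lemma L2_integrable_inner:
  assumes "f \<in> L2 M" "g \<in> L2 M"
  shows "integrable M (\<lambda>x. f x * cnj (g x))"
  by (rule L2_integrable_mult[OF assms(1) L2_cnj[OF assms(2)]])

lemma L2_add:
  assumes f: "f \<in> L2 M" and g: "g \<in> L2 M"
  shows "(\<lambda>x. f x + g x) \<in> L2 M"
proof (rule L2_I)
  note [measurable] = L2_measurable[OF f] L2_measurable[OF g]
  show "(\<lambda>x. f x + g x) \<in> borel_measurable M" by measurable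
  show "integrable M (\<lambda>x. (cmod (f x + g x))\<^sup>2)"
  proof (rule Bochner_Integration.integrable_bound)
    show "integrable M (\<lambda>x. 2 * (cmod (f x))\<^sup>2 + 2 * (cmod (g x))\<^sup>2)"
      by (intro Bochner_Integration.integrable_add integrable_mult_right L2_integrable f g)
    show "(\<lambda>x. (cmod (f x + g x))\<^sup>2) \<in> borel_measurable M" by measurable
    have "(cmod (f x + g x))\<^sup>2 \<le> 2 * (cmod (f x))\<^sup>2 + 2 * (cmod (g x))\<^sup>2" for x
    proof -
      have "(cmod (f x + g x))\<^sup>2 \<le> (cmod (f x) + cmod (g x))\<^sup>2" by (intro power_mono norm_triangle_ineq) auto
      then show ?thesis using sum_squares_bound[of "cmod (f x)" "cmod (g x)"] by (simp add: power2_sum)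
    qed
    then show "AE x in M. norm ((cmod (f x + g x))\<^sup>2) \<le> norm (2 * (cmod (f x))\<^sup>2 + 2 * (cmod (g x))\<^sup>2)" by simp
  qed
qed

lemma L2_cmult: "f \<in> L2 M \<Longrightarrow> (\<lambda>x. c * f x) \<in> L2 M"
  by (auto simp: L2_def norm_mult power_mult_distrib)

lemma L2_diff: "f \<in> L2 M \<Longrightarrow> g \<in> L2 M \<Longrightarrow> (\<lambda>x. f x - g x) \<in> L2 M"
  using L2_add[OF _ L2_cmult[of g M "-1"], of f] by simp

lemma L2_minus: "f \<in> L2 M \<Longrightarrow> (\<lambda>x. - f x) \<in> L2 M"
  using L2_cmult[of f M "-1"] by simp

lemma L2_zero: "(\<lambda>x. 0) \<in> L2 M"
  by (simp add: L2_def)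

lemma L2_sum: "(\<And>i. i \<in> A \<Longrightarrow> f i \<in> L2 M) \<Longrightarrow> (\<lambda>x. \<Sum>i\<in>A. f i x) \<in> L2 M"
  by (induction A rule: infinite_finite_induct) (auto intro: L2_add L2_zero)

lemma L2_cong_AE:
  assumes "f \<in> L2 M" "g \<in> borel_measurable M" "AE x in M. f x = g x"
  shows "g \<in> L2 M"
proof (rule L2_I[OF assms(2)])
  note [measurable] = assms(2) L2_measurable[OF assms(1)]
  show "integrable M (\<lambda>x. (cmod (g x))\<^sup>2)"
    by (rule integrable_cong_AE_imp[OF L2_integrable[OF assms(1)]]) (use assms(3) in auto)
qed

lemma L2_bounded_mult:
  assumes f: "f \<in> L2 M" and b: "b \<in> borel_measurable M" "\<And>x. x \<in> space M \<Longrightarrow> cmod (b x) \<le> B"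
  shows "(\<lambda>x. b x * f x) \<in> L2 M"
proof (rule L2_I)
  note [measurable] = L2_measurable[OF f] b(1)
  show "(\<lambda>x. b x * f x) \<in> borel_measurable M" by measurable
  show "integrable M (\<lambda>x. (cmod (b x * f x))\<^sup>2)"
  proof (rule Bochner_Integration.integrable_bound)
    show "integrable M (\<lambda>x. B\<^sup>2 * (cmod (f x))\<^sup>2)" by (intro integrable_mult_right L2_integrable f)
    show "(\<lambda>x. (cmod (b x * f x))\<^sup>2) \<in> borel_measurable M" by measurable
    have "norm ((cmod (b x * f x))\<^sup>2) \<le> norm (B\<^sup>2 * (cmod (f x))\<^sup>2)" if "x \<in> space M" for x
      using power_mono[OF b(2)[OF that] norm_ge_zero, of 2] by (simp add: norm_mult power_mult_distrib mult_right_mono)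
    then show "AE x in M. norm ((cmod (b x * f x))\<^sup>2) \<le> norm (B\<^sup>2 * (cmod (f x))\<^sup>2)" by simp
  qed
qed

lemma L2_inner_cnj: "cnj (L2_inner M f g) = L2_inner M g f"
proof -
  have "cnj (L2_inner M f g) = (LINT x|M. cnj (f x * cnj (g x)))"
    unfolding L2_inner_def by (rule Bochner_Integration.integral_cnj[symmetric])
  then show ?thesis by (simp add: L2_inner_def mult.commute)
qed

lemma L2_inner_add_left:
  "f \<in> L2 M \<Longrightarrow> g \<in> L2 M \<Longrightarrow> h \<in> L2 M \<Longrightarrow> L2_inner M (\<lambda>x. f x + g x) h = L2_inner M f h + L2_inner M g h"
  by (simp add: L2_inner_def distrib_right L2_integrable_inner)

lemma L2_inner_diff_left:
  "f \<in> L2 M \<Longrightarrow> g \<in> L2 M \<Longrightarrow> h \<in> L2 M \<Longrightarrow> L2_inner M (\<lambda>x. f x - g x) h = L2_inner M f h - L2_inner M g h"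
  by (simp add: L2_inner_def left_diff_distrib L2_integrable_inner)

lemma L2_inner_diff_right:
  "f \<in> L2 M \<Longrightarrow> g \<in> L2 M \<Longrightarrow> h \<in> L2 M \<Longrightarrow> L2_inner M h (\<lambda>x. f x - g x) = L2_inner M h f - L2_inner M h g"
  by (simp add: L2_inner_def right_diff_distrib L2_integrable_inner)

lemma L2_inner_cmult_left: "L2_inner M (\<lambda>x. c * f x) h = c * L2_inner M f h"
  by (simp add: L2_inner_def mult.assoc)

lemma L2_inner_cmult_right: "L2_inner M h (\<lambda>x. c * f x) = cnj c * L2_inner M h f"
  by (simp add: L2_inner_def mult.left_commute)

lemma L2_inner_cong_AE:
  assumes "f \<in> L2 M" "g \<in> L2 M" "f' \<in> L2 M" "g' \<in> L2 M"
    and "AE x in M. f x = f' x" "AE x in M. g x = g' x"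
  shows "L2_inner M f g = L2_inner M f' g'"
  unfolding L2_inner_def
proof (rule integral_cong_AE)
  note [measurable] = assms(1-4)[THEN L2_measurable]
  show "(\<lambda>x. f x * cnj (g x)) \<in> borel_measurable M" "(\<lambda>x. f' x * cnj (g' x)) \<in> borel_measurable M"
    by measurable
  show "AE x in M. f x * cnj (g x) = f' x * cnj (g' x)" using assms(5,6) by auto
qed

lemma L2_inner_self: "L2_inner M f f = of_real ((L2_norm M f)\<^sup>2)"
proof -
  have "L2_inner M f f = (LINT x|M. complex_of_real ((cmod (f x))\<^sup>2))"
    by (simp only: L2_inner_def complex_norm_square)
  also have "\<dots> = of_real (LINT x|M. (cmod (f x))\<^sup>2)" by (rule integral_complex_of_real)
  finally show ?thesis by (simp add: L2_norm_def)
qed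

lemma L2_norm_nonneg: "L2_norm M f \<ge> 0"
  by (simp add: L2_norm_def)

lemma L2_norm_zero_iff:
  assumes "f \<in> L2 M"
  shows "L2_norm M f = 0 \<longleftrightarrow> (AE x in M. f x = 0)"
  using integral_nonneg_eq_0_iff_AE[OF L2_integrable[OF assms]] by (simp add: L2_norm_def)

lemma L2_norm_cong_AE:
  assumes "f \<in> L2 M" "g \<in> L2 M" "AE x in M. f x = g x"
  shows "L2_norm M f = L2_norm M g"
proof -
  have "complex_of_real ((L2_norm M f)\<^sup>2) = of_real ((L2_norm M g)\<^sup>2)"
    using L2_inner_cong_AE[OF assms(1) assms(1) assms(2) assms(2) assms(3) assms(3)] by (simp only: L2_inner_self)
  then have "(L2_norm M f)\<^sup>2 = (L2_norm M g)\<^sup>2" by (simp only: of_real_eq_iff)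
  then show ?thesis using L2_norm_nonneg by (metis power2_eq_iff_nonneg)
qed

subsection \<open>The space of square integrable classes on the real line\<close>

text \<open>The real inner product is the real part of the complex one, so that real Hilbert space
  facts of the library apply; complex multiples are provided by \<open>cscale\<close>.\<close>

quotient_type l2 = "real \<Rightarrow> complex" /
  partial: "\<lambda>f g. f \<in> L2 lebesgue \<and> g \<in> L2 lebesgue \<and> (AE x in lebesgue. f x = g x)"
proof (rule part_equivpI)
  show "\<exists>x::real \<Rightarrow> complex. x \<in> L2 lebesgue \<and> x \<in> L2 lebesgue \<and> (AE xa in lebesgue. x xa = x xa)"
    using L2_zero[of "lebesgue :: real measure"] by auto
qed (auto intro!: sympI transpI)

instantiation l2 :: real_inner
begin

lift_definition zero_l2 :: l2 is "\<lambda>_. 0" by (simp add: L2_zero)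
lift_definition plus_l2 :: "l2 \<Rightarrow> l2 \<Rightarrow> l2" is "\<lambda>f g x. f x + g x" by (auto intro: L2_add)
lift_definition minus_l2 :: "l2 \<Rightarrow> l2 \<Rightarrow> l2" is "\<lambda>f g x. f x - g x" by (auto intro: L2_diff)
lift_definition uminus_l2 :: "l2 \<Rightarrow> l2" is "\<lambda>f x. - f x" by (auto intro: L2_minus)
lift_definition scaleR_l2 :: "real \<Rightarrow> l2 \<Rightarrow> l2" is "\<lambda>r f x. of_real r * f x" by (auto intro: L2_cmult)
lift_definition inner_l2 :: "l2 \<Rightarrow> l2 \<Rightarrow> real" is "\<lambda>f g. Re (L2_inner lebesgue f g)"
  using L2_inner_cong_AE by metis
definition norm_l2 :: "l2 \<Rightarrow> real" where "norm_l2 x = sqrt (inner x x)"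
definition sgn_l2 :: "l2 \<Rightarrow> l2" where "sgn_l2 x = scaleR (inverse (norm x)) x"
definition dist_l2 :: "l2 \<Rightarrow> l2 \<Rightarrow> real" where "dist_l2 x y = norm (x - y)"
definition uniformity_l2 :: "(l2 \<times> l2) filter" where
  "uniformity_l2 = (INF e\<in>{0 <..}. principal {(x, y). dist x y < e})"
definition open_l2 :: "l2 set \<Rightarrow> bool" where
  "open_l2 U = (\<forall>x\<in>U. eventually (\<lambda>(x', y). x' = x \<longrightarrow> y \<in> U) uniformity)"

instance
proof
  fix x y z :: l2 and r s :: real
  show "x + y + z = x + (y + z)" by transfer (auto intro!: L2_add simp: add.assoc)
  show "x + y = y + x" by transfer (auto intro!: L2_add simp: add.commute)
  show "0 + x = x" by transfer auto
  show "- x + x = 0" by transfer (auto intro!: L2_add L2_minus L2_zero)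
  show "x - y = x + - y" by transfer (auto intro!: L2_add L2_minus L2_diff)
  show "r *\<^sub>R (x + y) = r *\<^sub>R x + r *\<^sub>R y" by transfer (auto intro!: L2_add L2_cmult simp: distrib_left)
  show "(r + s) *\<^sub>R x = r *\<^sub>R x + s *\<^sub>R x" by transfer (auto intro!: L2_add L2_cmult simp: distrib_right)
  show "r *\<^sub>R s *\<^sub>R x = (r * s) *\<^sub>R x" by transfer (auto intro!: L2_cmult simp: mult.assoc)
  show "1 *\<^sub>R x = x" by transfer auto
  show "inner x y = inner y x" by transfer (metis L2_inner_cnj complex_cnj cnj.sel(1))
  show "inner (x + y) z = inner x z + inner y z" by transfer (simp add: L2_inner_add_left)
  show "inner (r *\<^sub>R x) y = r * inner x y" by transfer (simp add: L2_inner_cmult_left)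
  show "0 \<le> inner x x" by transfer (simp add: L2_inner_self)
  show "inner x x = 0 \<longleftrightarrow> x = 0" by transfer (simp add: L2_inner_self L2_zero L2_norm_zero_iff)
qed (simp_all add: norm_l2_def sgn_l2_def dist_l2_def uniformity_l2_def open_l2_def)

end

lift_definition cscale :: "complex \<Rightarrow> l2 \<Rightarrow> l2" is "\<lambda>c f x. c * f x" by (auto intro: L2_cmult)

lemma cscale_cscale: "cscale a (cscale b x) = cscale (a * b) x"
  by transfer (auto intro!: L2_cmult simp: mult.assoc)

lemma cscale_1: "cscale 1 x = x"
  by transfer auto

lemma cscale_of_real: "cscale (of_real r) x = r *\<^sub>R x"
  by transfer (auto intro!: L2_cmult)

lemma cscale_add_left: "cscale (a + b) x = cscale a x + cscale b x"
  by transfer (auto intro!: L2_cmult L2_add simp: distrib_right)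

lemma norm_cscale: "norm (cscale a x) = cmod a * norm x"
proof -
  have "inner (cscale a x) (cscale a x) = (cmod a)\<^sup>2 * inner x x"
    by transfer (simp add: L2_inner_cmult_left L2_inner_cmult_right L2_inner_self mult.assoc[symmetric]
        complex_norm_square[symmetric] flip: of_real_power of_real_mult)
  then show ?thesis by (simp add: norm_eq_sqrt_inner real_sqrt_mult)
qed

lemma bounded_linear_cscale: "bounded_linear (cscale a)"
proof (rule bounded_linear_intro[where K = "cmod a"])
  show "cscale a (x + y) = cscale a x + cscale a y" for x y
    by transfer (auto intro!: L2_cmult L2_add simp: distrib_left)
  show "cscale a (r *\<^sub>R x) = r *\<^sub>R cscale a x" for r x
    by transfer (auto intro!: L2_cmult)
qed (simp add: norm_cscale)

text \<open>A type cannot depend on the interval, so a function on \<open>S\<close> enters the fixed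
  space \<open>l2\<close> through its extension by zero.\<close>

definition emb :: "real set \<Rightarrow> (real \<Rightarrow> complex) \<Rightarrow> l2" where
  "emb S f = abs_l2 (\<lambda>x. if x \<in> S then f x else 0)"

context
  fixes S :: "real set"
  assumes S [measurable]: "S \<in> sets lebesgue"
begin

lemma L2_extend:
  assumes "f \<in> L2 (lebesgue_on S)"
  shows "(\<lambda>x. if x \<in> S then f x else 0) \<in> L2 lebesgue"
proof (rule L2_I)
  show "(\<lambda>x. if x \<in> S then f x else 0) \<in> borel_measurable lebesgue"
    using L2_measurable[OF assms] by (simp add: borel_measurable_if[OF S])
  have "integrable lebesgue (\<lambda>x. indicator S x *\<^sub>R (cmod (f x))\<^sup>2)"
    using L2_integrable[OF assms] by (simp add: integrable_restrict_space S)
  then show "integrable lebesgue (\<lambda>x. (cmod (if x \<in> S then f x else 0))\<^sup>2)"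
    by (rule Bochner_Integration.integrable_cong[THEN iffD1, rotated -1]) (auto simp: indicator_def)
qed

lemma L2_restrict:
  assumes "f \<in> L2 lebesgue"
  shows "f \<in> L2 (lebesgue_on S)"
proof (rule L2_I)
  show "f \<in> borel_measurable (lebesgue_on S)"
    using L2_measurable[OF assms] by (rule measurable_restrict_space1)
  have "integrable lebesgue (\<lambda>x. indicator S x *\<^sub>R (cmod (f x))\<^sup>2)"
    by (intro integrable_mult_indicator L2_integrable assms) (use S in simp)
  then show "integrable (lebesgue_on S) (\<lambda>x. (cmod (f x))\<^sup>2)"
    by (simp add: integrable_restrict_space S)
qed

lemma L2_rep: "rep_l2 X \<in> L2 (lebesgue_on S)"
  using Quotient_rep_reflp[OF Quotient_l2, of X] by (auto intro: L2_restrict)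

lemma inner_emb:
  assumes "f \<in> L2 (lebesgue_on S)" "g \<in> L2 (lebesgue_on S)"
  shows "inner (emb S f) (emb S g) = Re (L2_inner (lebesgue_on S) f g)"
proof -
  have "inner (emb S f) (emb S g)
      = Re (L2_inner lebesgue (\<lambda>x. if x \<in> S then f x else 0) (\<lambda>x. if x \<in> S then g x else 0))"
    unfolding emb_def using L2_extend[OF assms(1)] L2_extend[OF assms(2)] by (simp add: inner_l2.abs_eq)
  also have "L2_inner lebesgue (\<lambda>x. if x \<in> S then f x else 0) (\<lambda>x. if x \<in> S then g x else 0)
     = L2_inner (lebesgue_on S) f g"
    unfolding L2_inner_def using S
    by (subst integral_restrict_space) (auto intro!: Bochner_Integration.integral_cong)
  finally show ?thesis .
qed

lemma norm_emb: "f \<in> L2 (lebesgue_on S) \<Longrightarrow> norm (emb S f) = L2_norm (lebesgue_on S) f"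
  by (simp add: norm_eq_sqrt_inner inner_emb L2_inner_self L2_norm_nonneg)

lemma emb_add: "f \<in> L2 (lebesgue_on S) \<Longrightarrow> g \<in> L2 (lebesgue_on S) \<Longrightarrow> emb S (\<lambda>x. f x + g x) = emb S f + emb S g"
  unfolding emb_def
  by (subst plus_l2.abs_eq) (auto intro!: L2_extend arg_cong[where f = abs_l2])

lemma emb_diff: "f \<in> L2 (lebesgue_on S) \<Longrightarrow> g \<in> L2 (lebesgue_on S) \<Longrightarrow> emb S (\<lambda>x. f x - g x) = emb S f - emb S g"
  unfolding emb_def
  by (subst minus_l2.abs_eq) (auto intro!: L2_extend arg_cong[where f = abs_l2])

lemma emb_cmult: "f \<in> L2 (lebesgue_on S) \<Longrightarrow> emb S (\<lambda>x. c * f x) = cscale c (emb S f)"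
  unfolding emb_def
  by (subst cscale.abs_eq) (auto intro!: L2_extend arg_cong[where f = abs_l2])

lemma emb_eq_0_iff:
  assumes "f \<in> L2 (lebesgue_on S)"
  shows "emb S f = 0 \<longleftrightarrow> (AE x in lebesgue_on S. f x = 0)"
  by (metis assms norm_emb L2_norm_zero_iff norm_eq_zero)

lemma emb_eq_iff:
  assumes "f \<in> L2 (lebesgue_on S)" "g \<in> L2 (lebesgue_on S)"
  shows "emb S f = emb S g \<longleftrightarrow> (AE x in lebesgue_on S. f x = g x)"
  using emb_eq_0_iff[OF L2_diff[OF assms]] emb_diff[OF assms] by simp

lemma emb_sum:
  assumes "\<And>i. i \<in> A \<Longrightarrow> f i \<in> L2 (lebesgue_on S)"
  shows "emb S (\<lambda>x. \<Sum>i\<in>A. f i x) = (\<Sum>i\<in>A. emb S (f i))"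
proof -
  have 0: "emb S (\<lambda>x. 0) = 0" by (simp add: emb_eq_0_iff L2_zero)
  show ?thesis using assms
    by (induction A rule: infinite_finite_induct) (simp_all add: 0 emb_add L2_sum)
qed

lemma emb_rep_emb:
  assumes "f \<in> L2 (lebesgue_on S)"
  shows "AE x in lebesgue_on S. rep_l2 (emb S f) x = f x"
proof -
  have "AE x in lebesgue. rep_l2 (emb S f) x = (if x \<in> S then f x else 0)"
    using Quotient3_rep_abs[OF Quotient3_l2, of "\<lambda>x. if x \<in> S then f x else 0"] L2_extend[OF assms]
    by (simp add: emb_def)
  then show ?thesis by (subst AE_restrict_space_iff) (use S in auto)
qed

text \<open>The representative of a class on the line need not vanish off \<open>S\<close>; cutting
  it off there can only decrease the norm.\<close>

lemma norm_emb_rep: "norm (emb S (rep_l2 X)) \<le> norm X"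
proof -
  have r: "rep_l2 X \<in> L2 lebesgue" using Quotient_rep_reflp[OF Quotient_l2, of X] by auto
  have "norm X = norm (abs_l2 (rep_l2 X))"
    using Quotient3_abs_rep[OF Quotient3_l2, of X] by simp
  also have "\<dots> = sqrt (LINT x|lebesgue. (cmod (rep_l2 X x))\<^sup>2)"
    using r by (simp add: norm_eq_sqrt_inner inner_l2.abs_eq L2_inner_self L2_norm_def)
  finally have "norm X = \<dots>" .
  moreover have "norm (emb S (rep_l2 X)) = sqrt (LINT x|lebesgue. indicator S x *\<^sub>R (cmod (rep_l2 X x))\<^sup>2)"
    by (simp add: norm_emb[OF L2_rep] L2_norm_def integral_restrict_space S)
  moreover have "(LINT x|lebesgue. indicator S x *\<^sub>R (cmod (rep_l2 X x))\<^sup>2) \<le> (LINT x|lebesgue. (cmod (rep_l2 X x))\<^sup>2)"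
    by (intro integral_mono integrable_mult_indicator L2_integrable r) (use S in \<open>auto simp: indicator_def\<close>)
  ultimately show ?thesis by simp
qed

lemma L2_norm_triangle:
  "f \<in> L2 (lebesgue_on S) \<Longrightarrow> g \<in> L2 (lebesgue_on S) \<Longrightarrow>
     L2_norm (lebesgue_on S) (\<lambda>x. f x + g x) \<le> L2_norm (lebesgue_on S) f + L2_norm (lebesgue_on S) g"
  using norm_triangle_ineq[of "emb S f" "emb S g"] by (simp add: norm_emb emb_add[symmetric] L2_add)

lemma L2_norm_triangle_diff:
  "f \<in> L2 (lebesgue_on S) \<Longrightarrow> g \<in> L2 (lebesgue_on S) \<Longrightarrow>
     L2_norm (lebesgue_on S) (\<lambda>x. f x - g x) \<le> L2_norm (lebesgue_on S) f + L2_norm (lebesgue_on S) g"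
  using norm_triangle_ineq4[of "emb S f" "emb S g"] by (simp add: norm_emb emb_diff[symmetric] L2_diff)

lemma L2_norm_cmult: "f \<in> L2 (lebesgue_on S) \<Longrightarrow> L2_norm (lebesgue_on S) (\<lambda>x. c * f x) = cmod c * L2_norm (lebesgue_on S) f"
  using norm_cscale[of c "emb S f"] by (simp add: norm_emb emb_cmult[symmetric] L2_cmult)

lemma L2_Cauchy_Schwarz_cmod:
  assumes "f \<in> L2 (lebesgue_on S)" "g \<in> L2 (lebesgue_on S)"
  shows "(LINT x|lebesgue_on S. cmod (f x) * cmod (g x)) \<le> L2_norm (lebesgue_on S) f * L2_norm (lebesgue_on S) g"
proof -
  let ?f = "\<lambda>x. complex_of_real (cmod (f x))" and ?g = "\<lambda>x. complex_of_real (cmod (g x))"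
  have "L2_inner (lebesgue_on S) ?f ?g = of_real (LINT x|lebesgue_on S. cmod (f x) * cmod (g x))"
    unfolding L2_inner_def by (subst integral_complex_of_real[symmetric]) simp
  then have "(LINT x|lebesgue_on S. cmod (f x) * cmod (g x)) = inner (emb S ?f) (emb S ?g)"
    using assms by (simp add: inner_emb L2_of_cmod)
  also have "\<dots> \<le> norm (emb S ?f) * norm (emb S ?g)" by (rule norm_cauchy_schwarz)
  finally show ?thesis using assms by (simp add: norm_emb L2_of_cmod L2_norm_def)
qed

lemma L2_Cauchy_Schwarz_mult:
  assumes "f \<in> L2 (lebesgue_on S)" "g \<in> L2 (lebesgue_on S)"
  shows "cmod (LINT x|lebesgue_on S. f x * g x) \<le> L2_norm (lebesgue_on S) f * L2_norm (lebesgue_on S) g"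
proof -
  have "cmod (LINT x|lebesgue_on S. f x * g x) \<le> (LINT x|lebesgue_on S. cmod (f x * g x))"
    by (rule integral_norm_bound)
  then show ?thesis using L2_Cauchy_Schwarz_cmod[OF assms] by (simp add: norm_mult)
qed

end

section \<open>Dominated convergence and boundedness in the L2 norm\<close>

lemma L2_norm_dominated_convergence:
  assumes "integrable M w" "f \<in> borel_measurable M" "\<And>n. g n \<in> borel_measurable M"
    and "AE x in M. (\<lambda>n. g n x) \<longlonglongrightarrow> f x" "\<And>n. AE x in M. (cmod (g n x - f x))\<^sup>2 \<le> w x"
  shows "(\<lambda>n. L2_norm M (\<lambda>x. g n x - f x)) \<longlonglongrightarrow> 0"
proof -
  note [measurable] = assms(2,3)
  have "(\<lambda>n. LINT x|M. (cmod (g n x - f x))\<^sup>2) \<longlonglongrightarrow> (LINT x|M. 0)"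
  proof (rule integral_dominated_convergence[OF _ _ assms(1)])
    show "AE x in M. (\<lambda>n. (cmod (g n x - f x))\<^sup>2) \<longlonglongrightarrow> 0"
      using assms(4)
    proof eventually_elim
      case (elim x)
      have "(\<lambda>n. (cmod (g n x - f x))\<^sup>2) \<longlonglongrightarrow> (cmod (f x - f x))\<^sup>2" by (intro tendsto_intros elim)
      then show ?case by simp
    qed
  qed (use assms(5) in auto)
  from tendsto_real_sqrt[OF this] show ?thesis by (simp add: L2_norm_def)
qed

lemma L2_bounded:
  assumes "finite_measure M" "f \<in> borel_measurable M" "\<And>x. x \<in> space M \<Longrightarrow> cmod (f x) \<le> B"
  shows "f \<in> L2 M"
proof (rule L2_I[OF assms(2)])
  interpret finite_measure M by fact
  note [measurable] = assms(2)
  show "integrable M (\<lambda>x. (cmod (f x))\<^sup>2)"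
  proof (rule integrable_const_bound[of _ "B\<^sup>2"])
    have "norm ((cmod (f x))\<^sup>2) \<le> B\<^sup>2" if "x \<in> space M" for x
      using power_mono[OF assms(3)[OF that] norm_ge_zero, of 2] by simp
    then show "AE x in M. norm ((cmod (f x))\<^sup>2) \<le> B\<^sup>2" by simp
  qed measurable
qed

lemma L2_norm_bounded:
  assumes "finite_measure M" "f \<in> borel_measurable M" "\<And>x. x \<in> space M \<Longrightarrow> cmod (f x) \<le> B" "B \<ge> 0"
  shows "L2_norm M f \<le> B * sqrt (measure M (space M))"
proof -
  interpret finite_measure M by fact
  have "(LINT x|M. (cmod (f x))\<^sup>2) \<le> (LINT x|M. B\<^sup>2)"
    by (intro integral_mono L2_integrable L2_bounded[OF assms(1-3)]) (use assms(3) in \<open>auto intro: power_mono\<close>)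
  also have "\<dots> = (measure M (space M)) * B\<^sup>2" by simp
  finally show ?thesis unfolding L2_norm_def using assms(4)
    by (smt (verit) mult.commute real_sqrt_le_mono real_sqrt_mult real_sqrt_unique)
qed

lemma L2_norm_dominated_convergence_bounded:
  assumes "finite_measure M" "f \<in> borel_measurable M" "\<And>n. g n \<in> borel_measurable M"
    and "AE x in M. (\<lambda>n. g n x) \<longlonglongrightarrow> f x" "\<And>n x. x \<in> space M \<Longrightarrow> cmod (g n x) \<le> B"
    "\<And>x. x \<in> space M \<Longrightarrow> cmod (f x) \<le> B"
  shows "(\<lambda>n. L2_norm M (\<lambda>x. g n x - f x)) \<longlonglongrightarrow> 0"
proof (rule L2_norm_dominated_convergence[OF _ assms(2-4)])
  interpret finite_measure M by fact
  show "integrable M (\<lambda>x. (2 * B)\<^sup>2)" by simp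
  have "(cmod (g n x - f x))\<^sup>2 \<le> (2 * B)\<^sup>2" if "x \<in> space M" for n x
    using norm_triangle_ineq4[of "g n x" "f x"] assms(5)[OF that, of n] assms(6)[OF that] by (intro power_mono) auto
  then show "AE x in M. (cmod (g n x - f x))\<^sup>2 \<le> (2 * B)\<^sup>2" for n by simp
qed

subsection \<open>Smooth functions with compact support\<close>

text \<open>The recursion moves one derivative into the function, so that an induction on the order
  with an arbitrary function proves the closure rules. \<open>smooth_in_iff\<close> translates to
  the iterated derivatives used in \<open>test_functions\<close>.\<close>

primrec times_differentiable :: "nat \<Rightarrow> real set \<Rightarrow> (real \<Rightarrow> complex) \<Rightarrow> bool" where
  "times_differentiable 0 S f \<longleftrightarrow> (\<forall>x\<in>S. f differentiable (at x))"
| "times_differentiable (Suc n) S f \<longleftrightarrow> (\<forall>x\<in>S. f differentiable (at x)) \<and> times_differentiable n S (vderiv f)"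

definition smooth_in :: "real set \<Rightarrow> (real \<Rightarrow> complex) \<Rightarrow> bool" where
  "smooth_in S f \<longleftrightarrow> (\<forall>n. times_differentiable n S f)"

lemma times_differentiable_imp_funpow: "times_differentiable n S f \<Longrightarrow> x \<in> S \<Longrightarrow> (vderiv ^^ n) f differentiable (at x)"
  by (induction n arbitrary: f) (auto simp: funpow_swap1)

lemma funpow_imp_times_differentiable: "(\<And>k x. k \<le> n \<Longrightarrow> x \<in> S \<Longrightarrow> (vderiv ^^ k) f differentiable (at x)) \<Longrightarrow> times_differentiable n S f"
proof (induction n arbitrary: f)
  case (Suc n)
  have "times_differentiable n S (vderiv f)"
    by (rule Suc.IH) (use Suc.prems[of "Suc k" for k] in \<open>auto simp: funpow_swap1\<close>)
  with Suc.prems[of 0] show ?case by auto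
qed auto

lemma smooth_in_iff: "smooth_in S f \<longleftrightarrow> (\<forall>n. \<forall>x\<in>S. (vderiv ^^ n) f differentiable (at x))"
  unfolding smooth_in_def by (meson times_differentiable_imp_funpow funpow_imp_times_differentiable)

lemma has_vderiv: "f differentiable (at x) \<Longrightarrow> (f has_vector_derivative vderiv f x) (at x)"
  by (simp add: vderiv_def vector_derivative_works)

lemma vderiv_eq: "(f has_vector_derivative d) (at x) \<Longrightarrow> vderiv f x = d"
  by (simp add: vderiv_def vector_derivative_at)

lemma hvd_differentiable: "(f has_vector_derivative d) (at x) \<Longrightarrow> f differentiable (at x)"
  by (rule differentiableI_vector)

lemma times_differentiable_cong:
  assumes "open S" "\<And>x. x \<in> S \<Longrightarrow> f x = g x"
  shows "times_differentiable n S f \<Longrightarrow> times_differentiable n S g"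
  using assms(2)
proof (induction n arbitrary: f g)
  case 0
  then show ?case using has_vderiv has_vector_derivative_transform_within_open[OF _ assms(1)] hvd_differentiable
    by (metis times_differentiable.simps(1))
next
  case (Suc n)
  have d: "(g has_vector_derivative vderiv f x) (at x)" if "x \<in> S" for x
    by (rule has_vector_derivative_transform_within_open[OF has_vderiv assms(1)]) (use Suc.prems that in auto)
  have "times_differentiable n S (vderiv g)"
    by (rule Suc.IH[of "vderiv f"]) (use Suc.prems(1) vderiv_eq[OF d] in auto)
  then show ?case using d hvd_differentiable by auto
qed

lemma times_differentiable_SucI:
  assumes "open S" "\<And>x. x \<in> S \<Longrightarrow> (f has_vector_derivative g x) (at x)" "times_differentiable n S g"
  shows "times_differentiable (Suc n) S f"
proof -
  have "times_differentiable n S (vderiv f)"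
    by (rule times_differentiable_cong[OF assms(1) _ assms(3)]) (simp add: vderiv_eq[OF assms(2)])
  then show ?thesis using assms(2) hvd_differentiable by auto
qed

lemma times_differentiable_SucD: "times_differentiable (Suc n) S f \<Longrightarrow> times_differentiable n S f"
  by (induction n arbitrary: f) auto

lemma times_differentiable_const: "open S \<Longrightarrow> times_differentiable n S (\<lambda>x. c)"
proof (induction n arbitrary: c)
  case (Suc n)
  show ?case by (rule times_differentiable_SucI[OF Suc.prems has_vector_derivative_const Suc.IH[OF Suc.prems]])
qed auto

lemma times_differentiable_add:
  assumes "open S"
  shows "times_differentiable n S f \<Longrightarrow> times_differentiable n S g \<Longrightarrow> times_differentiable n S (\<lambda>x. f x + g x)"
proof (induction n arbitrary: f g)
  case (Suc n)
  show ?case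
    by (rule times_differentiable_SucI[OF assms has_vector_derivative_add[OF has_vderiv has_vderiv] Suc.IH])
      (use Suc.prems in auto)
qed auto

lemma times_differentiable_mult:
  assumes "open S"
  shows "times_differentiable n S f \<Longrightarrow> times_differentiable n S g \<Longrightarrow> times_differentiable n S (\<lambda>x. f x * g x)"
proof (induction n arbitrary: f g)
  case (Suc n)
  show ?case
  proof (rule times_differentiable_SucI[OF assms])
    show "((\<lambda>x. f x * g x) has_vector_derivative f x * vderiv g x + vderiv f x * g x) (at x)" if "x \<in> S" for x
      using Suc.prems that by (intro has_vector_derivative_mult has_vderiv) auto
    show "times_differentiable n S (\<lambda>x. f x * vderiv g x + vderiv f x * g x)"
      by (rule times_differentiable_add[OF assms Suc.IH[OF times_differentiable_SucD] Suc.IH[OF _ times_differentiable_SucD]]) (use Suc.prems in auto)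
  qed
qed auto

lemma smooth_in_const: "open S \<Longrightarrow> smooth_in S (\<lambda>x. c)"
  by (simp add: smooth_in_def times_differentiable_const)

lemma smooth_in_add: "open S \<Longrightarrow> smooth_in S f \<Longrightarrow> smooth_in S g \<Longrightarrow> smooth_in S (\<lambda>x. f x + g x)"
  by (simp add: smooth_in_def times_differentiable_add)

lemma smooth_in_mult: "open S \<Longrightarrow> smooth_in S f \<Longrightarrow> smooth_in S g \<Longrightarrow> smooth_in S (\<lambda>x. f x * g x)"
  by (simp add: smooth_in_def times_differentiable_mult)

lemma smooth_in_cong: "open S \<Longrightarrow> (\<And>x. x \<in> S \<Longrightarrow> f x = g x) \<Longrightarrow> smooth_in S f \<Longrightarrow> smooth_in S g"
  unfolding smooth_in_def using times_differentiable_cong by blast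

lemma smooth_in_Un: "smooth_in S f \<Longrightarrow> smooth_in T f \<Longrightarrow> smooth_in (S \<union> T) f"
  by (auto simp: smooth_in_iff)

lemma smooth_in_subset: "smooth_in T f \<Longrightarrow> S \<subseteq> T \<Longrightarrow> smooth_in S f"
  by (auto simp: smooth_in_iff)

lemma smooth_in_primitive:
  assumes "open S" "\<And>x. x \<in> S \<Longrightarrow> (f has_vector_derivative g x) (at x)" "smooth_in S g"
  shows "smooth_in S f"
  unfolding smooth_in_def
proof
  fix n show "times_differentiable n S f"
    using times_differentiable_SucD[OF times_differentiable_SucI[OF assms(1,2), of n]] assms(3) by (simp add: smooth_in_def)
qed

lemma smooth_in_vderiv: "smooth_in S f \<Longrightarrow> smooth_in S (vderiv f)"
  unfolding smooth_in_def by (meson times_differentiable.simps(2))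

lemma smooth_in_hvd: "smooth_in S f \<Longrightarrow> x \<in> S \<Longrightarrow> (f has_vector_derivative vderiv f x) (at x)"
  unfolding smooth_in_def by (meson times_differentiable.simps(1) has_vderiv)

lemma smooth_in_continuous: "smooth_in S f \<Longrightarrow> continuous_on S f"
  by (meson continuous_at_imp_continuous_on has_vector_derivative_continuous smooth_in_hvd)

lemma smooth_in_polynomial:
  assumes "polynomial_function p"
  shows "smooth_in UNIV (p :: real \<Rightarrow> complex)"
  unfolding smooth_in_def
proof
  fix n show "times_differentiable n UNIV p" using assms
  proof (induction n arbitrary: p)
    case 0
    then show ?case by (metis times_differentiable.simps(1) has_vector_derivative_polynomial_function hvd_differentiable)
  next
    case (Suc n)
    then show ?case by (metis times_differentiable_SucI has_vector_derivative_polynomial_function open_UNIV)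
  qed
qed

section \<open>Cutoff functions built from exp(-1/t)\<close>

definition flat :: "nat \<Rightarrow> real \<Rightarrow> real" where
  "flat k t = (if t > 0 then exp (- (1 / t)) / t ^ k else 0)"

text \<open>This is the inequality of (1 + x/n)^n with exp x for x = 1/t and n = k + 2. The two
  powers beyond \<open>k\<close> leave a quadratic bound, which makes the derivative at 0
  vanish.\<close>

lemma flat_bound: "\<bar>flat k t\<bar> \<le> real (k + 2) ^ (k + 2) * t\<^sup>2"
proof (cases "t > 0")
  case True
  have "(1 + (1 / t) / real (k + 2)) ^ (k + 2) \<le> exp (1 / t)"
    by (rule exp_ge_one_plus_x_over_n_power_n) (use True in \<open>auto intro: order_trans[of _ 0]\<close>)
  moreover have "(1 / t / real (k + 2)) ^ (k + 2) \<le> (1 + (1 / t) / real (k + 2)) ^ (k + 2)"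
    using True by (intro power_mono) auto
  ultimately have "(1 / t / real (k + 2)) ^ (k + 2) \<le> exp (1 / t)" by linarith
  then have "1 \<le> exp (1 / t) * (t ^ (k + 2) * real (k + 2) ^ (k + 2))"
    using True by (simp add: power_divide divide_simps del: power_Suc of_nat_add)
  then have "exp (- (1 / t)) \<le> t ^ (k + 2) * real (k + 2) ^ (k + 2)"
    by (simp add: exp_minus field_simps del: power_Suc of_nat_add)
  then have "exp (- (1 / t)) / t ^ k \<le> t ^ (k + 2) * real (k + 2) ^ (k + 2) / t ^ k"
    using True by (intro divide_right_mono) auto
  also have "\<dots> = real (k + 2) ^ (k + 2) * t\<^sup>2"
    using True by (simp add: power_add power2_eq_square)
  finally show ?thesis using True by (simp add: flat_def)
qed (simp add: flat_def)

text \<open>The family is closed under differentiation up to linear combinations, which is the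
  purpose of the index \<open>k\<close>: smoothness follows by induction on the order for all
  \<open>k\<close> at once.\<close>

lemma flat_deriv: "(flat k has_real_derivative flat (k + 2) t - real k * flat (k + 1) t) (at t)"
proof -
  consider "t > 0" | "t < 0" | "t = 0" by linarith
  then show ?thesis
  proof cases
    case 1
    have "((\<lambda>t. exp (- (1 / t)) / t ^ k) has_real_derivative flat (k + 2) t - real k * flat (k + 1) t) (at t)"
      using 1 by (auto intro!: derivative_eq_intros simp: flat_def power2_eq_square field_simps)
        (cases k; simp add: field_simps)
    then show ?thesis
      by (rule has_field_derivative_transform_within_open[of _ _ _ "{0<..}"]) (use 1 in \<open>auto simp: flat_def\<close>)
  next
    case 2
    have "((\<lambda>t. 0) has_real_derivative flat (k + 2) t - real k * flat (k + 1) t) (at t)"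
      using 2 by (simp add: flat_def)
    then show ?thesis
      by (rule has_field_derivative_transform_within_open[of _ _ _ "{..<0}"]) (use 2 in \<open>auto simp: flat_def\<close>)
  next
    case 3
    let ?C = "real (k + 2) ^ (k + 2)"
    have "(\<lambda>h. (flat k (0 + h) - flat k 0) / h) \<midarrow>0\<rightarrow> 0"
    proof (rule Lim_null_comparison)
      show "\<forall>\<^sub>F h in at 0. norm ((flat k (0 + h) - flat k 0) / h) \<le> ?C * \<bar>h\<bar>"
      proof (rule always_eventually, rule allI)
        fix h :: real
        have "\<bar>flat k h\<bar> / \<bar>h\<bar> \<le> ?C * \<bar>h\<bar>" if "h \<noteq> 0"
          using flat_bound[of k h] that by (simp add: divide_simps power2_eq_square mult.assoc)
        then show "norm ((flat k (0 + h) - flat k 0) / h) \<le> ?C * \<bar>h\<bar>"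
          by (cases "h = 0") (auto simp: flat_def abs_divide)
      qed
      have "(\<lambda>h::real. ?C * \<bar>h\<bar>) \<midarrow>0\<rightarrow> ?C * \<bar>0\<bar>" by (intro tendsto_intros)
      then show "(\<lambda>h::real. ?C * \<bar>h\<bar>) \<midarrow>0\<rightarrow> 0" by simp
    qed
    then show ?thesis using 3 by (simp add: DERIV_def flat_def)
  qed
qed

lemma smooth_in_flat: "smooth_in UNIV (\<lambda>x. of_real (flat k (p * x + q)))"
proof -
  have d: "((\<lambda>x. complex_of_real (flat k (p * x + q))) has_vector_derivative
     of_real p * (of_real (flat (k + 2) (p * x + q)) + (- of_nat k) * of_real (flat (k + 1) (p * x + q)))) (at x)" for k x
  proof -
    have "((\<lambda>x. p * x + q) has_real_derivative p) (at x)" by (auto intro!: derivative_eq_intros)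
    from DERIV_chain2[OF flat_deriv this]
    have "((\<lambda>x. flat k (p * x + q)) has_vector_derivative
        (flat (k + 2) (p * x + q) - real k * flat (k + 1) (p * x + q)) * p) (at x)"
      by (simp only: has_real_derivative_iff_has_vector_derivative)
    from has_vector_derivative_of_real[OF this[folded has_real_derivative_iff_has_vector_derivative], where ?'a = complex] show ?thesis
      by (simp add: algebra_simps)
  qed
  have "times_differentiable n UNIV (\<lambda>x. complex_of_real (flat k (p * x + q)))" for n
  proof (induction n arbitrary: k)
    case 0
    show ?case using hvd_differentiable[OF d] by simp
  next
    case (Suc n)
    show ?case
      by (rule times_differentiable_SucI[OF open_UNIV d]) (intro times_differentiable_mult times_differentiable_add times_differentiable_const open_UNIV Suc.IH)
  qed
  then show ?thesis by (simp add: smooth_in_def)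
qed

lemma flat_0_bounds: "0 \<le> flat 0 t" "flat 0 t \<le> 1"
  by (auto simp: flat_def)

lemma flat_0_pos: "t > 0 \<Longrightarrow> 0 < flat 0 t"
  by (simp add: flat_def)

lemma flat_0_tendsto: "(flat 0 \<longlongrightarrow> 1) at_top"
proof -
  have "((\<lambda>t::real. exp (- (1 / t))) \<longlongrightarrow> 1) at_top" by real_asymp
  moreover have "\<forall>\<^sub>F t in at_top. exp (- (1 / t)) = flat 0 t"
    using eventually_gt_at_top[of 0] by eventually_elim (simp add: flat_def)
  ultimately show ?thesis by (rule Lim_transform_eventually)
qed

section \<open>Test functions on a symmetric interval\<close>

lemma test_functions_iff:
  assumes "a > 0"
  shows "w \<in> test_functions {-a<..<a} \<longleftrightarrow> smooth_in UNIV w \<and> (\<exists>b. 0 < b \<and> b < a \<and> (\<forall>x. b \<le> \<bar>x\<bar> \<longrightarrow> w x = 0))"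
proof
  assume w: "w \<in> test_functions {-a<..<a}"
  define K where "K = closure {x. w x \<noteq> 0}"
  have K: "compact K" "K \<subseteq> {-a<..<a}" using w by (auto simp: test_functions_def K_def)
  have "\<exists>b<a. \<forall>x\<in>K. \<bar>x\<bar> \<le> b"
  proof (cases "K = {}")
    case False
    have "continuous_on K (\<lambda>x. \<bar>x\<bar>)" by (intro continuous_intros)
    from continuous_attains_sup[OF K(1) False this] obtain y where "y \<in> K" "\<And>x. x \<in> K \<Longrightarrow> \<bar>x\<bar> \<le> \<bar>y\<bar>" by blast
    moreover have "\<bar>y\<bar> < a" using K(2) \<open>y \<in> K\<close> by (auto simp: abs_less_iff subset_iff)
    ultimately show ?thesis by blast
  qed (use assms in \<open>auto intro: exI[of _ 0]\<close>)
  then obtain b where b: "b < a" "\<And>x. x \<in> K \<Longrightarrow> \<bar>x\<bar> \<le> b" by blast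
  \<comment> \<open>The midpoint of \<open>b\<close> and \<open>a\<close> lies strictly beyond every
    modulus attained on the support, and \<open>a / 2\<close> keeps the bound positive.\<close>
  have "w x = 0" if "max ((b + a) / 2) (a / 2) \<le> \<bar>x\<bar>" for x
  proof (rule ccontr)
    assume "w x \<noteq> 0"
    then have "x \<in> K" using closure_subset[of "{x. w x \<noteq> 0}"] by (auto simp: K_def)
    with b that show False by fastforce
  qed
  moreover have "0 < max ((b + a) / 2) (a / 2)" "max ((b + a) / 2) (a / 2) < a" using assms b(1) by auto
  ultimately show "smooth_in UNIV w \<and> (\<exists>b. 0 < b \<and> b < a \<and> (\<forall>x. b \<le> \<bar>x\<bar> \<longrightarrow> w x = 0))"
    using w by (auto simp: test_functions_def smooth_in_iff)
next
  assume "smooth_in UNIV w \<and> (\<exists>b. 0 < b \<and> b < a \<and> (\<forall>x. b \<le> \<bar>x\<bar> \<longrightarrow> w x = 0))"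
  then obtain b where b: "smooth_in UNIV w" "0 < b" "b < a" "\<And>x. b \<le> \<bar>x\<bar> \<Longrightarrow> w x = 0" by blast
  have "x \<in> {-b..b}" if "w x \<noteq> 0" for x using b(4)[of x] that by force
  then have "closure {x. w x \<noteq> 0} \<subseteq> {-b..b}" by (intro closure_minimal) auto
  moreover from this have "compact (closure {x. w x \<noteq> 0})"
    using compact_Icc closed_closure closed_subset by (metis compact_Int_closed inf.absorb_iff2)
  ultimately show "w \<in> test_functions {-a<..<a}"
    using b(1,3) by (auto simp: test_functions_def smooth_in_iff)
qed

lemma continuous_closure_L2:
  fixes g :: "real \<Rightarrow> complex"
  assumes "continuous_on UNIV g"
  shows "g \<in> L2 (lebesgue_on {-a<..<a})"
proof -
  have "bounded (g ` {-a..a})"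
    by (intro compact_imp_bounded compact_continuous_image continuous_on_subset[OF assms]) auto
  then obtain B where "\<And>x. x \<in> {-a..a} \<Longrightarrow> cmod (g x) \<le> B" unfolding bounded_iff by blast
  then show ?thesis
    by (intro L2_bounded[where B = B] continuous_imp_measurable_on_sets_lebesgue
        finite_measure_lebesgue_on continuous_on_subset[OF assms]) auto
qed

locale symmetric_interval =
  fixes a :: real
  assumes a_pos: "a > 0"
begin

definition I :: "real set" where "I = {-a<..<a}"
abbreviation M :: "real measure" where "M \<equiv> lebesgue_on I"

lemma I_open [simp, intro]: "open I" by (simp add: I_def)
lemma I_lebesgue [simp, intro]: "I \<in> sets lebesgue" by (simp add: I_def)
lemma I_iff: "x \<in> I \<longleftrightarrow> \<bar>x\<bar> < a" by (auto simp: I_def)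
lemma zero_in_I [simp]: "0 \<in> I" using a_pos by (simp add: I_iff)

lemma finite_M: "finite_measure M"
  by (rule finite_measure_lebesgue_on) (simp add: I_def)

sublocale M: finite_measure M by (rule finite_M)

lemma test_iff: "w \<in> test_functions I \<longleftrightarrow> smooth_in UNIV w \<and> (\<exists>b. 0 < b \<and> b < a \<and> (\<forall>x. b \<le> \<bar>x\<bar> \<longrightarrow> w x = 0))"
  unfolding I_def by (rule test_functions_iff[OF a_pos])

lemma continuous_M: "continuous_on I f \<Longrightarrow> f \<in> borel_measurable M"
  by (rule continuous_imp_measurable_on_sets_lebesgue) auto

lemma test_continuous: "w \<in> test_functions I \<Longrightarrow> continuous_on UNIV w"
  using test_iff smooth_in_continuous by blast

lemma test_L2: "w \<in> test_functions I \<Longrightarrow> w \<in> L2 M"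
  using continuous_closure_L2[OF test_continuous] by (simp add: I_def)

text \<open>The factor \<open>g\<close> is smooth only inside \<open>I\<close>, as are
  \<open>\<phi>\<close> and its inverse later. The open sets \<open>I\<close> and
  \<open>{x. b < \<bar>x\<bar>}\<close> cover the line, and on the second the product is identically
  zero.\<close>

lemma test_mult:
  assumes "w \<in> test_functions I" "smooth_in I g"
  shows "(\<lambda>x. g x * w x) \<in> test_functions I"
proof -
  obtain b where b: "smooth_in UNIV w" "0 < b" "b < a" "\<And>x. b \<le> \<bar>x\<bar> \<Longrightarrow> w x = 0"
    using assms(1) test_iff by blast
  have o: "open {x. b < \<bar>x\<bar>}" by (intro open_Collect_less continuous_intros)
  have "smooth_in I (\<lambda>x. g x * w x)"
    by (intro smooth_in_mult assms(2) smooth_in_subset[OF b(1)]) auto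
  moreover have "smooth_in {x. b < \<bar>x\<bar>} (\<lambda>x. g x * w x)"
    by (rule smooth_in_cong[OF o _ smooth_in_const[OF o, of 0]]) (use b(4) in auto)
  ultimately have "smooth_in (I \<union> {x. b < \<bar>x\<bar>}) (\<lambda>x. g x * w x)" by (rule smooth_in_Un)
  moreover have "I \<union> {x. b < \<bar>x\<bar>} = UNIV" using b(3) by (auto simp: I_iff)
  ultimately show ?thesis unfolding test_iff using b by (auto intro!: exI[of _ b])
qed

lemma test_add:
  assumes "v \<in> test_functions I" "w \<in> test_functions I"
  shows "(\<lambda>x. v x + w x) \<in> test_functions I"
proof -
  obtain b c where b: "0 < b" "b < a" "\<And>x. b \<le> \<bar>x\<bar> \<Longrightarrow> v x = 0" and c: "0 < c" "c < a" "\<And>x. c \<le> \<bar>x\<bar> \<Longrightarrow> w x = 0"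
    using assms unfolding test_iff by metis
  have "smooth_in UNIV (\<lambda>x. v x + w x)" using assms by (intro smooth_in_add) (auto simp: test_iff)
  then show ?thesis unfolding test_iff using b c by (auto intro!: exI[of _ "max b c"])
qed

lemma smooth_const: "smooth_in I (\<lambda>x. c)"
  by (rule smooth_in_const) simp

lemma test_cmult: "w \<in> test_functions I \<Longrightarrow> (\<lambda>x. c * w x) \<in> test_functions I"
  by (rule test_mult[OF _ smooth_const])

lemma test_diff: "v \<in> test_functions I \<Longrightarrow> w \<in> test_functions I \<Longrightarrow> (\<lambda>x. v x - w x) \<in> test_functions I"
  using test_add[OF _ test_cmult[of w "-1"], of v] by simp

lemma test_vderiv:
  assumes "w \<in> test_functions I"
  shows "vderiv w \<in> test_functions I"
proof -
  obtain b where b: "smooth_in UNIV w" "0 < b" "b < a" "\<And>x. b \<le> \<bar>x\<bar> \<Longrightarrow> w x = 0"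
    using assms(1) test_iff by blast
  have o: "open {x. b < \<bar>x\<bar>}" by (intro open_Collect_less continuous_intros)
  have "vderiv w x = 0" if "b < \<bar>x\<bar>" for x
  proof (rule vderiv_eq)
    show "(w has_vector_derivative 0) (at x)"
      by (rule has_vector_derivative_transform_within_open[OF has_vector_derivative_const o, of _ 0])
        (use that b(4) in auto)
  qed
  then show ?thesis unfolding test_iff using b smooth_in_vderiv[OF b(1)]
    by (auto intro!: exI[of _ "(b + a) / 2"])
qed

lemma test_hvd: "w \<in> test_functions I \<Longrightarrow> (w has_vector_derivative vderiv w x) (at x)"
  using test_iff smooth_in_hvd by blast

text \<open>One flat factor vanishes up to \<open>p\<close>, the other from \<open>q\<close> on. The
  slope \<open>r\<close> controls the transition: on a fixed inner point the value tends to 1 as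
  \<open>r\<close> grows, and \<open>r\<close> inversely proportional to \<open>q - p\<close> gives
  rescaled copies of one profile.\<close>

definition bump :: "real \<Rightarrow> real \<Rightarrow> real \<Rightarrow> real \<Rightarrow> complex" where
  "bump r p q x = of_real (flat 0 (r * x + (- r * p))) * of_real (flat 0 ((- r) * x + r * q))"

lemma bump_test:
  assumes "r > 0" "- a < p" "q < a"
  shows "bump r p q \<in> test_functions I"
  unfolding test_iff
proof
  show "smooth_in UNIV (bump r p q)" unfolding bump_def
    by (intro smooth_in_mult smooth_in_flat) simp
  define b where "b = max (max \<bar>p\<bar> \<bar>q\<bar>) 0"
  have z: "bump r p q x = 0" if "x \<le> p \<or> q \<le> x" for x
    using that assms(1) by (auto simp: bump_def flat_def algebra_simps dest: mult_left_mono[of _ _ r])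
  show "\<exists>b. 0 < b \<and> b < a \<and> (\<forall>x. b \<le> \<bar>x\<bar> \<longrightarrow> bump r p q x = 0)"
  proof (intro exI conjI allI impI)
    let ?b = "max (max (- p) q) (a / 2)"
    show "0 < ?b" "?b < a" using assms a_pos by auto
    show "bump r p q x = 0" if "?b \<le> \<bar>x\<bar>" for x
      using that by (intro z) (auto simp: abs_if split: if_splits)
  qed
qed

lemma cmod_bump: "cmod (bump r p q x) \<le> 1"
  using flat_0_bounds by (simp add: bump_def norm_mult mult_le_one)

lemma bump_real: "bump r p q x = of_real (Re (bump r p q x))" "0 \<le> Re (bump r p q x)"
  using flat_0_bounds by (auto simp: bump_def)

lemma bump_pos: "r > 0 \<Longrightarrow> p < x \<Longrightarrow> x < q \<Longrightarrow> 0 < Re (bump r p q x)"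
proof -
  assume "r > 0" "p < x" "x < q"
  then have "r * x + - r * p > 0" "- r * x + r * q > 0" by (auto simp: mult_strict_left_mono)
  then show ?thesis using flat_0_pos by (simp add: bump_def)
qed

lemma bump_zero: "r > 0 \<Longrightarrow> x \<le> p \<or> q \<le> x \<Longrightarrow> bump r p q x = 0"
    by (auto simp: bump_def flat_def algebra_simps dest: mult_left_mono[of _ _ r])

end

section \<open>Density of the test functions in L2\<close>

context symmetric_interval
begin

lemma L2_norm_minus_commute: "L2_norm N (\<lambda>x. f x - g x) = L2_norm N (\<lambda>x. g x - f x)"
  by (simp add: L2_norm_def norm_minus_commute)

lemma L2_norm_diff_triangle:
  assumes "f \<in> L2 M" "g \<in> L2 M" "h \<in> L2 M"
  shows "L2_norm M (\<lambda>x. f x - h x) \<le> L2_norm M (\<lambda>x. f x - g x) + L2_norm M (\<lambda>x. g x - h x)"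
  using L2_norm_triangle[OF I_lebesgue L2_diff[OF assms(1,2)] L2_diff[OF assms(2,3)]] by simp

lemma L2_approx_bounded:
  assumes "f \<in> L2 M" "e > 0"
  shows "\<exists>g B. B > 0 \<and> g \<in> borel_measurable M \<and> (\<forall>x. cmod (g x) \<le> B) \<and> L2_norm M (\<lambda>x. f x - g x) < e"
proof -
  define g where "g n x = (if cmod (f x) \<le> real n then f x else 0)" for n x
  note [measurable] = L2_measurable[OF assms(1)]
  have gm [measurable]: "g n \<in> borel_measurable M" for n unfolding g_def by measurable
  have "(\<lambda>n. L2_norm M (\<lambda>x. g n x - f x)) \<longlonglongrightarrow> 0"
  proof (rule L2_norm_dominated_convergence[OF L2_integrable[OF assms(1)]])
    have "(\<lambda>n. g n x) \<longlonglongrightarrow> f x" for x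
    proof (rule tendsto_eventually)
      obtain N where N: "cmod (f x) \<le> real N" using real_arch_simple by blast
      show "\<forall>\<^sub>F n in sequentially. g n x = f x"
        using eventually_ge_at_top[of N] by eventually_elim (use N in \<open>auto simp: g_def\<close>)
    qed
    then show "AE x in M. (\<lambda>n. g n x) \<longlonglongrightarrow> f x" by simp
    show "AE x in M. (cmod (g n x - f x))\<^sup>2 \<le> (cmod (f x))\<^sup>2" for n by (simp add: g_def)
  qed (use gm L2_measurable[OF assms(1)] in auto)
  from LIMSEQ_D[OF this assms(2)] obtain n where "L2_norm M (\<lambda>x. g n x - f x) < e" by (auto simp: L2_norm_nonneg)
  then show ?thesis
    by (intro exI[of _ "g n"] exI[of _ "real n + 1"] conjI allI gm)
      (auto simp: g_def L2_norm_minus_commute add_nonneg_pos)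
qed

lemma L2_approx_continuous:
  assumes "g \<in> borel_measurable M" "\<And>x. cmod (g x) \<le> B" "B > 0" "e > 0"
  shows "\<exists>h. continuous_on UNIV h \<and> L2_norm M (\<lambda>x. g x - h x) < e"
proof -
  have "g measurable_on I" using assms(1) by (simp add: measurable_on_iff_borel_measurable)
  then obtain N k where k: "negligible N" "\<And>n. continuous_on UNIV (k n)"
    "\<And>x. x \<notin> N \<Longrightarrow> (\<lambda>n. k n x) \<longlonglongrightarrow> (if x \<in> I then g x else 0)"
    unfolding measurable_on_def by metis
  \<comment> \<open>The radial retraction onto the disc of radius \<open>B\<close>: it is
    continuous, fixes the values of \<open>g\<close>, and makes the approximating functions
    uniformly bounded, as dominated convergence requires.\<close>
  define r :: "complex \<Rightarrow> complex" where "r z = z / of_real (max 1 (cmod z / B))" for z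
  have rc: "continuous_on UNIV r" unfolding r_def by (intro continuous_intros) (use assms(3) in auto)
  have r1: "r z = z" if "cmod z \<le> B" for z using that assms(3) by (simp add: r_def max_def)
  have r2: "cmod (r z) \<le> B" for z
    using assms(3) by (auto simp: r_def norm_divide max_def field_simps)
  have rk: "continuous_on UNIV (\<lambda>x. r (k n x))" for n
    using continuous_on_compose2[OF rc k(2)] by simp
  have "(\<lambda>n. L2_norm M (\<lambda>x. r (k n x) - g x)) \<longlonglongrightarrow> 0"
  proof (rule L2_norm_dominated_convergence_bounded[OF finite_M assms(1)])
    show "(\<lambda>x. r (k n x)) \<in> borel_measurable M" for n
      using continuous_on_subset[OF rk] by (intro continuous_M) auto
    have "(\<lambda>n. r (k n x)) \<longlonglongrightarrow> g x" if "x \<notin> N" "x \<in> I" for x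
    proof -
      have "(\<lambda>n. k n x) \<longlonglongrightarrow> g x" using k(3)[OF that(1)] that(2) by simp
      then have "(\<lambda>n. r (k n x)) \<longlonglongrightarrow> r (g x)"
        using rc by (intro continuous_on_tendsto_compose[OF rc]) auto
      then show ?thesis using r1[OF assms(2)] by simp
    qed
    moreover have "N \<in> null_sets lebesgue" using k(1) by (simp add: negligible_iff_null_sets)
    ultimately show "AE x in M. (\<lambda>n. r (k n x)) \<longlonglongrightarrow> g x"
      by (subst AE_restrict_space_iff) (auto simp: dest: AE_not_in elim!: eventually_mono)
  qed (use r2 assms(2) in auto)
  from LIMSEQ_D[OF this assms(4)] obtain n where "L2_norm M (\<lambda>x. r (k n x) - g x) < e" by (auto simp: L2_norm_nonneg)
  then show ?thesis using rk by (auto simp: L2_norm_minus_commute)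
qed

lemma continuous_L2: "continuous_on UNIV g \<Longrightarrow> g \<in> L2 M"
  using continuous_closure_L2 by (simp add: I_def)

text \<open>The supports exhaust \<open>I\<close> while the slopes grow, so at each inner point the
  arguments of both flat factors tend to infinity.\<close>

lemma cutoff_tendsto:
  defines "q n \<equiv> a - a / (real n + 2)"
  assumes "x \<in> I"
  shows "(\<lambda>n. bump (real n + 1) (- q n) (q n) x) \<longlonglongrightarrow> 1"
proof -
  have r: "filterlim (\<lambda>n. real n + 1) at_top sequentially"
    by (intro filterlim_tendsto_add_at_top[OF tendsto_const, of _ _ 1, simplified add.commute[of 1]] filterlim_real_sequentially)
  have "(\<lambda>n. a / (real n + 2)) \<longlonglongrightarrow> 0" by real_asymp
  then have q: "q \<longlonglongrightarrow> a" unfolding q_def using tendsto_diff[OF tendsto_const[of a]] by fastforce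
  have 1: "filterlim (\<lambda>n. (q n + x) * (real n + 1)) at_top sequentially"
    by (rule filterlim_tendsto_pos_mult_at_top[OF tendsto_add[OF q tendsto_const] _ r])
      (use assms(2) in \<open>auto simp: I_def\<close>)
  have 2: "filterlim (\<lambda>n. (q n - x) * (real n + 1)) at_top sequentially"
    by (rule filterlim_tendsto_pos_mult_at_top[OF tendsto_diff[OF q tendsto_const] _ r])
      (use assms(2) in \<open>auto simp: I_def\<close>)
  have "(\<lambda>n. complex_of_real (flat 0 ((q n + x) * (real n + 1))) * of_real (flat 0 ((q n - x) * (real n + 1))))
     \<longlonglongrightarrow> of_real 1 * of_real 1"
    by (intro tendsto_intros filterlim_compose[OF flat_0_tendsto] 1 2)
  moreover have "(real n + 1) * x + - (real n + 1) * - q n = (q n + x) * (real n + 1)"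
    "- (real n + 1) * x + (real n + 1) * q n = (q n - x) * (real n + 1)" for n
    by (simp_all add: algebra_simps)
  ultimately show ?thesis unfolding bump_def by simp
qed

text \<open>Smoothness comes from a polynomial that is uniformly close on the closed interval,
  compact support from multiplication with the exhausting cutoffs.\<close>

lemma L2_approx_test_of_continuous:
  assumes g: "continuous_on UNIV g" and e: "e > 0"
  shows "\<exists>h\<in>test_functions I. L2_norm M (\<lambda>x. g x - h x) < e"
proof -
  define d where "d = e / (2 * (sqrt (measure M (space M)) + 1))"
  have m0: "sqrt (measure M (space M)) \<ge> 0" by simp
  have d: "d > 0" using e m0 by (simp add: d_def add_nonneg_pos)
  obtain p where p: "polynomial_function p" "\<And>x. x \<in> {-a..a} \<Longrightarrow> cmod (g x - p x) < d"
    using Stone_Weierstrass_polynomial_function[OF compact_Icc continuous_on_subset[OF g subset_UNIV] d] by metis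
  have ps: "smooth_in UNIV p" by (rule smooth_in_polynomial[OF p(1)])
  have phi_coeff: "continuous_on UNIV p" by (rule smooth_in_continuous[OF ps])
  have "L2_norm M (\<lambda>x. g x - p x) \<le> d * sqrt (measure M (space M))"
  proof (rule L2_norm_bounded[OF finite_M])
    show "(\<lambda>x. g x - p x) \<in> borel_measurable M"
      by (intro continuous_M continuous_intros continuous_on_subset[OF g] continuous_on_subset[OF phi_coeff]) auto
  qed (use p(2) d in \<open>auto simp: I_def intro: less_imp_le\<close>)
  also have "\<dots> < e / 2"
  proof -
    have "d * sqrt (measure M (space M)) < d * (sqrt (measure M (space M)) + 1)" using d by simp
    also have "\<dots> = e / 2" using m0 by (simp add: d_def field_simps add_nonneg_eq_0_iff)
    finally show ?thesis .
  qed
  finally have gp: "L2_norm M (\<lambda>x. g x - p x) < e / 2" .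
  define q where "q n = a - a / (real n + 2)" for n
  define h where "h n x = p x * bump (real n + 1) (- q n) (q n) x" for n x
  have q: "- a < - q n" "q n < a" for n using a_pos by (auto simp: q_def)
  have ht: "h n \<in> test_functions I" for n unfolding h_def
    by (intro test_mult bump_test smooth_in_subset[OF ps] q) auto
  obtain B where B: "\<And>x. x \<in> {-a..a} \<Longrightarrow> cmod (p x) \<le> B"
    using compact_imp_bounded[OF compact_continuous_image[OF continuous_on_subset[OF phi_coeff subset_UNIV] compact_Icc]]
    unfolding bounded_iff by blast
  have "(\<lambda>n. L2_norm M (\<lambda>x. h n x - p x)) \<longlonglongrightarrow> 0"
  proof (rule L2_norm_dominated_convergence_bounded[OF finite_M, where B = B])
    show "p \<in> borel_measurable M" using continuous_on_subset[OF phi_coeff] by (intro continuous_M) auto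
    show "h n \<in> borel_measurable M" for n using L2_measurable[OF test_L2[OF ht]] .
    have "(\<lambda>n. h n x) \<longlonglongrightarrow> p x * 1" if "x \<in> I" for x
      unfolding h_def q_def by (intro tendsto_intros cutoff_tendsto that)
    then show "AE x in M. (\<lambda>n. h n x) \<longlonglongrightarrow> p x" by (intro AE_I2) simp
    show "cmod (h n x) \<le> B" if "x \<in> space M" for n x
    proof -
      have "cmod (h n x) \<le> cmod (p x) * 1" unfolding h_def norm_mult by (intro mult_left_mono cmod_bump) auto
      also have "\<dots> \<le> B" using B[of x] that by (auto simp: I_def)
      finally show ?thesis .
    qed
    show "cmod (p x) \<le> B" if "x \<in> space M" for x using B[of x] that by (auto simp: I_def)
  qed
  from LIMSEQ_D[OF this half_gt_zero[OF e]] obtain n where "L2_norm M (\<lambda>x. h n x - p x) < e / 2"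
    by (auto simp: L2_norm_nonneg)
  then have "L2_norm M (\<lambda>x. p x - h n x) < e / 2" by (simp add: L2_norm_minus_commute)
  with gp L2_norm_diff_triangle[OF continuous_L2[OF g] continuous_L2[OF phi_coeff] test_L2[OF ht[of n]]]
  have "L2_norm M (\<lambda>x. g x - h n x) < e" by linarith
  with ht show ?thesis by blast
qed

theorem test_functions_dense:
  assumes "f \<in> L2 M" "e > 0"
  shows "\<exists>h\<in>test_functions I. L2_norm M (\<lambda>x. f x - h x) < e"
proof -
  have e: "e / 3 > 0" using assms(2) by simp
  obtain g B where g: "B > 0" "g \<in> borel_measurable M" "\<And>x. cmod (g x) \<le> B" "L2_norm M (\<lambda>x. f x - g x) < e / 3"
    using L2_approx_bounded[OF assms(1) e] by blast
  obtain k where k: "continuous_on UNIV k" "L2_norm M (\<lambda>x. g x - k x) < e / 3"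
    using L2_approx_continuous[OF g(2,3,1) e] by blast
  obtain h where h: "h \<in> test_functions I" "L2_norm M (\<lambda>x. k x - h x) < e / 3"
    using L2_approx_test_of_continuous[OF k(1) e] by blast
  have L: "g \<in> L2 M" "k \<in> L2 M" "h \<in> L2 M"
    using L2_bounded[OF finite_M g(2)] g(3) continuous_L2[OF k(1)] test_L2[OF h(1)] by auto
  have "L2_norm M (\<lambda>x. f x - h x) < e"
    using L2_norm_diff_triangle[OF assms(1) L(1,3)] L2_norm_diff_triangle[OF L] g(4) k(2) h(2) by linarith
  with h(1) show ?thesis by blast
qed

text \<open>The pairing is bilinear, without conjugation; therefore test functions approximating the
  conjugate of \<open>y\<close> bound the squared norm of \<open>y\<close> by an arbitrarily small
  multiple of its norm.\<close>

lemma L2_orthogonal_test_functions: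
  assumes y: "y \<in> L2 M" and "\<And>h. h \<in> test_functions I \<Longrightarrow> (LINT x|M. h x * y x) = 0"
  shows "AE x in M. y x = 0"
proof -
  let ?c = "\<lambda>x. cnj (y x)"
  have c: "?c \<in> L2 M" by (rule L2_cnj[OF y])
  have ny: "L2_norm M ?c = L2_norm M y" by (simp add: L2_norm_def)
  have "L2_norm M y \<le> e" if e: "e > 0" for e
  proof -
    obtain h where h: "h \<in> test_functions I" "L2_norm M (\<lambda>x. ?c x - h x) < e"
      using test_functions_dense[OF c e] by blast
    note hL = test_L2[OF h(1)]
    have "L2_inner M ?c ?c = (LINT x|M. (?c x - h x) * y x)"
      using assms(2)[OF h(1)] L2_integrable_mult[OF c y] L2_integrable_mult[OF hL y]
      by (simp add: L2_inner_def left_diff_distrib)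
    then have "(L2_norm M y)\<^sup>2 = cmod (LINT x|M. (?c x - h x) * y x)"
      by (metis L2_inner_self ny norm_of_real abs_power2)
    also have "\<dots> \<le> L2_norm M (\<lambda>x. ?c x - h x) * L2_norm M y"
      by (rule L2_Cauchy_Schwarz_mult[OF I_lebesgue L2_diff[OF c hL] y])
    also have "\<dots> \<le> e * L2_norm M y" using h(2) by (intro mult_right_mono) (auto simp: L2_norm_nonneg)
    finally have "L2_norm M y * L2_norm M y \<le> e * L2_norm M y" by (simp add: power2_eq_square)
    then show ?thesis using L2_norm_nonneg[of M y] e by (auto simp: mult_le_cancel_right)
  qed
  then have "L2_norm M y \<le> 0" by (rule dense_ge)
  then have "L2_norm M y = 0" using L2_norm_nonneg[of M y] by simp
  then show ?thesis by (simp add: L2_norm_zero_iff[OF y])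
qed

section \<open>Integration by parts with one compactly supported factor\<close>

lemma compact_support_integral:
  fixes g :: "real \<Rightarrow> complex"
  assumes g: "continuous_on I g" and b: "0 < b" "b < a" and z: "\<And>x. x \<in> I \<Longrightarrow> b \<le> \<bar>x\<bar> \<Longrightarrow> g x = 0"
  shows "integrable M g" "(LINT x|M. g x) = integral {-b..b} g"
proof -
  have sub: "{-b..b} \<subseteq> I" using b by (auto simp: I_def)
  obtain B where B: "\<And>x. x \<in> {-b..b} \<Longrightarrow> cmod (g x) \<le> B"
    using compact_imp_bounded[OF compact_continuous_image[OF continuous_on_subset[OF g sub] compact_Icc]]
    unfolding bounded_iff by blast
  have "cmod (g x) \<le> max B 0" if "x \<in> I" for x
  proof (cases "b \<le> \<bar>x\<bar>")
    case False
    then have "x \<in> {-b..b}" by auto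
    then show ?thesis using B[of x] by simp
  qed (use z[OF that] in simp)
  then show int: "integrable M g"
    by (intro M.integrable_const_bound[where B = "max B 0"] continuous_M g) auto
  have "(LINT x|M. g x) = (LINT x|M. (if x \<in> {-b..b} then g x else 0))"
    by (rule Bochner_Integration.integral_cong) (use z in auto)
  also have "\<dots> = (LINT x|lebesgue_on ({-b..b} \<inter> I). g x)" by (rule Lebesgue_Measure.integral_restrict_Int) auto
  also have "{-b..b} \<inter> I = {-b..b}" using sub by auto
  also have "(LINT x|lebesgue_on {-b..b}. g x) = integral {-b..b} g"
    by (rule lebesgue_integral_eq_integral[OF continuous_imp_integrable_real[OF continuous_on_subset[OF g sub]]]) simp
  finally show "(LINT x|M. g x) = integral {-b..b} g" .
qed

lemma compact_support_derivative:
  assumes f: "\<And>x. x \<in> I \<Longrightarrow> (f has_vector_derivative f' x) (at x)"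
    and z: "\<And>x. x \<in> I \<Longrightarrow> b \<le> \<bar>x\<bar> \<Longrightarrow> f x = 0" and x: "x \<in> I" "b < \<bar>x\<bar>"
  shows "f' x = 0"
proof -
  have o: "open (I \<inter> {x. b < \<bar>x\<bar>})" by (intro open_Int I_open open_Collect_less continuous_intros)
  have "(f has_vector_derivative 0) (at x)"
    by (rule has_vector_derivative_transform_within_open[OF has_vector_derivative_const o, of _ 0])
      (use x z in auto)
  then show ?thesis using f[OF x(1)] vector_derivative_at by metis
qed

lemma integral_derivative_compact_support:
  fixes f :: "real \<Rightarrow> complex"
  assumes f: "\<And>x. x \<in> I \<Longrightarrow> (f has_vector_derivative f' x) (at x)" and c: "continuous_on I f'"
    and b: "0 < b" "b < a" and z: "\<And>x. x \<in> I \<Longrightarrow> b \<le> \<bar>x\<bar> \<Longrightarrow> f x = 0"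
  shows "integrable M f'" "(LINT x|M. f' x) = 0"
proof -
  \<comment> \<open>\<open>f'\<close> is known to vanish only on the open set where
    \<open>b < \<bar>x\<bar>\<close>, so the closed condition required for the integral needs a
    slightly larger bound.\<close>
  define b' where "b' = (a + b) / 2"
  have b': "0 < b'" "b' < a" "b < b'" using b by (auto simp: b'_def)
  have z': "f' x = 0" if "x \<in> I" "b' \<le> \<bar>x\<bar>" for x
    using compact_support_derivative[OF f z that(1)] that b'(3) by auto
  show "integrable M f'" by (rule compact_support_integral(1)[OF c b'(1,2) z'])
  have "(f has_vector_derivative f' x) (at x within {-b'..b'})" if "x \<in> {-b'..b'}" for x
    by (rule has_vector_derivative_at_within[OF f]) (use that b' in \<open>auto simp: I_def\<close>)
  then have "(f' has_integral f b' - f (- b')) {-b'..b'}"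
    by (intro fundamental_theorem_of_calculus) (use b' in auto)
  then have "integral {-b'..b'} f' = f b' - f (- b')" by (rule integral_unique)
  also have "\<dots> = 0" using z[of b'] z[of "- b'"] b' by (simp add: I_iff)
  finally show "(LINT x|M. f' x) = 0" using compact_support_integral(2)[OF c b'(1,2) z'] by simp
qed

text \<open>Only \<open>v\<close> vanishes near the endpoints, so \<open>u\<close> and
  \<open>u'\<close> may be singular there; the product rule is integrated over a compact
  subinterval.\<close>

lemma integral_by_parts_compact_support:
  fixes u v :: "real \<Rightarrow> complex"
  assumes u: "\<And>x. x \<in> I \<Longrightarrow> (u has_vector_derivative u' x) (at x)" "continuous_on I u'"
    and v: "\<And>x. x \<in> I \<Longrightarrow> (v has_vector_derivative v' x) (at x)" "continuous_on I v'"
    and b: "0 < b" "b < a" and z: "\<And>x. x \<in> I \<Longrightarrow> b \<le> \<bar>x\<bar> \<Longrightarrow> v x = 0"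
  shows "(LINT x|M. u' x * v x) = - (LINT x|M. u x * v' x)"
proof -
  have uc: "continuous_on I u" "continuous_on I v"
    using u(1) v(1) has_vector_derivative_continuous continuous_at_imp_continuous_on by blast+
  have d: "((\<lambda>x. u x * v x) has_vector_derivative u x * v' x + u' x * v x) (at x)" if "x \<in> I" for x
    by (intro has_vector_derivative_mult u(1) v(1) that)
  have c: "continuous_on I (\<lambda>x. u x * v' x + u' x * v x)" by (intro continuous_intros u(2) v(2) uc)
  have "(LINT x|M. u x * v' x + u' x * v x) = 0"
    by (rule integral_derivative_compact_support(2)[OF d c b]) (simp_all add: z)
  moreover have i1: "integrable M (\<lambda>x. u' x * v x)"
    by (rule compact_support_integral(1)[OF _ b]) (auto intro!: continuous_intros u(2) uc simp: z)
  moreover have "integrable M (\<lambda>x. u x * v' x + u' x * v x)"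
    by (rule integral_derivative_compact_support(1)[OF d c b]) (simp_all add: z)
  from Bochner_Integration.integrable_diff[OF this i1] have "integrable M (\<lambda>x. u x * v' x)" by simp
  ultimately show ?thesis by (simp add: eq_neg_iff_add_eq_0 add.commute)
qed

text \<open>The primitive that starts with 0 on the left of the support is constant on its right,
  and the constant is the mean of \<open>p\<close>.\<close>

lemma test_primitive:
  assumes p: "p \<in> test_functions I" and 0: "(LINT x|M. p x) = 0"
  shows "\<exists>ch\<in>test_functions I. \<forall>x. (ch has_vector_derivative p x) (at x)"
proof -
  obtain b where b: "smooth_in UNIV p" "0 < b" "b < a" "\<And>x. b \<le> \<bar>x\<bar> \<Longrightarrow> p x = 0"
    using p test_iff by blast
  have phi_coeff: "continuous_on UNIV p" by (rule test_continuous[OF p])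
  then have "isCont p x" for x by (simp add: continuous_on_eq_continuous_at)
  then obtain F0 where "\<And>x. (F0 has_vector_derivative p x) (at x)"
    using einterval_antiderivative[of "-\<infinity>" "\<infinity>" p] by auto
  then have F: "((\<lambda>x. F0 x - F0 (-b)) has_vector_derivative p x) (at x)" for x
    using has_vector_derivative_diff[OF _ has_vector_derivative_const] by fastforce
  define F where "F = (\<lambda>x. F0 x - F0 (-b))"
  note F = F[folded F_def]
  have const: "F x = F y" if S: "convex S" "\<And>z. z \<in> S \<Longrightarrow> b \<le> \<bar>z\<bar>" "x \<in> S" "y \<in> S" for S x y
  proof -
    have "(F has_vector_derivative 0) (at z within S)" if "z \<in> S" for z
      using has_vector_derivative_at_within[OF F[of z], of S] b(4)[OF S(2)[OF that]] by simp
    from has_vector_derivative_zero_constant[OF S(1) this] obtain k where "\<And>z. z \<in> S \<Longrightarrow> F z = k"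
      by blast
    then show ?thesis using S by simp
  qed
  have "(p has_integral F b - F (- b)) {-b..b}"
    by (rule fundamental_theorem_of_calculus) (use b in \<open>auto intro: has_vector_derivative_at_within F\<close>)
  then have "F b - F (-b) = 0"
    using 0 compact_support_integral(2)[OF continuous_on_subset[OF phi_coeff subset_UNIV] b(2,3)] b(4) by (simp add: integral_unique)
  then have Fb: "F (-b) = 0" "F b = 0" by (auto simp: F_def)
  have "F x = 0" if "b \<le> \<bar>x\<bar>" for x
  proof (cases "x \<ge> 0")
    case True
    then show ?thesis using const[of "{b..}" x b] that b(2) Fb by auto
  next
    case False
    then show ?thesis using const[of "{..-b}" x "-b"] that b(2) Fb by auto
  qed
  moreover have "smooth_in UNIV F" by (rule smooth_in_primitive[OF open_UNIV F b(1)])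
  ultimately have "F \<in> test_functions I" unfolding test_iff using b(2,3) by blast
  with F show ?thesis by blast
qed

end

subsection \<open>The inverse of the transformed operator\<close>

text \<open>The analysis uses two features of \<psi>: its zeros at the endpoints are simple,
  expressed by the two-sided comparison with \<open>a\<^sup>2 - x\<^sup>2\<close>, and it solves a
  linear equation of second order. Values of \<open>m\<close> and \<open>k\<close> are found in the
  final theorem.\<close>

locale profile = symmetric_interval +
  fixes c m k :: real and \<psi> \<psi>' :: "real \<Rightarrow> real"
  assumes m_pos: "m > 0"
    and psi_lower: "\<bar>x\<bar> < a \<Longrightarrow> m * (a\<^sup>2 - x\<^sup>2) \<le> \<psi> x"
    and psi_upper: "\<bar>x\<bar> < a \<Longrightarrow> \<psi> x \<le> k * (a\<^sup>2 - x\<^sup>2)"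
    and psi_deriv: "(\<psi> has_real_derivative \<psi>' x) (at x)"
    and psi'_deriv: "(\<psi>' has_real_derivative 2 * c - 2 * \<psi> x) (at x)"
begin

definition \<phi> :: "real \<Rightarrow> real" where "\<phi> x = sqrt (\<psi> x)"
definition \<tau> :: "real \<Rightarrow> real" where "\<tau> x = a\<^sup>2 - x\<^sup>2"

lemma tau_pos: "x \<in> I \<Longrightarrow> \<tau> x > 0"
  using abs_square_less_1[of "x / a"] a_pos by (simp add: \<tau>_def I_iff power_divide abs_divide)

lemma tau_factor: "\<tau> x = (a - x) * (a + x)"
  by (simp add: \<tau>_def power2_eq_square algebra_simps)

lemma tau_le: "\<tau> x \<le> a\<^sup>2"
  by (simp add: \<tau>_def)

lemma psi_bounds: "x \<in> I \<Longrightarrow> m * \<tau> x \<le> \<psi> x" "x \<in> I \<Longrightarrow> \<psi> x \<le> k * \<tau> x"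
  using psi_lower psi_upper by (auto simp: \<tau>_def I_iff)

lemma psi_pos: "x \<in> I \<Longrightarrow> \<psi> x > 0"
  using psi_bounds(1)[of x] tau_pos[of x] m_pos by (metis mult_pos_pos order_less_le_trans)

lemma k_pos: "k > 0"
proof -
  have "0 < k * \<tau> 0" using psi_pos[OF zero_in_I] psi_bounds(2)[OF zero_in_I] by linarith
  then show ?thesis using tau_pos[OF zero_in_I] by (simp add: zero_less_mult_iff)
qed

lemma phi_pos: "x \<in> I \<Longrightarrow> \<phi> x > 0"
  using psi_pos by (simp add: \<phi>_def)

lemma phi_sq: "x \<in> I \<Longrightarrow> \<phi> x * \<phi> x = \<psi> x"
  using psi_pos[of x] by (simp add: \<phi>_def)

lemma cphi_sq: "x \<in> I \<Longrightarrow> complex_of_real (\<phi> x) * (of_real (\<phi> x) * z) = of_real (\<psi> x) * z"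
  using phi_sq[of x] by (metis mult.assoc of_real_mult)

lemma phi_nonzero: "x \<in> I \<Longrightarrow> complex_of_real (\<phi> x) \<noteq> 0"
  using phi_pos[of x] by simp

lemma psi_nonzero: "x \<in> I \<Longrightarrow> complex_of_real (\<psi> x) \<noteq> 0"
  using psi_pos[of x] by simp

lemma psi_hvd: "((\<lambda>x. complex_of_real (\<psi> x)) has_vector_derivative of_real (\<psi>' x)) (at x)"
  by (rule has_vector_derivative_of_real[OF psi_deriv])

lemma psi'_hvd: "((\<lambda>x. complex_of_real (\<psi>' x)) has_vector_derivative 2 * of_real c + (- 2) * of_real (\<psi> x)) (at x)"
  using has_vector_derivative_of_real[OF psi'_deriv, where ?'a = complex] by simp

text \<open>The differential equation closes the system: each of \<psi> and its derivative has a
  derivative that is affine in the other or the other itself, so both gain one order in a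
  simultaneous induction.\<close>

lemma psi_smooth: "smooth_in UNIV (\<lambda>x. complex_of_real (\<psi> x))"
proof -
  have "times_differentiable n UNIV (\<lambda>x. complex_of_real (\<psi> x)) \<and> times_differentiable n UNIV (\<lambda>x. complex_of_real (\<psi>' x))" for n
  proof (induction n)
    case 0
    show ?case using hvd_differentiable[OF psi_hvd] hvd_differentiable[OF psi'_hvd] by simp
  next
    case (Suc n)
    have "times_differentiable n UNIV (\<lambda>x. 2 * complex_of_real c + (- 2) * of_real (\<psi> x))"
      using Suc by (intro times_differentiable_add times_differentiable_mult times_differentiable_const) auto
    then show ?case
      using Suc times_differentiable_SucI[OF open_UNIV psi_hvd] times_differentiable_SucI[OF open_UNIV psi'_hvd] by blast
  qed
  then show ?thesis by (simp add: smooth_in_def)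
qed

lemma psi_smooth_I: "smooth_in I (\<lambda>x. complex_of_real (\<psi> x))"
  by (rule smooth_in_subset[OF psi_smooth]) simp

lemma psi'_smooth_I: "smooth_in I (\<lambda>x. complex_of_real (\<psi>' x))"
  by (rule smooth_in_cong[OF I_open _ smooth_in_vderiv[OF psi_smooth_I]]) (simp add: vderiv_eq[OF psi_hvd])

text \<open>The right side is a product of \<psi>' and three copies of \<open>1 / \<phi>\<close>. In
  this form smoothness of \<open>1 / \<phi>\<close> follows by induction on the order, and that of
  \<open>\<phi>\<close> as \<open>\<psi>\<close> times \<open>1 / \<phi>\<close>.\<close>

lemma inverse_phi_deriv:
  assumes "x \<in> I"
  shows "((\<lambda>x. 1 / \<phi> x) has_real_derivative - (1/2) * \<psi>' x * ((1 / \<phi> x) * ((1 / \<phi> x) * (1 / \<phi> x)))) (at x)"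
proof -
  have "(\<phi> has_real_derivative \<psi>' x * (inverse (sqrt (\<psi> x)) / 2)) (at x)"
    unfolding \<phi>_def[abs_def] using DERIV_chain2[OF DERIV_real_sqrt[OF psi_pos[OF assms]] psi_deriv]
    by (simp add: mult.commute)
  then show ?thesis
    using phi_pos[OF assms] by (auto intro!: derivative_eq_intros simp: \<phi>_def[symmetric] field_simps)
qed

lemma inverse_phi_smooth: "smooth_in I (\<lambda>x. 1 / complex_of_real (\<phi> x))"
proof -
  have "times_differentiable n I (\<lambda>x. complex_of_real (1 / \<phi> x))" for n
  proof (induction n)
    case 0
    show ?case using hvd_differentiable[OF has_vector_derivative_of_real[OF inverse_phi_deriv, where ?'a = complex]] by simp
  next
    case (Suc n)
    have "times_differentiable n I (\<lambda>x. - (1/2) * complex_of_real (\<psi>' x) * (of_real (1 / \<phi> x) * (of_real (1 / \<phi> x) * of_real (1 / \<phi> x))))"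
      using psi'_smooth_I Suc by (intro times_differentiable_mult times_differentiable_const I_open) (auto simp: smooth_in_def)
    then have "times_differentiable n I (\<lambda>x. complex_of_real (- (1/2) * \<psi>' x * ((1 / \<phi> x) * ((1 / \<phi> x) * (1 / \<phi> x)))))"
      by simp
    then show ?case
      by (rule times_differentiable_SucI[OF I_open has_vector_derivative_of_real[OF inverse_phi_deriv], rotated])
  qed
  then show ?thesis by (simp add: smooth_in_def)
qed

lemma phi_smooth: "smooth_in I (\<lambda>x. complex_of_real (\<phi> x))"
proof (rule smooth_in_cong[OF I_open _ smooth_in_mult[OF I_open psi_smooth_I inverse_phi_smooth]])
  fix x assume "x \<in> I"
  then show "complex_of_real (\<psi> x) * (1 / of_real (\<phi> x)) = of_real (\<phi> x)"
    using phi_sq[of x] phi_nonzero[of x] by (simp add: field_simps flip: of_real_mult)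
qed

lemma inverse_psi_smooth: "smooth_in I (\<lambda>x. 1 / complex_of_real (\<psi> x))"
proof (rule smooth_in_cong[OF I_open _ smooth_in_mult[OF I_open inverse_phi_smooth inverse_phi_smooth]])
  fix x assume "x \<in> I"
  then show "1 / complex_of_real (\<phi> x) * (1 / of_real (\<phi> x)) = 1 / of_real (\<psi> x)"
    using phi_sq[of x] by (simp flip: of_real_mult)
qed

lemma psi_continuous: "continuous_on S \<psi>"
  by (meson DERIV_isCont continuous_at_imp_continuous_on psi_deriv)

lemma phi_continuous: "continuous_on S \<phi>"
  unfolding \<phi>_def[abs_def] by (intro continuous_intros psi_continuous)

lemma psi_le: "x \<in> I \<Longrightarrow> \<psi> x \<le> k * a\<^sup>2"
  using psi_bounds(2)[of x] mult_left_mono[OF tau_le[of x], of k] k_pos by linarith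

lemma phi_L2: "(\<lambda>x. complex_of_real (\<phi> x)) \<in> L2 M"
proof (rule L2_bounded[OF finite_M, where B = "sqrt (k * a\<^sup>2)"])
  show "(\<lambda>x. complex_of_real (\<phi> x)) \<in> borel_measurable M" by (intro continuous_M continuous_intros phi_continuous)
  show "cmod (complex_of_real (\<phi> x)) \<le> sqrt (k * a\<^sup>2)" if "x \<in> space M" for x
    using psi_le[of x] phi_pos[of x] that by (simp add: \<phi>_def)
qed

section \<open>The inner primitive, which is half Hoelder continuous and decays at the
  endpoints\<close>

definition F :: "(real \<Rightarrow> complex) \<Rightarrow> real \<Rightarrow> complex" where
  "F h x = (LINT y|M. indicator {..<x} y *\<^sub>R (of_real (\<phi> y) * h y))"

lemma phi_mult_integrable: "h \<in> L2 M \<Longrightarrow> integrable M (\<lambda>y. of_real (\<phi> y) * h y)"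
  by (rule L2_integrable_mult[OF phi_L2])

lemma indicator_M [measurable]: "{..<x} \<inter> I \<in> sets M" "{y..<x} \<inter> I \<in> sets M" for x y :: real
  by (auto simp: sets_restrict_space_iff)

lemma F_integrable: "h \<in> L2 M \<Longrightarrow> integrable M (\<lambda>y. indicator {y0..<x} y *\<^sub>R (of_real (\<phi> y) * h y))"
  "h \<in> L2 M \<Longrightarrow> integrable M (\<lambda>y. indicator {..<x} y *\<^sub>R (of_real (\<phi> y) * h y))"
proof -
  assume h: "h \<in> L2 M"
  have "integrable M (\<lambda>y. indicator (S \<inter> I) y *\<^sub>R (of_real (\<phi> y) * h y)) \<longleftrightarrow>
    integrable M (\<lambda>y. indicator S y *\<^sub>R (of_real (\<phi> y) * h y))" for S
    by (rule Bochner_Integration.integrable_cong) (auto simp: indicator_def)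
  then show "integrable M (\<lambda>y. indicator {y0..<x} y *\<^sub>R (of_real (\<phi> y) * h y))"
   "integrable M (\<lambda>y. indicator {..<x} y *\<^sub>R (of_real (\<phi> y) * h y))"
    using integrable_mult_indicator[OF indicator_M(1) phi_mult_integrable[OF h]]
      integrable_mult_indicator[OF indicator_M(2) phi_mult_integrable[OF h]] by blast+
qed

lemma F_add: "h \<in> L2 M \<Longrightarrow> g \<in> L2 M \<Longrightarrow> F (\<lambda>x. h x + g x) x = F h x + F g x"
  unfolding F_def by (simp add: distrib_left scaleR_add_right F_integrable)

lemma F_cmult: "F (\<lambda>x. z * h x) x = z * F h x"
proof -
  have "F (\<lambda>x. z * h x) x = (LINT y|M. z * (indicator {..<x} y *\<^sub>R (of_real (\<phi> y) * h y)))"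
    unfolding F_def by (rule Bochner_Integration.integral_cong) (auto simp: mult.left_commute)
  also have "\<dots> = z * F h x" unfolding F_def by (rule integral_mult_right_zero)
  finally show ?thesis .
qed

lemma F_diff: "h \<in> L2 M \<Longrightarrow> g \<in> L2 M \<Longrightarrow> F (\<lambda>x. h x - g x) x = F h x - F g x"
  using F_add[OF _ L2_cmult[of g M "-1"], of h x] F_cmult[of "-1" g x] by simp

lemma F_cong_AE:
  assumes "h \<in> L2 M" "g \<in> L2 M" "AE x in M. h x = g x"
  shows "F h x = F g x"
  unfolding F_def
  by (rule integral_cong_AE[OF borel_measurable_integrable borel_measurable_integrable])
    (use assms F_integrable in auto)

lemma F_left: "x \<le> - a \<Longrightarrow> F h x = 0"
proof -
  assume "x \<le> - a"
  then have "F h x = (LINT y|M. 0)" unfolding F_def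
    by (intro Bochner_Integration.integral_cong) (auto simp: I_def indicator_def)
  then show ?thesis by simp
qed

lemma F_total: "F h a = L2_inner M h (\<lambda>x. of_real (\<phi> x))"
  unfolding F_def L2_inner_def by (rule Bochner_Integration.integral_cong) (auto simp: I_def mult.commute)

text \<open>This is Cauchy-Schwarz on \<open>[y, x)\<close>, where \<open>B\<close> bounds
  \<open>\<psi> = \<phi>\<^sup>2\<close>. A global \<open>B\<close> gives uniform Hoelder continuity
  of exponent 1/2; a \<open>B\<close> proportional to the distance from an endpoint gives linear
  decay there.\<close>

lemma F_holder:
  assumes h: "h \<in> L2 M" and yx: "y \<le> x" and B: "B \<ge> 0" "\<And>t. t \<in> I \<Longrightarrow> y \<le> t \<Longrightarrow> t < x \<Longrightarrow> \<psi> t \<le> B"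
  shows "cmod (F h x - F h y) \<le> sqrt (B * (x - y)) * L2_norm M h"
proof -
  define f where "f t = complex_of_real (indicator {y..<x} t * \<phi> t)" for t
  have "{y..<x} \<inter> I = {t \<in> I. y \<le> t \<and> t < x}" by auto
  then have S: "{t \<in> I. y \<le> t \<and> t < x} \<in> sets M" using indicator_M(2)[of y x] by simp
  have fm: "f \<in> borel_measurable M"
  proof -
    have "(\<lambda>t. indicator {y..<x} t * \<phi> t) \<in> borel_measurable M"
      using continuous_M[OF phi_continuous] S by (intro borel_measurable_times borel_measurable_indicator') auto
    then show ?thesis unfolding f_def by measurable
  qed
  have fb: "(cmod (f t))\<^sup>2 \<le> indicator {y..<x} t * B" if "t \<in> I" for t
    using B(2)[OF that] phi_sq[OF that] by (auto simp: f_def indicator_def norm_mult power2_eq_square abs_mult)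
  have fL: "f \<in> L2 M"
  proof (rule L2_bounded[OF finite_M fm, of "sqrt B"])
    fix t assume "t \<in> space M"
    then have "(cmod (f t))\<^sup>2 \<le> indicator {y..<x} t * B" using fb by simp
    also have "\<dots> \<le> B" using B(1) by (auto simp: indicator_def)
    finally have "(cmod (f t))\<^sup>2 \<le> B" .
    then show "cmod (f t) \<le> sqrt B" by (simp add: real_le_rsqrt)
  qed
  have "(LINT t|M. (cmod (f t))\<^sup>2) \<le> (LINT t|M. indicator ({y..<x} \<inter> I) t * B)"
  proof (rule integral_mono[OF L2_integrable[OF fL]])
    show "integrable M (\<lambda>t. indicator ({y..<x} \<inter> I) t * B)"
      by (intro integrable_mult_left integrable_real_indicator) (auto simp: M.emeasure_eq_measure)
    show "(cmod (f t))\<^sup>2 \<le> indicator ({y..<x} \<inter> I) t * B" if "t \<in> space M" for t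
      using fb[of t] that by (auto simp: indicator_def)
  qed
  also have "\<dots> = measure M ({y..<x} \<inter> I) * B" by (simp add: Int_absorb2)
  also have "measure M ({y..<x} \<inter> I) = measure lebesgue ({y..<x} \<inter> I)"
    by (rule measure_restrict_space) auto
  also have "measure lebesgue ({y..<x} \<inter> I) \<le> measure lebesgue {y..<x}"
    by (rule measure_mono_fmeasurable) (auto simp: fmeasurable_def emeasure_lborel_Ico[OF yx])
  also have "measure lebesgue {y..<x} = x - y" using yx by simp
  finally have "(LINT t|M. (cmod (f t))\<^sup>2) \<le> B * (x - y)" using B(1) by (simp add: mult.commute mult_right_mono)
  then have nf: "L2_norm M f \<le> sqrt (B * (x - y))" by (simp add: L2_norm_def)
  have "F h x - F h y = (LINT t|M. f t * h t)"
  proof -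
    have "F h x - F h y = (LINT t|M. indicator {..<x} t *\<^sub>R (of_real (\<phi> t) * h t) - indicator {..<y} t *\<^sub>R (of_real (\<phi> t) * h t))"
      unfolding F_def using F_integrable(2)[OF h] by simp
    also have "\<dots> = (LINT t|M. f t * h t)"
      by (rule Bochner_Integration.integral_cong) (use yx in \<open>auto simp: f_def indicator_def\<close>)
    finally show ?thesis .
  qed
  then have "cmod (F h x - F h y) \<le> L2_norm M f * L2_norm M h"
    using L2_Cauchy_Schwarz_mult[OF I_lebesgue fL h] by simp
  also have "\<dots> \<le> sqrt (B * (x - y)) * L2_norm M h" by (intro mult_right_mono nf L2_norm_nonneg)
  finally show ?thesis .
qed

lemma F_uniform_holder:
  assumes h: "h \<in> L2 M"
  shows "cmod (F h x - F h y) \<le> sqrt (k * a\<^sup>2 * \<bar>x - y\<bar>) * L2_norm M h"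
proof -
  have "k * a\<^sup>2 \<ge> 0" using k_pos by simp
  then show ?thesis
    using F_holder[OF h, of y x "k * a\<^sup>2"] F_holder[OF h, of x y "k * a\<^sup>2"] psi_le
    by (cases "y \<le> x") (auto simp: norm_minus_commute)
qed

lemma F_continuous:
  assumes h: "h \<in> L2 M"
  shows "continuous_on S (F h)"
proof (rule continuous_on_subset[OF _ subset_UNIV], unfold continuous_on_def, intro ballI)
  fix x :: real
  have "((\<lambda>y. F h y - F h x) \<longlongrightarrow> 0) (at x)"
  proof (rule Lim_null_comparison)
    show "\<forall>\<^sub>F y in at x. cmod (F h y - F h x) \<le> sqrt (k * a\<^sup>2 * \<bar>y - x\<bar>) * L2_norm M h"
      using F_uniform_holder[OF h] by simp
    have "((\<lambda>y. sqrt (k * a\<^sup>2 * \<bar>y - x\<bar>) * L2_norm M h) \<longlongrightarrow> sqrt (k * a\<^sup>2 * \<bar>x - x\<bar>) * L2_norm M h) (at x)"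
      by (intro tendsto_intros)
    then show "((\<lambda>y. sqrt (k * a\<^sup>2 * \<bar>y - x\<bar>) * L2_norm M h) \<longlongrightarrow> 0) (at x)" by simp
  qed
  then show "(F h \<longlongrightarrow> F h x) (at x)" by (simp add: LIM_zero_iff)
qed

definition C0 :: real where "C0 = sqrt (2 * a * k) / a"

lemma C0_pos: "C0 > 0" using a_pos k_pos by (simp add: C0_def)

text \<open>\<open>F h a = 0\<close> allows integration from either endpoint. Between an endpoint
  and \<open>x\<close> the function \<psi> is at most \<open>2 * a * k\<close> times the distance,
  so the square root in \<open>F_holder\<close> becomes linear in that distance.\<close>

lemma F_bound:
  assumes h: "h \<in> L2 M" and 0: "F h a = 0" and x: "x \<in> I"
  shows "cmod (F h x) \<le> C0 * L2_norm M h * \<tau> x"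
proof -
  have ax: "- a < x" "x < a" using x by (auto simp: I_def)
  have kk: "\<psi> t \<le> 2 * a * k * (a + x)" if "t \<in> I" "t < x" for t
  proof -
    have "\<psi> t \<le> k * ((a - t) * (a + t))" using psi_bounds(2)[OF that(1)] by (simp add: tau_factor)
    also have "\<dots> \<le> k * (2 * a * (a + x))" using that k_pos a_pos
      by (intro mult_left_mono mult_mono) (auto simp: I_def)
    finally show ?thesis by (simp add: mult_ac)
  qed
  have kr: "\<psi> t \<le> 2 * a * k * (a - x)" if "t \<in> I" "x \<le> t" for t
  proof -
    have "\<psi> t \<le> k * ((a + t) * (a - t))" using psi_bounds(2)[OF that(1)] by (simp add: tau_factor mult.commute)
    also have "\<dots> \<le> k * (2 * a * (a - x))" using that k_pos a_pos
      by (intro mult_left_mono mult_mono) (auto simp: I_def)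
    finally show ?thesis by (simp add: mult_ac)
  qed
  have s: "sqrt (2 * a * k * d * d) = sqrt (2 * a * k) * d" if "d > 0" for d
    using that by (simp add: real_sqrt_mult mult.assoc)
  have l: "cmod (F h x) \<le> sqrt (2 * a * k) * (a + x) * L2_norm M h"
    using F_holder[OF h, of "-a" x "2 * a * k * (a + x)"] kk ax a_pos k_pos F_left[of "-a" h] s[of "a + x"]
    by (simp add: add.commute)
  have r: "cmod (F h x) \<le> sqrt (2 * a * k) * (a - x) * L2_norm M h"
    using F_holder[OF h, of x a "2 * a * k * (a - x)"] kr ax a_pos k_pos 0 s[of "a - x"] by simp
  \<comment> \<open>One of the factors \<open>a + x\<close> and \<open>a - x\<close> is at least
    \<open>a\<close>; multiplying the estimate for the nearer endpoint by it completes the product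
    \<tau>.\<close>
  have "a * cmod (F h x) \<le> sqrt (2 * a * k) * \<tau> x * L2_norm M h"
  proof (cases "x \<ge> 0")
    case True
    have "a * cmod (F h x) \<le> (a + x) * cmod (F h x)" using True by (simp add: mult_right_mono)
    also have "\<dots> \<le> (a + x) * (sqrt (2 * a * k) * (a - x) * L2_norm M h)" using r ax by (simp add: mult_left_mono)
    finally show ?thesis by (simp add: tau_factor mult_ac)
  next
    case False
    have "a * cmod (F h x) \<le> (a - x) * cmod (F h x)" using False by (simp add: mult_right_mono)
    also have "\<dots> \<le> (a - x) * (sqrt (2 * a * k) * (a + x) * L2_norm M h)" using l ax by (simp add: mult_left_mono)
    finally show ?thesis by (simp add: tau_factor mult_ac)
  qed
  then show ?thesis using a_pos by (simp add: C0_def field_simps)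
qed

section \<open>The outer primitive and its growth at the endpoints\<close>

text \<open>The base point is the centre because the integrands are continuous on the open interval
  only and may fail to be integrable up to either endpoint.\<close>

definition prim :: "(real \<Rightarrow> complex) \<Rightarrow> real \<Rightarrow> complex" where
  "prim g = (SOME v. v 0 = 0 \<and> (\<forall>x\<in>I. (v has_vector_derivative g x) (at x)))"

lemma prim:
  assumes "continuous_on I g"
  shows "prim g 0 = 0" "x \<in> I \<Longrightarrow> (prim g has_vector_derivative g x) (at x)"
proof -
  have "\<exists>v. v 0 = 0 \<and> (\<forall>x\<in>I. (v has_vector_derivative g x) (at x))"
  proof -
    have "isCont g x" if "- a < x" "x < a" for x
      using assms that by (simp add: I_def continuous_on_eq_continuous_at)
    then obtain v where "\<And>x. x \<in> I \<Longrightarrow> (v has_vector_derivative g x) (at x)"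
      using einterval_antiderivative[of "ereal (-a)" "ereal a" g] a_pos by (auto simp: I_def)
    then have "((\<lambda>x. v x - v 0) has_vector_derivative g x) (at x)" if "x \<in> I" for x
      using has_vector_derivative_diff[OF \<open>\<And>x. x \<in> I \<Longrightarrow> (v has_vector_derivative g x) (at x)\<close>[OF that] has_vector_derivative_const[of "v 0"]]
      by simp
    then show ?thesis by (intro exI[of _ "\<lambda>x. v x - v 0"]) auto
  qed
  from someI_ex[OF this, folded prim_def]
  show "prim g 0 = 0" "x \<in> I \<Longrightarrow> (prim g has_vector_derivative g x) (at x)" by auto
qed

lemma I_convex: "convex I" by (simp add: I_def)

lemma derivative_eq_imp_const:
  assumes "\<And>x. x \<in> I \<Longrightarrow> (u has_vector_derivative g x) (at x)" "\<And>x. x \<in> I \<Longrightarrow> (v has_vector_derivative g x) (at x)"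
    "x \<in> I" "y \<in> I"
  shows "u x - v x = u y - (v y :: complex)"
proof -
  have "((\<lambda>x. u x - v x) has_vector_derivative 0) (at z within I)" if "z \<in> I" for z
    using has_vector_derivative_at_within[OF has_vector_derivative_diff[OF assms(1,2)[OF that]]] by simp
  from has_vector_derivative_zero_constant[OF I_convex this] show ?thesis using assms(3,4) by metis
qed

lemma prim_unique:
  assumes "continuous_on I g" "v 0 = 0" "\<And>x. x \<in> I \<Longrightarrow> (v has_vector_derivative g x) (at x)" "x \<in> I"
  shows "v x = prim g x"
  using derivative_eq_imp_const[OF assms(3) prim(2)[OF assms(1)] assms(4) zero_in_I] prim(1)[OF assms(1)] assms(2)
  by simp

lemma prim_bound:
  assumes v: "\<And>x. x \<in> I \<Longrightarrow> (v has_vector_derivative g x) (at x)" and "v 0 = (0::complex)"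
    and H: "\<And>x. x \<in> I \<Longrightarrow> (H has_real_derivative H' x) (at x)" "H 0 = 0" "\<And>x. x \<in> I \<Longrightarrow> cmod (g x) \<le> H' x"
    and x: "x \<in> I"
  shows "cmod (v x) \<le> \<bar>H x\<bar>"
proof -
  have vc: "continuous_on I v" using v has_vector_derivative_continuous continuous_at_imp_continuous_on by blast
  have Hc: "continuous_on I H" by (meson H(1) DERIV_isCont continuous_at_imp_continuous_on)
  have Hv: "(H has_vector_derivative H' x) (at x)" if "x \<in> I" for x
    using H(1)[OF that] by (simp add: has_real_derivative_iff_has_vector_derivative)
  have b: "cmod (v q - v p) \<le> H q - H p" if "p < q" "p \<in> I" "q \<in> I" for p q
  proof (rule differentiable_bound_general[OF that(1)])
    have sub: "{p..q} \<subseteq> I" using that by (auto simp: I_def)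
    show "continuous_on {p..q} v" "continuous_on {p..q} H" using sub vc Hc continuous_on_subset by blast+
    fix x assume "p < x" "x < q"
    then have "x \<in> I" using sub by auto
    then show "(v has_vector_derivative g x) (at x)" "(H has_vector_derivative H' x) (at x)" "cmod (g x) \<le> H' x"
      using v Hv H(3) by auto
  qed
  show ?thesis
    using b[of 0 x] b[of x 0] x assms(2) H(2) by (cases "x > 0"; cases "x = 0") auto
qed

definition C1 :: real where "C1 = sqrt k * (2 / a) * (4 * a\<^sup>2) powr (1/4)"

lemma C1_pos: "C1 > 0" using k_pos a_pos by (simp add: C1_def)

text \<open>With \<open>s = 4 * a\<^sup>2 / \<tau> x\<close>, each quotient of the two distances is
  at most \<open>s\<close>, and ln s = 4 ln (s^(1/4)) is at most 4 s^(1/4). The exponent 1/4 is half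
  of the one with which \<open>\<phi>\<close> decays, so a positive power survives the
  product.\<close>

lemma ln_bound:
  assumes "x \<in> I"
  shows "\<bar>(ln (a + x) - ln (a - x)) / (2 * a)\<bar> \<le> (2 / a) * (4 * a\<^sup>2 / \<tau> x) powr (1/4)"
proof -
  have ax: "a + x > 0" "a - x > 0" "a + x \<le> 2 * a" "a - x \<le> 2 * a" using assms by (auto simp: I_def)
  have t: "\<tau> x > 0" by (rule tau_pos[OF assms])
  define s where "s = 4 * a\<^sup>2 / \<tau> x"
  have s: "s > 0" using t a_pos by (simp add: s_def)
  have le: "ln d - ln e \<le> ln s" if "d * e = \<tau> x" "d > 0" "e > 0" "d \<le> 2 * a" for d e
  proof -
    have "ln d - ln e = ln (d * d / \<tau> x)" using that by (simp add: ln_div ln_mult flip: that(1))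
    also have "\<dots> \<le> ln s"
    proof (rule ln_mono)
      have "d * d \<le> (2 * a) * (2 * a)" using that by (intro mult_mono) auto
      then show "d * d / \<tau> x \<le> s" using t by (simp add: s_def divide_right_mono power2_eq_square)
    qed (use that t s in auto)
    finally show ?thesis .
  qed
  have "\<bar>ln (a + x) - ln (a - x)\<bar> \<le> ln s"
    using le[of "a + x" "a - x"] le[of "a - x" "a + x"] ax by (auto simp: tau_factor mult.commute abs_le_iff)
  also have "\<dots> = 4 * ln (s powr (1/4))" using s by (simp add: ln_powr)
  also have "\<dots> \<le> 4 * s powr (1/4)"
    using ln_le_minus_one[of "s powr (1/4)"] s by auto
  finally show ?thesis using a_pos by (simp add: abs_divide s_def field_simps)
qed

text \<open>The integrand is dominated by the derivative of a logarithm; \<open>\<phi>\<close>, of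
  order \<tau>^(1/2), absorbs the resulting \<tau>^(-1/4) and leaves a bound that vanishes at the
  endpoints.\<close>

lemma prim_bound_inverse_tau:
  assumes v: "\<And>x. x \<in> I \<Longrightarrow> (v has_vector_derivative g x) (at x)" "v 0 = 0"
    and g: "\<And>x. x \<in> I \<Longrightarrow> cmod (g x) \<le> C / \<tau> x" and x: "x \<in> I" and C: "C \<ge> 0"
  shows "cmod (of_real (\<phi> x) * v x) \<le> C * C1 * \<tau> x powr (1/4)"
proof -
  have t: "\<tau> x > 0" by (rule tau_pos[OF x])
  define H where "H x = C * ((ln (a + x) - ln (a - x)) / (2 * a))" for x
  have "(H has_real_derivative C / \<tau> y) (at y)" if "y \<in> I" for y
  proof -
    have ay: "a + y > 0" "a - y > 0" using that by (auto simp: I_def)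
    then have "(H has_real_derivative C * ((1 / (a + y) + 1 / (a - y)) / (2 * a))) (at y)" unfolding H_def
      by (auto intro!: derivative_eq_intros)
    moreover have "1 / (a + y) + 1 / (a - y) = (2 * a) / \<tau> y" using ay by (simp add: tau_factor add_frac_eq)
    ultimately show ?thesis using a_pos by simp
  qed
  from prim_bound[OF v this _ g x] have "cmod (v x) \<le> \<bar>H x\<bar>" by (simp add: H_def)
  also have "\<dots> \<le> C * ((2 / a) * (4 * a\<^sup>2 / \<tau> x) powr (1/4))"
    unfolding H_def abs_mult using ln_bound[OF x] C by (intro mult_mono) auto
  also have "(4 * a\<^sup>2 / \<tau> x) powr (1/4) = (4 * a\<^sup>2) powr (1/4) / \<tau> x powr (1/4)"
    using t by (simp add: powr_divide)
  finally have vb: "cmod (v x) \<le> C * ((2 / a) * ((4 * a\<^sup>2) powr (1/4) / \<tau> x powr (1/4)))" .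
  have pb: "\<phi> x \<le> sqrt k * \<tau> x powr (1/2)"
    using psi_bounds(2)[OF x] t by (simp add: \<phi>_def real_sqrt_mult[symmetric] powr_half_sqrt)
  have "cmod (of_real (\<phi> x) * v x) = \<phi> x * cmod (v x)" using phi_pos[OF x] by (simp add: norm_mult)
  also have "\<dots> \<le> (sqrt k * \<tau> x powr (1/2)) * (C * ((2 / a) * ((4 * a\<^sup>2) powr (1/4) / \<tau> x powr (1/4))))"
    by (intro mult_mono pb vb) (use k_pos in auto)
  also have "\<tau> x powr (1/2) = \<tau> x powr (1/4) * \<tau> x powr (1/4)" by (simp flip: powr_add)
  also have "(sqrt k * (\<tau> x powr (1/4) * \<tau> x powr (1/4))) * (C * ((2 / a) * ((4 * a\<^sup>2) powr (1/4) / \<tau> x powr (1/4))))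
     = C * C1 * \<tau> x powr (1/4)"
    using t by (simp add: C1_def)
  finally show ?thesis .
qed

lemma prim_bound_inverse_tau_sq:
  assumes v: "\<And>x. x \<in> I \<Longrightarrow> (v has_vector_derivative g x) (at x)" "v 0 = 0"
    and g: "\<And>x. x \<in> I \<Longrightarrow> cmod (g x) \<le> C / (\<tau> x)\<^sup>2" and x: "x \<in> I" and C: "C \<ge> 0"
  shows "cmod (v x) \<le> C / (a * \<tau> x)"
proof -
  have t: "\<tau> x > 0" by (rule tau_pos[OF x])
  \<comment> \<open>The derivative of \<open>x / \<tau> x\<close> is
    \<open>(a\<^sup>2 + x\<^sup>2) / (\<tau> x)\<^sup>2\<close>, which is at least
    \<open>a\<^sup>2 / (\<tau> x)\<^sup>2\<close>; this explains the normalization by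
    \<open>a\<^sup>2\<close>.\<close>
  define H where "H x = C / a\<^sup>2 * (x / \<tau> x)" for x
  have d: "(H has_real_derivative C / a\<^sup>2 * ((a\<^sup>2 + y\<^sup>2) / (\<tau> y)\<^sup>2)) (at y)" if "y \<in> I" for y
  proof -
    have nz: "a\<^sup>2 - y\<^sup>2 \<noteq> 0" using tau_pos[OF that] by (simp add: \<tau>_def)
    have "((\<lambda>x. x / (a\<^sup>2 - x\<^sup>2)) has_real_derivative (1 * (a\<^sup>2 - y\<^sup>2) - y * (0 - 2 * y)) / ((a\<^sup>2 - y\<^sup>2) * (a\<^sup>2 - y\<^sup>2))) (at y)"
      by (rule DERIV_divide[OF DERIV_ident]) (use nz in \<open>auto intro!: derivative_eq_intros\<close>)
    moreover have "1 * (a\<^sup>2 - y\<^sup>2) - y * (0 - 2 * y) = a\<^sup>2 + y\<^sup>2" by (simp add: power2_eq_square)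
    ultimately have "((\<lambda>x. x / (a\<^sup>2 - x\<^sup>2)) has_real_derivative (a\<^sup>2 + y\<^sup>2) / (\<tau> y)\<^sup>2) (at y)"
      by (simp add: \<tau>_def power2_eq_square add.commute)
    from DERIV_cmult[OF this, of "C / a\<^sup>2"] show ?thesis unfolding H_def \<tau>_def by simp
  qed
  have "cmod (g y) \<le> C / a\<^sup>2 * ((a\<^sup>2 + y\<^sup>2) / (\<tau> y)\<^sup>2)" if "y \<in> I" for y
  proof -
    have "C / (\<tau> y)\<^sup>2 = C / a\<^sup>2 * (a\<^sup>2 / (\<tau> y)\<^sup>2)" using a_pos by simp
    also have "\<dots> \<le> C / a\<^sup>2 * ((a\<^sup>2 + y\<^sup>2) / (\<tau> y)\<^sup>2)"
      using C by (intro mult_left_mono divide_right_mono) auto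
    finally show ?thesis using g[OF that] by linarith
  qed
  from prim_bound[OF v d _ this x] have "cmod (v x) \<le> \<bar>H x\<bar>" by (simp add: H_def)
  also have "\<dots> = C / a\<^sup>2 * (\<bar>x\<bar> / \<tau> x)" using C t by (simp add: H_def abs_mult)
  also have "\<dots> \<le> C / a\<^sup>2 * (a / \<tau> x)" using C t x by (intro mult_left_mono divide_right_mono) (auto simp: I_iff)
  also have "\<dots> = C / (a * \<tau> x)" using a_pos by (simp add: power2_eq_square)
  finally show ?thesis .
qed


lemma measure_I: "measure M (space M) = 2 * a"
  using a_pos by (simp add: measure_restrict_space I_def)

lemma F_deriv:
  assumes g: "g \<in> L2 M" "continuous_on I g" and x: "x \<in> I"
  shows "(F g has_vector_derivative of_real (\<phi> x) * g x) (at x)"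
proof -
  define p q where "p = (x - a) / 2" and "q = (x + a) / 2"
  have pq: "- a < p" "p < x" "x < q" "q < a" using x by (auto simp: p_def q_def I_def)
  have sub: "{p..q} \<subseteq> I" using pq by (auto simp: I_def)
  let ?f = "\<lambda>t. complex_of_real (\<phi> t) * g t"
  have fc: "continuous_on {p..q} ?f"
    by (intro continuous_intros phi_continuous continuous_on_subset[OF g(2) sub])
  have eq: "F g y = F g p + integral {p..y} ?f" if y: "y \<in> {p..q}" for y
  proof -
    have "F g y - F g p = (LINT t|M. indicator {..<y} t *\<^sub>R ?f t - indicator {..<p} t *\<^sub>R ?f t)"
      unfolding F_def using F_integrable(2)[OF g(1)] by simp
    also have "\<dots> = (LINT t|M. (if t \<in> {p..<y} then ?f t else 0))"
      by (rule Bochner_Integration.integral_cong) (use y in \<open>auto simp: indicator_def\<close>)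
    also have "\<dots> = (LINT t|lebesgue_on ({p..<y} \<inter> I). ?f t)"
      by (rule Lebesgue_Measure.integral_restrict_Int) auto
    also have "{p..<y} \<inter> I = {p..<y}" using sub y by auto
    also have "(LINT t|lebesgue_on {p..<y}. ?f t) = integral {p..<y} ?f"
    proof (rule lebesgue_integral_eq_integral)
      have "integrable (lebesgue_on {p..y}) ?f"
        using y by (intro continuous_imp_integrable_real continuous_on_subset[OF fc]) auto
      then have "set_integrable lebesgue {p..y} ?f" by (simp add: set_integrable_def integrable_restrict_space)
      then have "set_integrable lebesgue {p..<y} ?f" by (rule set_integrable_subset) auto
      then show "integrable (lebesgue_on {p..<y}) ?f" by (simp add: set_integrable_def integrable_restrict_space)
    qed auto
    also have "\<dots> = integral {p..y} ?f"
      by (rule integral_spike_set) (auto intro: negligible_subset[of "{y}"])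
    finally show ?thesis by (simp add: algebra_simps)
  qed
  have "((\<lambda>y. integral {p..y} ?f) has_vector_derivative ?f x) (at x within {p..q})"
    by (rule integral_has_vector_derivative[OF fc]) (use pq in auto)
  then have "((\<lambda>y. F g p + integral {p..y} ?f) has_vector_derivative 0 + ?f x) (at x within {p..q})"
    by (intro has_vector_derivative_add has_vector_derivative_const)
  then have tr: "((\<lambda>y. F g p + integral {p..y} ?f) has_vector_derivative ?f x) (at x within {p..q})" by simp
  have "(F g has_vector_derivative ?f x) (at x within {p..q})"
    by (rule has_vector_derivative_transform[OF _ eq tr]) (use pq in auto)
  moreover have "at x within {p..q} = at x" using pq by (intro at_within_interior) simp
  ultimately show ?thesis by simp
qed

definition CF :: real where "CF = sqrt (k * a\<^sup>2 * (2 * a))"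

lemma F_le: "h \<in> L2 M \<Longrightarrow> \<bar>x\<bar> \<le> a \<Longrightarrow> cmod (F h x) \<le> CF * L2_norm M h"
proof -
  assume h: "h \<in> L2 M" and x: "\<bar>x\<bar> \<le> a"
  have "cmod (F h x) \<le> sqrt (k * a\<^sup>2 * \<bar>x - (-a)\<bar>) * L2_norm M h"
    using F_uniform_holder[OF h, of x "-a"] F_left[of "-a" h] by simp
  also have "\<dots> \<le> CF * L2_norm M h" unfolding CF_def
    using x k_pos by (intro mult_right_mono real_sqrt_le_mono mult_left_mono L2_norm_nonneg) auto
  finally show ?thesis .
qed

text \<open>For test functions in place of \<open>g\<close> this is integration by parts. The defect
  \<open>D\<close> is linear and bounded by a multiple of the L2 norm, hence vanishes on the
  closure.\<close>

lemma F_weak_derivative: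
  assumes g: "g \<in> L2 M" and v: "v \<in> test_functions I"
  shows "(LINT x|M. of_real (\<phi> x) * g x * v x) = - (LINT x|M. F g x * vderiv v x)"
proof -
  note v' = test_vderiv[OF v]
  have pv: "(\<lambda>x. of_real (\<phi> x) * v x) \<in> L2 M" by (rule test_L2[OF test_mult[OF v phi_smooth]])
  have FL: "F h \<in> L2 M" if "h \<in> L2 M" for h
    by (rule L2_bounded[OF finite_M continuous_M[OF F_continuous[OF that]] F_le[OF that]]) (auto simp: I_iff)
  define C where "C = L2_norm M (\<lambda>x. of_real (\<phi> x) * v x) + CF * sqrt (2 * a) * L2_norm M (vderiv v)"
  have CF0: "CF \<ge> 0" using k_pos a_pos by (simp add: CF_def)
  have C: "C \<ge> 0" unfolding C_def using CF0 a_pos by (intro add_nonneg_nonneg mult_nonneg_nonneg L2_norm_nonneg) auto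
  define D where "D h = (LINT x|M. of_real (\<phi> x) * v x * h x) + (LINT x|M. F h x * vderiv v x)" for h
  have D_bound: "cmod (D h) \<le> C * L2_norm M h" if h: "h \<in> L2 M" for h
  proof -
    have "L2_norm M (F h) \<le> (CF * L2_norm M h) * sqrt (2 * a)"
      unfolding measure_I[symmetric]
      by (rule L2_norm_bounded[OF finite_M continuous_M[OF F_continuous[OF h]] F_le[OF h]])
        (use CF0 in \<open>auto simp: I_iff L2_norm_nonneg\<close>)
    then have "L2_norm M (F h) * L2_norm M (vderiv v) \<le> (CF * L2_norm M h) * sqrt (2 * a) * L2_norm M (vderiv v)"
      by (rule mult_right_mono) (rule L2_norm_nonneg)
    moreover have "cmod (LINT x|M. F h x * vderiv v x) \<le> L2_norm M (F h) * L2_norm M (vderiv v)"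
      by (rule L2_Cauchy_Schwarz_mult[OF I_lebesgue FL[OF h] test_L2[OF v']])
    moreover have "cmod (LINT x|M. of_real (\<phi> x) * v x * h x) \<le> L2_norm M (\<lambda>x. of_real (\<phi> x) * v x) * L2_norm M h"
      by (rule L2_Cauchy_Schwarz_mult[OF I_lebesgue pv h])
    ultimately show ?thesis
      using norm_triangle_ineq[of "LINT x|M. of_real (\<phi> x) * v x * h x" "LINT x|M. F h x * vderiv v x"]
      unfolding D_def C_def by (simp add: algebra_simps)
  qed
  have D_diff: "D (\<lambda>x. h x - h' x) = D h - D h'" if "h \<in> L2 M" "h' \<in> L2 M" for h h'
    unfolding D_def F_diff[OF that]
    using L2_integrable_mult[OF pv that(1)] L2_integrable_mult[OF pv that(2)]
      L2_integrable_mult[OF FL[OF that(1)] test_L2[OF v']] L2_integrable_mult[OF FL[OF that(2)] test_L2[OF v']]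
    by (simp add: left_diff_distrib right_diff_distrib)
  have D_test: "D h = 0" if h: "h \<in> test_functions I" for h
  proof -
    have hc: "continuous_on I h" using continuous_on_subset[OF test_continuous[OF h]] by simp
    have vc: "continuous_on I (vderiv v)" using continuous_on_subset[OF test_continuous[OF v']] by simp
    obtain b where b: "0 < b" "b < a" "\<And>x. b \<le> \<bar>x\<bar> \<Longrightarrow> v x = 0" using v test_iff by blast
    have "(LINT x|M. of_real (\<phi> x) * h x * v x) = - (LINT x|M. F h x * vderiv v x)"
      by (rule integral_by_parts_compact_support[OF F_deriv[OF test_L2[OF h] hc] _ test_hvd[OF v] vc b(1,2) b(3)])
        (auto intro!: continuous_intros phi_continuous hc)
    then show ?thesis by (simp add: D_def mult_ac)
  qed
  have "cmod (D g) \<le> e" if e: "e > 0" for e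
  proof -
    have "e / (C + 1) > 0" using e C by simp
    then obtain h where h: "h \<in> test_functions I" "L2_norm M (\<lambda>x. g x - h x) < e / (C + 1)"
      using test_functions_dense[OF g] by blast
    have "D g = D (\<lambda>x. g x - h x)" using D_diff[OF g test_L2[OF h(1)]] D_test[OF h(1)] by simp
    then have "cmod (D g) \<le> C * L2_norm M (\<lambda>x. g x - h x)" using D_bound[OF L2_diff[OF g test_L2[OF h(1)]]] by simp
    also have "\<dots> \<le> C * (e / (C + 1))" using h(2) C by (intro mult_left_mono) auto
    also have "\<dots> \<le> e" using C e by (simp add: field_simps)
    finally show ?thesis .
  qed
  then have "cmod (D g) \<le> 0" by (rule dense_ge)
  then show ?thesis by (simp add: D_def eq_neg_iff_add_eq_0 mult_ac)
qed

text \<open>If \<open>F h a = 0\<close>, then \<open>V h\<close> solves \<open>(L + 2 c) (V h) = h\<close>.\<close>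

definition J :: "(real \<Rightarrow> complex) \<Rightarrow> real \<Rightarrow> complex" where
  "J h = prim (\<lambda>x. F h x / (of_real (\<psi> x))\<^sup>2)"

definition V :: "(real \<Rightarrow> complex) \<Rightarrow> real \<Rightarrow> complex" where
  "V h x = - (of_real (\<phi> x) * J h x)"

lemma quotient_continuous: "continuous_on I G \<Longrightarrow> continuous_on I (\<lambda>x. G x / (complex_of_real (\<psi> x))\<^sup>2)"
  by (intro continuous_intros psi_continuous) (auto dest: psi_pos)

lemma F_quotient_continuous: "h \<in> L2 M \<Longrightarrow> continuous_on I (\<lambda>x. F h x / (complex_of_real (\<psi> x))\<^sup>2)"
  by (rule quotient_continuous[OF F_continuous])

lemma J_hvd: "h \<in> L2 M \<Longrightarrow> x \<in> I \<Longrightarrow> (J h has_vector_derivative F h x / (of_real (\<psi> x))\<^sup>2) (at x)"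
  unfolding J_def by (rule prim(2)[OF F_quotient_continuous])

lemma J_0: "h \<in> L2 M \<Longrightarrow> J h 0 = 0"
  unfolding J_def by (rule prim(1)[OF F_quotient_continuous])

lemma J_continuous: "h \<in> L2 M \<Longrightarrow> continuous_on I (J h)"
  using J_hvd has_vector_derivative_continuous continuous_at_imp_continuous_on by blast

lemma V_continuous: "h \<in> L2 M \<Longrightarrow> continuous_on I (V h)"
  unfolding V_def[abs_def] by (intro continuous_intros phi_continuous J_continuous)

lemma V_measurable: "h \<in> L2 M \<Longrightarrow> V h \<in> borel_measurable M"
  by (rule continuous_M[OF V_continuous])

lemma quotient_bound:
  assumes "cmod G \<le> C * \<tau> x" "x \<in> I" "C \<ge> 0"
  shows "cmod (G / (of_real (\<psi> x))\<^sup>2) \<le> (C / m\<^sup>2) / \<tau> x"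
proof -
  have t: "\<tau> x > 0" by (rule tau_pos[OF assms(2)])
  have "(m * \<tau> x)\<^sup>2 \<le> (\<psi> x)\<^sup>2" using psi_bounds(1)[OF assms(2)] m_pos t by (intro power_mono) auto
  then have "cmod G / (\<psi> x)\<^sup>2 \<le> (C * \<tau> x) / (m * \<tau> x)\<^sup>2"
    using mult_nonneg_nonneg[OF assms(3) less_imp_le[OF t]] zero_less_power[OF mult_pos_pos[OF m_pos t], of 2]
    by (intro frac_le[OF _ assms(1)])
  then have "cmod (G / (of_real (\<psi> x))\<^sup>2) \<le> (C * \<tau> x) / (m * \<tau> x)\<^sup>2"
    by (simp add: norm_divide norm_power)
  also have "\<dots> = (C / m\<^sup>2) / \<tau> x" using t by (simp add: power2_eq_square)
  finally show ?thesis .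
qed

definition C3 :: real where "C3 = C0 / m\<^sup>2 * C1"

lemma C3_pos: "C3 > 0" using C0_pos C1_pos m_pos by (simp add: C3_def)

text \<open>\<open>F h\<close> is of order \<tau> and \<open>\<psi>\<^sup>2\<close> of order
  \<tau>^2, so the outer integrand is of order 1/\<tau> and its primitive diverges only
  logarithmically.\<close>

lemma V_bound_tau:
  assumes h: "h \<in> L2 M" "F h a = 0" and x: "x \<in> I"
  shows "cmod (V h x) \<le> C3 * L2_norm M h * \<tau> x powr (1/4)"
proof -
  have "cmod (of_real (\<phi> x) * J h x) \<le> (C0 * L2_norm M h / m\<^sup>2) * C1 * \<tau> x powr (1/4)"
    by (rule prim_bound_inverse_tau[OF J_hvd[OF h(1)] J_0[OF h(1)] quotient_bound[OF F_bound[OF h]] x])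
      (use C0_pos in \<open>auto simp: L2_norm_nonneg\<close>)
  then show ?thesis by (simp add: V_def C3_def field_simps)
qed

definition C4 :: real where "C4 = C3 * (a\<^sup>2) powr (1/4)"

lemma C4_pos: "C4 > 0" using C3_pos a_pos by (simp add: C4_def)

lemma V_bound:
  assumes h: "h \<in> L2 M" "F h a = 0" and x: "x \<in> I"
  shows "cmod (V h x) \<le> C4 * L2_norm M h"
proof -
  have "C3 * L2_norm M h * \<tau> x powr (1/4) \<le> C3 * L2_norm M h * (a\<^sup>2) powr (1/4)"
    using C3_pos tau_pos[OF x] tau_le[of x] by (intro mult_left_mono powr_mono2) (auto simp: L2_norm_nonneg)
  then show ?thesis using V_bound_tau[OF assms] by (simp add: C4_def mult_ac)
qed

lemma V_L2: "h \<in> L2 M \<Longrightarrow> F h a = 0 \<Longrightarrow> V h \<in> L2 M"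
  by (rule L2_bounded[OF finite_M V_measurable V_bound]) auto

lemma J_add: "h \<in> L2 M \<Longrightarrow> g \<in> L2 M \<Longrightarrow> x \<in> I \<Longrightarrow> J (\<lambda>x. h x + g x) x = J h x + J g x"
  unfolding J_def
  by (rule prim_unique[symmetric, OF F_quotient_continuous[OF L2_add]])
    (auto simp: F_add add_divide_distrib J_0 J_def[symmetric] intro!: has_vector_derivative_add J_hvd)

lemma J_cmult:
  assumes h: "h \<in> L2 M" and x: "x \<in> I"
  shows "J (\<lambda>x. z * h x) x = z * J h x"
proof -
  have "((\<lambda>x. z * J h x) has_vector_derivative F (\<lambda>x. z * h x) y / (of_real (\<psi> y))\<^sup>2) (at y)" if "y \<in> I" for y
    using has_vector_derivative_mult_right[OF J_hvd[OF h that], of z] by (simp add: F_cmult)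
  then show ?thesis unfolding J_def[of "\<lambda>x. z * h x"]
    by (intro prim_unique[symmetric, OF F_quotient_continuous[OF L2_cmult[OF h]] _ _ x]) (simp_all add: J_0 h)
qed

lemma F_cnj: "F (\<lambda>x. cnj (h x)) x = cnj (F h x)"
  unfolding F_def by (subst Bochner_Integration.integral_cnj[symmetric]) simp

lemma J_cnj:
  assumes h: "h \<in> L2 M" and x: "x \<in> I"
  shows "J (\<lambda>x. cnj (h x)) x = cnj (J h x)"
proof -
  have "((\<lambda>x. cnj (J h x)) has_vector_derivative F (\<lambda>x. cnj (h x)) y / (of_real (\<psi> y))\<^sup>2) (at y)" if "y \<in> I" for y
    using bounded_linear.has_vector_derivative[OF bounded_linear_cnj J_hvd[OF h that]] by (simp add: F_cnj)
  then show ?thesis unfolding J_def[of "\<lambda>x. cnj (h x)"]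
    by (intro prim_unique[symmetric, OF F_quotient_continuous[OF L2_cnj[OF h]] _ _ x]) (simp_all add: J_0 h)
qed

lemma V_add: "h \<in> L2 M \<Longrightarrow> g \<in> L2 M \<Longrightarrow> x \<in> I \<Longrightarrow> V (\<lambda>x. h x + g x) x = V h x + V g x"
  by (simp add: V_def J_add algebra_simps)

lemma V_cmult: "h \<in> L2 M \<Longrightarrow> x \<in> I \<Longrightarrow> V (\<lambda>x. z * h x) x = z * V h x"
  by (simp add: V_def J_cmult)

lemma V_cnj: "h \<in> L2 M \<Longrightarrow> x \<in> I \<Longrightarrow> V (\<lambda>x. cnj (h x)) x = cnj (V h x)"
  by (simp add: V_def J_cnj)

lemma J_cong_AE:
  assumes "h \<in> L2 M" "g \<in> L2 M" "AE x in M. h x = g x"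
  shows "J h = J g"
  unfolding J_def using F_cong_AE[OF assms] by presburger

lemma V_cong_AE:
  assumes "h \<in> L2 M" "g \<in> L2 M" "AE x in M. h x = g x"
  shows "V h = V g"
  unfolding V_def[abs_def] J_cong_AE[OF assms] ..

text \<open>An unconstrained approximation \<open>h\<close> is corrected by a multiple of a fixed
  nonnegative bump \<open>h0\<close>. Since \<open>F g a = 0\<close>, the value \<open>F h a\<close>
  to be removed is bounded by the approximation error itself.\<close>

lemma test_functions_dense_orthogonal:
  assumes g: "g \<in> L2 M" "F g a = 0" and e: "e > 0"
  shows "\<exists>h\<in>test_functions I. F h a = 0 \<and> L2_norm M (\<lambda>x. g x - h x) < e"
proof -
  define h0 where "h0 = bump 1 (-a/2) (a/2)"
  have h0: "h0 \<in> test_functions I" unfolding h0_def using a_pos by (intro bump_test) auto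
  note h0L = test_L2[OF h0]
  have f0: "F h0 a \<noteq> 0"
  proof
    assume "F h0 a = 0"
    then have "L2_inner M h0 (\<lambda>x. of_real (\<phi> x)) = 0" by (simp add: F_total)
    moreover have "L2_inner M h0 (\<lambda>x. of_real (\<phi> x)) = of_real (LINT x|M. Re (h0 x) * \<phi> x)"
      unfolding L2_inner_def
      by (subst integral_complex_of_real[symmetric], rule Bochner_Integration.integral_cong)
        (auto simp: h0_def bump_real(1)[symmetric])
    ultimately have z: "(LINT x|M. Re (h0 x) * \<phi> x) = 0" by simp
    have "integrable M (\<lambda>x. Re (complex_of_real (\<phi> x) * h0 x))"
      using phi_mult_integrable[OF h0L] by (rule integrable_Re)
    then have i: "integrable M (\<lambda>x. Re (h0 x) * \<phi> x)" by (simp add: mult.commute)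
    have "AE x in M. Re (h0 x) * \<phi> x = 0"
    proof (subst integral_nonneg_eq_0_iff_AE[OF i, symmetric])
      show "AE x in M. 0 \<le> Re (h0 x) * \<phi> x"
        by (rule AE_I2) (use bump_real(2) phi_pos in \<open>auto simp: h0_def less_imp_le\<close>)
    qed (rule z)
    then have "AE x in lebesgue. x \<in> I \<longrightarrow> Re (h0 x) * \<phi> x = 0" by (simp add: AE_restrict_space_iff)
    then have "AE x in lebesgue. x \<notin> {-a/2<..<a/2}"
    proof eventually_elim
      case (elim x)
      then show ?case using bump_pos[of 1 "-a/2" x "a/2"] phi_pos[of x] by (auto simp: h0_def I_def)
    qed
    then have "{-a/2<..<a/2} \<in> null_sets lebesgue" by (subst (asm) AE_iff_null_sets[symmetric]) auto
    then show False using a_pos by (simp add: null_sets_def)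
  qed
  define d where "d = e / (1 + CF / cmod (F h0 a) * L2_norm M h0)"
  have CF0: "CF \<ge> 0" using k_pos a_pos by (simp add: CF_def)
  have den: "1 + CF / cmod (F h0 a) * L2_norm M h0 > 0"
    using CF0 by (intro add_pos_nonneg mult_nonneg_nonneg divide_nonneg_nonneg L2_norm_nonneg) auto
  have d: "d > 0" using den e by (simp add: d_def)
  obtain h where h: "h \<in> test_functions I" "L2_norm M (\<lambda>x. g x - h x) < d"
    using test_functions_dense[OF g(1) d] by blast
  note hL = test_L2[OF h(1)]
  define z where "z = F h a / F h0 a"
  define h' where "h' = (\<lambda>x. h x - z * h0 x)"
  have "h' \<in> test_functions I" unfolding h'_def by (intro test_diff test_cmult h h0)
  moreover have "F h' a = 0"
  proof -
    have "F h' a = F h a - z * F h0 a" unfolding h'_def by (simp add: F_diff hL L2_cmult h0L F_cmult)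
    then show ?thesis using f0 by (simp add: z_def)
  qed
  moreover have "L2_norm M (\<lambda>x. g x - h' x) < e"
  proof -
    have "F h a = - F (\<lambda>x. g x - h x) a" using g by (simp add: F_diff hL)
    then have "cmod (F h a) \<le> CF * L2_norm M (\<lambda>x. g x - h x)"
      using F_le[OF L2_diff[OF g(1) hL], of a] a_pos by simp
    then have "cmod z \<le> CF * L2_norm M (\<lambda>x. g x - h x) / cmod (F h0 a)"
      by (simp add: z_def norm_divide divide_right_mono)
    then have "cmod z * L2_norm M h0 \<le> CF * L2_norm M (\<lambda>x. g x - h x) / cmod (F h0 a) * L2_norm M h0"
      by (rule mult_right_mono) (rule L2_norm_nonneg)
    moreover have "L2_norm M (\<lambda>x. g x - h' x) \<le> L2_norm M (\<lambda>x. g x - h x) + cmod z * L2_norm M h0"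
      using L2_norm_triangle[OF I_lebesgue L2_diff[OF g(1) hL] L2_cmult[OF h0L, of z]]
      by (simp add: h'_def L2_norm_cmult[OF I_lebesgue h0L] algebra_simps)
    ultimately have "L2_norm M (\<lambda>x. g x - h' x) \<le> L2_norm M (\<lambda>x. g x - h x) * (1 + CF / cmod (F h0 a) * L2_norm M h0)"
      by (simp add: algebra_simps)
    also have "\<dots> < d * (1 + CF / cmod (F h0 a) * L2_norm M h0)" using h(2) den by (rule mult_strict_right_mono)
    also have "\<dots> = e" using den by (simp add: d_def)
    finally show ?thesis .
  qed
  ultimately show ?thesis by blast
qed

text \<open>The right side is symmetric in \<open>f\<close> and \<open>g\<close>, which is the
  source of \<open>V_symmetric\<close>. For a test function \<open>g\<close> orthogonal to
  \<open>\<phi>\<close> the primitive \<open>F g\<close> has compact support and integration by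
  parts applies; the general case follows because both sides are bounded in
  \<open>g\<close>.\<close>

lemma V_bilinear:
  assumes f: "f \<in> L2 M" "F f a = 0" and g: "g \<in> L2 M" "F g a = 0"
  shows "(LINT x|M. V f x * g x) = (LINT x|M. F f x / (of_real (\<psi> x))\<^sup>2 * F g x)"
proof -
  note Vf = V_L2[OF f]
  define q where "q x = F f x / (complex_of_real (\<psi> x))\<^sup>2" for x
  have qc: "continuous_on I q" unfolding q_def by (rule F_quotient_continuous[OF f(1)])
  have bound: "cmod (q x * F h x) \<le> (C0 * L2_norm M f / m\<^sup>2) * (C0 * L2_norm M h)"
    if h: "h \<in> L2 M" "F h a = 0" and x: "x \<in> I" for h x
  proof -
    have "cmod (q x) \<le> (C0 * L2_norm M f / m\<^sup>2) / \<tau> x"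
      unfolding q_def by (rule quotient_bound[OF F_bound[OF f x] x]) (use C0_pos in \<open>auto simp: L2_norm_nonneg\<close>)
    then have "cmod (q x * F h x) \<le> (C0 * L2_norm M f / m\<^sup>2) / \<tau> x * (C0 * L2_norm M h * \<tau> x)"
      unfolding norm_mult using tau_pos[OF x] C0_pos
      by (intro mult_mono F_bound[OF h x]) (auto simp: L2_norm_nonneg intro!: mult_nonneg_nonneg divide_nonneg_nonneg)
    then show ?thesis using tau_pos[OF x] by simp
  qed
  have qi: "integrable M (\<lambda>x. q x * F h x)" if h: "h \<in> L2 M" "F h a = 0" for h
    by (rule M.integrable_const_bound[OF AE_I2 continuous_M]) (use bound[OF h] in \<open>auto intro!: continuous_intros qc F_continuous h\<close>)
  define C where "C = L2_norm M (V f) + (C0 * L2_norm M f / m\<^sup>2) * C0 * (2 * a)"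
  have C: "C \<ge> 0" unfolding C_def using C0_pos a_pos
    by (intro add_nonneg_nonneg mult_nonneg_nonneg L2_norm_nonneg divide_nonneg_nonneg) auto
  define D where "D h = (LINT x|M. V f x * h x) - (LINT x|M. q x * F h x)" for h
  have D_bound: "cmod (D h) \<le> C * L2_norm M h" if h: "h \<in> L2 M" "F h a = 0" for h
  proof -
    have "cmod (LINT x|M. q x * F h x) \<le> (LINT x|M. cmod (q x * F h x))" by (rule integral_norm_bound)
    also have "\<dots> \<le> (LINT x|M. (C0 * L2_norm M f / m\<^sup>2) * (C0 * L2_norm M h))"
      by (rule integral_mono[OF integrable_norm[OF qi[OF h]]]) (use bound[OF h] in auto)
    also have "\<dots> = (C0 * L2_norm M f / m\<^sup>2) * (C0 * L2_norm M h) * (2 * a)"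
      unfolding lebesgue_integral_const measure_I by (simp add: mult_ac)
    finally have "cmod (LINT x|M. q x * F h x) \<le> \<dots>" .
    moreover have "cmod (LINT x|M. V f x * h x) \<le> L2_norm M (V f) * L2_norm M h"
      by (rule L2_Cauchy_Schwarz_mult[OF I_lebesgue Vf h(1)])
    ultimately show ?thesis
      using norm_triangle_ineq4[of "LINT x|M. V f x * h x" "LINT x|M. q x * F h x"]
      unfolding D_def C_def by (simp add: algebra_simps)
  qed
  have D_diff: "D (\<lambda>x. h x - h' x) = D h - D h'" if "h \<in> L2 M" "F h a = 0" "h' \<in> L2 M" "F h' a = 0" for h h'
    unfolding D_def F_diff[OF that(1,3)]
    using L2_integrable_mult[OF Vf that(1)] L2_integrable_mult[OF Vf that(3)] qi[OF that(1,2)] qi[OF that(3,4)]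
    by (simp add: right_diff_distrib)
  have D_test: "D h = 0" if h: "h \<in> test_functions I" "F h a = 0" for h
  proof -
    have hc: "continuous_on I h" using continuous_on_subset[OF test_continuous[OF h(1)]] by simp
    obtain b where b: "0 < b" "b < a" "\<And>x. b \<le> \<bar>x\<bar> \<Longrightarrow> h x = 0" using h(1) test_iff by blast
    note hL = test_L2[OF h(1)]
    have Fz: "F h x = 0" if "b \<le> \<bar>x\<bar>" for x
    proof (cases "x \<le> 0")
      case True
      then have "F h x = (LINT y|M. 0)" unfolding F_def
        by (intro Bochner_Integration.integral_cong) (use b that in \<open>auto simp: indicator_def\<close>)
      then show ?thesis by simp
    next
      case False
      then have "F h x = F h a" unfolding F_def
        by (intro Bochner_Integration.integral_cong) (use b that in \<open>auto simp: indicator_def I_def\<close>)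
      then show ?thesis using h(2) by simp
    qed
    have "(LINT x|M. q x * F h x) = - (LINT x|M. J f x * (of_real (\<phi> x) * h x))"
      unfolding q_def
      by (rule integral_by_parts_compact_support[OF J_hvd[OF f(1)] qc[unfolded q_def] F_deriv[OF hL hc] _ b(1,2) Fz])
        (auto intro!: continuous_intros phi_continuous hc)
    also have "\<dots> = (LINT x|M. V f x * h x)"
      unfolding V_def by (simp add: mult_ac flip: Bochner_Integration.integral_minus)
    finally show ?thesis by (simp add: D_def)
  qed
  have "cmod (D g) \<le> e" if e: "e > 0" for e
  proof -
    have "e / (C + 1) > 0" using e C by simp
    then obtain h where h: "h \<in> test_functions I" "F h a = 0" "L2_norm M (\<lambda>x. g x - h x) < e / (C + 1)"
      using test_functions_dense_orthogonal[OF g] by blast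
    note hL = test_L2[OF h(1)]
    have "D g = D (\<lambda>x. g x - h x)" using D_diff[OF g hL h(2)] D_test[OF h(1,2)] by simp
    moreover have "F (\<lambda>x. g x - h x) a = 0" using g h(2) by (simp add: F_diff hL)
    ultimately have "cmod (D g) \<le> C * L2_norm M (\<lambda>x. g x - h x)" using D_bound[OF L2_diff[OF g(1) hL]] by simp
    also have "\<dots> \<le> C * (e / (C + 1))" using h(3) C by (intro mult_left_mono) auto
    also have "\<dots> \<le> e" using C e by (simp add: field_simps)
    finally show ?thesis .
  qed
  then have "cmod (D g) \<le> 0" by (rule dense_ge)
  then show ?thesis by (simp add: D_def q_def)
qed

lemma V_symmetric:
  assumes f: "f \<in> L2 M" "F f a = 0" and g: "g \<in> L2 M" "F g a = 0"
  shows "L2_inner M (V f) g = L2_inner M f (V g)"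
proof -
  let ?g = "\<lambda>x. cnj (g x)"
  have g': "?g \<in> L2 M" "F ?g a = 0" using g L2_cnj by (auto simp: F_cnj)
  have "L2_inner M (V f) g = (LINT x|M. F f x / (of_real (\<psi> x))\<^sup>2 * F ?g x)"
    unfolding L2_inner_def by (rule V_bilinear[OF f g'])
  also have "\<dots> = (LINT x|M. F ?g x / (of_real (\<psi> x))\<^sup>2 * F f x)" by (simp add: mult.commute)
  also have "\<dots> = (LINT x|M. V ?g x * f x)" by (rule V_bilinear[OF g' f, symmetric])
  also have "\<dots> = L2_inner M f (V g)"
    unfolding L2_inner_def by (rule Bochner_Integration.integral_cong) (auto simp: V_cnj[OF g(1)])
  finally show ?thesis .
qed

text \<open>Uniform Hoelder continuity makes the inner primitives equicontinuous, so a subsequence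
  converges uniformly on the closed interval. The outer primitives then converge pointwise, and the
  uniform bound for \<open>V\<close> turns this into L2 convergence.\<close>

lemma V_compact:
  assumes f: "\<And>n. f n \<in> L2 M" "\<And>n. F (f n) a = 0" and B: "\<And>n. L2_norm M (f n) \<le> B"
  shows "\<exists>w r. w \<in> L2 M \<and> strict_mono (r :: nat \<Rightarrow> nat) \<and> (\<lambda>n. L2_norm M (\<lambda>x. V (f (r n)) x - w x)) \<longlonglongrightarrow> 0"
proof -
  have B0: "B \<ge> 0" using B[of 0] L2_norm_nonneg[of M "f 0"] by linarith
  have CF0: "CF \<ge> 0" using k_pos a_pos by (simp add: CF_def)
  obtain G r where G: "continuous_on {-a..a} G" and r: "strict_mono (r :: nat \<Rightarrow> nat)"
    and lim: "\<And>e. 0 < e \<Longrightarrow> \<exists>N. \<forall>n x. n \<ge> N \<and> x \<in> {-a..a} \<longrightarrow> cmod (F (f (r n)) x - G x) < e"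
  proof (rule Arzela_Ascoli[of "{-a..a}" "\<lambda>n. F (f n)" "CF * B"])
    show "cmod (F (f n) x) \<le> CF * B" if "x \<in> {-a..a}" for n x
    proof -
      have "cmod (F (f n) x) \<le> CF * L2_norm M (f n)" using that by (intro F_le[OF f(1)]) auto
      then show ?thesis using mult_left_mono[OF B CF0, of n] by linarith
    qed
    show "\<exists>d>0. \<forall>n y. y \<in> {-a..a} \<and> norm (x - y) < d \<longrightarrow> cmod (F (f n) x - F (f n) y) < e"
      if "x \<in> {-a..a}" "0 < e" for x e
    proof -
      have "((\<lambda>t. sqrt (k * a\<^sup>2 * t) * B) \<longlongrightarrow> sqrt (k * a\<^sup>2 * 0) * B) (at_right 0)" by (intro tendsto_intros)
      then have "\<forall>\<^sub>F t in at_right 0. sqrt (k * a\<^sup>2 * t) * B < e" using that(2) by (auto intro: order_tendstoD(2))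
      then obtain d where d: "d > 0" "\<And>t. 0 < t \<Longrightarrow> t < d \<Longrightarrow> sqrt (k * a\<^sup>2 * t) * B < e"
        by (auto simp: eventually_at_right_field)
      have "cmod (F (f n) x - F (f n) y) < e" if "\<bar>x - y\<bar> < d" for n y
      proof (cases "x = y")
        case False
        have "cmod (F (f n) x - F (f n) y) \<le> sqrt (k * a\<^sup>2 * \<bar>x - y\<bar>) * L2_norm M (f n)"
          by (rule F_uniform_holder[OF f(1)])
        also have "\<dots> \<le> sqrt (k * a\<^sup>2 * \<bar>x - y\<bar>) * B" using B k_pos by (intro mult_left_mono) auto
        also have "\<dots> < e" using d(2) that False by simp
        finally show ?thesis .
      qed (use \<open>0 < e\<close> in simp)
      then show ?thesis using d(1) by auto
    qed
  qed auto
  have Gc: "continuous_on I G" by (rule continuous_on_subset[OF G]) (auto simp: I_def)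
  have pt: "(\<lambda>n. F (f (r n)) x) \<longlonglongrightarrow> G x" if "x \<in> I" for x
  proof (rule LIMSEQ_I)
    fix e :: real assume "e > 0"
    moreover have "x \<in> {-a..a}" using that by (auto simp: I_def)
    ultimately show "\<exists>N. \<forall>n\<ge>N. cmod (F (f (r n)) x - G x) < e" using lim by blast
  qed
  have Gb: "cmod (G x) \<le> C0 * B * \<tau> x" if x: "x \<in> I" for x
  proof (rule LIMSEQ_le_const2[OF tendsto_norm[OF pt[OF x]]], intro exI allI impI)
    fix n
    have "cmod (F (f (r n)) x) \<le> C0 * L2_norm M (f (r n)) * \<tau> x" by (rule F_bound[OF f x])
    also have "\<dots> \<le> C0 * B * \<tau> x" using B C0_pos tau_pos[OF x] by (intro mult_right_mono mult_left_mono) auto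
    finally show "cmod (F (f (r n)) x) \<le> C0 * B * \<tau> x" .
  qed
  define g where "g x = G x / (complex_of_real (\<psi> x))\<^sup>2" for x
  have gc: "continuous_on I g" unfolding g_def by (rule quotient_continuous[OF Gc])
  define w where "w x = - (complex_of_real (\<phi> x) * prim g x)" for x
  have "continuous_on I (prim g)"
    using prim(2)[OF gc] has_vector_derivative_continuous continuous_at_imp_continuous_on by blast
  then have wm: "w \<in> borel_measurable M" unfolding w_def[abs_def]
    by (intro continuous_M continuous_intros phi_continuous)
  have wb: "cmod (w x) \<le> C4 * B" if x: "x \<in> I" for x
  proof -
    have "cmod (of_real (\<phi> x) * prim g x) \<le> (C0 * B / m\<^sup>2) * C1 * \<tau> x powr (1/4)"
      by (rule prim_bound_inverse_tau[OF prim(2)[OF gc] prim(1)[OF gc] _ x])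
        (use C0_pos B0 quotient_bound[OF Gb] in \<open>auto simp: g_def\<close>)
    also have "\<dots> \<le> (C0 * B / m\<^sup>2) * C1 * (a\<^sup>2) powr (1/4)"
      using tau_pos[OF x] tau_le[of x] C0_pos C1_pos B0 by (intro mult_left_mono powr_mono2) auto
    finally show ?thesis by (simp add: w_def C4_def C3_def mult_ac)
  qed
  have Jlim: "(\<lambda>n. J (f (r n)) x) \<longlonglongrightarrow> prim g x" if x: "x \<in> I" for x
  proof (rule LIMSEQ_I)
    fix e :: real assume e: "e > 0"
    have t: "\<tau> x > 0" by (rule tau_pos[OF x])
    \<comment> \<open>The outer primitive of a difference below \<open>d\<close> is at most
      \<open>(d / m\<^sup>2) / (a * \<tau> x)\<close>, which this choice makes \<open>e / 2\<close>.
      The choice depends on \<open>x\<close>, so the convergence obtained is pointwise.\<close>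
    define d where "d = e * m\<^sup>2 * (a * \<tau> x) / 2"
    have d: "d > 0" using e m_pos a_pos t by (simp add: d_def)
    obtain N where N: "\<And>n y. n \<ge> N \<Longrightarrow> y \<in> {-a..a} \<Longrightarrow> cmod (F (f (r n)) y - G y) < d" using lim[OF d] by blast
    have "cmod (J (f (r n)) x - prim g x) < e" if n: "n \<ge> N" for n
    proof -
      have "cmod (J (f (r n)) x - prim g x) \<le> (d / m\<^sup>2) / (a * \<tau> x)"
      proof (rule prim_bound_inverse_tau_sq[OF _ _ _ x])
        show "((\<lambda>x. J (f (r n)) x - prim g x) has_vector_derivative F (f (r n)) y / (of_real (\<psi> y))\<^sup>2 - g y) (at y)"
          if "y \<in> I" for y by (intro has_vector_derivative_diff J_hvd f(1) prim(2)[OF gc] that)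
        show "J (f (r n)) 0 - prim g 0 = 0" by (simp add: J_0 f(1) prim(1)[OF gc])
        show "0 \<le> d / m\<^sup>2" using d by simp
        show "cmod (F (f (r n)) y / (of_real (\<psi> y))\<^sup>2 - g y) \<le> (d / m\<^sup>2) / (\<tau> y)\<^sup>2" if y: "y \<in> I" for y
        proof -
          have "(m * \<tau> y)\<^sup>2 \<le> (\<psi> y)\<^sup>2" using psi_bounds(1)[OF y] m_pos tau_pos[OF y] by (intro power_mono) auto
          then have "cmod (F (f (r n)) y - G y) / (\<psi> y)\<^sup>2 \<le> d / (m * \<tau> y)\<^sup>2"
            using N[OF n, of y] y m_pos tau_pos[OF y] d by (intro frac_le) (auto simp: I_def)
          moreover have "F (f (r n)) y / (of_real (\<psi> y))\<^sup>2 - g y = (F (f (r n)) y - G y) / (of_real (\<psi> y))\<^sup>2"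
            by (simp add: g_def diff_divide_distrib)
          ultimately show ?thesis by (simp add: norm_divide norm_power power_mult_distrib)
        qed
      qed
      also have "\<dots> = e / 2" using m_pos a_pos t by (simp add: d_def)
      finally show ?thesis using e by simp
    qed
    then show "\<exists>N. \<forall>n\<ge>N. cmod (J (f (r n)) x - prim g x) < e" by blast
  qed
  have "(\<lambda>n. L2_norm M (\<lambda>x. V (f (r n)) x - w x)) \<longlonglongrightarrow> 0"
  proof (rule L2_norm_dominated_convergence_bounded[OF finite_M wm V_measurable[OF f(1)], where B = "C4 * B"])
    have "(\<lambda>n. V (f (r n)) x) \<longlonglongrightarrow> w x" if "x \<in> I" for x
      unfolding V_def w_def by (intro tendsto_intros Jlim that)
    then show "AE x in M. (\<lambda>n. V (f (r n)) x) \<longlonglongrightarrow> w x" by (intro AE_I2) simp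
    show "cmod (V (f (r n)) x) \<le> C4 * B" if "x \<in> space M" for n x
      using V_bound[OF f, of x "r n"] mult_left_mono[OF B[of "r n"] less_imp_le[OF C4_pos]] that by simp
    show "cmod (w x) \<le> C4 * B" if "x \<in> space M" for x using wb that by simp
  qed
  moreover have "w \<in> L2 M" by (rule L2_bounded[OF finite_M wm wb]) simp
  ultimately show ?thesis using r by blast
qed


section \<open>The projection along the ground state and the compact operator\<close>

abbreviation cphi :: "real \<Rightarrow> complex" where "cphi \<equiv> (\<lambda>x. of_real (\<phi> x))"

definition norm_phi :: real where "norm_phi = L2_norm M cphi"

lemma interval_not_null: "p < q \<Longrightarrow> {p<..<q :: real} \<notin> null_sets lebesgue"
  by (simp add: null_sets_def)

lemma not_AE_zero_I:
  assumes "AE x in M. P x"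
  shows "\<exists>x\<in>I. P x"
proof (rule ccontr)
  assume "\<not> ?thesis"
  moreover have "AE x in lebesgue. x \<in> I \<longrightarrow> P x" using assms by (simp add: AE_restrict_space_iff)
  ultimately have "AE x in lebesgue. x \<notin> I" by (auto elim: eventually_mono)
  then have "I \<in> null_sets lebesgue" by (subst (asm) AE_iff_null_sets[symmetric]) auto
  then show False using interval_not_null[of "-a" a] a_pos by (simp add: I_def)
qed

lemma norm_phi_pos: "norm_phi > 0"
proof -
  have "norm_phi \<noteq> 0"
  proof
    assume "norm_phi = 0"
    then have "AE x in M. cphi x = 0" using L2_norm_zero_iff[OF phi_L2] by (simp add: norm_phi_def)
    from not_AE_zero_I[OF this] show False using phi_nonzero by auto
  qed
  then show ?thesis using L2_norm_nonneg[of M cphi] by (simp add: norm_phi_def)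
qed

lemma F_phi: "F cphi a = of_real (norm_phi\<^sup>2)"
  by (simp add: F_total L2_inner_self norm_phi_def)

definition phi_coeff :: "(real \<Rightarrow> complex) \<Rightarrow> complex" where "phi_coeff h = F h a / of_real (norm_phi\<^sup>2)"

text \<open>Orthogonal projection onto the complement of \<open>\<phi>\<close>.\<close>

definition Q :: "(real \<Rightarrow> complex) \<Rightarrow> real \<Rightarrow> complex" where "Q h x = h x - phi_coeff h * of_real (\<phi> x)"

lemma Q_L2: "h \<in> L2 M \<Longrightarrow> Q h \<in> L2 M"
  unfolding Q_def[abs_def] by (intro L2_diff L2_cmult phi_L2)

lemma F_Q: "h \<in> L2 M \<Longrightarrow> F (Q h) a = 0"
proof -
  assume h: "h \<in> L2 M"
  have "F (Q h) a = F h a - phi_coeff h * F cphi a"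
    unfolding Q_def[abs_def] F_diff[OF h L2_cmult[OF phi_L2]] F_cmult ..
  then show ?thesis using norm_phi_pos by (simp add: F_phi phi_coeff_def)
qed

lemma Q_id: "F h a = 0 \<Longrightarrow> Q h = h"
  by (simp add: Q_def[abs_def] phi_coeff_def)

lemma Q_add: "h \<in> L2 M \<Longrightarrow> g \<in> L2 M \<Longrightarrow> Q (\<lambda>x. h x + g x) x = Q h x + Q g x"
  by (simp add: Q_def phi_coeff_def F_add add_divide_distrib algebra_simps)

lemma Q_cmult: "Q (\<lambda>x. z * h x) x = z * Q h x"
  by (simp add: Q_def phi_coeff_def F_cmult algebra_simps)

lemma Q_cong_AE:
  assumes "h \<in> L2 M" "g \<in> L2 M" "AE x in M. h x = g x"
  shows "AE x in M. Q h x = Q g x"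
  using assms(3) F_cong_AE[OF assms] by (auto simp: Q_def phi_coeff_def)

definition CQ :: real where "CQ = 1 + CF / norm_phi"

lemma CF_nonneg: "CF \<ge> 0" using k_pos a_pos by (simp add: CF_def)

lemma CQ_pos: "CQ > 0" using CF_nonneg norm_phi_pos by (simp add: CQ_def add_pos_nonneg)

lemma Q_norm:
  assumes h: "h \<in> L2 M"
  shows "L2_norm M (Q h) \<le> CQ * L2_norm M h"
proof -
  have "L2_norm M (Q h) \<le> L2_norm M h + cmod (phi_coeff h) * norm_phi"
    unfolding Q_def[abs_def] norm_phi_def
    using L2_norm_triangle_diff[OF I_lebesgue h L2_cmult[OF phi_L2, of "phi_coeff h"]]
    by (simp add: L2_norm_cmult[OF I_lebesgue phi_L2])
  moreover have "cmod (phi_coeff h) * norm_phi \<le> CF / norm_phi * L2_norm M h"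
  proof -
    have "cmod (F h a) \<le> CF * L2_norm M h" using F_le[OF h, of a] a_pos by simp
    then have "cmod (F h a) / norm_phi \<le> CF * L2_norm M h / norm_phi" using norm_phi_pos by (simp add: divide_right_mono)
    moreover have "cmod (phi_coeff h) * norm_phi = cmod (F h a) / norm_phi"
      using norm_phi_pos by (simp add: phi_coeff_def norm_divide norm_mult power2_eq_square)
    ultimately show ?thesis by simp
  qed
  ultimately show ?thesis by (simp add: CQ_def algebra_simps)
qed

lemma Q_sym:
  assumes f: "f \<in> L2 M" and g: "g \<in> L2 M"
  shows "L2_inner M (Q f) g = L2_inner M f (Q g)"
proof -
  have "L2_inner M cphi g = cnj (F g a)" by (simp add: F_total L2_inner_cnj)
  moreover have "L2_inner M (Q f) g = L2_inner M f g - phi_coeff f * L2_inner M cphi g"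
    unfolding Q_def[abs_def] L2_inner_diff_left[OF f L2_cmult[OF phi_L2] g] L2_inner_cmult_left ..
  moreover have "L2_inner M f (Q g) = L2_inner M f g - cnj (phi_coeff g) * L2_inner M f cphi"
    unfolding Q_def[abs_def] L2_inner_diff_right[OF g L2_cmult[OF phi_L2] f] L2_inner_cmult_right ..
  ultimately show ?thesis by (simp add: phi_coeff_def F_total)
qed

text \<open>\<open>V\<close> is a bounded symmetric form only on functions orthogonal to
  \<open>\<phi>\<close>, and its values need not be orthogonal to \<open>\<phi>\<close>. Projecting
  on both sides gives a symmetric operator on all of L2.\<close>

definition N :: "(real \<Rightarrow> complex) \<Rightarrow> real \<Rightarrow> complex" where "N h = Q (V (Q h))"

lemma VQ_L2: "h \<in> L2 M \<Longrightarrow> V (Q h) \<in> L2 M" by (rule V_L2[OF Q_L2 F_Q])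

lemma N_L2: "h \<in> L2 M \<Longrightarrow> N h \<in> L2 M" unfolding N_def by (rule Q_L2[OF VQ_L2])

lemma F_N: "h \<in> L2 M \<Longrightarrow> F (N h) a = 0" unfolding N_def by (rule F_Q[OF VQ_L2])

lemma Q_cong_I:
  assumes "h \<in> L2 M" "g \<in> L2 M" "\<And>x. x \<in> I \<Longrightarrow> h x = g x"
  shows "x \<in> I \<Longrightarrow> Q h x = Q g x"
  using F_cong_AE[OF assms(1,2) AE_I2] assms(3) by (auto simp: Q_def phi_coeff_def)

lemma N_add:
  assumes h: "h \<in> L2 M" and g: "g \<in> L2 M" and x: "x \<in> I"
  shows "N (\<lambda>x. h x + g x) x = N h x + N g x"
proof -
  have 1: "Q (\<lambda>x. h x + g x) = (\<lambda>x. Q h x + Q g x)" using Q_add[OF h g] by blast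
  have "N (\<lambda>x. h x + g x) x = Q (\<lambda>x. V (Q h) x + V (Q g) x) x"
    unfolding N_def 1
  proof (rule Q_cong_I[OF _ _ _ x])
    show "V (\<lambda>x. Q h x + Q g x) \<in> L2 M" using VQ_L2[OF L2_add[OF h g]] by (simp add: 1)
    show "(\<lambda>x. V (Q h) x + V (Q g) x) \<in> L2 M" by (intro L2_add VQ_L2 h g)
    show "V (\<lambda>x. Q h x + Q g x) x = V (Q h) x + V (Q g) x" if "x \<in> I" for x
      by (rule V_add[OF Q_L2[OF h] Q_L2[OF g] that])
  qed
  then show ?thesis by (simp add: N_def Q_add VQ_L2 h g)
qed

lemma N_cmult:
  assumes h: "h \<in> L2 M" and x: "x \<in> I"
  shows "N (\<lambda>x. z * h x) x = z * N h x"
proof -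
  have 1: "Q (\<lambda>x. z * h x) = (\<lambda>x. z * Q h x)" using Q_cmult by blast
  have "N (\<lambda>x. z * h x) x = Q (\<lambda>x. z * V (Q h) x) x"
    unfolding N_def 1
  proof (rule Q_cong_I[OF _ _ _ x])
    show "V (\<lambda>x. z * Q h x) \<in> L2 M" using VQ_L2[OF L2_cmult[OF h, of z]] by (simp add: 1)
    show "(\<lambda>x. z * V (Q h) x) \<in> L2 M" by (intro L2_cmult VQ_L2 h)
    show "V (\<lambda>x. z * Q h x) x = z * V (Q h) x" if "x \<in> I" for x
      by (rule V_cmult[OF Q_L2[OF h] that])
  qed
  then show ?thesis by (simp add: N_def Q_cmult)
qed

lemma N_cong_AE:
  assumes "h \<in> L2 M" "g \<in> L2 M" "AE x in M. h x = g x"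
  shows "N h = N g"
  unfolding N_def using V_cong_AE[OF Q_L2[OF assms(1)] Q_L2[OF assms(2)] Q_cong_AE[OF assms]] by simp

lemma N_symmetric:
  assumes f: "f \<in> L2 M" and g: "g \<in> L2 M"
  shows "L2_inner M (N f) g = L2_inner M f (N g)"
  unfolding N_def
  by (simp add: Q_sym[OF VQ_L2[OF f] g] V_symmetric[OF Q_L2[OF f] F_Q[OF f] Q_L2[OF g] F_Q[OF g]]
      Q_sym[OF f VQ_L2[OF g]])

text \<open>The chosen representative is read on \<open>I\<close> only; \<open>N_cong_AE\<close>
  makes the result independent of the choice.\<close>

definition K :: "l2 \<Rightarrow> l2" where "K X = emb I (N (rep_l2 X))"

lemma rep_L2: "rep_l2 X \<in> L2 M" by (rule L2_rep[OF I_lebesgue])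

lemma emb_cong: "(\<And>x. x \<in> I \<Longrightarrow> f x = g x) \<Longrightarrow> emb I f = emb I g"
  unfolding emb_def by (rule arg_cong[where f = abs_l2]) auto

lemma K_emb: "f \<in> L2 M \<Longrightarrow> K (emb I f) = emb I (N f)"
  unfolding K_def using N_cong_AE[OF rep_L2 _ emb_rep_emb[OF I_lebesgue]] by simp

lemma AE_rep_add: "AE x in M. rep_l2 (X + Y) x = rep_l2 X x + rep_l2 Y x"
proof -
  have r: "rep_l2 X \<in> L2 lebesgue" "rep_l2 Y \<in> L2 lebesgue"
    using Quotient_rep_reflp[OF Quotient_l2] by auto
  have "X + Y = abs_l2 (\<lambda>x. rep_l2 X x + rep_l2 Y x)"
    using plus_l2.abs_eq[of "rep_l2 X" "rep_l2 Y"] r Quotient3_abs_rep[OF Quotient3_l2] by simp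
  then have "AE x in lebesgue. rep_l2 (X + Y) x = rep_l2 X x + rep_l2 Y x"
    using Quotient3_rep_abs[OF Quotient3_l2, of "\<lambda>x. rep_l2 X x + rep_l2 Y x"] L2_add[OF r] by simp
  then show ?thesis by (subst AE_restrict_space_iff) auto
qed

lemma AE_rep_cscale: "AE x in M. rep_l2 (cscale z X) x = z * rep_l2 X x"
proof -
  have r: "rep_l2 X \<in> L2 lebesgue"
    using Quotient_rep_reflp[OF Quotient_l2] by auto
  have "cscale z X = abs_l2 (\<lambda>x. z * rep_l2 X x)"
    using cscale.abs_eq[of "rep_l2 X" z] r Quotient3_abs_rep[OF Quotient3_l2] by simp
  then have "AE x in lebesgue. rep_l2 (cscale z X) x = z * rep_l2 X x"
    using Quotient3_rep_abs[OF Quotient3_l2, of "\<lambda>x. z * rep_l2 X x"] L2_cmult[OF r] by simp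
  then show ?thesis by (subst AE_restrict_space_iff) auto
qed

lemma inner_emb_left:
  assumes "f \<in> L2 M"
  shows "inner (emb I f) Y = Re (L2_inner M f (rep_l2 Y))"
proof -
  have r: "rep_l2 Y \<in> L2 lebesgue"
    using Quotient_rep_reflp[OF Quotient_l2] by auto
  have "inner (emb I f) Y = inner (emb I f) (abs_l2 (rep_l2 Y))"
    using Quotient3_abs_rep[OF Quotient3_l2] by simp
  also have "\<dots> = Re (L2_inner lebesgue (\<lambda>x. if x \<in> I then f x else 0) (rep_l2 Y))"
    unfolding emb_def using L2_extend[OF I_lebesgue assms] r by (simp add: inner_l2.abs_eq)
  also have "L2_inner lebesgue (\<lambda>x. if x \<in> I then f x else 0) (rep_l2 Y) = L2_inner M f (rep_l2 Y)"
    unfolding L2_inner_def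
    by (subst integral_restrict_space) (auto intro!: Bochner_Integration.integral_cong)
  finally show ?thesis .
qed

lemma K_cscale: "K (cscale z X) = cscale z (K X)"
proof -
  have "K (cscale z X) = emb I (N (\<lambda>x. z * rep_l2 X x))"
    unfolding K_def using N_cong_AE[OF rep_L2 L2_cmult[OF rep_L2] AE_rep_cscale] by simp
  also have "\<dots> = emb I (\<lambda>x. z * N (rep_l2 X) x)"
    by (rule emb_cong) (simp add: N_cmult rep_L2)
  finally show ?thesis by (simp add: emb_cmult N_L2 rep_L2 K_def)
qed

sublocale K: compact_symmetric K
proof
  show "K (X + Y) = K X + K Y" for X Y
  proof -
    have "K (X + Y) = emb I (N (\<lambda>x. rep_l2 X x + rep_l2 Y x))"
      unfolding K_def using N_cong_AE[OF rep_L2 L2_add[OF rep_L2 rep_L2] AE_rep_add] by simp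
    also have "\<dots> = emb I (\<lambda>x. N (rep_l2 X) x + N (rep_l2 Y) x)"
      by (rule emb_cong) (simp add: N_add rep_L2)
    finally show ?thesis by (simp add: emb_add N_L2 rep_L2 K_def)
  qed
  show "K (r *\<^sub>R X) = r *\<^sub>R K X" for r X
    using K_cscale[of "of_real r" X] by (simp add: cscale_of_real)
  show "inner (K X) Y = inner X (K Y)" for X Y
  proof -
    have "inner (K X) Y = Re (L2_inner M (N (rep_l2 X)) (rep_l2 Y))"
      by (simp add: K_def inner_emb_left N_L2 rep_L2)
    also have "\<dots> = Re (L2_inner M (rep_l2 X) (N (rep_l2 Y)))" by (simp add: N_symmetric rep_L2)
    also have "\<dots> = Re (L2_inner M (N (rep_l2 Y)) (rep_l2 X))"
      by (subst L2_inner_cnj[symmetric]) simp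
    also have "\<dots> = inner (K Y) X" by (simp add: K_def inner_emb_left N_L2 rep_L2)
    finally show ?thesis by (simp add: inner_commute)
  qed
  show "\<exists>l r. strict_mono r \<and> (\<lambda>n. K (X (r n))) \<longlonglongrightarrow> l" if X: "\<And>n::nat. norm (X n) \<le> 1" for X
  proof -
    define f where "f n = Q (rep_l2 (X n))" for n
    have f: "f n \<in> L2 M" "F (f n) a = 0" for n by (auto simp: f_def Q_L2 F_Q rep_L2)
    have "L2_norm M (f n) \<le> CQ" for n
    proof -
      have "L2_norm M (rep_l2 (X n)) \<le> 1"
        using norm_emb_rep[OF I_lebesgue, of "X n"] X[of n] by (simp add: norm_emb[OF I_lebesgue rep_L2])
      then have "CQ * L2_norm M (rep_l2 (X n)) \<le> CQ * 1" using CQ_pos by (intro mult_left_mono) auto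
      then show ?thesis using Q_norm[OF rep_L2, of "X n"] by (simp add: f_def)
    qed
    from V_compact[of f CQ, OF f this] obtain w r where w: "w \<in> L2 M" and r: "strict_mono (r :: nat \<Rightarrow> nat)"
      and lim: "(\<lambda>n. L2_norm M (\<lambda>x. V (f (r n)) x - w x)) \<longlonglongrightarrow> 0" by blast
    have Vf: "V (f n) \<in> L2 M" for n by (rule V_L2[OF f])
    have "(\<lambda>n. K (X (r n)) - emb I (Q w)) \<longlonglongrightarrow> 0"
    proof (rule Lim_null_comparison)
      show "(\<lambda>n. CQ * L2_norm M (\<lambda>x. V (f (r n)) x - w x)) \<longlonglongrightarrow> 0"
        using tendsto_mult[OF tendsto_const lim, of CQ] by simp
      have "norm (K (X (r n)) - emb I (Q w)) \<le> CQ * L2_norm M (\<lambda>x. V (f (r n)) x - w x)" for n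
      proof -
        have "K (X (r n)) - emb I (Q w) = emb I (\<lambda>x. Q (V (f (r n))) x - Q w x)"
          unfolding K_def N_def f_def[symmetric]
          by (rule emb_diff[OF I_lebesgue Q_L2[OF Vf] Q_L2[OF w], symmetric])
        also have "(\<lambda>x. Q (V (f (r n))) x - Q w x) = Q (\<lambda>x. V (f (r n)) x - w x)"
        proof
          fix x show "Q (V (f (r n))) x - Q w x = Q (\<lambda>x. V (f (r n)) x - w x) x"
            using Q_add[OF Vf L2_cmult[OF w, of "-1"], of "r n" x] Q_cmult[of "-1" w x] by simp
        qed
        finally show ?thesis
          using Q_norm[OF L2_diff[OF Vf w], of "r n"]
          by (simp add: norm_emb[OF I_lebesgue Q_L2[OF L2_diff[OF Vf w]]])
      qed
      then show "\<forall>\<^sub>F n in sequentially. norm (K (X (r n)) - emb I (Q w)) \<le> CQ * L2_norm M (\<lambda>x. V (f (r n)) x - w x)"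
        by simp
    qed
    then show ?thesis using r by (auto simp: LIM_zero_iff)
  qed
qed

end

subsection \<open>The domain of the Friedrichs extension\<close>

text \<open>Integrating the lower bound gives
  \<open>Re (l * v x) \<ge> \<kappa> / (a - x) - C\<close>, so near \<open>a\<close> the integrand
  dominates a multiple of \<open>1 / (a - x)\<close>, whose integral diverges logarithmically. The
  factor \<open>l\<close> selects a direction in the complex plane in which \<open>v\<close>
  grows.\<close>

lemma blowup_not_integrable:
  fixes v v' :: "real \<Rightarrow> complex"
  assumes x1: "x1 < a" and v: "\<And>x. x1 < x \<Longrightarrow> x < a \<Longrightarrow> (v has_vector_derivative v' x) (at x)"
    and l: "\<And>x. x1 < x \<Longrightarrow> x < a \<Longrightarrow> Re (l * v' x) \<ge> \<kappa> / (a - x)\<^sup>2" and \<kappa>: "\<kappa> > 0"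
  shows "\<not> integrable (lebesgue_on {x1<..<a}) (\<lambda>x. (a - x) * (cmod (v x))\<^sup>2)"
proof
  assume int: "integrable (lebesgue_on {x1<..<a}) (\<lambda>x. (a - x) * (cmod (v x))\<^sup>2)"
  define x0 where "x0 = (x1 + a) / 2"
  have x0: "x1 < x0" "x0 < a" using x1 by (auto simp: x0_def)
  have l0: "cmod l > 0"
  proof -
    have "Re (l * v' x0) > 0" using l[OF x0] \<kappa> x0 by (smt (verit) divide_pos_pos zero_less_power)
    then show ?thesis by auto
  qed
  define C where "C = \<kappa> / (a - x0) - Re (l * v x0)"
  have low: "Re (l * v x) \<ge> \<kappa> / (a - x) - C" if x: "x0 \<le> x" "x < a" for x
  proof -
    let ?f = "\<lambda>x. Re (l * v x) - \<kappa> / (a - x)"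
    have "?f x0 \<le> ?f x"
    proof (rule DERIV_nonneg_imp_nondecreasing[OF x(1)])
      fix t assume t: "x0 \<le> t" "t \<le> x"
      then have t': "x1 < t" "t < a" using x x0 by auto
      have "((\<lambda>x. l * v x) has_vector_derivative l * v' t) (at t)"
        by (rule has_vector_derivative_mult_right[OF v[OF t']])
      then have 1: "((\<lambda>x. Re (l * v x)) has_real_derivative Re (l * v' t)) (at t)"
        unfolding has_real_derivative_iff_has_vector_derivative
        by (rule bounded_linear.has_vector_derivative[OF bounded_linear_Re])
      have 2: "((\<lambda>x. \<kappa> / (a - x)) has_real_derivative \<kappa> / (a - t)\<^sup>2) (at t)"
        using t' by (auto intro!: derivative_eq_intros simp: power2_eq_square)
      show "\<exists>y. (?f has_real_derivative y) (at t) \<and> 0 \<le> y"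
        using DERIV_diff[OF 1 2] l[OF t'] by (intro exI[of _ "Re (l * v' t) - \<kappa> / (a - t)\<^sup>2"]) auto
    qed
    then show ?thesis by (simp add: C_def)
  qed
  \<comment> \<open>Beyond \<open>x2\<close> the constant \<open>C\<close> is at most half of
    \<open>\<kappa> / (a - x)\<close>, so the other half remains as a lower bound.\<close>
  define x2 where "x2 = max x0 (a - \<kappa> / (2 * (\<bar>C\<bar> + 1)))"
  have x2: "x0 \<le> x2" "x2 < a" using x0 \<kappa> by (auto simp: x2_def add_nonneg_pos)
  define d where "d = (\<kappa> / (2 * cmod l))\<^sup>2"
  have d: "d > 0" using \<kappa> l0 by (simp add: d_def)
  have big: "d / (a - x) \<le> (a - x) * (cmod (v x))\<^sup>2" if x: "x2 < x" "x < a" for x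
  proof -
    have ax: "0 < a - x" using x by simp
    have "a - x \<le> \<kappa> / (2 * (\<bar>C\<bar> + 1))" using x by (simp add: x2_def)
    then have "(\<bar>C\<bar> + 1) * (a - x) \<le> \<kappa> / 2" by (simp add: field_simps add_nonneg_pos)
    then have "\<bar>C\<bar> * (a - x) \<le> \<kappa> / 2" using ax by (simp add: algebra_simps)
    then have "C * (a - x) \<le> \<kappa> / 2" using ax by (meson abs_ge_self mult_right_mono less_imp_le order_trans)
    then have C: "C \<le> \<kappa> / 2 / (a - x)" by (simp only: pos_le_divide_eq[OF ax])
    define D where "D = \<kappa> / 2 / (a - x)"
    have "D = \<kappa> / (a - x) / 2" by (simp add: D_def)
    then have D1: "\<kappa> / (a - x) = D + D" by (simp only: field_sum_of_halves)
    have D2: "\<kappa> / (2 * (a - x)) = D"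
      unfolding D_def by (simp only: divide_divide_eq_left)
    have "\<kappa> / (2 * (a - x)) \<le> \<kappa> / (a - x) - C" unfolding D1 D2 using C[folded D_def] by simp
    also have "\<dots> \<le> Re (l * v x)" using low[of x] x x2 by simp
    also have "\<dots> \<le> cmod l * cmod (v x)" using complex_Re_le_cmod[of "l * v x"] by (simp add: norm_mult)
    finally have "\<kappa> / (2 * cmod l) \<le> cmod (v x) * (a - x)" using l0 ax by (simp add: field_simps)
    then have "d \<le> (cmod (v x) * (a - x))\<^sup>2" unfolding d_def using \<kappa> l0 by (intro power_mono) auto
    then show ?thesis using ax by (simp add: field_simps power2_eq_square)
  qed
  have sub: "set_integrable lebesgue {x1<..<a} (\<lambda>x. (a - x) * (cmod (v x))\<^sup>2)"
    using int by (simp add: set_integrable_def integrable_restrict_space)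
  define B where "B = (LINT x|lebesgue_on {x1<..<a}. (a - x) * (cmod (v x))\<^sup>2) / d"
  have upper: "ln (a - x2) - ln (a - y) \<le> B" if y: "x2 < y" "y < a" for y
  proof -
    have "continuous_on {x2..y} (\<lambda>x. d / (a - x))" by (intro continuous_intros) (use y in auto)
    from continuous_imp_integrable_real[OF this]
    have iy: "set_integrable lebesgue {x2..y} (\<lambda>x. d / (a - x))"
      by (simp add: set_integrable_def integrable_restrict_space)
    have "((\<lambda>x. d / (a - x)) has_integral (- d * ln (a - y)) - (- d * ln (a - x2))) {x2..y}"
      by (rule fundamental_theorem_of_calculus)
        (use y in \<open>auto intro!: derivative_eq_intros simp: has_real_derivative_iff_has_vector_derivative[symmetric]\<close>)
    then have "d * (ln (a - x2) - ln (a - y)) = integral {x2..y} (\<lambda>x. d / (a - x))"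
      by (simp add: integral_unique algebra_simps)
    also have "\<dots> = (LINT x:{x2..y}|lebesgue. d / (a - x))"
      by (rule set_lebesgue_integral_eq_integral(2)[OF iy, symmetric])
    also have "\<dots> = (LINT x:{x2<..y}|lebesgue. d / (a - x))"
      unfolding set_lebesgue_integral_def
    proof (rule integral_cong_AE)
      show "AE x in lebesgue. indicat_real {x2..y} x *\<^sub>R (d / (a - x)) = indicat_real {x2<..y} x *\<^sub>R (d / (a - x))"
        by (rule AE_I[of _ _ "{x2}"]) (auto simp: indicator_def split: if_splits)
      have "set_integrable lebesgue {x2<..y} (\<lambda>x. d / (a - x))" by (rule set_integrable_subset[OF iy]) auto
      then show "(\<lambda>x. indicat_real {x2<..y} x *\<^sub>R (d / (a - x))) \<in> borel_measurable lebesgue"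
        unfolding set_integrable_def by (rule borel_measurable_integrable)
    qed (use iy in \<open>auto simp: set_integrable_def\<close>)
    also have "\<dots> \<le> (LINT x:{x1<..<a}|lebesgue. (a - x) * (cmod (v x))\<^sup>2)"
      unfolding set_lebesgue_integral_def
    proof (rule integral_mono)
      have "set_integrable lebesgue {x2<..y} (\<lambda>x. d / (a - x))" by (rule set_integrable_subset[OF iy]) auto
      then show "integrable lebesgue (\<lambda>x. indicat_real {x2<..y} x *\<^sub>R (d / (a - x)))"
        by (simp add: set_integrable_def)
      show "integrable lebesgue (\<lambda>x. indicat_real {x1<..<a} x *\<^sub>R ((a - x) * (cmod (v x))\<^sup>2))"
        using sub by (simp add: set_integrable_def)
      show "indicat_real {x2<..y} x *\<^sub>R (d / (a - x)) \<le> indicat_real {x1<..<a} x *\<^sub>R ((a - x) * (cmod (v x))\<^sup>2)" for x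
      proof (cases "x2 < x \<and> x \<le> y")
        case True
        then have "x1 < x" "x < a" using x2 x0 y by auto
        then show ?thesis using True big[of x] by (simp add: indicator_def)
      next
        case False
        then show ?thesis by (auto simp: indicator_def)
      qed
    qed
    also have "\<dots> = B * d" using d by (simp add: B_def set_lebesgue_integral_def integral_restrict_space)
    finally show ?thesis using d by (simp add: mult.commute)
  qed
  \<comment> \<open>The exponential forces the logarithms to differ by at least
    \<open>B + 1\<close>, against \<open>upper\<close>; the other argument of the minimum keeps
    \<open>a - e\<close> to the right of \<open>x2\<close>.\<close>
  define e where "e = min ((a - x2) / 2) (exp (ln (a - x2) - B - 1))"
  have e: "e > 0" "e < a - x2" using x2 by (auto simp: e_def min_less_iff_disj)
  have "ln e \<le> ln (a - x2) - B - 1" using e(1) by (metis e_def exp_gt_zero exp_le_cancel_iff exp_ln min.cobounded2)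
  moreover have "ln (a - x2) - ln e \<le> B" using upper[of "a - e"] e by simp
  ultimately show False by linarith
qed

context profile
begin

text \<open>\<open>\<psi>\<close> dominates a multiple of the distance to the nearer endpoint. The
  second conclusion reflects the left half of the interval, so that one growth lemma serves both
  endpoints.\<close>

lemma L2_restrict_right:
  assumes "u \<in> L2 M" "v \<in> borel_measurable M" "AE x in M. u x = of_real (\<phi> x) * v x" "0 \<le> x1" "x1 < a"
  shows "integrable (lebesgue_on {x1<..<a}) (\<lambda>x. (a - x) * (cmod (v x))\<^sup>2)"
    "integrable (lebesgue_on {x1<..<a}) (\<lambda>x. (a - x) * (cmod (v (- x)))\<^sup>2)"
proof -
  define f where "f x = \<psi> x * (cmod (v x))\<^sup>2" for x
  have fm: "f \<in> borel_measurable M" unfolding f_def[abs_def]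
    using continuous_M[OF psi_continuous] assms(2) by measurable
  have fi: "integrable M f"
  proof (rule integrable_cong_AE_imp[OF L2_integrable[OF assms(1)] fm])
    show "AE x in M. (cmod (u x))\<^sup>2 = f x"
      using assms(3) AE_space
    proof eventually_elim
      case (elim x)
      then have "x \<in> I" by simp
      then show ?case using elim phi_pos[of x] phi_sq[of x]
        by (simp add: f_def norm_mult power_mult_distrib power2_eq_square)
    qed
  qed
  define g where "g x = (a - \<bar>x\<bar>) * (cmod (v x))\<^sup>2" for x
  have gm: "g \<in> borel_measurable M"
  proof -
    have "(\<lambda>x. a - \<bar>x\<bar>) \<in> borel_measurable M" by (intro continuous_M continuous_intros)
    then show ?thesis unfolding g_def[abs_def] using assms(2) by measurable
  qed
  have gi: "integrable M g"
  proof (rule Bochner_Integration.integrable_bound[OF _ gm])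
    show "integrable M (\<lambda>x. (1 / (m * a)) * f x)" by (intro integrable_mult_right fi)
    show "AE x in M. norm (g x) \<le> norm ((1 / (m * a)) * f x)"
    proof (rule AE_I2)
      fix x assume "x \<in> space M"
      then have x: "x \<in> I" by simp
      have "(a - \<bar>x\<bar>) * a \<le> (a - \<bar>x\<bar>) * (a + \<bar>x\<bar>)" using x by (intro mult_left_mono) (auto simp: I_iff)
      also have "\<dots> = \<tau> x" by (simp add: \<tau>_def algebra_simps power2_eq_square flip: abs_mult)
      finally have "m * ((a - \<bar>x\<bar>) * a) \<le> m * \<tau> x" using m_pos by (intro mult_left_mono) auto
      then have "m * ((a - \<bar>x\<bar>) * a) \<le> \<psi> x" using psi_bounds(1)[OF x] by linarith
      then have "(a - \<bar>x\<bar>) \<le> (1 / (m * a)) * \<psi> x" using m_pos a_pos by (simp add: field_simps)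
      then have "g x \<le> (1 / (m * a)) * f x"
        unfolding g_def f_def using mult_right_mono[of "a - \<bar>x\<bar>" "(1 / (m * a)) * \<psi> x" "(cmod (v x))\<^sup>2"] by (simp add: mult.assoc)
      moreover have "0 \<le> g x" using x by (simp add: g_def I_iff)
      ultimately have "norm (g x) \<le> (1 / (m * a)) * f x" by simp
      then show "norm (g x) \<le> norm ((1 / (m * a)) * f x)" using abs_ge_self order_trans unfolding real_norm_def by blast
    qed
  qed
  have s: "set_integrable lebesgue I g" using gi by (simp add: set_integrable_def integrable_restrict_space)
  have "set_integrable lebesgue {x1<..<a} g" by (rule set_integrable_subset[OF s]) (use assms(4) in \<open>auto simp: I_iff\<close>)
  then have "integrable (lebesgue_on {x1<..<a}) g" by (simp add: set_integrable_def integrable_restrict_space)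
  then show "integrable (lebesgue_on {x1<..<a}) (\<lambda>x. (a - x) * (cmod (v x))\<^sup>2)"
    by (rule Bochner_Integration.integrable_cong[THEN iffD1, rotated -1]) (use assms(4) in \<open>auto simp: g_def\<close>)
  define g0 where "g0 x = (if x \<in> I then g x else 0)" for x
  have "set_integrable lebesgue {-a..a} g0"
  proof -
    have "integrable lebesgue (\<lambda>x. indicator {-a..a} x *\<^sub>R g0 x) \<longleftrightarrow> integrable lebesgue (\<lambda>x. indicator I x *\<^sub>R g x)"
      by (rule Bochner_Integration.integrable_cong) (auto simp: g0_def indicator_def I_def)
    then show ?thesis using s by (simp add: set_integrable_def)
  qed
  then have "integrable (lebesgue_on {-a..a}) g0" by (simp add: set_integrable_def integrable_restrict_space)
  then have "integrable (lebesgue_on {-a..a}) (\<lambda>x. g0 (- x))"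
    using integrable_reflect_real[where a = "-a" and b = a and f = g0] by simp
  then have "set_integrable lebesgue {-a..a} (\<lambda>x. g0 (- x))" by (simp add: set_integrable_def integrable_restrict_space)
  then have "set_integrable lebesgue {x1<..<a} (\<lambda>x. g0 (- x))" by (rule set_integrable_subset) (use assms(4) a_pos in auto)
  then have "integrable (lebesgue_on {x1<..<a}) (\<lambda>x. g0 (- x))" by (simp add: set_integrable_def integrable_restrict_space)
  then show "integrable (lebesgue_on {x1<..<a}) (\<lambda>x. (a - x) * (cmod (v (- x)))\<^sup>2)"
    by (rule Bochner_Integration.integrable_cong[THEN iffD1, rotated -1])
      (use assms(4) in \<open>auto simp: g0_def g_def I_iff\<close>)
qed

text \<open>The limit point property: a nonzero boundary value of \<open>\<psi>\<^sup>2 v'\<close> forces \<open>v\<close> to grow like the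
  inverse of the distance to the endpoint.\<close>

lemma boundary_value_zero:
  assumes u: "u \<in> L2 M" "AE x in M. u x = of_real (\<phi> x) * v x"
    and v: "\<And>x. x \<in> I \<Longrightarrow> (v has_vector_derivative W x / (of_real (\<psi> x))\<^sup>2) (at x)"
    and W: "continuous_on UNIV W"
  shows "W a = 0" "W (- a) = 0"
proof -
  have vm: "v \<in> borel_measurable M"
    using v has_vector_derivative_continuous by (intro continuous_M continuous_at_imp_continuous_on) blast
  \<comment> \<open>Multiplication by the conjugate of the boundary value makes the real part tend
    to its squared modulus, hence stay above half of it; the sign \<open>s\<close> treats both
    endpoints together.\<close>
  have *: "\<exists>x1. 0 \<le> x1 \<and> x1 < a \<and> (\<forall>x. x1 < x \<longrightarrow> x < a \<longrightarrow>
      Re (cnj (W (s * a)) * (W (s * x) / (of_real (\<psi> (s * x)))\<^sup>2)) \<ge> ((cmod (W (s * a)))\<^sup>2 / (2 * (k * (2 * a))\<^sup>2)) / (a - x)\<^sup>2)"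
    if s: "s = 1 \<or> s = -1" and nz: "W (s * a) \<noteq> 0" for s :: real
  proof -
    have "continuous_on UNIV (\<lambda>x. W (s * x))" by (intro continuous_on_compose2[OF W] continuous_intros) auto
    then have "((\<lambda>x. W (s * x)) \<longlongrightarrow> W (s * a)) (at a)" by (simp add: continuous_on_def)
    then have "((\<lambda>x. Re (cnj (W (s * a)) * W (s * x))) \<longlongrightarrow> Re (cnj (W (s * a)) * W (s * a))) (at a)"
      by (intro tendsto_intros)
    moreover have "Re (cnj (W (s * a)) * W (s * a)) = (cmod (W (s * a)))\<^sup>2" by (simp add: cmod_power2 flip: power2_eq_square)
    ultimately have "((\<lambda>x. Re (cnj (W (s * a)) * W (s * x))) \<longlongrightarrow> (cmod (W (s * a)))\<^sup>2) (at_left a)"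
      by (simp add: filterlim_at_split)
    moreover have "(cmod (W (s * a)))\<^sup>2 / 2 < (cmod (W (s * a)))\<^sup>2" using nz by simp
    ultimately have "\<forall>\<^sub>F x in at_left a. (cmod (W (s * a)))\<^sup>2 / 2 < Re (cnj (W (s * a)) * W (s * x))"
      by (rule order_tendstoD(1))
    then obtain y where y: "y < a" "\<And>x. y < x \<Longrightarrow> x < a \<Longrightarrow> (cmod (W (s * a)))\<^sup>2 / 2 < Re (cnj (W (s * a)) * W (s * x))"
      by (auto simp: eventually_at_left_field)
    show ?thesis
    proof (intro exI[of _ "max y 0"] conjI allI impI)
      fix x assume x: "max y 0 < x" "x < a"
      have sx: "s * x \<in> I" using s x by (auto simp: I_iff)
      have t: "\<tau> (s * x) = (a - x) * (a + x)" using s by (auto simp: tau_factor)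
      have "\<psi> (s * x) \<le> k * ((a - x) * (a + x))" using psi_bounds(2)[OF sx] by (simp add: t)
      also have "\<dots> \<le> k * ((a - x) * (2 * a))" using k_pos x by (intro mult_left_mono) auto
      finally have up: "(\<psi> (s * x))\<^sup>2 \<le> (k * (2 * a) * (a - x))\<^sup>2"
        using psi_pos[OF sx] by (intro power_mono) (auto simp: mult_ac)
      have "((cmod (W (s * a)))\<^sup>2 / (2 * (k * (2 * a))\<^sup>2)) / (a - x)\<^sup>2 = ((cmod (W (s * a)))\<^sup>2 / 2) / (k * (2 * a) * (a - x))\<^sup>2"
        by (simp add: power_mult_distrib)
      also have "\<dots> \<le> ((cmod (W (s * a)))\<^sup>2 / 2) / (\<psi> (s * x))\<^sup>2"
        using up psi_pos[OF sx] by (intro divide_left_mono) (auto intro!: mult_pos_pos zero_less_power simp: k_pos a_pos x)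
      also have "\<dots> \<le> Re (cnj (W (s * a)) * W (s * x)) / (\<psi> (s * x))\<^sup>2"
        using y(2)[of x] x psi_pos[OF sx] by (intro divide_right_mono) auto
      also have "\<dots> = Re (cnj (W (s * a)) * (W (s * x) / (of_real (\<psi> (s * x)))\<^sup>2))"
        by (simp flip: of_real_power)
      finally show "((cmod (W (s * a)))\<^sup>2 / (2 * (k * (2 * a))\<^sup>2)) / (a - x)\<^sup>2 \<le> \<dots>" .
    qed (use y a_pos in auto)
  qed
  have pos: "(cmod z)\<^sup>2 / (2 * (k * (2 * a))\<^sup>2) > 0" if "z \<noteq> 0" for z
    using that k_pos a_pos by simp
  show "W a = 0"
  proof (rule ccontr)
    assume nz: "W a \<noteq> 0"
    then obtain x1 where x1: "0 \<le> x1" "x1 < a" "\<And>x. x1 < x \<Longrightarrow> x < a \<Longrightarrow>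
      Re (cnj (W a) * (W x / (of_real (\<psi> x))\<^sup>2)) \<ge> ((cmod (W a))\<^sup>2 / (2 * (k * (2 * a))\<^sup>2)) / (a - x)\<^sup>2"
      using *[of 1] by auto
    have "\<not> integrable (lebesgue_on {x1<..<a}) (\<lambda>x. (a - x) * (cmod (v x))\<^sup>2)"
      by (rule blowup_not_integrable[OF x1(2) v x1(3) pos[OF nz]]) (use x1 in \<open>auto simp: I_iff\<close>)
    then show False using L2_restrict_right(1)[OF u(1) vm u(2) x1(1,2)] by blast
  qed
  show "W (- a) = 0"
  proof (rule ccontr)
    assume nz: "W (- a) \<noteq> 0"
    then obtain x1 where x1: "0 \<le> x1" "x1 < a" "\<And>x. x1 < x \<Longrightarrow> x < a \<Longrightarrow>
      Re (cnj (W (- a)) * (W (- x) / (of_real (\<psi> (- x)))\<^sup>2)) \<ge> ((cmod (W (- a)))\<^sup>2 / (2 * (k * (2 * a))\<^sup>2)) / (a - x)\<^sup>2"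
      using *[of "-1"] by auto
    have "\<not> integrable (lebesgue_on {x1<..<a}) (\<lambda>x. (a - x) * (cmod (v (- x)))\<^sup>2)"
    \<comment> \<open>The reflection \<open>x \<mapsto> - x\<close> changes the sign of the
      derivative, which the sign of \<open>l\<close> compensates.\<close>
    proof (rule blowup_not_integrable[OF x1(2) _ _ pos[OF nz], where l = "- cnj (W (- a))"])
      fix x assume x: "x1 < x" "x < a"
      then have "- x \<in> I" using x1 by (simp add: I_iff)
      moreover have "(uminus has_vector_derivative (- 1)) (at x)" for x :: real
        by (auto intro!: derivative_eq_intros simp: has_real_derivative_iff_has_vector_derivative[symmetric])
      ultimately show "((\<lambda>x. v (- x)) has_vector_derivative - (W (- x) / (of_real (\<psi> (- x)))\<^sup>2)) (at x)"
        using vector_diff_chain_at[of uminus "-1" x v] v[of "- x"] by (simp add: o_def)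
      show "(cmod (W (- a)))\<^sup>2 / (2 * (k * (2 * a))\<^sup>2) / (a - x)\<^sup>2
          \<le> Re (- cnj (W (- a)) * - (W (- x) / (of_real (\<psi> (- x)))\<^sup>2))" using x1(3)[OF x] by simp
    qed
    then show False using L2_restrict_right(2)[OF u(1) vm u(2) x1(1,2)] by blast
  qed
qed


section \<open>The adjoint of the minimal operator\<close>

definition flux_deriv :: "(real \<Rightarrow> complex) \<Rightarrow> real \<Rightarrow> complex" where
  "flux_deriv v = vderiv (\<lambda>x. (of_real (\<psi> x))\<^sup>2 * vderiv v x)"

definition T :: "real op" where "T = SL_friedrichs \<phi> I"

lemma psi_sq_smooth: "smooth_in I (\<lambda>x. (complex_of_real (\<psi> x))\<^sup>2)"
  unfolding power2_eq_square by (intro smooth_in_mult psi_smooth_I) simp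

lemma psi_vderiv_test: "v \<in> test_functions I \<Longrightarrow> (\<lambda>x. (of_real (\<psi> x))\<^sup>2 * vderiv v x) \<in> test_functions I"
  by (rule test_mult[OF test_vderiv psi_sq_smooth])

lemma flux_deriv_test: "v \<in> test_functions I \<Longrightarrow> flux_deriv v \<in> test_functions I"
  unfolding flux_deriv_def by (intro test_vderiv psi_vderiv_test)

lemma phi_test: "v \<in> test_functions I \<Longrightarrow> (\<lambda>x. of_real (\<phi> x) * v x) \<in> test_functions I"
  by (rule test_mult[OF _ phi_smooth])

lemma flux_deriv_phi_test: "v \<in> test_functions I \<Longrightarrow> (\<lambda>x. 1 / of_real (\<phi> x) * flux_deriv v x) \<in> test_functions I"
  by (rule test_mult[OF flux_deriv_test inverse_phi_smooth])

lemma test_off_I: "w \<in> test_functions I \<Longrightarrow> x \<notin> I \<Longrightarrow> w x = 0"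
  unfolding test_iff I_iff by force

lemma test_phi_factor:
  assumes "w \<in> test_functions I"
  obtains v where "v \<in> test_functions I" "w = (\<lambda>x. of_real (\<phi> x) * v x)"
proof
  show "(\<lambda>x. 1 / of_real (\<phi> x) * w x) \<in> test_functions I" by (rule test_mult[OF assms inverse_phi_smooth])
  show "w = (\<lambda>x. of_real (\<phi> x) * (1 / of_real (\<phi> x) * w x))"
  proof
    fix x show "w x = of_real (\<phi> x) * (1 / of_real (\<phi> x) * w x)"
      using test_off_I[OF assms, of x] phi_nonzero[of x] by (cases "x \<in> I") auto
  qed
qed

text \<open>In \<open>(\<psi> v)'' + 2 \<psi> v\<close> the equation for \<psi>'' cancels the terms
  \<open>2 \<psi> v\<close> and leaves \<open>2 c v\<close>; the remaining
  \<open>\<psi> v'' + 2 \<psi>' v'\<close> is \<open>(\<psi>\<^sup>2 v')'\<close> divided by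
  \<open>\<psi>\<close>.\<close>

lemma SL_expr_phi:
  assumes v: "v \<in> test_functions I" and x: "x \<in> I"
  shows "SL_expr \<phi> (\<lambda>x. of_real (\<phi> x) * v x) x = - 2 * of_real c * (of_real (\<phi> x) * v x) - 1 / of_real (\<phi> x) * flux_deriv v x"
proof -
  note v1 = test_hvd[OF v] and v2 = test_hvd[OF test_vderiv[OF v]]
  let ?w = "\<lambda>y. of_real (\<phi> y) * (of_real (\<phi> y) * v y)"
  have eq: "?w y = of_real (\<psi> y) * v y" if "y \<in> I" for y using cphi_sq[OF that] .
  have d1: "(?w has_vector_derivative of_real (\<psi> y) * vderiv v y + of_real (\<psi>' y) * v y) (at y)" if y: "y \<in> I" for y
    by (rule has_vector_derivative_transform_within_open[OF has_vector_derivative_mult[OF psi_hvd v1] I_open y])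
      (simp add: eq)
  have "(vderiv ?w has_vector_derivative
      (of_real (\<psi> x) * vderiv (vderiv v) x + of_real (\<psi>' x) * vderiv v x) +
      (of_real (\<psi>' x) * vderiv v x + (2 * of_real c + (- 2) * of_real (\<psi> x)) * v x)) (at x)"
    by (rule has_vector_derivative_transform_within_open[OF has_vector_derivative_add[OF
          has_vector_derivative_mult[OF psi_hvd v2] has_vector_derivative_mult[OF psi'_hvd v1]] I_open x])
      (simp add: vderiv_eq[OF d1])
  then have d2: "vderiv (vderiv ?w) x = of_real (\<psi> x) * vderiv (vderiv v) x + 2 * of_real (\<psi>' x) * vderiv v x
     + 2 * of_real c * v x - 2 * (of_real (\<psi> x) * v x)"
    by (simp add: vderiv_eq algebra_simps)
  have "((\<lambda>x. (of_real (\<psi> x))\<^sup>2 * vderiv v x) has_vector_derivative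
     (of_real (\<psi> x))\<^sup>2 * vderiv (vderiv v) x + (of_real (\<psi> x) * of_real (\<psi>' x) + of_real (\<psi>' x) * of_real (\<psi> x)) * vderiv v x) (at x)"
    unfolding power2_eq_square by (intro has_vector_derivative_mult psi_hvd v2)
  then have r: "flux_deriv v x = of_real (\<psi> x) * (of_real (\<psi> x) * vderiv (vderiv v) x + 2 * of_real (\<psi>' x) * vderiv v x)"
    by (simp add: flux_deriv_def vderiv_eq algebra_simps power2_eq_square)
  have ph: "complex_of_real (\<psi> x) = of_real (\<phi> x) * of_real (\<phi> x)" using phi_sq[OF x] by (metis of_real_mult)
  have "1 / of_real (\<phi> x) * flux_deriv v x = of_real (\<phi> x) * (of_real (\<psi> x) * vderiv (vderiv v) x + 2 * of_real (\<psi>' x) * vderiv v x)"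
    unfolding r using phi_nonzero[OF x] by (subst ph) simp
  then show ?thesis
    unfolding SL_expr_def d2 eq[OF x] by (simp add: algebra_simps)
qed

text \<open>\<open>\<phi>\<close> is smooth without zeros in \<open>I\<close>, so the test functions
  are exactly the products \<open>\<phi> v\<close> with a test function \<open>v\<close>, and the
  weak equation can be tested with these.\<close>

lemma adjoint_iff:
  "(u, f) \<in> adjoint_op M (SL_minimal \<phi> I) \<longleftrightarrow> u \<in> L2 M \<and> f \<in> L2 M \<and>
    (\<forall>v\<in>test_functions I. L2_inner M (\<lambda>x. 1 / of_real (\<phi> x) * flux_deriv v x) u
        = - L2_inner M (\<lambda>x. of_real (\<phi> x) * v x) (\<lambda>x. f x + 2 * of_real c * u x))"
proof -
  have "L2_inner M (SL_expr \<phi> (\<lambda>x. of_real (\<phi> x) * v x)) u = L2_inner M (\<lambda>x. of_real (\<phi> x) * v x) f \<longleftrightarrow>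
    L2_inner M (\<lambda>x. 1 / of_real (\<phi> x) * flux_deriv v x) u
        = - L2_inner M (\<lambda>x. of_real (\<phi> x) * v x) (\<lambda>x. f x + 2 * of_real c * u x)"
    if u: "u \<in> L2 M" and f: "f \<in> L2 M" and v: "v \<in> test_functions I" for v
  proof -
    note pL = test_L2[OF phi_test[OF v]] and rL = test_L2[OF flux_deriv_phi_test[OF v]]
    have "L2_inner M (SL_expr \<phi> (\<lambda>x. of_real (\<phi> x) * v x)) u
       = L2_inner M (\<lambda>x. - 2 * of_real c * (of_real (\<phi> x) * v x) - 1 / of_real (\<phi> x) * flux_deriv v x) u"
      unfolding L2_inner_def
      by (rule Bochner_Integration.integral_cong) (simp_all only: space_lebesgue_on SL_expr_phi[OF v])
    also have "\<dots> = - 2 * of_real c * L2_inner M (\<lambda>x. of_real (\<phi> x) * v x) u - L2_inner M (\<lambda>x. 1 / of_real (\<phi> x) * flux_deriv v x) u"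
      unfolding L2_inner_diff_left[OF L2_cmult[OF pL] rL u] L2_inner_cmult_left ..
    finally have 1: "L2_inner M (SL_expr \<phi> (\<lambda>x. of_real (\<phi> x) * v x)) u = \<dots>" .
    have "L2_inner M (\<lambda>x. of_real (\<phi> x) * v x) (\<lambda>x. f x - (- 2 * of_real c) * u x)
      = L2_inner M (\<lambda>x. of_real (\<phi> x) * v x) f - cnj (- 2 * of_real c) * L2_inner M (\<lambda>x. of_real (\<phi> x) * v x) u"
      unfolding L2_inner_diff_right[OF f L2_cmult[OF u] pL] L2_inner_cmult_right ..
    then have 2: "L2_inner M (\<lambda>x. of_real (\<phi> x) * v x) (\<lambda>x. f x + 2 * of_real c * u x)
      = L2_inner M (\<lambda>x. of_real (\<phi> x) * v x) f + 2 * of_real c * L2_inner M (\<lambda>x. of_real (\<phi> x) * v x) u"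
      by simp
    have "- 2 * z * X - Y = A \<longleftrightarrow> Y = - (A + 2 * z * X)" for z X Y A :: complex
    proof
      assume "- 2 * z * X - Y = A"
      then have "A = - 2 * z * X - Y" by simp
      then show "Y = - (A + 2 * z * X)" by simp
    qed simp
    then show ?thesis unfolding 1 2 .
  qed
  moreover have "(\<forall>(w, g)\<in>SL_minimal \<phi> I. L2_inner M g u = L2_inner M w f) \<longleftrightarrow>
    (\<forall>v\<in>test_functions I. L2_inner M (SL_expr \<phi> (\<lambda>x. of_real (\<phi> x) * v x)) u = L2_inner M (\<lambda>x. of_real (\<phi> x) * v x) f)"
  proof
    assume "\<forall>(w, g)\<in>SL_minimal \<phi> I. L2_inner M g u = L2_inner M w f"
    then show "\<forall>v\<in>test_functions I. L2_inner M (SL_expr \<phi> (\<lambda>x. of_real (\<phi> x) * v x)) u = L2_inner M (\<lambda>x. of_real (\<phi> x) * v x) f"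
      using phi_test by (auto simp: SL_minimal_def)
  next
    assume "\<forall>v\<in>test_functions I. L2_inner M (SL_expr \<phi> (\<lambda>x. of_real (\<phi> x) * v x)) u = L2_inner M (\<lambda>x. of_real (\<phi> x) * v x) f"
    then show "\<forall>(w, g)\<in>SL_minimal \<phi> I. L2_inner M g u = L2_inner M w f"
      by (auto simp: SL_minimal_def elim: test_phi_factor)
  qed
  ultimately show ?thesis unfolding adjoint_op_def by auto
qed

text \<open>\<open>F\<close> vanishes at the left endpoint by construction; the condition at
  \<open>a\<close> therefore says that the flux \<open>\<psi>\<^sup>2 v'\<close> vanishes at both
  endpoints, where \<open>v\<close> is the factor multiplying \<open>\<phi>\<close>.\<close>

definition canonical :: "(real \<Rightarrow> complex) \<Rightarrow> (real \<Rightarrow> complex) \<Rightarrow> bool" where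
  "canonical u f \<longleftrightarrow> u \<in> L2 M \<and> f \<in> L2 M \<and> F (\<lambda>x. f x + 2 * of_real c * u x) a = 0 \<and>
     (\<exists>\<alpha>. AE x in M. u x = of_real (\<phi> x) * (\<alpha> - J (\<lambda>x. f x + 2 * of_real c * u x) x))"

text \<open>The du Bois-Reymond lemma: after subtraction of a multiple of a fixed bump, a test
  function has mean zero and is the derivative of a test function, so the functional depends on the
  mean alone.\<close>

lemma functional_vanishing_on_derivatives:
  assumes add: "\<And>p q. p \<in> test_functions I \<Longrightarrow> q \<in> test_functions I \<Longrightarrow> \<Lambda> (\<lambda>x. p x - q x) = \<Lambda> p - \<Lambda> q"
    and cm: "\<And>p z. p \<in> test_functions I \<Longrightarrow> \<Lambda> (\<lambda>x. z * p x) = (z :: complex) * \<Lambda> p"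
    and v: "\<And>v. v \<in> test_functions I \<Longrightarrow> \<Lambda> (vderiv v) = 0"
  shows "\<exists>\<beta>. \<forall>p\<in>test_functions I. \<Lambda> p = \<beta> * (LINT x|M. p x)"
proof -
  define b where "b = bump 1 (-a/2) (a/2)"
  have b: "b \<in> test_functions I" unfolding b_def using a_pos by (intro bump_test) auto
  have ti: "integrable M p" if "p \<in> test_functions I" for p
    using that compact_support_integral(1)[of p] continuous_on_subset[OF test_continuous[OF that]] unfolding test_iff
    by (metis subset_UNIV)
  have b0: "(LINT x|M. b x) \<noteq> 0"
  proof
    assume z: "(LINT x|M. b x) = 0"
    have "(LINT x|M. b x) = of_real (LINT x|M. Re (b x))"
      by (subst integral_complex_of_real[symmetric]) (simp add: b_def bump_real(1)[symmetric])
    then have z: "(LINT x|M. Re (b x)) = 0" using z by simp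
    have "AE x in M. Re (b x) = 0"
      by (subst integral_nonneg_eq_0_iff_AE[OF integrable_Re[OF ti[OF b]], symmetric])
        (use z bump_real(2) in \<open>auto simp: b_def\<close>)
    then have "AE x in lebesgue. x \<in> I \<longrightarrow> Re (b x) = 0" by (simp add: AE_restrict_space_iff)
    then have "AE x in lebesgue. x \<notin> {-a/2<..<a/2}"
    proof eventually_elim
      case (elim x)
      then show ?case using bump_pos[of 1 "-a/2" x "a/2"] by (auto simp: b_def I_def)
    qed
    then have "{-a/2<..<a/2} \<in> null_sets lebesgue" by (subst (asm) AE_iff_null_sets[symmetric]) auto
    then show False using interval_not_null[of "-a/2" "a/2"] a_pos by simp
  qed
  have "\<Lambda> p = \<Lambda> b / (LINT x|M. b x) * (LINT x|M. p x)" if p: "p \<in> test_functions I" for p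
  proof -
    define z where "z = (LINT x|M. p x) / (LINT x|M. b x)"
    have q: "(\<lambda>x. p x - z * b x) \<in> test_functions I" by (intro test_diff test_cmult p b)
    have "(LINT x|M. p x - z * b x) = 0" using b0 ti[OF p] ti[OF b] by (simp add: z_def)
    from test_primitive[OF q this] obtain v where v': "v \<in> test_functions I"
      "\<And>x. (v has_vector_derivative p x - z * b x) (at x)" by blast
    then have "vderiv v = (\<lambda>x. p x - z * b x)" by (intro ext vderiv_eq)
    then have "\<Lambda> p - z * \<Lambda> b = 0" using v[OF v'(1)] add[OF p test_cmult[OF b]] cm[OF b] by simp
    then show ?thesis by (simp add: z_def)
  qed
  then show ?thesis by blast
qed

lemma test_integrable: "p \<in> test_functions I \<Longrightarrow> integrable M p"
proof -
  assume p: "p \<in> test_functions I"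
  then obtain b where b: "0 < b" "b < a" "\<And>x. b \<le> \<bar>x\<bar> \<Longrightarrow> p x = 0" unfolding test_iff by blast
  show ?thesis by (rule compact_support_integral(1)[OF continuous_on_subset[OF test_continuous[OF p]] b(1,2)]) (use b in auto)
qed

text \<open>Two applications of the du Bois-Reymond lemma show that an element of the domain of the
  adjoint is a classical solution, and the boundary values of \<open>\<psi>\<^sup>2 v'\<close> vanish by square
  integrability.\<close>

lemma adjoint_imp_canonical:
  assumes "(u, f) \<in> adjoint_op M (SL_minimal \<phi> I)"
  shows "canonical u f"
proof -
  define g where "g x = f x + 2 * of_real c * u x" for x
  have u: "u \<in> L2 M" and f: "f \<in> L2 M" and
    weak: "\<And>v. v \<in> test_functions I \<Longrightarrow> L2_inner M (\<lambda>x. 1 / of_real (\<phi> x) * flux_deriv v x) u = - L2_inner M (\<lambda>x. of_real (\<phi> x) * v x) g"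
    using assms unfolding adjoint_iff g_def by auto
  have g: "g \<in> L2 M" unfolding g_def by (intro L2_add L2_cmult f u)
  define U where "U x = cnj (u x)" for x
  define G where "G = F (\<lambda>x. cnj (g x))"
  have U: "U \<in> L2 M" unfolding U_def by (rule L2_cnj[OF u])
  note g' = L2_cnj[OF g]
  have GL: "G \<in> L2 M"
    unfolding G_def by (rule L2_bounded[OF finite_M continuous_M[OF F_continuous[OF g']] F_le[OF g']]) (auto simp: I_iff)
  \<comment> \<open>The weak equation, tested with \<open>v\<close>, is rewritten as a functional of
    \<open>p = v'\<close>: one derivative is removed from the right side through
    \<open>F_weak_derivative\<close>, so \<open>\<Lambda>\<close> vanishes on derivatives.\<close>
  define \<Lambda> where "\<Lambda> p = (LINT x|M. 1 / of_real (\<phi> x) * vderiv (\<lambda>x. (of_real (\<psi> x))\<^sup>2 * p x) x * U x) - (LINT x|M. G x * p x)" for p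
  have t1: "(\<lambda>x. (of_real (\<psi> x))\<^sup>2 * p x) \<in> test_functions I" if "p \<in> test_functions I" for p
    by (rule test_mult[OF that psi_sq_smooth])
  have t2: "(\<lambda>x. 1 / of_real (\<phi> x) * vderiv (\<lambda>x. (of_real (\<psi> x))\<^sup>2 * p x) x) \<in> test_functions I" if "p \<in> test_functions I" for p
    by (rule test_mult[OF test_vderiv[OF t1[OF that]] inverse_phi_smooth])
  note i1 = L2_integrable_mult[OF test_L2[OF t2] U] and i2 = L2_integrable_mult[OF GL test_L2]
  have "\<exists>\<beta>. \<forall>p\<in>test_functions I. \<Lambda> p = \<beta> * (LINT x|M. p x)"
  proof (rule functional_vanishing_on_derivatives)
    fix p q assume p: "p \<in> test_functions I" and q: "q \<in> test_functions I"
    have "vderiv (\<lambda>x. (of_real (\<psi> x))\<^sup>2 * (p x - q x)) x = vderiv (\<lambda>x. (of_real (\<psi> x))\<^sup>2 * p x) x - vderiv (\<lambda>x. (of_real (\<psi> x))\<^sup>2 * q x) x" for x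
      using has_vector_derivative_diff[OF test_hvd[OF t1[OF p]] test_hvd[OF t1[OF q]], of x]
      by (intro vderiv_eq) (simp add: right_diff_distrib)
    note vd = this
    have "(LINT x|M. 1 / of_real (\<phi> x) * vderiv (\<lambda>x. (of_real (\<psi> x))\<^sup>2 * (p x - q x)) x * U x)
      = (LINT x|M. 1 / of_real (\<phi> x) * vderiv (\<lambda>x. (of_real (\<psi> x))\<^sup>2 * p x) x * U x - 1 / of_real (\<phi> x) * vderiv (\<lambda>x. (of_real (\<psi> x))\<^sup>2 * q x) x * U x)"
      unfolding vd by (simp only: right_diff_distrib left_diff_distrib)
    then show "\<Lambda> (\<lambda>x. p x - q x) = \<Lambda> p - \<Lambda> q"
      unfolding \<Lambda>_def using Bochner_Integration.integral_diff[OF i1[OF p] i1[OF q]] Bochner_Integration.integral_diff[OF i2[OF p] i2[OF q]]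
      by (simp add: right_diff_distrib)
  next
    fix p z assume p: "p \<in> test_functions I"
    have "vderiv (\<lambda>x. (of_real (\<psi> x))\<^sup>2 * (z * p x)) x = z * vderiv (\<lambda>x. (of_real (\<psi> x))\<^sup>2 * p x) x" for x
      using has_vector_derivative_mult_right[OF test_hvd[OF t1[OF p]], of z x]
      by (intro vderiv_eq) (simp add: mult.left_commute)
    then have "(LINT x|M. 1 / of_real (\<phi> x) * vderiv (\<lambda>x. (of_real (\<psi> x))\<^sup>2 * (z * p x)) x * U x)
      = (LINT x|M. z * (1 / of_real (\<phi> x) * vderiv (\<lambda>x. (of_real (\<psi> x))\<^sup>2 * p x) x * U x))"
      by (simp add: mult_ac)
    moreover have "(LINT x|M. G x * (z * p x)) = (LINT x|M. z * (G x * p x))" by (simp add: mult_ac)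
    ultimately show "\<Lambda> (\<lambda>x. z * p x) = z * \<Lambda> p"
      unfolding \<Lambda>_def by (simp only: integral_mult_right_zero right_diff_distrib)
  next
    fix v assume v: "v \<in> test_functions I"
    have "(LINT x|M. of_real (\<phi> x) * cnj (g x) * v x) = - (LINT x|M. G x * vderiv v x)"
      unfolding G_def by (rule F_weak_derivative[OF g' v])
    then show "\<Lambda> (vderiv v) = 0"
      using weak[OF v] unfolding \<Lambda>_def flux_deriv_def[symmetric] L2_inner_def U_def by (simp add: mult_ac)
  qed
  then obtain \<beta> where \<beta>: "\<And>p. p \<in> test_functions I \<Longrightarrow> \<Lambda> p = \<beta> * (LINT x|M. p x)" by blast
  define q where "q x = (G x + \<beta>) / (of_real (\<psi> x))\<^sup>2" for x
  have Gc: "continuous_on S G" for S unfolding G_def by (rule F_continuous[OF g'])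
  have qc: "continuous_on I q" unfolding q_def by (rule quotient_continuous) (intro continuous_intros Gc)
  \<comment> \<open>With the constant \<beta> from the first application, \<open>Y\<close> has weak
    derivative 0; the second application makes it a constant \<alpha>, that is,
    \<open>U = \<phi> (\<alpha> - prim q)\<close>.\<close>
  define Y where "Y x = 1 / of_real (\<phi> x) * U x + prim q x" for x
  have pqc: "continuous_on I (prim q)"
    using prim(2)[OF qc] has_vector_derivative_continuous continuous_at_imp_continuous_on by blast
  have iU: "integrable M (\<lambda>x. p x * (1 / of_real (\<phi> x) * U x))" if p: "p \<in> test_functions I" for p
    using L2_integrable_mult[OF test_L2[OF test_mult[OF p inverse_phi_smooth]] U] by (simp add: mult_ac)
  have iJ: "integrable M (\<lambda>x. p x * prim q x)" if p: "p \<in> test_functions I" for p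
  proof -
    obtain b where b: "0 < b" "b < a" "\<And>x. b \<le> \<bar>x\<bar> \<Longrightarrow> p x = 0" using p unfolding test_iff by blast
    show ?thesis
      by (rule compact_support_integral(1)[OF _ b(1,2)])
        (use b in \<open>auto intro!: continuous_intros pqc continuous_on_subset[OF test_continuous[OF p]]\<close>)
  qed
  have iY: "integrable M (\<lambda>x. p x * Y x)" if p: "p \<in> test_functions I" for p
    using Bochner_Integration.integrable_add[OF iU[OF p] iJ[OF p]] by (simp add: Y_def distrib_left)
  have Yr: "(LINT x|M. vderiv r x * Y x) = 0" if r: "r \<in> test_functions I" for r
  proof -
    obtain b where b: "0 < b" "b < a" "\<And>x. b \<le> \<bar>x\<bar> \<Longrightarrow> r x = 0" using r unfolding test_iff by blast
    \<comment> \<open>Dividing by \<open>\<psi>\<^sup>2\<close> prescribes the flux: the function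
      differentiated in \<open>\<Lambda> p\<close> becomes the given test function
      \<open>r\<close>.\<close>
    define p where "p x = 1 / of_real (\<psi> x) * (1 / of_real (\<psi> x) * r x)" for x
    have p: "p \<in> test_functions I" unfolding p_def by (intro test_mult r inverse_psi_smooth)
    have rp: "(\<lambda>x. (of_real (\<psi> x))\<^sup>2 * p x) = r"
    proof
      fix x show "(of_real (\<psi> x))\<^sup>2 * p x = r x"
        using test_off_I[OF r, of x] psi_nonzero[of x] by (cases "x \<in> I") (auto simp: p_def power2_eq_square)
    qed
    have "(LINT x|M. 1 / of_real (\<phi> x) * vderiv r x * U x) = (LINT x|M. G x * p x) + \<beta> * (LINT x|M. p x)"
    proof -
      have "(LINT x|M. 1 / of_real (\<phi> x) * vderiv r x * U x) - (LINT x|M. G x * p x) = \<beta> * (LINT x|M. p x)"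
        using \<beta>[OF p] unfolding \<Lambda>_def rp .
      then show ?thesis by (simp add: diff_eq_eq add.commute)
    qed
    also have "\<dots> = (LINT x|M. q x * r x)"
    proof -
      have "(LINT x|M. G x * p x) + \<beta> * (LINT x|M. p x) = (LINT x|M. G x * p x + \<beta> * p x)"
        using i2[OF p] test_integrable[OF p] by simp
      also have "\<dots> = (LINT x|M. q x * r x)"
        by (rule Bochner_Integration.integral_cong) (auto simp: q_def p_def power2_eq_square field_simps dest: psi_nonzero)
      finally show ?thesis .
    qed
    also have "\<dots> = - (LINT x|M. prim q x * vderiv r x)"
      by (rule integral_by_parts_compact_support[OF prim(2)[OF qc] qc test_hvd[OF r] _ b(1,2) b(3)])
        (use continuous_on_subset[OF test_continuous[OF test_vderiv[OF r]]] in auto)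
    finally have "(LINT x|M. vderiv r x * (1 / of_real (\<phi> x) * U x)) + (LINT x|M. vderiv r x * prim q x) = 0"
      by (simp add: mult_ac)
    then show ?thesis using iU[OF test_vderiv[OF r]] iJ[OF test_vderiv[OF r]] by (simp add: Y_def distrib_left)
  qed
  have "\<exists>\<alpha>. \<forall>p\<in>test_functions I. (LINT x|M. p x * Y x) = \<alpha> * (LINT x|M. p x)"
  proof (rule functional_vanishing_on_derivatives)
    show "(LINT x|M. (p x - q x) * Y x) = (LINT x|M. p x * Y x) - (LINT x|M. q x * Y x)"
      if "p \<in> test_functions I" "q \<in> test_functions I" for p q
      using iY that by (simp add: left_diff_distrib)
    show "(LINT x|M. z * p x * Y x) = z * (LINT x|M. p x * Y x)" for z p
      by (simp add: mult.assoc)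
  qed (rule Yr)
  then obtain \<alpha> where \<alpha>: "\<And>p. p \<in> test_functions I \<Longrightarrow> (LINT x|M. p x * Y x) = \<alpha> * (LINT x|M. p x)" by blast
  \<comment> \<open>\<open>Y - \<alpha>\<close> is weighted with \<open>\<psi>\<^sup>2\<close>
    because both \<open>U / \<phi>\<close> and \<open>prim q\<close> may be too singular at the
    endpoints; the weighted function is square integrable and orthogonal to all test
    functions.\<close>
  define Z where "Z x = of_real (\<phi> x) * of_real (\<psi> x) * U x + (of_real (\<psi> x))\<^sup>2 * (prim q x - \<alpha>)" for x
  have ZY: "Z x = (of_real (\<psi> x))\<^sup>2 * (Y x - \<alpha>)" if x: "x \<in> I" for x
  proof -
    have ph: "complex_of_real (\<psi> x) = of_real (\<phi> x) * of_real (\<phi> x)" using phi_sq[OF x] by (metis of_real_mult)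
    have "(of_real (\<psi> x))\<^sup>2 * (1 / of_real (\<phi> x) * U x) = of_real (\<phi> x) * of_real (\<psi> x) * U x"
      unfolding power2_eq_square using phi_nonzero[OF x] by (subst ph) simp
    then show ?thesis by (simp add: Z_def Y_def algebra_simps)
  qed
  have ZL: "Z \<in> L2 M"
  proof -
    have 1: "(\<lambda>x. of_real (\<phi> x) * of_real (\<psi> x) * U x) \<in> L2 M"
    proof (rule L2_bounded_mult[OF U, where B = "sqrt (k * a\<^sup>2) * (k * a\<^sup>2)"])
      show "(\<lambda>x. complex_of_real (\<phi> x) * of_real (\<psi> x)) \<in> borel_measurable M"
        by (intro continuous_M continuous_intros phi_continuous psi_continuous)
      fix x assume "x \<in> space M"
      then have x: "x \<in> I" by simp
      have "\<phi> x \<le> sqrt (k * a\<^sup>2)" using psi_le[OF x] by (simp add: \<phi>_def)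
      then show "cmod (of_real (\<phi> x) * of_real (\<psi> x)) \<le> sqrt (k * a\<^sup>2) * (k * a\<^sup>2)"
        using phi_pos[OF x] psi_pos[OF x] psi_le[OF x] k_pos unfolding norm_mult
        by (intro mult_mono) auto
    qed
    define D where "D = (CF * L2_norm M (\<lambda>x. cnj (g x)) + cmod \<beta>) / m\<^sup>2"
    have D: "D \<ge> 0" unfolding D_def using CF_nonneg by (intro divide_nonneg_nonneg add_nonneg_nonneg mult_nonneg_nonneg L2_norm_nonneg) auto
    have pb: "cmod (prim q x) \<le> D / (a * \<tau> x)" if x: "x \<in> I" for x
    proof (rule prim_bound_inverse_tau_sq[OF prim(2)[OF qc] prim(1)[OF qc] _ x D])
      fix y assume y: "y \<in> I"
      have "(m * \<tau> y)\<^sup>2 \<le> (\<psi> y)\<^sup>2" using psi_bounds(1)[OF y] m_pos tau_pos[OF y] by (intro power_mono) auto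
      moreover have "cmod (G y + \<beta>) \<le> CF * L2_norm M (\<lambda>x. cnj (g x)) + cmod \<beta>"
        using norm_triangle_ineq[of "G y" \<beta>] F_le[OF g', of y] y by (simp add: G_def I_iff)
      moreover have "0 < (m * \<tau> y)\<^sup>2" using m_pos tau_pos[OF y] by simp
      ultimately have "cmod (G y + \<beta>) / (\<psi> y)\<^sup>2 \<le> (CF * L2_norm M (\<lambda>x. cnj (g x)) + cmod \<beta>) / (m * \<tau> y)\<^sup>2"
        by (intro frac_le) (auto intro: order_trans[OF norm_ge_zero])
      then show "cmod (q y) \<le> D / (\<tau> y)\<^sup>2"
        by (simp add: q_def norm_divide norm_power D_def power_mult_distrib)
    qed
    have 2: "(\<lambda>x. (of_real (\<psi> x))\<^sup>2 * (prim q x - \<alpha>)) \<in> L2 M"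
    proof (rule L2_bounded[OF finite_M, where B = "k * a\<^sup>2 * (k * D / a) + (k * a\<^sup>2)\<^sup>2 * cmod \<alpha>"])
      show "(\<lambda>x. (complex_of_real (\<psi> x))\<^sup>2 * (prim q x - \<alpha>)) \<in> borel_measurable M"
        by (intro continuous_M continuous_intros psi_continuous pqc)
      fix x assume "x \<in> space M"
      then have x: "x \<in> I" by simp
      have "\<psi> x * cmod (prim q x) \<le> (k * \<tau> x) * (D / (a * \<tau> x))"
        using psi_bounds(2)[OF x] pb[OF x] psi_pos[OF x] k_pos tau_pos[OF x] by (intro mult_mono) auto
      also have "\<dots> = k * D / a" using tau_pos[OF x] by simp
      finally have "\<psi> x * (\<psi> x * cmod (prim q x)) \<le> (k * a\<^sup>2) * (k * D / a)"
        using psi_le[OF x] psi_pos[OF x] k_pos by (intro mult_mono) auto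
      moreover have "(\<psi> x)\<^sup>2 * cmod \<alpha> \<le> (k * a\<^sup>2)\<^sup>2 * cmod \<alpha>"
        using psi_le[OF x] psi_pos[OF x] by (intro mult_right_mono power_mono) auto
      moreover have "cmod ((of_real (\<psi> x))\<^sup>2 * (prim q x - \<alpha>)) \<le> (\<psi> x)\<^sup>2 * (cmod (prim q x) + cmod \<alpha>)"
        unfolding norm_mult norm_power by (intro mult_mono norm_triangle_ineq4) auto
      ultimately show "cmod ((of_real (\<psi> x))\<^sup>2 * (prim q x - \<alpha>)) \<le> k * a\<^sup>2 * (k * D / a) + (k * a\<^sup>2)\<^sup>2 * cmod \<alpha>"
        by (simp add: power2_eq_square algebra_simps)
    qed
    show ?thesis unfolding Z_def[abs_def] by (rule L2_add[OF 1 2])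
  qed
  have "AE x in M. Z x = 0"
  proof (rule L2_orthogonal_test_functions[OF ZL])
    fix h assume h: "h \<in> test_functions I"
    have h': "(\<lambda>x. (of_real (\<psi> x))\<^sup>2 * h x) \<in> test_functions I" by (rule t1[OF h])
    have "(LINT x|M. h x * Z x) = (LINT x|M. (of_real (\<psi> x))\<^sup>2 * h x * Y x - (of_real (\<psi> x))\<^sup>2 * h x * \<alpha>)"
      by (rule Bochner_Integration.integral_cong) (auto simp: ZY algebra_simps)
    also have "\<dots> = 0" using \<alpha>[OF h'] iY[OF h'] test_integrable[OF h'] by simp
    finally show "(LINT x|M. h x * Z x) = 0" .
  qed
  then have uv: "AE x in M. u x = of_real (\<phi> x) * (cnj \<alpha> - cnj (prim q x))"
    using AE_space
  proof eventually_elim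
    case (elim x)
    then have x: "x \<in> I" by simp
    have "Y x = \<alpha>" using elim ZY[OF x] psi_nonzero[OF x] by simp
    then have "U x = of_real (\<phi> x) * (\<alpha> - prim q x)" using phi_nonzero[OF x] by (auto simp: Y_def field_simps)
    then have "cnj (U x) = of_real (\<phi> x) * (cnj \<alpha> - cnj (prim q x))" by simp
    then show ?case by (simp add: U_def)
  qed
  define W where "W x = - (F g x + cnj \<beta>)" for x
  have vd: "((\<lambda>x. cnj \<alpha> - cnj (prim q x)) has_vector_derivative W x / (of_real (\<psi> x))\<^sup>2) (at x)" if x: "x \<in> I" for x
  proof -
    have "((\<lambda>x. cnj \<alpha> - cnj (prim q x)) has_vector_derivative 0 - cnj (q x)) (at x)"
      by (intro has_vector_derivative_diff has_vector_derivative_const bounded_linear.has_vector_derivative[OF bounded_linear_cnj] prim(2)[OF qc x])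
    moreover have "0 - cnj (q x) = W x / (of_real (\<psi> x))\<^sup>2" by (simp add: q_def W_def G_def F_cnj diff_divide_distrib add_divide_distrib)
    ultimately show ?thesis by simp
  qed
  have Wc: "continuous_on UNIV W" unfolding W_def[abs_def] by (intro continuous_intros F_continuous[OF g])
  \<comment> \<open>At the left endpoint \<open>F g\<close> vanishes, so the boundary value there is
    \<beta> up to sign and conjugation; with \<open>\<beta> = 0\<close> the right boundary value
    becomes \<open>F g a\<close>.\<close>
  note bv = boundary_value_zero[OF u uv vd Wc]
  then have b0: "\<beta> = 0" using F_left[of "-a" g] bv(2) by (simp add: W_def)
  then have Fg: "F g a = 0" using bv(1) by (simp add: W_def)
  have cJ: "cnj \<alpha> - cnj (prim q x) = cnj \<alpha> - J g x" if x: "x \<in> I" for x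
  proof -
    have "((\<lambda>x. cnj (prim q x)) has_vector_derivative F g y / (of_real (\<psi> y))\<^sup>2) (at y)" if "y \<in> I" for y
      using bounded_linear.has_vector_derivative[OF bounded_linear_cnj prim(2)[OF qc that]]
      by (simp add: q_def b0 G_def F_cnj)
    from prim_unique[OF F_quotient_continuous[OF g] _ this x]
    show ?thesis by (simp add: prim(1)[OF qc] J_def)
  qed
  have "AE x in M. u x = of_real (\<phi> x) * (cnj \<alpha> - J g x)"
    using uv AE_space by eventually_elim (simp add: cJ)
  then show ?thesis unfolding canonical_def g_def[abs_def, symmetric] using u f Fg by blast
qed

text \<open>Two integrations by parts against the compactly supported \<open>v\<close>: the first
  moves the derivative from the flux of \<open>v\<close> to the factor of \<open>u\<close>, the
  second is \<open>F_weak_derivative\<close>.\<close>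

lemma canonical_imp_adjoint:
  assumes "canonical u f"
  shows "(u, f) \<in> adjoint_op M (SL_minimal \<phi> I)"
proof -
  define g where "g x = f x + 2 * of_real c * u x" for x
  obtain \<alpha> where u: "u \<in> L2 M" and f: "f \<in> L2 M" and Fg: "F g a = 0"
    and uv: "AE x in M. u x = of_real (\<phi> x) * (\<alpha> - J g x)"
    using assms unfolding canonical_def g_def[abs_def, symmetric] by blast
  have g: "g \<in> L2 M" unfolding g_def by (intro L2_add L2_cmult f u)
  note g' = L2_cnj[OF g]
  define y where "y x = cnj (\<alpha> - J g x)" for x
  have yd: "(y has_vector_derivative - (F (\<lambda>x. cnj (g x)) x / (of_real (\<psi> x))\<^sup>2)) (at x)" if x: "x \<in> I" for x
  proof -
    have "((\<lambda>x. cnj (\<alpha> - J g x)) has_vector_derivative cnj (0 - F g x / (of_real (\<psi> x))\<^sup>2)) (at x)"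
      by (intro has_vector_derivative_diff has_vector_derivative_const bounded_linear.has_vector_derivative[OF bounded_linear_cnj] J_hvd g x)
    then show ?thesis by (simp add: y_def[abs_def] F_cnj)
  qed
  have yc: "continuous_on I (\<lambda>x. - (F (\<lambda>x. cnj (g x)) x / (complex_of_real (\<psi> x))\<^sup>2))"
    by (intro continuous_intros F_quotient_continuous g')
  have "L2_inner M (\<lambda>x. 1 / of_real (\<phi> x) * flux_deriv v x) u = - L2_inner M (\<lambda>x. of_real (\<phi> x) * v x) g"
    if v: "v \<in> test_functions I" for v
  proof -
    define r where "r x = (of_real (\<psi> x))\<^sup>2 * vderiv v x" for x
    have r: "r \<in> test_functions I" unfolding r_def by (rule psi_vderiv_test[OF v])
    obtain b where b: "0 < b" "b < a" "\<And>x. b \<le> \<bar>x\<bar> \<Longrightarrow> r x = 0" using r unfolding test_iff by blast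
    have rrr: "flux_deriv v = vderiv r" by (simp add: flux_deriv_def r_def[abs_def])
    have m1: "(\<lambda>x. 1 / of_real (\<phi> x) * flux_deriv v x * cnj (u x)) \<in> borel_measurable M"
      by (rule borel_measurable_integrable[OF L2_integrable_inner[OF test_L2[OF flux_deriv_phi_test[OF v]] u]])
    have yM: "y \<in> borel_measurable M"
      by (rule continuous_M) (use yd has_vector_derivative_continuous continuous_at_imp_continuous_on in blast)
    have "L2_inner M (\<lambda>x. 1 / of_real (\<phi> x) * flux_deriv v x) u = (LINT x|M. y x * vderiv r x)"
      unfolding L2_inner_def
    proof (rule integral_cong_AE[OF m1])
      show "(\<lambda>x. y x * vderiv r x) \<in> borel_measurable M"
        using yM L2_measurable[OF test_L2[OF test_vderiv[OF r]]] by measurable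
      show "AE x in M. 1 / of_real (\<phi> x) * flux_deriv v x * cnj (u x) = y x * vderiv r x"
        using uv AE_space
      proof eventually_elim
        case (elim x)
        then show ?case using phi_nonzero[of x] by (simp add: rrr y_def)
      qed
    qed
    also have "\<dots> = - (LINT x|M. - (F (\<lambda>x. cnj (g x)) x / (of_real (\<psi> x))\<^sup>2) * r x)"
      using integral_by_parts_compact_support[OF yd yc test_hvd[OF r] _ b(1,2) b(3)]
        continuous_on_subset[OF test_continuous[OF test_vderiv[OF r]]] by simp
    also have "(LINT x|M. - (F (\<lambda>x. cnj (g x)) x / (of_real (\<psi> x))\<^sup>2) * r x) = (LINT x|M. - (F (\<lambda>x. cnj (g x)) x * vderiv v x))"
      by (rule Bochner_Integration.integral_cong) (auto simp: r_def dest: psi_pos)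
    also have "- \<dots> = - (LINT x|M. of_real (\<phi> x) * cnj (g x) * v x)"
      unfolding F_weak_derivative[OF g' v] by simp
    also have "\<dots> = - L2_inner M (\<lambda>x. of_real (\<phi> x) * v x) g"
      by (simp add: L2_inner_def mult_ac)
    finally show ?thesis .
  qed
  then show ?thesis unfolding adjoint_iff g_def[abs_def] using u f by blast
qed


section \<open>Canonical elements are form limits of test functions\<close>

lemma ftc_M:
  fixes e h :: "real \<Rightarrow> complex"
  assumes h: "continuous_on I h" and e: "\<And>x. x \<in> I \<Longrightarrow> (e has_vector_derivative h x) (at x)"
    and xy: "x \<in> I" "y \<in> I" "y \<le> x"
  shows "integrable M (\<lambda>t. indicator {y..<x} t *\<^sub>R h t)" "(LINT t|M. indicator {y..<x} t *\<^sub>R h t) = e x - e y"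
proof -
  have sub: "{y..x} \<subseteq> I" using xy by (auto simp: I_def)
  have "set_integrable lebesgue {y..x} h"
    using continuous_imp_integrable_real[OF continuous_on_subset[OF h sub]]
    by (simp add: set_integrable_def integrable_restrict_space)
  then have i: "set_integrable lebesgue {y..<x} h" by (rule set_integrable_subset) auto
  have ind: "indicat_real I t * indicat_real {y..<x} t = indicat_real {y..<x} t" for t
    using sub by (auto simp: indicator_def)
  show "integrable M (\<lambda>t. indicator {y..<x} t *\<^sub>R h t)"
    using i by (simp add: integrable_restrict_space ind set_integrable_def)
  have "(LINT t|M. indicator {y..<x} t *\<^sub>R h t) = (LINT t:{y..<x}|lebesgue. h t)"
    by (simp add: integral_restrict_space ind set_lebesgue_integral_def)
  also have "\<dots> = integral {y..<x} h" by (rule set_lebesgue_integral_eq_integral(2)[OF i])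
  also have "\<dots> = integral {y..x} h"
    by (rule integral_spike_set) (auto intro: negligible_subset[of "{x}"])
  also have "(h has_integral e x - e y) {y..x}"
  proof (rule fundamental_theorem_of_calculus[OF xy(3)])
    show "(e has_vector_derivative h t) (at t within {y..x})" if "t \<in> {y..x}" for t
      by (rule has_vector_derivative_at_within[OF e]) (use that sub in auto)
  qed
  then have "integral {y..x} h = e x - e y" by (rule integral_unique)
  finally show "(LINT t|M. indicator {y..<x} t *\<^sub>R h t) = e x - e y" .
qed

definition C5 :: real where "C5 = sqrt (k / (m\<^sup>2 * a))"

text \<open>Cauchy-Schwarz separates \<open>R\<close> from \<open>1 / \<psi>\<close>. The square
  integral of the latter from 0 to \<open>x\<close> is at most of order 1/\<tau>, so
  \<open>e\<close> grows at most like \<tau>^(-1/2), which \<open>\<phi>\<close> compensates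
  exactly.\<close>

lemma primitive_bound:
  assumes e: "\<And>x. x \<in> I \<Longrightarrow> (e has_vector_derivative R x / of_real (\<psi> x)) (at x)" "e 0 = 0"
    and R: "R \<in> L2 M" "continuous_on I R" and x: "x \<in> I"
  shows "cmod (of_real (\<phi> x) * e x) \<le> C5 * L2_norm M R"
proof -
  have phi_coeff: "continuous_on I (\<lambda>x. R x / of_real (\<psi> x))"
    by (intro continuous_intros R(2) psi_continuous) (auto dest: psi_pos)
  define \<theta> where "\<theta> = prim (\<lambda>x. 1 / (of_real (\<psi> x))\<^sup>2)"
  have qc: "continuous_on I (\<lambda>x. 1 / (complex_of_real (\<psi> x))\<^sup>2)" by (rule quotient_continuous) simp
  have \<theta>d: "(\<theta> has_vector_derivative 1 / (of_real (\<psi> x))\<^sup>2) (at x)" if "x \<in> I" for x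
    unfolding \<theta>_def by (rule prim(2)[OF qc that])
  have \<theta>0: "\<theta> 0 = 0" unfolding \<theta>_def by (rule prim(1)[OF qc])
  have \<theta>b: "cmod (\<theta> y) \<le> (1 / m\<^sup>2) / (a * \<tau> y)" if y: "y \<in> I" for y
  proof (rule prim_bound_inverse_tau_sq[OF \<theta>d \<theta>0 _ y])
    fix z assume z: "z \<in> I"
    have "(m * \<tau> z)\<^sup>2 \<le> (\<psi> z)\<^sup>2" using psi_bounds(1)[OF z] m_pos tau_pos[OF z] by (intro power_mono) auto
    moreover have "0 < (m * \<tau> z)\<^sup>2" using m_pos tau_pos[OF z] by simp
    ultimately have "1 / (\<psi> z)\<^sup>2 \<le> 1 / (m * \<tau> z)\<^sup>2" by (intro frac_le) simp_all
    then show "cmod (1 / (of_real (\<psi> z))\<^sup>2) \<le> 1 / m\<^sup>2 / (\<tau> z)\<^sup>2"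
      by (simp add: norm_divide norm_power power_mult_distrib)
  next
    show "0 \<le> 1 / m\<^sup>2" using m_pos by (intro divide_nonneg_nonneg) auto
  qed
  have main: "cmod (e x - e y) \<le> L2_norm M R * sqrt (cmod (\<theta> x - \<theta> y))" if xy: "x \<in> I" "y \<in> I" "y \<le> x" for x y
  proof -
    define f where "f t = indicator {y..<x} t *\<^sub>R (1 / complex_of_real (\<psi> t))" for t
    have fsq: "(cmod (f t))\<^sup>2 = Re (indicator {y..<x} t *\<^sub>R (1 / (of_real (\<psi> t))\<^sup>2))" for t
    proof -
      have "1 / (complex_of_real (\<psi> t))\<^sup>2 = of_real (1 / (\<psi> t)\<^sup>2)" by simp
      then have "Re (indicator {y..<x} t *\<^sub>R (1 / (complex_of_real (\<psi> t))\<^sup>2)) = indicator {y..<x} t * (1 / (\<psi> t)\<^sup>2)"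
        by (simp only: scaleR_complex.sel Re_complex_of_real)
      moreover have "(cmod (f t))\<^sup>2 = indicator {y..<x} t * (1 / (\<psi> t)\<^sup>2)"
        by (simp add: f_def norm_divide power_divide indicator_def)
      ultimately show ?thesis by simp
    qed
    have fi: "integrable M f" unfolding f_def[abs_def]
    proof (rule ftc_M(1)[OF _ _ xy])
      show c: "continuous_on I (\<lambda>t. 1 / complex_of_real (\<psi> t))"
        by (rule smooth_in_continuous[OF inverse_psi_smooth])
      show "(prim (\<lambda>t. 1 / complex_of_real (\<psi> t)) has_vector_derivative 1 / complex_of_real (\<psi> x)) (at x)" if "x \<in> I" for x
        by (rule prim(2)[OF c that])
    qed
    have fL: "f \<in> L2 M"
      by (rule L2_I[OF borel_measurable_integrable[OF fi]])
        (simp only: fsq integrable_Re[OF ftc_M(1)[OF qc \<theta>d xy]])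
    have "L2_norm M f = sqrt (Re (LINT t|M. indicator {y..<x} t *\<^sub>R (1 / (complex_of_real (\<psi> t))\<^sup>2)))"
      unfolding L2_norm_def fsq using integral_Re[OF ftc_M(1)[OF qc \<theta>d xy]] by simp
    also have "\<dots> \<le> sqrt (cmod (\<theta> x - \<theta> y))"
    proof -
      have "(LINT t|M. indicator {y..<x} t *\<^sub>R (1 / (complex_of_real (\<psi> t))\<^sup>2)) = \<theta> x - \<theta> y"
        by (rule ftc_M(2)[OF qc \<theta>d xy])
      then show ?thesis by (simp only: complex_Re_le_cmod real_sqrt_le_mono)
    qed
    finally have fn: "L2_norm M f \<le> sqrt (cmod (\<theta> x - \<theta> y))" .
    have "e x - e y = (LINT t|M. indicator {y..<x} t *\<^sub>R (R t / of_real (\<psi> t)))"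
      by (rule ftc_M(2)[OF phi_coeff e(1) xy, symmetric])
    also have "\<dots> = (LINT t|M. R t * f t)"
      by (rule Bochner_Integration.integral_cong) (auto simp: f_def)
    finally have "cmod (e x - e y) \<le> L2_norm M R * L2_norm M f"
      using L2_Cauchy_Schwarz_mult[OF I_lebesgue R(1) fL] by simp
    also have "\<dots> \<le> L2_norm M R * sqrt (cmod (\<theta> x - \<theta> y))" by (intro mult_left_mono fn L2_norm_nonneg)
    finally show ?thesis .
  qed
  have t: "\<tau> x > 0" by (rule tau_pos[OF x])
  have "cmod (e x) \<le> L2_norm M R * sqrt (cmod (\<theta> x))"
    using main[OF x zero_in_I] main[OF zero_in_I x] e(2) \<theta>0 by (cases "0 \<le> x") auto
  also have "\<dots> \<le> L2_norm M R * sqrt ((1 / m\<^sup>2) / (a * \<tau> x))"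
    by (intro mult_left_mono real_sqrt_le_mono \<theta>b x L2_norm_nonneg)
  finally have ex: "cmod (e x) \<le> L2_norm M R * sqrt ((1 / m\<^sup>2) / (a * \<tau> x))" .
  have "\<phi> x \<le> sqrt (k * \<tau> x)" using psi_bounds(2)[OF x] by (simp add: \<phi>_def)
  then have "\<phi> x * cmod (e x) \<le> sqrt (k * \<tau> x) * (L2_norm M R * sqrt ((1 / m\<^sup>2) / (a * \<tau> x)))"
    using ex phi_pos[OF x] k_pos t by (intro mult_mono) auto
  also have "\<dots> = L2_norm M R * sqrt (k * \<tau> x * ((1 / m\<^sup>2) / (a * \<tau> x)))" by (simp only: real_sqrt_mult mult_ac)
  also have "k * \<tau> x * ((1 / m\<^sup>2) / (a * \<tau> x)) = k / (m\<^sup>2 * a)" using t by simp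
  finally show ?thesis using phi_pos[OF x] by (simp add: norm_mult C5_def mult.commute)
qed

text \<open>The integral of \<open>P / \<psi>\<close> from the left endpoint: the factor
  \<open>\<phi>\<close> inside \<open>F\<close> cancels, and the facts about \<open>F\<close> carry
  over.\<close>

definition S :: "(real \<Rightarrow> complex) \<Rightarrow> real \<Rightarrow> complex" where
  "S P = F (\<lambda>x. 1 / of_real (\<phi> x) * (1 / of_real (\<psi> x) * P x))"

lemma S_test: "P \<in> test_functions I \<Longrightarrow> (\<lambda>x. 1 / of_real (\<phi> x) * (1 / of_real (\<psi> x) * P x)) \<in> test_functions I"
  by (intro test_mult inverse_phi_smooth inverse_psi_smooth)

lemma S_add: "P \<in> test_functions I \<Longrightarrow> R \<in> test_functions I \<Longrightarrow> S (\<lambda>x. P x + R x) x = S P x + S R x"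
  unfolding S_def distrib_left by (rule F_add[OF test_L2[OF S_test] test_L2[OF S_test]])

lemma S_cmult: "S (\<lambda>x. z * P x) x = z * S P x"
  unfolding S_def mult.left_commute[of _ z] by (rule F_cmult)

lemma S_eq: "S P x = (LINT t|M. indicator {..<x} t *\<^sub>R (1 / of_real (\<psi> t) * P t))"
  unfolding S_def F_def
  by (rule Bochner_Integration.integral_cong) (auto dest: phi_pos)

text \<open>A bump of width \<open>d\<close> at a distance comparable to \<open>d\<close> from an
  endpoint has L2 norm at most \<open>sqrt d\<close>, but \<psi> is of order \<open>d\<close> on it,
  so its integral against \<open>1 / \<psi>\<close> stays away from 0 as \<open>d\<close> tends to
  0.\<close>

lemma bump_mass:
  assumes d: "d > 0" "- a < p" "p + d < a" and t: "\<And>x. p < x \<Longrightarrow> x < p + d \<Longrightarrow> \<tau> x \<le> 4 * a * d"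
  defines "b \<equiv> bump (1 / d) p (p + d)"
  shows "b \<in> test_functions I" "L2_norm M b \<le> sqrt d" "x \<le> p \<Longrightarrow> S b x = 0"
    "\<exists>\<kappa>. cmod \<kappa> \<ge> exp (- 6) / (12 * a * k) \<and> (\<forall>x. p + d \<le> x \<longrightarrow> S b x = \<kappa>)"
proof -
  have d': "1 / d > 0" using d by simp
  show b: "b \<in> test_functions I" unfolding b_def by (rule bump_test[OF d' d(2,3)])
  have bz: "b x = 0" if "x \<le> p \<or> p + d \<le> x" for x unfolding b_def by (rule bump_zero[OF d' that])
  have msr: "measure M ({p<..<p + d} \<inter> I) = d"
  proof -
    have e: "{p<..<p + d} \<inter> I = {p<..<p + d}" using d by (auto simp: I_def)
    have "measure M {p<..<p + d} = measure lebesgue {p<..<p + d}"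
      by (rule measure_restrict_space) (use d in \<open>auto simp: I_def\<close>)
    then show ?thesis using d unfolding e by simp
  qed
  have "(LINT x|M. (cmod (b x))\<^sup>2) \<le> (LINT x|M. indicator ({p<..<p + d} \<inter> I) x)"
  proof (rule integral_mono[OF L2_integrable[OF test_L2[OF b]]])
    show "integrable M (indicat_real ({p<..<p + d} \<inter> I))"
      by (intro integrable_real_indicator) (auto simp: M.emeasure_eq_measure sets_restrict_space_iff)
    show "(cmod (b x))\<^sup>2 \<le> indicator ({p<..<p + d} \<inter> I) x" if "x \<in> space M" for x
    proof (cases "p < x \<and> x < p + d")
      case True
      then show ?thesis using cmod_bump[of "1 / d" p "p + d" x] that by (simp add: b_def power_le_one)
    next
      case False
      then show ?thesis using bz[of x] by auto
    qed
  qed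
  also have "\<dots> = d" by (simp add: msr Int_absorb2)
  finally show "L2_norm M b \<le> sqrt d" by (simp add: L2_norm_def)
  show "S b x = 0" if "x \<le> p"
  proof -
    have "S b x = (LINT t|M. 0)" unfolding S_eq
      by (rule Bochner_Integration.integral_cong) (use bz that in \<open>auto simp: indicator_def\<close>)
    then show ?thesis by simp
  qed
  have pt: "(\<lambda>t. 1 / of_real (\<psi> t) * b t) \<in> test_functions I" by (intro test_mult b inverse_psi_smooth)
  define \<kappa> where "\<kappa> = (LINT t|M. 1 / of_real (\<psi> t) * b t)"
  have "S b x = \<kappa>" if "p + d \<le> x" for x
    unfolding S_eq \<kappa>_def
    by (rule Bochner_Integration.integral_cong) (use bz that in \<open>auto simp: indicator_def\<close>)
  moreover have "cmod \<kappa> \<ge> exp (- 6) / (12 * a * k)"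
  proof -
    \<comment> \<open>On the middle third both flat factors have argument at least 1/3 and hence
      value at least exp(-3). With length \<open>d / 3\<close> and
      \<open>\<psi> \<le> 4 * a * k * d\<close> this gives the constant
      \<open>exp (- 6) / (12 * a * k)\<close>.\<close>
    define J where "J = {p + d / 3..<p + 2 * d / 3}"
    have JI: "J \<subseteq> I" using d by (auto simp: J_def I_def)
    have msJ: "measure M J = d / 3"
    proof -
      have "measure M J = measure lebesgue J"
        by (rule measure_restrict_space) (use JI in \<open>auto simp: J_def\<close>)
      then show ?thesis using d by (simp add: J_def)
    qed
    have JM: "J \<in> sets M" using JI by (auto simp: sets_restrict_space_iff J_def)
    have "(LINT t|M. indicator J t * (exp (- 6) / (4 * a * k * d))) \<le> (LINT t|M. Re (1 / of_real (\<psi> t) * b t))"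
    proof (rule integral_mono)
      show "integrable M (\<lambda>t. indicator J t * (exp (- 6) / (4 * a * k * d)))"
        using JM by (intro integrable_mult_left integrable_real_indicator) (auto simp: M.emeasure_eq_measure)
      show "integrable M (\<lambda>t. Re (1 / of_real (\<psi> t) * b t))" by (rule integrable_Re[OF test_integrable[OF pt]])
      fix t assume "t \<in> space M"
      then have tI: "t \<in> I" by simp
      have re: "Re (1 / of_real (\<psi> t) * b t) = Re (b t) / \<psi> t" by (simp add: Re_divide_of_real)
      have b0: "0 \<le> Re (b t) / \<psi> t" using bump_real(2) psi_pos[OF tI] by (simp add: b_def)
      show "indicator J t * (exp (- 6) / (4 * a * k * d)) \<le> Re (1 / of_real (\<psi> t) * b t)"
      proof (cases "t \<in> J")
        case True
        have fl: "exp (- 3) \<le> flat 0 s" if "s \<ge> 1 / 3" for s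
        proof -
          have "1 / s \<le> 3" using that by (simp add: field_simps)
          then show ?thesis using that by (simp add: flat_def)
        qed
        have s1: "1 / d * t + - (1 / d) * p \<ge> 1 / 3" "- (1 / d) * t + 1 / d * (p + d) \<ge> 1 / 3"
        proof -
          have "1 / d * t + - (1 / d) * p = (t - p) / d" "- (1 / d) * t + 1 / d * (p + d) = (p + d - t) / d"
            by (simp_all add: diff_divide_distrib add_divide_distrib)
          then show "1 / d * t + - (1 / d) * p \<ge> 1 / 3" "- (1 / d) * t + 1 / d * (p + d) \<ge> 1 / 3"
            using True d by (simp_all add: J_def pos_le_divide_eq)
        qed
        have "exp (- 6 :: real) = exp (- 3) * exp (- 3)" by (simp flip: exp_add)
        also have "\<dots> \<le> flat 0 (1 / d * t + - (1 / d) * p) * flat 0 (- (1 / d) * t + 1 / d * (p + d))"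
          by (intro mult_mono fl s1) (auto simp: flat_0_bounds)
        also have "\<dots> = Re (b t)" by (simp add: b_def bump_def)
        finally have 1: "exp (- 6) \<le> Re (b t)" .
        have "\<psi> t \<le> k * \<tau> t" by (rule psi_bounds(2)[OF tI])
        also have "\<dots> \<le> k * (4 * a * d)" using t[of t] True d k_pos by (intro mult_left_mono) (auto simp: J_def)
        finally have 2: "\<psi> t \<le> 4 * a * k * d" by (simp add: mult_ac)
        have "exp (- 6) / (4 * a * k * d) \<le> Re (b t) / \<psi> t"
          using 1 2 psi_pos[OF tI] by (intro frac_le) (auto intro: order_trans[OF exp_ge_zero])
        then show ?thesis using True by (simp add: re)
      qed (use b0 re in simp)
    qed
    also have "(LINT t|M. indicator J t * (exp (- 6) / (4 * a * k * d))) = measure M J * (exp (- 6) / (4 * a * k * d))"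
      using JI by (simp add: Int_absorb2)
    also have "\<dots> = exp (- 6) / (12 * a * k)" using d a_pos k_pos by (simp add: msJ)
    also have "(LINT t|M. Re (1 / of_real (\<psi> t) * b t)) = Re \<kappa>"
      unfolding \<kappa>_def by (rule integral_Re[OF test_integrable[OF pt]])
    finally show ?thesis using complex_Re_le_cmod[of \<kappa>] by linarith
  qed
  ultimately show "\<exists>\<kappa>. cmod \<kappa> \<ge> exp (- 6) / (12 * a * k) \<and> (\<forall>x. p + d \<le> x \<longrightarrow> S b x = \<kappa>)" by blast
qed

text \<open>The two constraints are functionals that are unbounded for the \<open>L\<^sup>2\<close> norm, since \<open>1 / \<psi>\<close>
  is not square integrable near either endpoint; so they can be met at arbitrarily small cost.\<close>

lemma test_functions_dense_constrained:
  assumes P0: "P0 \<in> L2 M" and \<epsilon>: "\<epsilon> > 0"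
  shows "\<exists>P\<in>test_functions I. L2_norm M (\<lambda>x. P0 x - P x) < \<epsilon> \<and> S P 0 = s \<and> S P a = 0"
proof -
  obtain P' where P': "P' \<in> test_functions I" "L2_norm M (\<lambda>x. P0 x - P' x) < \<epsilon> / 2"
    using test_functions_dense[OF P0 half_gt_zero[OF \<epsilon>]] by blast
  define \<kappa> where "\<kappa> = exp (- 6) / (12 * a * k)"
  have \<kappa>: "\<kappa> > 0" using a_pos k_pos by (simp add: \<kappa>_def)
  \<comment> \<open>\<open>A\<close> bounds the sum of the moduli of the two correcting coefficients
    whatever \<open>d\<close> is; \<open>d\<close> is then taken so small that
    \<open>A * sqrt d\<close> stays below \<open>\<epsilon> / 2\<close>.\<close>
  define A where "A = (cmod (s - S P' 0) + cmod (S P' a + (s - S P' 0))) / \<kappa>"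
  have A: "A \<ge> 0" using \<kappa> by (simp add: A_def)
  define d where "d = min (a / 4) ((\<epsilon> / (2 * (A + 1)))\<^sup>2)"
  have d: "d > 0" "d \<le> a / 4" using a_pos \<epsilon> A by (auto simp: d_def)
  have "sqrt d \<le> sqrt ((\<epsilon> / (2 * (A + 1)))\<^sup>2)"
    unfolding d_def by (rule real_sqrt_le_mono) (rule min.cobounded2)
  moreover have "\<epsilon> / (2 * (A + 1)) \<ge> 0" using \<epsilon> A by simp
  ultimately have sd: "sqrt d \<le> \<epsilon> / (2 * (A + 1))" by (simp only: real_sqrt_abs abs_of_nonneg)
  \<comment> \<open>The right bump does not affect the value of \<open>S\<close> at 0, the left one
    affects its values at 0 and \<open>a\<close> equally. The two conditions thus form a triangular
    system: \<open>zL\<close> settles the value at 0, then \<open>zR\<close> the value at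
    \<open>a\<close>.\<close>
  define bR bL where "bR = bump (1 / d) (a - 2 * d) (a - 2 * d + d)" and "bL = bump (1 / d) (- a + d) (- a + d + d)"
  have tR: "\<tau> x \<le> 4 * a * d" if "a - 2 * d < x" "x < a - 2 * d + d" for x
  proof -
    have "\<tau> x \<le> (2 * d) * (2 * a)" unfolding tau_factor using that d a_pos by (intro mult_mono) auto
    then show ?thesis by (simp add: mult_ac)
  qed
  have tL: "\<tau> x \<le> 4 * a * d" if "- a + d < x" "x < - a + d + d" for x
  proof -
    have "\<tau> x \<le> (2 * a) * (2 * d)" unfolding tau_factor using that d a_pos by (intro mult_mono) auto
    then show ?thesis by (simp add: mult_ac)
  qed
  have pR: "- a < a - 2 * d" "a - 2 * d + d < a" and pL: "- a < - a + d" "- a + d + d < a"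
    using d a_pos by auto
  note R = bump_mass[OF d(1) pR tR, folded bR_def] and L = bump_mass[OF d(1) pL tL, folded bL_def]
  obtain \<kappa>R where \<kappa>R: "cmod \<kappa>R \<ge> \<kappa>" "S bR a = \<kappa>R" using R(4) d unfolding \<kappa>_def by force
  obtain \<kappa>L where \<kappa>L: "cmod \<kappa>L \<ge> \<kappa>" "S bL 0 = \<kappa>L" "S bL a = \<kappa>L" using L(4) d a_pos unfolding \<kappa>_def by force
  have "0 \<le> a - 2 * d" using d a_pos by simp
  then have R0: "S bR 0 = 0" using R(3)[of 0] by simp
  have nz: "\<kappa>R \<noteq> 0" "\<kappa>L \<noteq> 0" using \<kappa> \<kappa>R(1) \<kappa>L(1) by auto
  define zL zR where "zL = (s - S P' 0) / \<kappa>L" and "zR = - (S P' a + (s - S P' 0)) / \<kappa>R"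
  define P where "P x = P' x + (zL * bL x + zR * bR x)" for x
  have b': "(\<lambda>x. zL * bL x + zR * bR x) \<in> test_functions I" by (intro test_add test_cmult L(1) R(1))
  have Pt: "P \<in> test_functions I" unfolding P_def by (intro test_add P'(1) b')
  have SP: "S P x = S P' x + (zL * S bL x + zR * S bR x)" for x
    unfolding P_def[abs_def] by (simp add: S_add[OF P'(1) b'] S_add[OF test_cmult[OF L(1)] test_cmult[OF R(1)]] S_cmult)
  have "S P 0 = s" using nz by (simp add: SP R0 \<kappa>L zL_def)
  moreover have "S P a = 0" using nz by (simp add: SP \<kappa>R \<kappa>L zL_def zR_def)
  moreover have "L2_norm M (\<lambda>x. P0 x - P x) < \<epsilon>"
  proof -
    note bLL = test_L2[OF L(1)] and bRL = test_L2[OF R(1)]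
    have zb: "cmod (z / y) \<le> cmod z / \<kappa>" if "cmod y \<ge> \<kappa>" for z y
      using that \<kappa> by (simp add: norm_divide frac_le)
    have "L2_norm M (\<lambda>x. zL * bL x + zR * bR x) \<le> cmod zL * L2_norm M bL + cmod zR * L2_norm M bR"
      using L2_norm_triangle[OF I_lebesgue L2_cmult[OF bLL, of zL] L2_cmult[OF bRL, of zR]]
      by (simp add: L2_norm_cmult[OF I_lebesgue bLL] L2_norm_cmult[OF I_lebesgue bRL])
    also have "\<dots> \<le> cmod (s - S P' 0) / \<kappa> * sqrt d + cmod (- (S P' a + (s - S P' 0))) / \<kappa> * sqrt d"
      unfolding zL_def zR_def using \<kappa>
      by (intro add_mono mult_mono zb \<kappa>L(1) \<kappa>R(1) L(2) R(2) L2_norm_nonneg divide_nonneg_nonneg) auto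
    also have "\<dots> = A * sqrt d" 
      unfolding norm_minus_cancel A_def by (simp only: add_divide_distrib distrib_right)
    also have "\<dots> \<le> A * (\<epsilon> / (2 * (A + 1)))" using A sd by (intro mult_left_mono)
    also have "\<dots> < \<epsilon> / 2" using A \<epsilon> by (simp add: field_simps)
    finally have "L2_norm M (\<lambda>x. zL * bL x + zR * bR x) < \<epsilon> / 2" .
    moreover have "L2_norm M (\<lambda>x. P0 x - P x) \<le> L2_norm M (\<lambda>x. P0 x - P' x) + L2_norm M (\<lambda>x. zL * bL x + zR * bR x)"
      using L2_norm_triangle_diff[OF I_lebesgue L2_diff[OF P0 test_L2[OF P'(1)]] test_L2[OF b']]
      by (simp add: P_def algebra_simps)
    ultimately show ?thesis using P'(2) by linarith
  qed
  ultimately show ?thesis using Pt by blast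
qed

lemma S_primitive:
  assumes P: "P \<in> test_functions I" and 0: "S P a = 0"
  shows "\<exists>v\<in>test_functions I. (\<forall>x. vderiv v x = 1 / of_real (\<psi> x) * P x) \<and> v 0 = S P 0"
proof -
  define p where "p x = 1 / of_real (\<psi> x) * P x" for x
  have p: "p \<in> test_functions I" unfolding p_def by (rule test_mult[OF P inverse_psi_smooth])
  have "(LINT x|M. p x) = S P a"
    unfolding S_eq p_def by (rule Bochner_Integration.integral_cong) (auto simp: I_def)
  then obtain v where v: "v \<in> test_functions I" "\<And>x. (v has_vector_derivative p x) (at x)"
    using test_primitive[OF p] 0 by auto
  obtain b1 where b1: "0 < b1" "b1 < a" "\<And>x. b1 \<le> \<bar>x\<bar> \<Longrightarrow> v x = 0" using v(1) unfolding test_iff by blast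
  obtain b2 where b2: "0 < b2" "b2 < a" "\<And>x. b2 \<le> \<bar>x\<bar> \<Longrightarrow> P x = 0" using P unfolding test_iff by blast
  define b where "b = max b1 b2"
  have b: "- b \<in> I" using b1 b2 by (auto simp: b_def I_iff)
  have "S P (- b) = (LINT t|M. 0)" unfolding S_eq
    by (rule Bochner_Integration.integral_cong) (use b2 in \<open>auto simp: indicator_def b_def\<close>)
  then have Sb: "S P (- b) = 0" by simp
  have vb: "v (- b) = 0" using b1(3)[of "- b"] b1(1) by (simp add: b_def)
  note h = S_test[OF P]
  have Sd: "(S P has_vector_derivative p x) (at x)" if x: "x \<in> I" for x
  proof -
    have "(S P has_vector_derivative of_real (\<phi> x) * (1 / of_real (\<phi> x) * (1 / of_real (\<psi> x) * P x))) (at x)"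
      unfolding S_def by (rule F_deriv[OF test_L2[OF h] _ x]) (rule continuous_on_subset[OF test_continuous[OF h]], simp)
    then show ?thesis using phi_nonzero[OF x] by (simp add: p_def)
  qed
  have "v 0 = S P 0"
    using derivative_eq_imp_const[OF v(2) Sd zero_in_I b] Sb vb by simp
  then show ?thesis using v vderiv_eq[OF v(2)] by (auto simp: p_def)
qed

text \<open>Up to the term \<open>- 2 c\<close>, the form of \<open>\<phi> v\<close> is the squared
  norm of \<open>\<psi> v'\<close>. Hence \<open>P0 = \<psi> y'\<close> is approximated in L2 by
  test functions whose primitives \<open>v n\<close> have compact support and agree with
  \<open>y\<close> at 0; \<open>primitive_bound\<close> then gives convergence of
  \<open>\<phi> v\<close>.\<close>

lemma canonical_imp_form_domain:
  assumes "canonical u f"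
  shows "u \<in> form_domain M (SL_minimal \<phi> I)"
proof -
  define g where "g x = f x + 2 * of_real c * u x" for x
  obtain \<alpha> where u: "u \<in> L2 M" and f: "f \<in> L2 M" and Fg: "F g a = 0"
    and uv: "AE x in M. u x = of_real (\<phi> x) * (\<alpha> - J g x)"
    using assms unfolding canonical_def g_def[abs_def, symmetric] by blast
  have g: "g \<in> L2 M" unfolding g_def by (intro L2_add L2_cmult f u)
  define y where "y x = \<alpha> - J g x" for x
  define P0 where "P0 x = - (F g x / of_real (\<psi> x))" for x
  have P0c: "continuous_on I P0" unfolding P0_def[abs_def]
    by (intro continuous_intros psi_continuous F_continuous g) (auto dest: psi_pos)
  have P0L: "P0 \<in> L2 M"
  proof (rule L2_bounded[OF finite_M continuous_M[OF P0c]])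
    fix x assume "x \<in> space M"
    then have x: "x \<in> I" by simp
    have "cmod (F g x) / \<psi> x \<le> (C0 * L2_norm M g * \<tau> x) / (m * \<tau> x)"
      using F_bound[OF g Fg x] psi_bounds(1)[OF x] m_pos tau_pos[OF x]
      by (intro frac_le) (auto intro: order_trans[OF norm_ge_zero])
    also have "\<dots> = C0 * L2_norm M g / m" using tau_pos[OF x] by simp
    finally show "cmod (P0 x) \<le> C0 * L2_norm M g / m" using psi_pos[OF x] by (simp add: P0_def norm_divide)
  qed
  have yd: "(y has_vector_derivative P0 x / of_real (\<psi> x)) (at x)" if x: "x \<in> I" for x
    using has_vector_derivative_diff[OF has_vector_derivative_const J_hvd[OF g x], of \<alpha>]
    by (simp add: y_def[abs_def] P0_def power2_eq_square)
  have "\<exists>P\<in>test_functions I. L2_norm M (\<lambda>x. P0 x - P x) < inverse (real (Suc n)) \<and> S P 0 = y 0 \<and> S P a = 0" for n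
    by (rule test_functions_dense_constrained[OF P0L]) simp
  then obtain P where P: "\<And>n. P n \<in> test_functions I" "\<And>n. L2_norm M (\<lambda>x. P0 x - P n x) < inverse (real (Suc n))"
    "\<And>n. S (P n) 0 = y 0" "\<And>n. S (P n) a = 0" by metis
  have "\<exists>v\<in>test_functions I. (\<forall>x. vderiv v x = 1 / of_real (\<psi> x) * P n x) \<and> v 0 = y 0" for n
    using S_primitive[OF P(1) P(4), of n] P(3)[of n] by simp
  then obtain v where v: "\<And>n. v n \<in> test_functions I" "\<And>n x. vderiv (v n) x = 1 / of_real (\<psi> x) * P n x" "\<And>n. v n 0 = y 0"
    by metis
  define w where "w n x = of_real (\<phi> x) * v n x" for n x
  have wt: "w n \<in> test_functions I" for n unfolding w_def by (rule phi_test[OF v(1)])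
  have PL: "P n \<in> L2 M" for n by (rule test_L2[OF P(1)])
  have Plim: "(\<lambda>n. L2_norm M (\<lambda>x. P n x - P0 x)) \<longlonglongrightarrow> 0"
  proof (rule Lim_null_comparison[OF always_eventually LIMSEQ_inverse_real_of_nat], rule allI)
    show "norm (L2_norm M (\<lambda>x. P n x - P0 x)) \<le> inverse (real (Suc n))" for n
      using P(2)[of n] by (simp add: L2_norm_nonneg L2_norm_minus_commute[of M "P n"])
  qed
  have bound: "cmod (of_real (\<phi> x) * (v n x - y x)) \<le> C5 * L2_norm M (\<lambda>x. P n x - P0 x)" if x: "x \<in> I" for n x
  proof (rule primitive_bound[OF _ _ _ _ x])
    show "((\<lambda>x. v n x - y x) has_vector_derivative (P n x - P0 x) / of_real (\<psi> x)) (at x)" if "x \<in> I" for x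
      using has_vector_derivative_diff[OF test_hvd[OF v(1)] yd[OF that], of n] by (simp add: v(2) diff_divide_distrib)
    show "v n 0 - y 0 = 0" by (simp add: v(3))
    show "(\<lambda>x. P n x - P0 x) \<in> L2 M" by (rule L2_diff[OF PL P0L])
    show "continuous_on I (\<lambda>x. P n x - P0 x)"
      using continuous_on_subset[OF test_continuous[OF P(1)]] by (intro continuous_intros P0c) auto
  qed
  have C50: "C5 \<ge> 0" using k_pos a_pos m_pos by (simp add: C5_def)
  have wL: "w n \<in> L2 M" for n by (rule test_L2[OF wt])
  have wu: "L2_norm M (\<lambda>x. w n x - u x) \<le> C5 * L2_norm M (\<lambda>x. P n x - P0 x) * sqrt (2 * a)" for n
  proof -
    have ym: "continuous_on I y" using yd has_vector_derivative_continuous continuous_at_imp_continuous_on by blast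
    have m1: "(\<lambda>x. of_real (\<phi> x) * (v n x - y x)) \<in> borel_measurable M"
      using continuous_on_subset[OF test_continuous[OF v(1)]] by (intro continuous_M continuous_intros phi_continuous ym) auto
    have "L2_norm M (\<lambda>x. w n x - u x) = L2_norm M (\<lambda>x. of_real (\<phi> x) * (v n x - y x))"
    proof (rule L2_norm_cong_AE[OF L2_diff[OF wL u]])
      show "(\<lambda>x. of_real (\<phi> x) * (v n x - y x)) \<in> L2 M" by (rule L2_bounded[OF finite_M m1 bound]) simp
      show "AE x in M. w n x - u x = of_real (\<phi> x) * (v n x - y x)"
        using uv by eventually_elim (simp add: w_def y_def algebra_simps)
    qed
    also have "\<dots> \<le> C5 * L2_norm M (\<lambda>x. P n x - P0 x) * sqrt (2 * a)"
      unfolding measure_I[symmetric]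
      by (rule L2_norm_bounded[OF finite_M m1 bound]) (use C50 in \<open>auto simp: L2_norm_nonneg\<close>)
    finally show ?thesis .
  qed
  have wlim: "(\<lambda>n. L2_norm M (\<lambda>x. w n x - u x)) \<longlonglongrightarrow> 0"
  proof (rule Lim_null_comparison)
    show "\<forall>\<^sub>F n in sequentially. norm (L2_norm M (\<lambda>x. w n x - u x)) \<le> C5 * L2_norm M (\<lambda>x. P n x - P0 x) * sqrt (2 * a)"
      using wu by (simp add: L2_norm_nonneg)
    have "(\<lambda>n. C5 * L2_norm M (\<lambda>x. P n x - P0 x) * sqrt (2 * a)) \<longlonglongrightarrow> C5 * 0 * sqrt (2 * a)"
      by (intro tendsto_intros Plim)
    then show "(\<lambda>n. C5 * L2_norm M (\<lambda>x. P n x - P0 x) * sqrt (2 * a)) \<longlonglongrightarrow> 0" by simp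
  qed
  have form: "L2_inner M (\<lambda>x. SL_expr \<phi> (w n) x - SL_expr \<phi> (w m) x) (\<lambda>x. w n x - w m x)
     = - 2 * of_real c * of_real ((L2_norm M (\<lambda>x. w n x - w m x))\<^sup>2) + of_real ((L2_norm M (\<lambda>x. P n x - P m x))\<^sup>2)" for n m
  proof -
    define r where "r x = of_real (\<psi> x) * (P n x - P m x)" for x
    define z where "z x = cnj (v n x - v m x)" for x
    have Pd: "(\<lambda>x. P n x - P m x) \<in> test_functions I" by (rule test_diff[OF P(1) P(1)])
    have vd: "(\<lambda>x. v n x - v m x) \<in> test_functions I" by (rule test_diff[OF v(1) v(1)])
    have r: "r \<in> test_functions I" unfolding r_def by (rule test_mult[OF Pd psi_smooth_I])
    have rrd: "(r has_vector_derivative flux_deriv (v n) x - flux_deriv (v m) x) (at x)" if x: "x \<in> I" for x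
    proof (rule has_vector_derivative_transform_within_open[OF _ I_open x])
      show "((\<lambda>x. (of_real (\<psi> x))\<^sup>2 * vderiv (v n) x - (of_real (\<psi> x))\<^sup>2 * vderiv (v m) x) has_vector_derivative flux_deriv (v n) x - flux_deriv (v m) x) (at x)"
        unfolding flux_deriv_def by (intro has_vector_derivative_diff test_hvd psi_vderiv_test v(1))
      show "(of_real (\<psi> x))\<^sup>2 * vderiv (v n) x - (of_real (\<psi> x))\<^sup>2 * vderiv (v m) x = r x" if "x \<in> I" for x
        using psi_pos[OF that] by (simp add: v(2) r_def power2_eq_square right_diff_distrib)
    qed
    have rrc: "continuous_on I (\<lambda>x. flux_deriv (v n) x - flux_deriv (v m) x)"
      using continuous_on_subset[OF test_continuous[OF test_diff[OF flux_deriv_test[OF v(1)] flux_deriv_test[OF v(1)]]]] by simp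
    have zd: "(z has_vector_derivative cnj (1 / of_real (\<psi> x) * (P n x - P m x))) (at x)" for x
      using bounded_linear.has_vector_derivative[OF bounded_linear_cnj has_vector_derivative_diff[OF test_hvd[OF v(1), of n x] test_hvd[OF v(1), of m x]]]
      by (simp add: z_def[abs_def] v(2) diff_divide_distrib)
    have zc: "continuous_on I (\<lambda>x. cnj (1 / of_real (\<psi> x) * (P n x - P m x)))"
      using continuous_on_subset[OF test_continuous[OF P(1)]] by (intro continuous_intros psi_continuous) (auto dest: psi_pos)
    obtain b where b: "0 < b" "b < a" "\<And>x. b \<le> \<bar>x\<bar> \<Longrightarrow> v n x - v m x = 0" using vd unfolding test_iff by blast
    have zz: "z x = 0" if "b \<le> \<bar>x\<bar>" for x
      unfolding z_def b(3)[OF that] by simp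
    have "L2_inner M (\<lambda>x. SL_expr \<phi> (w n) x - SL_expr \<phi> (w m) x) (\<lambda>x. w n x - w m x)
      = (LINT x|M. - 2 * of_real c * ((w n x - w m x) * cnj (w n x - w m x)) - (flux_deriv (v n) x - flux_deriv (v m) x) * z x)"
      unfolding L2_inner_def
    proof (rule Bochner_Integration.integral_cong[OF refl])
      fix x assume "x \<in> space M"
      then have x: "x \<in> I" by simp
      have "SL_expr \<phi> (w n) x - SL_expr \<phi> (w m) x = - 2 * of_real c * (w n x - w m x) - 1 / of_real (\<phi> x) * (flux_deriv (v n) x - flux_deriv (v m) x)"
        unfolding w_def[abs_def] SL_expr_phi[OF v(1) x] by (simp add: algebra_simps)
      moreover have "1 / of_real (\<phi> x) * (flux_deriv (v n) x - flux_deriv (v m) x) * cnj (w n x - w m x) = (flux_deriv (v n) x - flux_deriv (v m) x) * z x"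
        using phi_pos[OF x] by (simp add: w_def z_def right_diff_distrib[symmetric])
      ultimately show "(SL_expr \<phi> (w n) x - SL_expr \<phi> (w m) x) * cnj (w n x - w m x) =
          - 2 * of_real c * ((w n x - w m x) * cnj (w n x - w m x)) - (flux_deriv (v n) x - flux_deriv (v m) x) * z x"
        by (simp only: left_diff_distrib mult.assoc)
    qed
    also have "\<dots> = - 2 * of_real c * (LINT x|M. (w n x - w m x) * cnj (w n x - w m x)) - (LINT x|M. (flux_deriv (v n) x - flux_deriv (v m) x) * z x)"
    proof -
      have "integrable M (\<lambda>x. (w n x - w m x) * cnj (w n x - w m x))"
        by (rule L2_integrable_inner[OF L2_diff[OF wL wL] L2_diff[OF wL wL]])
      moreover have "integrable M (\<lambda>x. (flux_deriv (v n) x - flux_deriv (v m) x) * z x)"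
        unfolding z_def by (rule L2_integrable_inner[OF test_L2[OF test_diff[OF flux_deriv_test[OF v(1)] flux_deriv_test[OF v(1)]]] test_L2[OF vd]])
      ultimately show ?thesis by (subst Bochner_Integration.integral_diff) (simp_all only: integrable_mult_right integral_mult_right_zero)
    qed
    also have "(LINT x|M. (flux_deriv (v n) x - flux_deriv (v m) x) * z x) = - (LINT x|M. r x * cnj (1 / of_real (\<psi> x) * (P n x - P m x)))"
      by (rule integral_by_parts_compact_support[OF rrd rrc zd zc b(1,2) zz])
    also have "(LINT x|M. r x * cnj (1 / of_real (\<psi> x) * (P n x - P m x))) = L2_inner M (\<lambda>x. P n x - P m x) (\<lambda>x. P n x - P m x)"
      unfolding L2_inner_def by (rule Bochner_Integration.integral_cong) (auto simp: r_def dest: psi_pos)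
    finally show ?thesis
      unfolding L2_inner_def[symmetric, of M "\<lambda>x. w n x - w m x" "\<lambda>x. w n x - w m x"] L2_inner_self by simp
  qed
  have cauchy: "\<exists>N. \<forall>m\<ge>N. \<forall>n\<ge>N.
      cmod (L2_inner M (\<lambda>x. SL_expr \<phi> (w n) x - SL_expr \<phi> (w m) x) (\<lambda>x. w n x - w m x)) < \<epsilon>" if \<epsilon>: "\<epsilon> > 0" for \<epsilon>
  proof -
    define A where "A n = (L2_norm M (\<lambda>x. w n x - u x))" for n
    define B where "B n = (L2_norm M (\<lambda>x. P n x - P0 x))" for n
    have le: "cmod (L2_inner M (\<lambda>x. SL_expr \<phi> (w n) x - SL_expr \<phi> (w m) x) (\<lambda>x. w n x - w m x))
        \<le> 2 * \<bar>c\<bar> * (A n + A m)\<^sup>2 + (B n + B m)\<^sup>2" for n m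
    proof -
      have "L2_norm M (\<lambda>x. w n x - w m x) \<le> A n + A m"
        using L2_norm_diff_triangle[OF wL u wL, of n m] by (simp add: A_def L2_norm_minus_commute[of M u])
      then have 1: "(L2_norm M (\<lambda>x. w n x - w m x))\<^sup>2 \<le> (A n + A m)\<^sup>2" by (intro power_mono L2_norm_nonneg)
      have "L2_norm M (\<lambda>x. P n x - P m x) \<le> B n + B m"
        using L2_norm_diff_triangle[OF PL P0L PL, of n m] by (simp add: B_def L2_norm_minus_commute[of M P0])
      then have 2: "(L2_norm M (\<lambda>x. P n x - P m x))\<^sup>2 \<le> (B n + B m)\<^sup>2" by (intro power_mono L2_norm_nonneg)
      have "cmod (L2_inner M (\<lambda>x. SL_expr \<phi> (w n) x - SL_expr \<phi> (w m) x) (\<lambda>x. w n x - w m x))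
        \<le> 2 * \<bar>c\<bar> * (L2_norm M (\<lambda>x. w n x - w m x))\<^sup>2 + (L2_norm M (\<lambda>x. P n x - P m x))\<^sup>2"
        unfolding form
        by (rule order_trans[OF norm_triangle_ineq]) (simp add: norm_mult norm_power L2_norm_nonneg)
      also have "\<dots> \<le> 2 * \<bar>c\<bar> * (A n + A m)\<^sup>2 + (B n + B m)\<^sup>2" using 1 2 by (intro add_mono mult_left_mono) auto
      finally show ?thesis .
    qed
    define d where "d = sqrt (\<epsilon> / (2 * \<bar>c\<bar> + 2)) / 2"
    have d: "d > 0" using \<epsilon> by (simp add: d_def add_nonneg_pos)
    have dd: "(2 * d)\<^sup>2 = \<epsilon> / (2 * \<bar>c\<bar> + 2)" using \<epsilon> by (simp add: d_def)
    obtain N1 where N1: "\<And>n. n \<ge> N1 \<Longrightarrow> A n < d" using LIMSEQ_D[OF wlim d] by (auto simp: A_def L2_norm_nonneg)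
    obtain N2 where N2: "\<And>n. n \<ge> N2 \<Longrightarrow> B n < d" using LIMSEQ_D[OF Plim d] by (auto simp: B_def L2_norm_nonneg)
    have "cmod (L2_inner M (\<lambda>x. SL_expr \<phi> (w n) x - SL_expr \<phi> (w m) x) (\<lambda>x. w n x - w m x)) < \<epsilon>"
      if n: "max N1 N2 \<le> m" "max N1 N2 \<le> n" for m n
    proof -
      have nn: "A n \<ge> 0" "A m \<ge> 0" "B n \<ge> 0" "B m \<ge> 0" by (simp_all add: A_def B_def L2_norm_nonneg)
      have "(A n + A m)\<^sup>2 \<le> (2 * d)\<^sup>2" using N1[of n] N1[of m] n nn by (intro power_mono) auto
      moreover have "(B n + B m)\<^sup>2 \<le> (2 * d)\<^sup>2" using N2[of n] N2[of m] n nn by (intro power_mono) auto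
      ultimately have "2 * \<bar>c\<bar> * (A n + A m)\<^sup>2 + (B n + B m)\<^sup>2 \<le> 2 * \<bar>c\<bar> * (2 * d)\<^sup>2 + (2 * d)\<^sup>2"
        by (intro add_mono mult_left_mono) auto
      also have "\<dots> = (2 * \<bar>c\<bar> + 1) * (\<epsilon> / (2 * \<bar>c\<bar> + 2))" unfolding dd by (simp only: distrib_right mult_1_left)
      also have "\<dots> < \<epsilon>" using \<epsilon> by (simp add: field_simps add_nonneg_pos)
      finally show ?thesis using le[of n m] by linarith
    qed
    then show ?thesis by blast
  qed
  have mem: "(w n, SL_expr \<phi> (w n)) \<in> SL_minimal \<phi> I" for n using wt by (auto simp: SL_minimal_def)
  show ?thesis unfolding form_domain_def
    using u mem wlim cauchy by (intro CollectI conjI exI[of _ w] exI[of _ "\<lambda>n. SL_expr \<phi> (w n)"] allI impI) auto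
qed

text \<open>The limit point property makes the adjoint and the Friedrichs extension coincide, both
  being described by \<open>canonical\<close>.\<close>

theorem T_iff: "(u, f) \<in> T \<longleftrightarrow> canonical u f"
  unfolding T_def SL_friedrichs_def friedrichs_extension_def
  using adjoint_imp_canonical canonical_imp_adjoint canonical_imp_form_domain by blast

end

subsection \<open>Eigenfunctions as solutions of a first-order system\<close>

text \<open>A nondecreasing function lies between its limits at the two ends. This replaces
  integration of derivative identities whose integrability up to the endpoints would have to be
  proved.\<close>

lemma monotone_zero_boundary:
  fixes R R' :: "real \<Rightarrow> real"
  assumes d: "\<And>x. p < x \<Longrightarrow> x < q \<Longrightarrow> (R has_real_derivative R' x) (at x)"
    and nn: "\<And>x. p < x \<Longrightarrow> x < q \<Longrightarrow> R' x \<ge> 0"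
    and lq: "(R \<longlongrightarrow> 0) (at_left q)" and lp: "(R \<longlongrightarrow> 0) (at_right p)" and x: "p < x" "x < q"
  shows "R x = 0" "R' x = 0"
proof -
  have mono: "R s \<le> R t" if "p < s" "s \<le> t" "t < q" for s t
    by (rule DERIV_nonneg_imp_nondecreasing[OF that(2)]) (use that d nn in \<open>meson order_le_less_trans order_less_le_trans\<close>)
  have z: "R y = 0" if y: "p < y" "y < q" for y
  proof (rule antisym)
    have "\<forall>\<^sub>F t in at_left q. R y \<le> R t"
      unfolding eventually_at_left_field using y mono by (intro exI[of _ y]) auto
    then show "R y \<le> 0" by (rule tendsto_lowerbound[OF lq]) simp
    have "\<forall>\<^sub>F t in at_right p. R t \<le> R y"
      unfolding eventually_at_right_field using y mono by (intro exI[of _ y]) auto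
    then show "0 \<le> R y" by (rule tendsto_upperbound[OF lp]) simp
  qed
  show "R x = 0" by (rule z[OF x])
  have "((\<lambda>x. 0) has_real_derivative R' x) (at x)"
    by (rule has_field_derivative_transform_within_open[OF d[OF x], of "{p<..<q}"]) (use x z in auto)
  then show "R' x = 0" using DERIV_unique[OF _ DERIV_const] by blast
qed

context profile
begin

text \<open>\<open>G\<close> is the negative flux \<open>- \<psi>\<^sup>2 v'\<close>, and
  \<open>z\<close> is the eigenvalue shifted by \<open>2 c\<close>. The decay bounds are not
  consequences of the equations: they record membership in the operator domain.\<close>

definition solution :: "complex \<Rightarrow> (real \<Rightarrow> complex) \<Rightarrow> (real \<Rightarrow> complex) \<Rightarrow> bool" where
  "solution z v G \<longleftrightarrow>
     (\<forall>x\<in>I. (v has_vector_derivative - (G x / (of_real (\<psi> x))\<^sup>2)) (at x) \<and>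
            (G has_vector_derivative z * (of_real (\<psi> x) * v x)) (at x)) \<and>
     (\<exists>D\<ge>0. \<forall>x\<in>I. cmod (G x) \<le> D * \<tau> x \<and> cmod (of_real (\<phi> x) * v x) \<le> D * \<tau> x powr (1/4))"

lemma eigenfunction_solution:
  assumes "(u, \<lambda>x. \<mu> * u x) \<in> T"
  obtains v G where "solution (\<mu> + 2 * of_real c) v G" "AE x in M. u x = of_real (\<phi> x) * v x"
proof -
  define z where "z = \<mu> + 2 * of_real c"
  define g where "g x = z * u x" for x
  have geq: "(\<lambda>x. \<mu> * u x + 2 * of_real c * u x) = g" by (simp add: g_def z_def algebra_simps fun_eq_iff)
  from assms[unfolded T_iff canonical_def geq] obtain \<alpha> where u: "u \<in> L2 M" and Fg: "F g a = 0"
    and uv: "AE x in M. u x = of_real (\<phi> x) * (\<alpha> - J g x)" by blast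
  have g: "g \<in> L2 M" unfolding g_def by (rule L2_cmult[OF u])
  define v where "v x = \<alpha> - J g x" for x
  have vd: "(v has_vector_derivative - (F g x / (of_real (\<psi> x))\<^sup>2)) (at x)" if "x \<in> I" for x
    using has_vector_derivative_diff[OF has_vector_derivative_const J_hvd[OF g that], of \<alpha>] by (simp add: v_def[abs_def])
  have vc: "continuous_on I v" using vd has_vector_derivative_continuous continuous_at_imp_continuous_on by blast
  \<comment> \<open>\<open>g\<close> is determined only almost everywhere. Its continuous version
    \<open>h\<close> has the same inner primitive, which is thereby differentiable at every point of
    \<open>I\<close>.\<close>
  define h where "h x = z * (of_real (\<phi> x) * v x)" for x
  have hc: "continuous_on I h" unfolding h_def[abs_def] by (intro continuous_intros phi_continuous vc)
  have gh: "AE x in M. g x = h x" using uv by eventually_elim (simp add: g_def h_def v_def)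
  have hL: "h \<in> L2 M" by (rule L2_cong_AE[OF g continuous_M[OF hc] gh])
  have Gd: "(F g has_vector_derivative z * (of_real (\<psi> x) * v x)) (at x)" if x: "x \<in> I" for x
  proof -
    have "F g = F h" using F_cong_AE[OF g hL gh] by blast
    moreover have "of_real (\<phi> x) * h x = z * (of_real (\<psi> x) * v x)"
      using cphi_sq[OF x, of "z * v x"] by (simp add: h_def mult_ac)
    ultimately show ?thesis using F_deriv[OF hL hc x] by simp
  qed
  define D where "D = C0 * L2_norm M g + C3 * L2_norm M g + cmod \<alpha> * (sqrt k * (a\<^sup>2) powr (1/4))"
  have nn: "0 \<le> C0 * L2_norm M g" "0 \<le> C3 * L2_norm M g" "0 \<le> cmod \<alpha> * (sqrt k * (a\<^sup>2) powr (1/4))"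
    using C0_pos C3_pos k_pos by (auto intro!: mult_nonneg_nonneg simp: L2_norm_nonneg)
  have "cmod (F g x) \<le> D * \<tau> x \<and> cmod (of_real (\<phi> x) * v x) \<le> D * \<tau> x powr (1/4)" if x: "x \<in> I" for x
  proof
    have t: "\<tau> x > 0" by (rule tau_pos[OF x])
    have "cmod (F g x) \<le> C0 * L2_norm M g * \<tau> x" by (rule F_bound[OF g Fg x])
    also have "\<dots> \<le> D * \<tau> x" using nn t by (intro mult_right_mono) (auto simp: D_def)
    finally show "cmod (F g x) \<le> D * \<tau> x" .
    have "\<phi> x \<le> sqrt (k * \<tau> x)" using psi_bounds(2)[OF x] by (simp add: \<phi>_def)
    also have "\<dots> = sqrt k * (\<tau> x powr (1/4) * \<tau> x powr (1/4))"
      using t by (simp add: real_sqrt_mult powr_half_sqrt flip: powr_add)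
    also have "\<dots> \<le> sqrt k * ((a\<^sup>2) powr (1/4) * \<tau> x powr (1/4))"
      using t tau_le[of x] k_pos by (intro mult_left_mono mult_right_mono powr_mono2) auto
    finally have "cmod \<alpha> * \<phi> x \<le> cmod \<alpha> * (sqrt k * ((a\<^sup>2) powr (1/4) * \<tau> x powr (1/4)))" by (rule mult_left_mono) simp
    moreover have "of_real (\<phi> x) * v x = of_real (\<phi> x) * \<alpha> + V g x" by (simp add: v_def V_def algebra_simps)
    then have "cmod (of_real (\<phi> x) * v x) \<le> cmod \<alpha> * \<phi> x + C3 * L2_norm M g * \<tau> x powr (1/4)"
      using norm_triangle_ineq[of "of_real (\<phi> x) * \<alpha>" "V g x"] V_bound_tau[OF g Fg x] phi_pos[OF x]
      by (simp add: norm_mult mult.commute)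
    ultimately have "cmod (of_real (\<phi> x) * v x) \<le> (cmod \<alpha> * (sqrt k * (a\<^sup>2) powr (1/4)) + C3 * L2_norm M g) * \<tau> x powr (1/4)"
      by (simp add: algebra_simps)
    also have "\<dots> \<le> D * \<tau> x powr (1/4)" using nn by (intro mult_right_mono) (auto simp: D_def)
    finally show "cmod (of_real (\<phi> x) * v x) \<le> D * \<tau> x powr (1/4)" .
  qed
  moreover have "D \<ge> 0" using nn by (simp add: D_def)
  ultimately have "solution z v (F g)" unfolding solution_def using vd Gd by blast
  moreover have "AE x in M. u x = of_real (\<phi> x) * v x" using uv by (simp add: v_def)
  ultimately show ?thesis using that by (simp add: z_def)
qed

lemma solutionD:
  assumes "solution z v G" "x \<in> I"
  shows "(v has_vector_derivative - (G x / (of_real (\<psi> x))\<^sup>2)) (at x)"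
    "(G has_vector_derivative z * (of_real (\<psi> x) * v x)) (at x)"
  using assms by (auto simp: solution_def)

lemma eventually_in_I: "\<forall>\<^sub>F x in at_left a. x \<in> I" "\<forall>\<^sub>F x in at_right (- a). x \<in> I"
  unfolding eventually_at_left_field eventually_at_right_field using a_pos
  by (auto simp: I_def intro!: exI[of _ 0])

lemma tau_powr_tendsto:
  assumes "s > 0"
  shows "((\<lambda>x. \<tau> x powr s) \<longlongrightarrow> 0) (at_left a)" "((\<lambda>x. \<tau> x powr s) \<longlongrightarrow> 0) (at_right (- a))"
proof -
  have "((\<lambda>x. \<tau> x powr s) \<longlongrightarrow> 0) (at b within B)" if "\<tau> b = 0" and ev: "\<forall>\<^sub>F x in at b within B. x \<in> I" for b B
  proof -
    have "(\<tau> \<longlongrightarrow> \<tau> b) (at b within B)" unfolding \<tau>_def[abs_def] by (intro tendsto_intros)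
    moreover have "\<forall>\<^sub>F x in at b within B. 0 \<le> \<tau> x"
      using ev by eventually_elim (rule less_imp_le[OF tau_pos])
    ultimately have "((\<lambda>x. \<tau> x powr s) \<longlongrightarrow> 0 powr s) (at b within B)"
      using \<open>\<tau> b = 0\<close> assms by (intro tendsto_powr2) auto
    then show ?thesis by simp
  qed
  from this[OF _ eventually_in_I(1)] this[OF _ eventually_in_I(2)]
  show "((\<lambda>x. \<tau> x powr s) \<longlongrightarrow> 0) (at_left a)" "((\<lambda>x. \<tau> x powr s) \<longlongrightarrow> 0) (at_right (- a))"
    by (simp_all add: \<tau>_def)
qed

lemma bound_tendsto_zero:
  fixes f :: "real \<Rightarrow> 'b::real_normed_vector"
  assumes "s > 0" "\<And>x. x \<in> I \<Longrightarrow> norm (f x) \<le> D * \<tau> x powr s"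
  shows "(f \<longlongrightarrow> 0) (at_left a)" "(f \<longlongrightarrow> 0) (at_right (- a))"
proof -
  show "(f \<longlongrightarrow> 0) (at_left a)"
    by (rule Lim_null_comparison[OF eventually_mono[OF eventually_in_I(1) assms(2)]])
      (use tendsto_mult[OF tendsto_const tau_powr_tendsto(1)[OF assms(1)], of D] in \<open>auto\<close>)
  show "(f \<longlongrightarrow> 0) (at_right (- a))"
    by (rule Lim_null_comparison[OF eventually_mono[OF eventually_in_I(2) assms(2)]])
      (use tendsto_mult[OF tendsto_const tau_powr_tendsto(2)[OF assms(1)], of D] in \<open>auto\<close>)
qed

text \<open>\<open>G\<close> is of order \<tau> and \<open>v'\<close> at most of order \<tau>^(1/4)
  / \<open>\<phi>\<close>, that is \<tau>^(-1/4). The remaining power 3/4 makes the boundary terms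
  of energies and Wronskians vanish.\<close>

lemma product_bound:
  assumes "solution z v G" "solution z' v' G'"
  shows "\<exists>D\<ge>0. \<forall>x\<in>I. cmod (G x) * cmod (v' x) \<le> D * \<tau> x powr (3/4)"
proof -
  obtain D1 D2 where D: "D1 \<ge> 0" "D2 \<ge> 0" "\<And>x. x \<in> I \<Longrightarrow> cmod (G x) \<le> D1 * \<tau> x"
    "\<And>x. x \<in> I \<Longrightarrow> cmod (of_real (\<phi> x) * v' x) \<le> D2 * \<tau> x powr (1/4)"
    using assms unfolding solution_def by metis
  have "cmod (G x) * cmod (v' x) \<le> D1 * D2 / sqrt m * \<tau> x powr (3/4)" if x: "x \<in> I" for x
  proof -
    have t: "\<tau> x > 0" by (rule tau_pos[OF x])
    have "sqrt (m * \<tau> x) \<le> \<phi> x" using psi_bounds(1)[OF x] by (simp add: \<phi>_def)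
    then have low: "sqrt m * \<tau> x powr (1/2) \<le> \<phi> x" using t by (simp add: real_sqrt_mult powr_half_sqrt)
    have "sqrt m * \<tau> x powr (1/2) * cmod (v' x) \<le> \<phi> x * cmod (v' x)" by (rule mult_right_mono[OF low]) simp
    also have "\<dots> \<le> D2 * \<tau> x powr (1/4)" using D(4)[OF x] phi_pos[OF x] by (simp add: norm_mult)
    finally have "cmod (G x) * (sqrt m * \<tau> x powr (1/2) * cmod (v' x)) \<le> (D1 * \<tau> x) * (D2 * \<tau> x powr (1/4))"
      using D(1) t m_pos by (intro mult_mono[OF D(3)[OF x]]) auto
    then have "sqrt m * \<tau> x powr (1/2) * (cmod (G x) * cmod (v' x)) \<le> D1 * D2 * (\<tau> x * \<tau> x powr (1/4))"
      by (simp only: mult_ac)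
    also have "\<tau> x * \<tau> x powr (1/4) = \<tau> x powr (1/2) * \<tau> x powr (3/4)"
      using powr_add[of "\<tau> x" 1 "1/4"] powr_add[of "\<tau> x" "1/2" "3/4"] t by simp
    finally have "\<tau> x powr (1/2) * (sqrt m * (cmod (G x) * cmod (v' x))) \<le> \<tau> x powr (1/2) * (D1 * D2 * \<tau> x powr (3/4))"
      by (simp only: mult_ac)
    then have "sqrt m * (cmod (G x) * cmod (v' x)) \<le> D1 * D2 * \<tau> x powr (3/4)"
      by (rule mult_left_le_imp_le) (use t in simp)
    then show ?thesis using m_pos by (simp add: field_simps)
  qed
  moreover have "D1 * D2 / sqrt m \<ge> 0" using D m_pos by simp
  ultimately show ?thesis by blast
qed

lemma solution_boundary:
  assumes "solution z v G"
  shows "(G \<longlongrightarrow> 0) (at_left a)" "(G \<longlongrightarrow> 0) (at_right (- a))"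
    "((\<lambda>x. of_real (\<phi> x) * v x) \<longlongrightarrow> 0) (at_left a)" "((\<lambda>x. of_real (\<phi> x) * v x) \<longlongrightarrow> 0) (at_right (- a))"
    "((\<lambda>x. G x * cnj (v x)) \<longlongrightarrow> 0) (at_left a)" "((\<lambda>x. G x * cnj (v x)) \<longlongrightarrow> 0) (at_right (- a))"
proof -
  obtain D where D: "\<And>x. x \<in> I \<Longrightarrow> cmod (G x) \<le> D * \<tau> x" "\<And>x. x \<in> I \<Longrightarrow> cmod (of_real (\<phi> x) * v x) \<le> D * \<tau> x powr (1/4)"
    using assms unfolding solution_def by blast
  have 1: "cmod (G x) \<le> D * \<tau> x powr 1" if "x \<in> I" for x using D(1)[OF that] tau_pos[OF that] by simp
  show "(G \<longlongrightarrow> 0) (at_left a)" "(G \<longlongrightarrow> 0) (at_right (- a))"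
    using bound_tendsto_zero[OF zero_less_one 1] by blast+
  show "((\<lambda>x. of_real (\<phi> x) * v x) \<longlongrightarrow> 0) (at_left a)" "((\<lambda>x. of_real (\<phi> x) * v x) \<longlongrightarrow> 0) (at_right (- a))"
    using bound_tendsto_zero[OF _ D(2)] by auto
  obtain D' where D': "\<And>x. x \<in> I \<Longrightarrow> cmod (G x) * cmod (v x) \<le> D' * \<tau> x powr (3/4)"
    using product_bound[OF assms assms] by blast
  have "cmod (G x * cnj (v x)) \<le> D' * \<tau> x powr (3/4)" if "x \<in> I" for x
    using D'[OF that] by (simp add: norm_mult)
  from bound_tendsto_zero[OF _ this]
  show "((\<lambda>x. G x * cnj (v x)) \<longlongrightarrow> 0) (at_left a)" "((\<lambda>x. G x * cnj (v x)) \<longlongrightarrow> 0) (at_right (- a))"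
    by auto
qed

lemma hvd_Re: "(f has_vector_derivative d) (at x) \<Longrightarrow> ((\<lambda>x. Re (f x)) has_real_derivative Re d) (at x)"
  unfolding has_real_derivative_iff_has_vector_derivative
  by (rule bounded_linear.has_vector_derivative[OF bounded_linear_Re])

lemma hvd_cnj: "(f has_vector_derivative d) (at x) \<Longrightarrow> ((\<lambda>x. cnj (f x)) has_vector_derivative cnj d) (at x)"
  by (rule bounded_linear.has_vector_derivative[OF bounded_linear_cnj])

text \<open>The boundary term \<open>P = G * cnj v\<close> tends to 0 at both endpoints and has
  derivative \<open>z \<psi> |v|^2 - |G|^2 / \<psi>^2\<close>. If \<open>z\<close> were not a
  nonnegative real, a suitable real part of a multiple of \<open>P\<close> would be monotone without
  being constant.\<close>

lemma solution_parameter: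
  assumes s: "solution z v G" and nz: "x0 \<in> I" "v x0 \<noteq> 0"
  shows "Im z = 0" "Re z \<ge> 0"
proof -
  define P where "P x = G x * cnj (v x)" for x
  have Pd: "(P has_vector_derivative z * of_real (\<psi> x * (cmod (v x))\<^sup>2) - of_real ((cmod (G x))\<^sup>2 / (\<psi> x)\<^sup>2)) (at x)"
    if x: "x \<in> I" for x
  proof -
    have "(P has_vector_derivative G x * cnj (- (G x / (of_real (\<psi> x))\<^sup>2)) + z * (of_real (\<psi> x) * v x) * cnj (v x)) (at x)"
      unfolding P_def[abs_def] by (intro has_vector_derivative_mult hvd_cnj solutionD[OF s x])
    moreover have "G x * cnj (- (G x / (of_real (\<psi> x))\<^sup>2)) = - (G x * cnj (G x)) / (of_real (\<psi> x))\<^sup>2" by simp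
    then have "G x * cnj (- (G x / (of_real (\<psi> x))\<^sup>2)) = - of_real ((cmod (G x))\<^sup>2 / (\<psi> x)\<^sup>2)"
      unfolding complex_norm_square[symmetric] by simp
    moreover have "z * (of_real (\<psi> x) * v x) * cnj (v x) = z * (of_real (\<psi> x) * (v x * cnj (v x)))" by (simp only: mult.assoc)
    then have "z * (of_real (\<psi> x) * v x) * cnj (v x) = z * of_real (\<psi> x * (cmod (v x))\<^sup>2)"
      unfolding complex_norm_square[symmetric] by simp
    ultimately show ?thesis by (simp only: add.commute[of "- _"] diff_conv_add_uminus)
  qed
  have lim: "(P \<longlongrightarrow> 0) (at_left a)" "(P \<longlongrightarrow> 0) (at_right (- a))"
    unfolding P_def[abs_def] by (rule solution_boundary(5,6)[OF s])+
  have I2: "x \<in> I \<longleftrightarrow> - a < x \<and> x < a" for x by (auto simp: I_def)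
  show im: "Im z = 0"
  proof (rule ccontr)
    assume "Im z \<noteq> 0"
    \<comment> \<open>The factor \<open>- \<i> * of_real (Im z)\<close> makes the real summand
      imaginary and turns the other one into a nonnegative multiple of
      \<open>(Im z)\<^sup>2\<close>.\<close>
    have d: "((\<lambda>x. Re (- \<i> * of_real (Im z) * P x)) has_real_derivative (Im z)\<^sup>2 * (\<psi> x * (cmod (v x))\<^sup>2)) (at x)" if "- a < x" "x < a" for x
      using hvd_Re[OF has_vector_derivative_mult_right[OF Pd, of x "- \<i> * of_real (Im z)"]] that
      by (simp add: I2 power2_eq_square algebra_simps)
    have "(Im z)\<^sup>2 * (\<psi> x0 * (cmod (v x0))\<^sup>2) = 0"
    proof (rule monotone_zero_boundary(2)[OF d])
      show "((\<lambda>x. Re (- \<i> * of_real (Im z) * P x)) \<longlongrightarrow> 0) (at_left a)"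
        using tendsto_Re[OF tendsto_mult[OF tendsto_const lim(1), of "- \<i> * of_real (Im z)"]] by simp
      show "((\<lambda>x. Re (- \<i> * of_real (Im z) * P x)) \<longlongrightarrow> 0) (at_right (- a))"
        using tendsto_Re[OF tendsto_mult[OF tendsto_const lim(2), of "- \<i> * of_real (Im z)"]] by simp
      show "0 \<le> (Im z)\<^sup>2 * (\<psi> x * (cmod (v x))\<^sup>2)" if "- a < x" "x < a" for x
        using psi_pos[of x] that by (simp add: I2)
    qed (use nz(1) I2 in auto)
    then show False using \<open>Im z \<noteq> 0\<close> nz psi_pos[OF nz(1)] by simp
  qed
  show "Re z \<ge> 0"
  proof (rule ccontr)
    assume neg: "\<not> Re z \<ge> 0"
    have d: "((\<lambda>x. Re (- P x)) has_real_derivative - Re z * (\<psi> x * (cmod (v x))\<^sup>2) + (cmod (G x))\<^sup>2 / (\<psi> x)\<^sup>2) (at x)" if "- a < x" "x < a" for x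
      using hvd_Re[OF has_vector_derivative_minus[OF Pd, of x]] that
      by (simp add: I2)
    have n1: "0 \<le> (cmod (G x))\<^sup>2 / (\<psi> x)\<^sup>2" for x by simp
    have n2: "0 \<le> - Re z * (\<psi> x * (cmod (v x))\<^sup>2)" if "x \<in> I" for x
      using psi_pos[OF that] neg by (intro mult_nonneg_nonneg[of "- Re z"]) auto
    have "- Re z * (\<psi> x0 * (cmod (v x0))\<^sup>2) + (cmod (G x0))\<^sup>2 / (\<psi> x0)\<^sup>2 = 0"
    proof (rule monotone_zero_boundary(2)[OF d])
      show "((\<lambda>x. Re (- P x)) \<longlongrightarrow> 0) (at_left a)"
        using tendsto_Re[OF tendsto_minus[OF lim(1)]] by simp
      show "((\<lambda>x. Re (- P x)) \<longlongrightarrow> 0) (at_right (- a))"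
        using tendsto_Re[OF tendsto_minus[OF lim(2)]] by simp
      show "0 \<le> - Re z * (\<psi> x * (cmod (v x))\<^sup>2) + (cmod (G x))\<^sup>2 / (\<psi> x)\<^sup>2" if "- a < x" "x < a" for x
        by (rule add_nonneg_nonneg[OF n2 n1]) (use that in \<open>simp add: I2\<close>)
    qed (use nz(1) I2 in auto)
    then have "- Re z * (\<psi> x0 * (cmod (v x0))\<^sup>2) = 0" using n1[of x0] n2[OF nz(1)] by linarith
    then show False using neg nz psi_pos[OF nz(1)] by simp
  qed
qed

text \<open>Gronwall's argument for \<open>E = |v|^2 + |G|^2\<close>: on a compact subinterval
  containing both points the coefficients are bounded, so
  \<open>\<bar>E' x\<bar> \<le> L * E x\<close>, and an exponential weight makes \<open>E\<close>
  monotone in either direction.\<close>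

lemma solution_unique:
  fixes v G :: "real \<Rightarrow> complex" and z :: complex
  assumes v: "\<And>x. x \<in> I \<Longrightarrow> (v has_vector_derivative - (G x / (of_real (\<psi> x))\<^sup>2)) (at x)"
    and G: "\<And>x. x \<in> I \<Longrightarrow> (G has_vector_derivative z * (of_real (\<psi> x) * v x)) (at x)"
    and 0: "x0 \<in> I" "v x0 = 0" "G x0 = 0" and x: "x \<in> I"
  shows "v x = 0"
proof -
  define b where "b = (max \<bar>x\<bar> \<bar>x0\<bar> + a) / 2"
  have b: "\<bar>x\<bar> < b" "\<bar>x0\<bar> < b" "b < a" using x 0(1) by (auto simp: b_def I_iff)
  have sub: "{-b..b} \<subseteq> I" using b by (auto simp: I_def)
  have "continuous_on {-b..b} (\<lambda>x. 1 / (\<psi> x)\<^sup>2 + cmod z * \<psi> x)"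
    using sub psi_pos by (intro continuous_intros psi_continuous) force
  then have "bounded ((\<lambda>x. 1 / (\<psi> x)\<^sup>2 + cmod z * \<psi> x) ` {-b..b})"
    by (intro compact_imp_bounded compact_continuous_image) auto
  then obtain L where L: "\<And>x. x \<in> {-b..b} \<Longrightarrow> \<bar>1 / (\<psi> x)\<^sup>2 + cmod z * \<psi> x\<bar> \<le> L"
    unfolding bounded_iff real_norm_def by blast
  define E where "E x = Re (v x * cnj (v x) + G x * cnj (G x))" for x
  have E: "E x = (cmod (v x))\<^sup>2 + (cmod (G x))\<^sup>2" for x
    unfolding E_def complex_norm_square[symmetric] by (simp flip: of_real_add of_real_power)
  define E' where "E' x = Re ((v x * cnj (- (G x / (of_real (\<psi> x))\<^sup>2)) + - (G x / (of_real (\<psi> x))\<^sup>2) * cnj (v x))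
      + (G x * cnj (z * (of_real (\<psi> x) * v x)) + z * (of_real (\<psi> x) * v x) * cnj (G x)))" for x
  have Ed: "(E has_real_derivative E' x) (at x)" if "x \<in> I" for x
    unfolding E_def[abs_def] E'_def
    by (intro hvd_Re has_vector_derivative_add has_vector_derivative_mult hvd_cnj v G that)
  have E'b: "\<bar>E' x\<bar> \<le> L * E x" if x: "x \<in> {-b..b}" for x
  proof -
    have p: "\<psi> x > 0" using psi_pos x sub by auto
    have n1: "cmod (v x * cnj (- (G x / (of_real (\<psi> x))\<^sup>2))) = cmod (v x) * cmod (G x) * (1 / (\<psi> x)\<^sup>2)"
      "cmod (- (G x / (of_real (\<psi> x))\<^sup>2) * cnj (v x)) = cmod (v x) * cmod (G x) * (1 / (\<psi> x)\<^sup>2)"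
      "cmod (G x * cnj (z * (of_real (\<psi> x) * v x))) = cmod (v x) * cmod (G x) * (cmod z * \<psi> x)"
      "cmod (z * (of_real (\<psi> x) * v x) * cnj (G x)) = cmod (v x) * cmod (G x) * (cmod z * \<psi> x)"
      using p by (simp_all add: norm_mult norm_divide norm_power)
    have "\<bar>E' x\<bar> \<le> cmod ((v x * cnj (- (G x / (of_real (\<psi> x))\<^sup>2)) + - (G x / (of_real (\<psi> x))\<^sup>2) * cnj (v x))
      + (G x * cnj (z * (of_real (\<psi> x) * v x)) + z * (of_real (\<psi> x) * v x) * cnj (G x)))"
      unfolding E'_def by (rule abs_Re_le_cmod)
    also have "\<dots> \<le> (cmod (v x) * cmod (G x) * (1 / (\<psi> x)\<^sup>2) + cmod (v x) * cmod (G x) * (1 / (\<psi> x)\<^sup>2))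
       + (cmod (v x) * cmod (G x) * (cmod z * \<psi> x) + cmod (v x) * cmod (G x) * (cmod z * \<psi> x))"
      by (intro norm_triangle_mono) (simp_all only: n1 order_refl)
    also have "\<dots> = (2 * cmod (v x) * cmod (G x)) * (1 / (\<psi> x)\<^sup>2 + cmod z * \<psi> x)" by (simp add: algebra_simps)
    also have "\<dots> \<le> E x * L"
    proof (rule mult_mono)
      show "2 * cmod (v x) * cmod (G x) \<le> E x" unfolding E by (rule sum_squares_bound)
      show "1 / (\<psi> x)\<^sup>2 + cmod z * \<psi> x \<le> L" using L[OF x] by simp
      show "0 \<le> E x" by (simp add: E)
      show "0 \<le> 1 / (\<psi> x)\<^sup>2 + cmod z * \<psi> x" using p by (intro add_nonneg_nonneg mult_nonneg_nonneg divide_nonneg_nonneg) auto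
    qed
    finally show ?thesis by (simp add: mult.commute)
  qed
  have E0: "E x0 = 0" using 0 by (simp add: E)
  have "E x \<le> 0"
  proof (cases "x0 \<le> x")
    case True
    have "E x * exp (- L * x) \<le> E x0 * exp (- L * x0)"
    proof (rule DERIV_nonpos_imp_nonincreasing[OF True])
      fix t assume t: "x0 \<le> t" "t \<le> x"
      then have t': "t \<in> {-b..b}" using b by auto
      have "((\<lambda>x. E x * exp (- L * x)) has_real_derivative (E' t - L * E t) * exp (- L * t)) (at t)"
        using sub t' by (auto intro!: derivative_eq_intros Ed simp: algebra_simps)
      moreover have "(E' t - L * E t) * exp (- L * t) \<le> 0" using E'b[OF t'] by (simp add: mult_le_0_iff)
      ultimately show "\<exists>y. ((\<lambda>x. E x * exp (- L * x)) has_real_derivative y) (at t) \<and> y \<le> 0" by blast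
    qed
    then show ?thesis using E0 by (simp add: mult_le_0_iff)
  next
    case False
    then have le: "x \<le> x0" by simp
    have "E x * exp (L * x) \<le> E x0 * exp (L * x0)"
    proof (rule DERIV_nonneg_imp_nondecreasing[OF le])
      fix t assume t: "x \<le> t" "t \<le> x0"
      then have t': "t \<in> {-b..b}" using b by auto
      have "((\<lambda>x. E x * exp (L * x)) has_real_derivative (E' t + L * E t) * exp (L * t)) (at t)"
        using sub t' by (auto intro!: derivative_eq_intros Ed simp: algebra_simps)
      moreover have "(E' t + L * E t) * exp (L * t) \<ge> 0" using E'b[OF t'] by (simp add: zero_le_mult_iff)
      ultimately show "\<exists>y. ((\<lambda>x. E x * exp (L * x)) has_real_derivative y) (at t) \<and> 0 \<le> y" by blast
    qed
    then show ?thesis using E0 by (simp add: mult_le_0_iff)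
  qed
  then show "v x = 0" unfolding E by (smt (verit) zero_le_power2 norm_ge_zero zero_eq_power2 norm_eq_zero)
qed

lemma solutions_proportional:
  assumes s1: "solution z v1 G1" and s2: "solution z v2 G2" and nz: "x1 \<in> I" "v1 x1 \<noteq> 0"
  shows "\<exists>k. \<forall>x\<in>I. v2 x = k * v1 x"
proof -
  define W where "W x = v1 x * G2 x - v2 x * G1 x" for x
  have Wd: "(W has_vector_derivative 0) (at x)" if x: "x \<in> I" for x
  proof -
    have "(W has_vector_derivative (v1 x * (z * (of_real (\<psi> x) * v2 x)) + - (G1 x / (of_real (\<psi> x))\<^sup>2) * G2 x)
       - (v2 x * (z * (of_real (\<psi> x) * v1 x)) + - (G2 x / (of_real (\<psi> x))\<^sup>2) * G1 x)) (at x)"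
      unfolding W_def[abs_def]
      by (intro has_vector_derivative_diff has_vector_derivative_mult solutionD[OF s1 x] solutionD[OF s2 x])
    then show ?thesis by (simp add: algebra_simps)
  qed
  obtain D1 where D1: "\<And>x. x \<in> I \<Longrightarrow> cmod (G2 x) * cmod (v1 x) \<le> D1 * \<tau> x powr (3/4)"
    using product_bound[OF s2 s1] by blast
  obtain D2 where D2: "\<And>x. x \<in> I \<Longrightarrow> cmod (G1 x) * cmod (v2 x) \<le> D2 * \<tau> x powr (3/4)"
    using product_bound[OF s1 s2] by blast
  have "cmod (W x) \<le> (D1 + D2) * \<tau> x powr (3/4)" if x: "x \<in> I" for x
    using norm_triangle_ineq4[of "v1 x * G2 x" "v2 x * G1 x"] D1[OF x] D2[OF x]
    by (simp add: W_def norm_mult algebra_simps)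
  then have "(W \<longlongrightarrow> 0) (at_left a)" by (intro bound_tendsto_zero(1)[of "3/4"]) auto
  moreover have "\<forall>\<^sub>F x in at_left a. W x = W 0"
    using eventually_in_I(1)
  proof eventually_elim
    case (elim x)
    have "W x - 0 = W 0 - 0" by (rule derivative_eq_imp_const[OF Wd has_vector_derivative_const elim zero_in_I])
    then show ?case by simp
  qed
  then have "(W \<longlongrightarrow> W 0) (at_left a)" by (rule tendsto_eventually)
  ultimately have W0: "W 0 = 0" using tendsto_unique[of "at_left a"] by auto
  have d0: "v1 0 \<noteq> 0 \<or> G1 0 \<noteq> 0"
  proof (rule ccontr)
    assume "\<not> ?thesis"
    then have "v1 0 = 0" "G1 0 = 0" by simp_all
    then have "v1 x1 = 0"
      using solution_unique[where v = v1 and G = G1 and z = z, OF _ _ zero_in_I _ _ nz(1)] solutionD[OF s1] by blast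
    then show False using nz by simp
  qed
  \<comment> \<open>At 0 the pair \<open>(v1, G1)\<close> is nonzero, and the vanishing Wronskian
    says that \<open>(v2, G2)\<close> is a multiple of it; the factor is read off from a nonzero
    component.\<close>
  define k where "k = (if v1 0 \<noteq> 0 then v2 0 / v1 0 else G2 0 / G1 0)"
  have k0: "v2 0 - k * v1 0 = 0" "G2 0 - k * G1 0 = 0"
    using d0 W0 by (auto simp: k_def W_def field_simps)
  have "v2 x - k * v1 x = 0" if x: "x \<in> I" for x
  proof (rule solution_unique[where v = "\<lambda>x. v2 x - k * v1 x" and G = "\<lambda>x. G2 x - k * G1 x" and z = z, OF _ _ zero_in_I k0 x])
    fix y assume y: "y \<in> I"
    show "((\<lambda>x. v2 x - k * v1 x) has_vector_derivative - ((G2 y - k * G1 y) / (of_real (\<psi> y))\<^sup>2)) (at y)"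
      using has_vector_derivative_diff[OF solutionD(1)[OF s2 y] has_vector_derivative_mult_right[OF solutionD(1)[OF s1 y], of k]]
      by (simp add: diff_divide_distrib algebra_simps)
    show "((\<lambda>x. G2 x - k * G1 x) has_vector_derivative z * (of_real (\<psi> y) * (v2 y - k * v1 y))) (at y)"
      using has_vector_derivative_diff[OF solutionD(2)[OF s2 y] has_vector_derivative_mult_right[OF solutionD(2)[OF s1 y], of k]]
      by (simp add: algebra_simps)
  qed
  then show ?thesis by (intro exI[of _ k]) auto
qed

text \<open>Sturm comparison by Picone's identity. A solution orthogonal to the ground state has a zero
  \<open>x0\<close>; on the shorter of the two intervals between \<open>x0\<close> and the endpoints it is compared with
  \<open>sin (sqrt 2 * (x - x0))\<close>, which has no zero there because \<open>sqrt 2 * a < pi\<close>.\<close>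

lemma solution_energy_pos:
  fixes v G :: "real \<Rightarrow> real" and \<mu> x1 :: real
  assumes api: "sqrt 2 * a < pi"
    and v: "\<And>x. x \<in> I \<Longrightarrow> (v has_real_derivative - (G x / (\<psi> x)\<^sup>2)) (at x)"
    and G: "\<And>x. x \<in> I \<Longrightarrow> (G has_real_derivative (\<mu> + 2 * c) * (\<psi> x * v x)) (at x)"
    and lim: "(G \<longlongrightarrow> 0) (at_left a)" "(G \<longlongrightarrow> 0) (at_right (- a))"
      "((\<lambda>x. \<phi> x * v x) \<longlongrightarrow> 0) (at_left a)" "((\<lambda>x. \<phi> x * v x) \<longlongrightarrow> 0) (at_right (- a))"
      "((\<lambda>x. G x * v x) \<longlongrightarrow> 0) (at_left a)" "((\<lambda>x. G x * v x) \<longlongrightarrow> 0) (at_right (- a))"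
    and nz: "x1 \<in> I" "v x1 \<noteq> 0" and \<mu>: "\<mu> + 2 * c > 0"
  shows "\<mu> > 0"
proof (rule ccontr)
  assume "\<not> \<mu> > 0"
  then have \<mu>0: "\<mu> \<le> 0" by simp
  have I2: "x \<in> I \<longleftrightarrow> - a < x \<and> x < a" for x by (auto simp: I_def)
  have vcont: "continuous_on I v" by (meson v DERIV_isCont continuous_at_imp_continuous_on)
  \<comment> \<open>If \<open>v\<close> had no zero, \<open>v x * v x1\<close> would be positive
    throughout, so \<open>G\<close> times \<open>v x1\<close> would increase while tending to 0 at
    both ends.\<close>
  have "\<exists>x0\<in>I. v x0 = 0"
  proof (rule ccontr)
    assume no: "\<not> (\<exists>x0\<in>I. v x0 = 0)"
    have same: "v x * v x1 > 0" if x: "x \<in> I" for x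
    proof (rule ccontr)
      assume "\<not> v x * v x1 > 0"
      moreover have ne: "v x \<noteq> 0" "v x1 \<noteq> 0" using no x nz by auto
      ultimately have neg: "v x * v x1 < 0" by (metis linorder_neqE_linordered_idom mult_eq_0_iff)
      have conn: "connected (v ` I)" by (rule connected_continuous_image[OF vcont]) (simp add: I_def)
      have "0 \<in> v ` I"
      proof (cases "v x < 0")
        case True
        then have "v x \<le> 0" "0 \<le> v x1" using neg by (auto simp: mult_less_0_iff)
        then show ?thesis using connectedD_interval[OF conn, of "v x" "v x1" 0] x nz by auto
      next
        case False
        then have "v x1 \<le> 0" "0 \<le> v x" using neg by (auto simp: mult_less_0_iff)
        then show ?thesis using connectedD_interval[OF conn, of "v x1" "v x" 0] x nz by auto
      qed
      then show False using no by auto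
    qed
    have "(\<mu> + 2 * c) * (\<psi> x1 * v x1) * v x1 = 0"
    proof (rule monotone_zero_boundary(2)[of "- a" a "\<lambda>x. G x * v x1" "\<lambda>x. (\<mu> + 2 * c) * (\<psi> x * v x) * v x1" x1])
      show "((\<lambda>x. G x * v x1) has_real_derivative (\<mu> + 2 * c) * (\<psi> x * v x) * v x1) (at x)" if "- a < x" "x < a" for x
        using that by (intro DERIV_cmult_right G) (simp add: I2)
      show "0 \<le> (\<mu> + 2 * c) * (\<psi> x * v x) * v x1" if "- a < x" "x < a" for x
      proof -
        have "0 \<le> (\<mu> + 2 * c) * (\<psi> x * (v x * v x1))"
          using same[of x] psi_pos[of x] \<mu> that by (intro mult_nonneg_nonneg[of _ "_ * (_ * _)"] mult_nonneg_nonneg[of "\<psi> x"]) (auto simp: I2)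
        then show ?thesis by (simp add: mult_ac)
      qed
      show "((\<lambda>x. G x * v x1) \<longlongrightarrow> 0) (at_left a)" using tendsto_mult[OF lim(1) tendsto_const] by simp
      show "((\<lambda>x. G x * v x1) \<longlongrightarrow> 0) (at_right (- a))" using tendsto_mult[OF lim(2) tendsto_const] by simp
    qed (use nz in \<open>auto simp: I2\<close>)
    then show False using \<mu> nz psi_pos[OF nz(1)] by simp
  qed
  then obtain x0 where x0: "x0 \<in> I" "v x0 = 0" by blast
  define W where "W x = \<psi> x * v x" for x
  define W' where "W' x = \<psi>' x * v x - G x / \<psi> x" for x
  define Sn where "Sn x = sin (sqrt 2 * (x - x0))" for x
  define Cs where "Cs x = sqrt 2 * cos (sqrt 2 * (x - x0))" for x
  have Wd: "(W has_real_derivative W' x) (at x)" if x: "x \<in> I" for x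
  proof -
    have "(W has_real_derivative \<psi> x * - (G x / (\<psi> x)\<^sup>2) + \<psi>' x * v x) (at x)"
      unfolding W_def[abs_def] using DERIV_mult'[OF psi_deriv v[OF x]] by simp
    then show ?thesis using psi_pos[OF x] by (simp add: W'_def power2_eq_square)
  qed
  have W'd: "(W' has_real_derivative - 2 * W x - \<mu> * v x) (at x)" if x: "x \<in> I" for x
  proof -
    have "(W' has_real_derivative (\<psi>' x * - (G x / (\<psi> x)\<^sup>2) + (2 * c - 2 * \<psi> x) * v x)
        - ((\<mu> + 2 * c) * (\<psi> x * v x) * \<psi> x - G x * \<psi>' x) / (\<psi> x * \<psi> x)) (at x)"
      unfolding W'_def[abs_def] using psi_pos[OF x]
      by (intro DERIV_diff DERIV_mult' psi'_deriv v x DERIV_divide G psi_deriv) auto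
    moreover have "((\<mu> + 2 * c) * (\<psi> x * v x) * \<psi> x - G x * \<psi>' x) / (\<psi> x * \<psi> x) = (\<mu> + 2 * c) * v x - G x * \<psi>' x / (\<psi> x)\<^sup>2"
      using psi_pos[OF x] by (simp add: diff_divide_distrib power2_eq_square)
    moreover have "(\<psi>' x * - (G x / (\<psi> x)\<^sup>2) + (2 * c - 2 * \<psi> x) * v x) - ((\<mu> + 2 * c) * v x - G x * \<psi>' x / (\<psi> x)\<^sup>2)
      = - 2 * W x - \<mu> * v x" by (simp add: W_def algebra_simps)
    ultimately show ?thesis by simp
  qed
  have Sd: "(Sn has_real_derivative Cs x) (at x)" for x
    unfolding Sn_def[abs_def] Cs_def by (auto intro!: derivative_eq_intros simp: algebra_simps)
  have Cd: "(Cs has_real_derivative - 2 * Sn x) (at x)" for x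
    unfolding Sn_def Cs_def[abs_def] by (auto intro!: derivative_eq_intros simp: algebra_simps)
  \<comment> \<open>The interval from \<open>x0\<close> to the endpoint on the same side of 0 has
    length at most \<open>a\<close>, so the argument of the sine stays below
    \<open>pi\<close>.\<close>
  define p q where "p = (if x0 \<ge> 0 then x0 else - a)" and "q = (if x0 \<ge> 0 then a else x0)"
  have pq: "p < q" "{p<..<q} \<subseteq> I" using x0(1) by (auto simp: p_def q_def I_def)
  have inI: "x \<in> I" if "p < x" "x < q" for x using pq that by auto
  have sin_nz: "sin (sqrt 2 * t) \<noteq> 0" if "t \<noteq> 0" "\<bar>t\<bar> \<le> a" for t
  proof -
    have "sqrt 2 * \<bar>t\<bar> < pi" using mult_left_mono[OF that(2), of "sqrt 2"] api
      by (metis order_le_less_trans real_sqrt_ge_0_iff zero_le_numeral)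
    then have "sin (sqrt 2 * \<bar>t\<bar>) > 0" using that by (intro sin_gt_zero) auto
    then show ?thesis by (cases "t \<ge> 0") auto
  qed
  have Snz: "Sn x \<noteq> 0" if "p < x" "x < q" for x
    unfolding Sn_def using that x0(1) by (intro sin_nz) (auto simp: p_def q_def I_def split: if_splits)
  \<comment> \<open>Picone's function: differentiated along \<open>W'' = - 2 W - \<mu> v\<close>, it
    yields a perfect square plus \<open>- \<mu> \<psi> v^2\<close>, both nonnegative for
    \<open>\<mu> \<le> 0\<close>.\<close>
  define R where "R x = W x * W' x - (W x)\<^sup>2 * Cs x / Sn x" for x
  define R' where "R' x = (W' x - W x * Cs x / Sn x)\<^sup>2 + (- \<mu>) * (\<psi> x * (v x)\<^sup>2)" for x
  have Rd: "(R has_real_derivative R' x) (at x)" if x: "p < x" "x < q" for x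
  proof -
    note xI = inI[OF x]
    have "(R has_real_derivative (W x * (- 2 * W x - \<mu> * v x) + W' x * W' x)
       - (((W x)\<^sup>2 * (- 2 * Sn x) + (2 * W x * W' x) * Cs x) * Sn x - (W x)\<^sup>2 * Cs x * Cs x) / (Sn x * Sn x)) (at x)"
      unfolding R_def[abs_def] power2_eq_square
      by (rule derivative_eq_intros Wd[OF xI] W'd[OF xI] Sd Cd Snz[OF x] refl | simp add: algebra_simps)+
    moreover have "(W x * (- 2 * W x - \<mu> * v x) + W' x * W' x)
       - (((W x)\<^sup>2 * (- 2 * Sn x) + (2 * W x * W' x) * Cs x) * Sn x - (W x)\<^sup>2 * Cs x * Cs x) / (Sn x * Sn x) = R' x"
      using Snz[OF x] by (simp add: R'_def W_def power2_eq_square field_simps)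
    ultimately show ?thesis by simp
  qed
  have R'nn: "R' x \<ge> 0" if "p < x" "x < q" for x
    unfolding R'_def using \<mu>0 psi_pos[OF inI[OF that]]
    by (intro add_nonneg_nonneg mult_nonneg_nonneg) auto
  \<comment> \<open>At \<open>x0\<close> both \<open>W\<close> and \<open>Sn\<close> vanish, the
    latter with nonzero derivative; the difference quotients give a finite limit of
    \<open>W / Sn\<close>, which is multiplied by \<open>W\<close>.\<close>
  have lim0: "(R \<longlongrightarrow> 0) (at x0)"
  proof -
    have Wc: "(W \<longlongrightarrow> W x0) (at x0)" "(W' \<longlongrightarrow> W' x0) (at x0)"
      using DERIV_isCont[OF Wd[OF x0(1)]] DERIV_isCont[OF W'd[OF x0(1)]] by (auto simp: isCont_def)
    have Cc: "(Cs \<longlongrightarrow> Cs x0) (at x0)" using DERIV_isCont[OF Cd] by (auto simp: isCont_def)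
    have W0: "W x0 = 0" using x0 by (simp add: W_def)
    have S0: "Sn x0 = 0" "Cs x0 \<noteq> 0" by (simp_all add: Sn_def Cs_def)
    have "((\<lambda>h. W (x0 + h) / h) \<longlongrightarrow> W' x0) (at 0)" "((\<lambda>h. Sn (x0 + h) / h) \<longlongrightarrow> Cs x0) (at 0)"
      using Wd[OF x0(1)] Sd[of x0] W0 S0 by (simp_all add: DERIV_def)
    from tendsto_divide[OF this S0(2)]
    have "((\<lambda>h. W (x0 + h) / h / (Sn (x0 + h) / h)) \<longlongrightarrow> W' x0 / Cs x0) (at 0)" .
    moreover have "\<forall>\<^sub>F h in at 0. W (x0 + h) / h / (Sn (x0 + h) / h) = W (x0 + h) / Sn (x0 + h)"
      by (auto simp: eventually_at_filter)
    ultimately have "((\<lambda>h. W (x0 + h) / Sn (x0 + h)) \<longlongrightarrow> W' x0 / Cs x0) (at 0)"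
      by (rule Lim_transform_eventually)
    then have q: "((\<lambda>x. W x / Sn x) \<longlongrightarrow> W' x0 / Cs x0) (at x0)" by (simp add: LIM_offset_zero_iff[of x0])
    have "((\<lambda>x. W x * W' x - W x * Cs x * (W x / Sn x)) \<longlongrightarrow> W x0 * W' x0 - W x0 * Cs x0 * (W' x0 / Cs x0)) (at x0)"
      by (intro tendsto_intros Wc Cc q)
    then show ?thesis using W0 by (simp add: R_def[abs_def] power2_eq_square mult_ac)
  qed
  have limW: "((\<lambda>x. W x) \<longlongrightarrow> 0) Fl" and limR: "(R \<longlongrightarrow> 0) Fl"
    if Fl: "(Fl = at_left a \<and> e = a \<and> x0 \<ge> 0) \<or> (Fl = at_right (- a) \<and> e = - a \<and> x0 < 0)" for Fl e
  proof -
    have le: "Fl \<le> at e" using Fl by (auto intro: at_le)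
    have ev: "\<forall>\<^sub>F x in Fl. x \<in> I" using Fl eventually_in_I by auto
    have 1: "((\<lambda>x. \<phi> x * v x) \<longlongrightarrow> 0) Fl" "((\<lambda>x. G x * v x) \<longlongrightarrow> 0) Fl" using Fl lim by auto
    have cont: "(f \<longlongrightarrow> f e) Fl" if "isCont f e" for f :: "real \<Rightarrow> real"
      using tendsto_mono[OF le] that by (auto simp: isCont_def)
    have "isCont \<psi>' e" "isCont \<psi> e" "isCont Cs e" "isCont Sn e" using DERIV_isCont psi'_deriv psi_deriv Cd Sd by blast+
    then have c: "(\<psi>' \<longlongrightarrow> \<psi>' e) Fl" "(\<psi> \<longlongrightarrow> \<psi> e) Fl" "(Cs \<longlongrightarrow> Cs e) Fl" "(Sn \<longlongrightarrow> Sn e) Fl" by (auto intro: cont)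
    have ph: "(\<phi> \<longlongrightarrow> \<phi> e) Fl" unfolding \<phi>_def by (intro tendsto_intros c)
    have Se: "Sn e \<noteq> 0" unfolding Sn_def using Fl x0(1) by (intro sin_nz) (auto simp: I_def)
    have "((\<lambda>x. \<phi> x * (\<phi> x * v x)) \<longlongrightarrow> \<phi> e * 0) Fl" by (intro tendsto_intros ph 1)
    moreover have "\<forall>\<^sub>F x in Fl. \<phi> x * (\<phi> x * v x) = W x"
      using ev by eventually_elim (simp add: W_def phi_sq[symmetric])
    ultimately show "((\<lambda>x. W x) \<longlongrightarrow> 0) Fl" using Lim_transform_eventually by fastforce
    \<comment> \<open>\<open>R\<close> is rewritten so that every term contains
      \<open>\<phi> v\<close> or \<open>G v\<close>, which tend to 0, while the remaining factors
      are continuous at the endpoint.\<close>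
    have "((\<lambda>x. (\<phi> x * v x) * (\<phi> x * v x) * \<psi>' x - G x * v x - (\<phi> x * v x) * (\<phi> x * v x) * \<psi> x * (Cs x / Sn x))
       \<longlongrightarrow> 0 * 0 * \<psi>' e - 0 - 0 * 0 * \<psi> e * (Cs e / Sn e)) Fl" by (intro tendsto_intros 1 c Se)
    moreover have "\<forall>\<^sub>F x in Fl. (\<phi> x * v x) * (\<phi> x * v x) * \<psi>' x - G x * v x - (\<phi> x * v x) * (\<phi> x * v x) * \<psi> x * (Cs x / Sn x) = R x"
      using ev
    proof eventually_elim
      case (elim x)
      have sq: "(\<phi> x * v x) * (\<phi> x * v x) = \<psi> x * (v x * v x)" by (simp add: phi_sq[OF elim, symmetric])
      show ?case unfolding sq using psi_pos[OF elim]
        by (simp add: R_def W_def W'_def power2_eq_square algebra_simps)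
    qed
    ultimately show "(R \<longlongrightarrow> 0) Fl" using Lim_transform_eventually by fastforce
  qed
  have Rq: "(R \<longlongrightarrow> 0) (at_left q)" and Rp: "(R \<longlongrightarrow> 0) (at_right p)"
    using lim0 limR[of "at_left a" a] limR[of "at_right (- a)" "- a"]
    by (auto simp: p_def q_def filterlim_at_split)
  have riccati: "W' x - W x * Cs x / Sn x = 0" if x: "p < x" "x < q" for x
  proof -
    have "R' x = 0" by (rule monotone_zero_boundary(2)[OF Rd R'nn Rq Rp x])
    moreover have "0 \<le> (- \<mu>) * (\<psi> x * (v x)\<^sup>2)" using \<mu>0 psi_pos[OF inI[OF x]] by (intro mult_nonneg_nonneg) auto
    ultimately have "(W' x - W x * Cs x / Sn x)\<^sup>2 \<le> 0" unfolding R'_def by linarith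
    then show ?thesis by simp
  qed
  define y where "y = (p + q) / 2"
  have y: "p < y" "y < q" using pq by (auto simp: y_def)
  have const: "W x = (W y / Sn y) * Sn x" if x: "p < x" "x < q" for x
  proof -
    have "\<exists>k. \<forall>x\<in>{p<..<q}. W x / Sn x = k"
    proof (rule has_field_derivative_zero_constant[of "{p<..<q}"])
      fix x assume "x \<in> {p<..<q}"
      then have x: "p < x" "x < q" by auto
      have "((\<lambda>x. W x / Sn x) has_real_derivative (W' x * Sn x - W x * Cs x) / (Sn x * Sn x)) (at x)"
        by (rule DERIV_divide[OF Wd[OF inI[OF x]] Sd Snz[OF x]])
      moreover have "W' x * Sn x - W x * Cs x = 0" 
        using arg_cong[OF riccati[OF x], of "\<lambda>t. t * Sn x"] Snz[OF x] by (simp add: left_diff_distrib)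
      ultimately show "((\<lambda>x. W x / Sn x) has_field_derivative 0) (at x within {p<..<q})"
        by (metis div_0 has_field_derivative_at_within)
    qed simp
    then obtain k where "\<And>x. p < x \<Longrightarrow> x < q \<Longrightarrow> W x / Sn x = k" by auto
    then have "W x / Sn x = W y / Sn y" using x y by metis
    then show ?thesis using Snz[OF x] by (simp add: field_simps)
  qed
  \<comment> \<open>At the endpoint \<open>W\<close> tends to 0 and \<open>Sn\<close> does not, so
    the constant ratio is 0. Then \<open>v\<close> and \<open>G\<close> vanish at an interior point,
    and uniqueness contradicts the choice of \<open>x1\<close>.\<close>
  have "W y / Sn y = 0"
  proof -
    define Fl e where "Fl = (if x0 \<ge> 0 then at_left a else at_right (- a))" and "e = (if x0 \<ge> 0 then a else - a)"
    then have Fl: "(Fl = at_left a \<and> e = a \<and> x0 \<ge> 0) \<or> (Fl = at_right (- a) \<and> e = - a \<and> x0 < 0)" by auto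
    have Fn: "Fl \<noteq> bot" unfolding Fl_def by simp
    have "isCont Sn e" using Sd DERIV_isCont by blast
    then have "(Sn \<longlongrightarrow> Sn e) Fl" using Fl tendsto_mono[of Fl "at e" Sn "Sn e"] by (auto simp: isCont_def intro: at_le)
    then have "((\<lambda>x. (W y / Sn y) * Sn x) \<longlongrightarrow> (W y / Sn y) * Sn e) Fl" by (intro tendsto_intros)
    moreover have "\<forall>\<^sub>F x in Fl. (W y / Sn y) * Sn x = W x"
    proof -
      have "\<forall>\<^sub>F x in Fl. p < x \<and> x < q"
        using Fl x0(1) unfolding p_def q_def I_def
        by (auto simp: eventually_at_left_field eventually_at_right_field intro: exI[of _ x0])
      then show ?thesis by eventually_elim (use const in auto)
    qed
    ultimately have "(W \<longlongrightarrow> (W y / Sn y) * Sn e) Fl" by (rule Lim_transform_eventually)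
    from tendsto_unique[OF Fn this limW[OF Fl]] have "(W y / Sn y) * Sn e = 0" .
    moreover have "Sn e \<noteq> 0" unfolding Sn_def using Fl x0(1) by (intro sin_nz) (auto simp: I_def)
    ultimately show ?thesis by simp
  qed
  then have W0: "W x = 0" if "p < x" "x < q" for x 
    using const[OF that] by (simp only: mult_zero_left)
  then have v0: "v x = 0" if "p < x" "x < q" for x using that psi_pos[OF inI[OF that]] by (fastforce simp: W_def)
  have "((\<lambda>x. 0) has_real_derivative - (G y / (\<psi> y)\<^sup>2)) (at y)"
    by (rule has_field_derivative_transform_within_open[OF v[OF inI[OF y]], of "{p<..<q}"]) (use y v0 in auto)
  then have "- (G y / (\<psi> y)\<^sup>2) = 0" using DERIV_unique[OF _ DERIV_const] by blast
  then have G0: "G y = 0" using psi_pos[OF inI[OF y]] by simp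
  have "complex_of_real (v x1) = 0"
  proof (rule solution_unique[where v = "\<lambda>x. of_real (v x)" and G = "\<lambda>x. of_real (G x)" and z = "of_real (\<mu> + 2 * c)", OF _ _ inI[OF y]])
    show "((\<lambda>x. complex_of_real (v x)) has_vector_derivative - (of_real (G x) / (of_real (\<psi> x))\<^sup>2)) (at x)" if "x \<in> I" for x
      using has_vector_derivative_of_real[OF v[OF that], where ?'a = complex] by simp
    show "((\<lambda>x. complex_of_real (G x)) has_vector_derivative of_real (\<mu> + 2 * c) * (of_real (\<psi> x) * of_real (v x))) (at x)" if "x \<in> I" for x
      using has_vector_derivative_of_real[OF G[OF that], where ?'a = complex] by simp
  qed (use v0[OF y] G0 nz in auto)
  then show False using nz by simp
qed

text \<open>The Sturm comparison concerns real functions. Since the parameter is real, real and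
  imaginary parts solve the system separately; they are the real parts after multiplication by 1 and
  by \<open>- \<i>\<close>, and one of them is nonzero at \<open>x1\<close>.\<close>

lemma eigenvalue_pos:
  assumes api: "sqrt 2 * a < pi" and s: "solution (of_real \<mu> + 2 * of_real c) v G" and \<mu>: "\<mu> + 2 * c > 0"
    and nz: "x1 \<in> I" "v x1 \<noteq> 0"
  shows "\<mu> > 0"
proof -
  have main: "\<mu> > 0" if l: "l \<in> {1, - \<i>}" and n: "Re (l * v x1) \<noteq> 0" for l
  proof (rule solution_energy_pos[where v = "\<lambda>x. Re (l * v x)" and G = "\<lambda>x. Re (l * G x)", OF api _ _ _ _ _ _ _ _ nz(1) n \<mu>])
    show "((\<lambda>x. Re (l * v x)) has_real_derivative - (Re (l * G x) / (\<psi> x)\<^sup>2)) (at x)" if "x \<in> I" for x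
    proof -
      have "- (Re (l * G x) / (\<psi> x)\<^sup>2) = Re (l * - (G x / (of_real (\<psi> x))\<^sup>2))"
        by (simp flip: of_real_power add: Re_divide_of_real)
      then show ?thesis
        using hvd_Re[OF has_vector_derivative_mult_right[OF solutionD(1)[OF s that], of l]] by simp
    qed
    show "((\<lambda>x. Re (l * G x)) has_real_derivative (\<mu> + 2 * c) * (\<psi> x * Re (l * v x))) (at x)" if "x \<in> I" for x
    proof -
      have "l * ((of_real \<mu> + 2 * of_real c) * (of_real (\<psi> x) * v x)) = of_real ((\<mu> + 2 * c) * \<psi> x) * (l * v x)"
        by (simp add: mult_ac)
      then have "Re (l * ((of_real \<mu> + 2 * of_real c) * (of_real (\<psi> x) * v x))) = (\<mu> + 2 * c) * (\<psi> x * Re (l * v x))"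
        by (simp only: Re_complex_of_real times_complex.sel Im_complex_of_real mult_zero_left diff_zero mult.assoc)
      then show ?thesis
        using hvd_Re[OF has_vector_derivative_mult_right[OF solutionD(2)[OF s that], of l]] by simp
    qed
    have z: "((\<lambda>x. Re (l * f x)) \<longlongrightarrow> 0) Q" if "(f \<longlongrightarrow> 0) Q" for f and Q :: "real filter"
      using tendsto_Re[OF tendsto_mult[OF tendsto_const that, of l]] by simp
    show "((\<lambda>x. Re (l * G x)) \<longlongrightarrow> 0) (at_left a)" "((\<lambda>x. Re (l * G x)) \<longlongrightarrow> 0) (at_right (- a))"
      by (intro z solution_boundary[OF s])+
    have "Re (l * (of_real (\<phi> x) * v x)) = \<phi> x * Re (l * v x)" for x
      by (simp add: algebra_simps)
    then show "((\<lambda>x. \<phi> x * Re (l * v x)) \<longlongrightarrow> 0) (at_left a)" "((\<lambda>x. \<phi> x * Re (l * v x)) \<longlongrightarrow> 0) (at_right (- a))"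
      using z[OF solution_boundary(3)[OF s]] z[OF solution_boundary(4)[OF s]] by simp_all
    have cb: "norm (Re (l * G x) * Re (l * v x)) \<le> cmod (G x * cnj (v x))" for x
    proof -
      have "cmod l = 1" using l by auto
      then have "\<bar>Re (l * G x)\<bar> \<le> cmod (G x)" "\<bar>Re (l * v x)\<bar> \<le> cmod (v x)"
        using abs_Re_le_cmod[of "l * G x"] abs_Re_le_cmod[of "l * v x"] by (simp_all add: norm_mult)
      then show ?thesis by (simp add: norm_mult abs_mult mult_mono)
    qed
    show "((\<lambda>x. Re (l * G x) * Re (l * v x)) \<longlongrightarrow> 0) (at_left a)"
      by (rule Lim_null_comparison[OF _ tendsto_norm_zero[OF solution_boundary(5)[OF s]]]) (rule always_eventually[OF allI[OF cb]])
    show "((\<lambda>x. Re (l * G x) * Re (l * v x)) \<longlongrightarrow> 0) (at_right (- a))"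
      by (rule Lim_null_comparison[OF _ tendsto_norm_zero[OF solution_boundary(6)[OF s]]]) (rule always_eventually[OF allI[OF cb]])
  qed
  have "Re (1 * v x1) \<noteq> 0 \<or> Re (- \<i> * v x1) \<noteq> 0" using nz(2) by (auto simp: complex_eq_iff)
  then show ?thesis using main[of 1] main[of "- \<i>"] by auto
qed


subsection \<open>Spectral decomposition\<close>

text \<open>For \<open>h\<close> orthogonal to \<open>\<phi>\<close>, the functions
  \<open>N h\<close> and \<open>V h = - \<phi> J h\<close> differ by a multiple of
  \<open>\<phi>\<close>, which the free constant absorbs.\<close>

lemma T_iff_N:
  "(u, f) \<in> T \<longleftrightarrow> u \<in> L2 M \<and> f \<in> L2 M \<and> F (\<lambda>x. f x + 2 * of_real c * u x) a = 0 \<and>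
     (\<exists>\<beta>. AE x in M. u x = \<beta> * of_real (\<phi> x) + N (\<lambda>x. f x + 2 * of_real c * u x) x)"
proof -
  define h where "h x = f x + 2 * of_real c * u x" for x
  have "(\<exists>\<alpha>. AE x in M. u x = of_real (\<phi> x) * (\<alpha> - J h x)) \<longleftrightarrow>
      (\<exists>\<beta>. AE x in M. u x = \<beta> * of_real (\<phi> x) + N h x)" if "F h a = 0"
  proof -
    have eq: "of_real (\<phi> x) * (\<alpha> - J h x) = (\<alpha> + phi_coeff (V h)) * of_real (\<phi> x) + N h x" for \<alpha> x
      using Q_id[OF that] by (simp add: N_def Q_def[of "V h"] V_def[of h x] algebra_simps)
    show ?thesis
    proof
      assume "\<exists>\<beta>. AE x in M. u x = \<beta> * of_real (\<phi> x) + N h x"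
      then obtain \<beta> where b: "AE x in M. u x = \<beta> * of_real (\<phi> x) + N h x" by blast
      have "AE x in M. u x = of_real (\<phi> x) * ((\<beta> - phi_coeff (V h)) - J h x)"
        unfolding eq using b by simp
      then show "\<exists>\<alpha>. AE x in M. u x = of_real (\<phi> x) * (\<alpha> - J h x)" by blast
    qed (unfold eq, blast)
  qed
  then show ?thesis unfolding T_iff canonical_def h_def[symmetric] by blast
qed

lemma AE_M_witness:
  assumes "AE x in M. P x" "- a \<le> p" "p < q" "q \<le> a"
  shows "\<exists>x\<in>I. p < x \<and> x < q \<and> P x"
proof (rule ccontr)
  assume no: "\<not> ?thesis"
  have "AE x in lebesgue. x \<in> I \<longrightarrow> P x" using assms(1) by (simp add: AE_restrict_space_iff)
  then have "AE x in lebesgue. x \<notin> {p<..<q}"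
    by eventually_elim (use no assms in \<open>auto simp: I_def\<close>)
  then have "{p<..<q} \<in> null_sets lebesgue" by (subst (asm) AE_iff_null_sets[symmetric]) auto
  then show False using interval_not_null[OF assms(3)] by simp
qed

lemma F_add_phi:
  assumes "h \<in> L2 M"
  shows "F (\<lambda>x. \<beta> * of_real (\<phi> x) + h x) a = \<beta> * of_real (norm_phi\<^sup>2) + F h a"
  using F_add[OF L2_cmult[OF phi_L2] assms, of \<beta> a] by (simp add: F_cmult F_phi)

text \<open>For a nonzero shifted eigenvalue the solvability condition says that \<open>u\<close> is
  orthogonal to \<open>\<phi>\<close>; so is \<open>N u\<close>, and therefore the coefficient
  \<beta> vanishes.\<close>

lemma eigen_iff:
  assumes z: "\<mu> + 2 * of_real c \<noteq> 0"
  shows "u \<in> eigenspace T \<mu> \<longleftrightarrow> u \<in> L2 M \<and> (AE x in M. u x = (\<mu> + 2 * of_real c) * N u x)"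
proof -
  define z where "z = \<mu> + 2 * of_real c"
  have heq: "(\<lambda>x. \<mu> * u x + 2 * of_real c * u x) = (\<lambda>x. z * u x)" by (simp add: z_def algebra_simps)
  have Nz: "AE x in M. N (\<lambda>x. z * u x) x = z * N u x" if "u \<in> L2 M"
    using N_cmult[OF that] by (auto intro: AE_I2)
  show ?thesis unfolding z_def[symmetric] eigenspace_def mem_Collect_eq T_iff_N heq F_cmult
  proof (intro iffI conjI)
    assume *: "u \<in> L2 M \<and> (\<lambda>x. \<mu> * u x) \<in> L2 M \<and> z * F u a = 0 \<and>
      (\<exists>\<beta>. AE x in M. u x = \<beta> * of_real (\<phi> x) + N (\<lambda>x. z * u x) x)"
    then show u: "u \<in> L2 M" by blast
    from * obtain \<beta> where "AE x in M. u x = \<beta> * of_real (\<phi> x) + N (\<lambda>x. z * u x) x" by blast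
    with Nz[OF u] have b: "AE x in M. u x = \<beta> * of_real (\<phi> x) + z * N u x" by eventually_elim simp
    have zN: "(\<lambda>x. z * N u x) \<in> L2 M" by (rule L2_cmult[OF N_L2[OF u]])
    have "F u a = F (\<lambda>x. \<beta> * of_real (\<phi> x) + z * N u x) a"
      by (rule F_cong_AE[OF u L2_add[OF L2_cmult[OF phi_L2] zN] b])
    moreover have "F u a = 0" using * z by (simp add: z_def)
    ultimately have "\<beta> * of_real (norm_phi\<^sup>2) = 0" by (simp only: F_add_phi[OF zN] F_cmult F_N[OF u]) simp
    then have "\<beta> = 0" using norm_phi_pos by simp
    then show "AE x in M. u x = z * N u x" using b by simp
  next
    assume *: "u \<in> L2 M \<and> (AE x in M. u x = z * N u x)"
    then have u: "u \<in> L2 M" by blast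
    then show "u \<in> L2 M" "(\<lambda>x. \<mu> * u x) \<in> L2 M" by (auto intro: L2_cmult)
    have "F u a = F (\<lambda>x. z * N u x) a" using * L2_cmult[OF N_L2[OF u]] by (intro F_cong_AE) auto
    then show "z * F u a = 0" by (simp add: F_cmult F_N[OF u])
    have "AE x in M. u x = 0 * of_real (\<phi> x) + N (\<lambda>x. z * u x) x"
      using conjunct2[OF *] Nz[OF u] by eventually_elim simp
    then show "\<exists>\<beta>. AE x in M. u x = \<beta> * of_real (\<phi> x) + N (\<lambda>x. z * u x) x" by blast
  qed
qed

lemma eigen_ground_iff:
  "u \<in> eigenspace T (of_real (- 2 * c)) \<longleftrightarrow> u \<in> L2 M \<and> (\<exists>\<beta>. AE x in M. u x = \<beta> * of_real (\<phi> x))"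
proof -
  have heq: "(\<lambda>x. of_real (- 2 * c) * u x + 2 * of_real c * u x) = (\<lambda>x. 0 * u x)" by simp
  have "AE x in M. N (\<lambda>x. 0 * u x) x = 0" if "u \<in> L2 M"
    using N_cmult[OF that, of _ 0] by (auto intro: AE_I2)
  then have "(AE x in M. u x = \<beta> * of_real (\<phi> x) + N (\<lambda>x. 0 * u x) x) \<longleftrightarrow> (AE x in M. u x = \<beta> * of_real (\<phi> x))"
    if "u \<in> L2 M" for \<beta>
    using that by (intro eventually_subst) (auto elim: eventually_mono)
  then show ?thesis
    unfolding eigenspace_def mem_Collect_eq T_iff_N heq F_cmult using L2_cmult[of u M "of_real (- 2 * c)"] by auto
qed

lemma eigenspace_L2: "u \<in> eigenspace T \<mu> \<Longrightarrow> u \<in> L2 M"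
  unfolding eigenspace_def T_iff_N by blast

lemma ground_eigenfunction: "eigenfunction M T (of_real (- 2 * c)) cphi"
proof -
  have "\<not> (AE x in M. complex_of_real (\<phi> x) = 0)" using not_AE_zero_I phi_nonzero by blast
  moreover have "AE x in M. complex_of_real (\<phi> x) = 1 * of_real (\<phi> x)" by simp
  then have "cphi \<in> eigenspace T (of_real (- 2 * c))" unfolding eigen_ground_iff using phi_L2 by blast
  ultimately show ?thesis by (simp add: eigenfunction_def)
qed

lemma eigenfunction_factor_nonzero:
  assumes "eigenfunction M T \<mu> u" and uv: "AE x in M. u x = of_real (\<phi> x) * v x"
  obtains x where "x \<in> I" "v x \<noteq> 0"
proof (rule ccontr)
  assume "\<not> thesis"
  then have "v x = 0" if "x \<in> I" for x using that \<open>\<And>x. x \<in> I \<Longrightarrow> v x \<noteq> 0 \<Longrightarrow> thesis\<close> by blast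
  then have "AE x in M. v x = 0" by (intro AE_I2) simp
  with uv have "AE x in M. u x = 0" by eventually_elim simp
  then show False using assms by (simp add: eigenfunction_def)
qed

lemma eigenfunction_real:
  assumes "eigenfunction M T \<mu> u"
  shows "\<mu> \<in> \<real>" "- 2 * c \<le> Re \<mu>"
proof -
  have "(u, \<lambda>x. \<mu> * u x) \<in> T" using assms by (simp add: eigenfunction_def eigenspace_def)
  then obtain v G where s: "solution (\<mu> + 2 * of_real c) v G" and uv: "AE x in M. u x = of_real (\<phi> x) * v x"
    by (rule eigenfunction_solution)
  obtain x0 where "x0 \<in> I" "v x0 \<noteq> 0" by (rule eigenfunction_factor_nonzero[OF assms uv])
  from solution_parameter[OF s this] show "\<mu> \<in> \<real>" "- 2 * c \<le> Re \<mu>" by (simp_all add: complex_is_Real_iff)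
qed

lemma eigenfunction_simple:
  assumes "eigenfunction M T \<mu> u"
  shows "simple_eigenfunction M T \<mu> u"
proof -
  have "\<exists>k. AE x in M. w x = k * u x" if w: "w \<in> eigenspace T \<mu>" for w
  proof -
    have "(u, \<lambda>x. \<mu> * u x) \<in> T" using assms by (simp add: eigenfunction_def eigenspace_def)
    then obtain v1 G1 where s1: "solution (\<mu> + 2 * of_real c) v1 G1" and u: "AE x in M. u x = of_real (\<phi> x) * v1 x"
      by (rule eigenfunction_solution)
    have "(w, \<lambda>x. \<mu> * w x) \<in> T" using w by (simp add: eigenspace_def)
    then obtain v2 G2 where s2: "solution (\<mu> + 2 * of_real c) v2 G2" and w: "AE x in M. w x = of_real (\<phi> x) * v2 x"
      by (rule eigenfunction_solution)
    obtain x1 where "x1 \<in> I" "v1 x1 \<noteq> 0" by (rule eigenfunction_factor_nonzero[OF assms u])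
    then obtain k where k: "\<And>x. x \<in> I \<Longrightarrow> v2 x = k * v1 x" using solutions_proportional[OF s1 s2] by blast
    then have "AE x in M. v2 x = k * v1 x" by (auto intro: AE_I2)
    with u w have "AE x in M. w x = k * u x" by eventually_elim simp
    then show ?thesis by blast
  qed
  then show ?thesis using assms by (simp add: simple_eigenfunction_def)
qed

lemma eigen_emb_iff:
  assumes z: "\<mu> + 2 * of_real c \<noteq> 0" and u: "u \<in> L2 M"
  shows "u \<in> eigenspace T \<mu> \<longleftrightarrow> emb I u = cscale (\<mu> + 2 * of_real c) (K (emb I u))"
  using u by (simp add: eigen_iff[OF z] K_emb emb_cmult[OF I_lebesgue N_L2, symmetric]
      emb_eq_iff[OF I_lebesgue u L2_cmult[OF N_L2]])

lemma fixed_point_emb: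
  assumes "X = cscale z (K X)"
  obtains u where "u \<in> L2 M" "X = emb I u"
proof
  show "(\<lambda>x. z * N (rep_l2 X) x) \<in> L2 M" by (rule L2_cmult[OF N_L2[OF rep_L2]])
  have "X = cscale z (emb I (N (rep_l2 X)))" using assms by (simp add: K_def)
  then show "X = emb I (\<lambda>x. z * N (rep_l2 X) x)" by (simp add: emb_cmult[OF I_lebesgue N_L2[OF rep_L2]])
qed

lemma fixed_point_eigen:
  assumes X: "X = cscale z (K X)" and z: "z \<noteq> 0"
  obtains u where "u \<in> eigenspace T (z - 2 * of_real c)" "X = emb I u"
proof -
  obtain u where u: "u \<in> L2 M" "X = emb I u" by (rule fixed_point_emb[OF X])
  have "u \<in> eigenspace T (z - 2 * of_real c)" using eigen_emb_iff[of "z - 2 * of_real c" u] u X z by simp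
  then show ?thesis using that u by blast
qed

abbreviation E :: "complex set" where "E \<equiv> eigenvalues M T"

lemma eigenvalueE:
  assumes "\<mu> \<in> E"
  obtains u where "eigenfunction M T \<mu> u"
  using assms by (auto simp: eigenvalues_def)

lemma eigenfunction_emb:
  assumes "eigenfunction M T \<mu> u"
  shows "u \<in> L2 M" "emb I u \<noteq> 0"
    "\<mu> \<noteq> of_real (- 2 * c) \<Longrightarrow> Re \<mu> + 2 * c > 0" "\<mu> \<noteq> of_real (- 2 * c) \<Longrightarrow> K (emb I u) = (1 / (Re \<mu> + 2 * c)) *\<^sub>R emb I u"
proof -
  show u: "u \<in> L2 M" using assms eigenspace_L2 by (auto simp: eigenfunction_def)
  show "emb I u \<noteq> 0" using assms by (simp add: emb_eq_0_iff[OF I_lebesgue u] eigenfunction_def)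
  assume ne: "\<mu> \<noteq> of_real (- 2 * c)"
  have r: "\<mu> = of_real (Re \<mu>)" using eigenfunction_real(1)[OF assms] by (simp add: complex_is_Real_iff complex_eq_iff)
  have "Re \<mu> \<noteq> - 2 * c" using ne r by metis
  then show pos: "Re \<mu> + 2 * c > 0" using eigenfunction_real(2)[OF assms] by simp
  have zeq: "\<mu> + 2 * of_real c = of_real (Re \<mu> + 2 * c)" using r by simp
  have z: "\<mu> + 2 * of_real c \<noteq> 0" unfolding zeq using pos by (simp only: of_real_eq_0_iff)
  have "emb I u = cscale (of_real (Re \<mu> + 2 * c)) (K (emb I u))"
    using eigen_emb_iff[OF z u] assms unfolding zeq by (simp add: eigenfunction_def)
  then have "emb I u = (Re \<mu> + 2 * c) *\<^sub>R K (emb I u)" by (simp only: cscale_of_real)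
  then have "(1 / (Re \<mu> + 2 * c)) *\<^sub>R emb I u = (1 / (Re \<mu> + 2 * c)) *\<^sub>R ((Re \<mu> + 2 * c) *\<^sub>R K (emb I u))" by simp
  then show "K (emb I u) = (1 / (Re \<mu> + 2 * c)) *\<^sub>R emb I u" using pos by simp
qed

text \<open>Apart from the ground state, an eigenvalue \<mu> becomes the eigenvalue
  \<open>1 / (Re \<mu> + 2 * c)\<close> of \<open>K\<close>. A bound \<open>R\<close> from above
  turns into a positive lower bound there, and only finitely many orthonormal eigenvectors satisfy
  it.\<close>

lemma eigenvalues_finite: "finite {\<mu> \<in> E. Re \<mu> \<le> R}"
proof -
  define A where "A = {\<mu> \<in> E. Re \<mu> \<le> R \<and> \<mu> \<noteq> of_real (- 2 * c)}"
  define f where "f \<mu> = (SOME u. eigenfunction M T \<mu> u)" for \<mu>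
  have f: "eigenfunction M T \<mu> (f \<mu>)" if "\<mu> \<in> E" for \<mu>
  proof -
    have "\<exists>u. eigenfunction M T \<mu> u" using that by (simp add: eigenvalues_def)
    then show ?thesis unfolding f_def by (rule someI_ex)
  qed
  define X where "X \<mu> = (1 / norm (emb I (f \<mu>))) *\<^sub>R emb I (f \<mu>)" for \<mu>
  have X: "norm (X \<mu>) = 1" "Re \<mu> + 2 * c > 0" "K (X \<mu>) = (1 / (Re \<mu> + 2 * c)) *\<^sub>R X \<mu>" if "\<mu> \<in> A" for \<mu>
    using eigenfunction_emb[OF f, of \<mu>] that
    by (simp_all add: A_def X_def linear_cmul[OF K.linear_K])
  have orth: "inner (X \<mu>) (X \<nu>) = 0" if "\<mu> \<in> A" "\<nu> \<in> A" "\<mu> \<noteq> \<nu>" for \<mu> \<nu>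
  proof -
    have "\<mu> \<in> \<real>" "\<nu> \<in> \<real>" using that f eigenfunction_real(1) by (auto simp: A_def)
    then have "Re \<mu> \<noteq> Re \<nu>" using that(3) by (auto simp: complex_is_Real_iff complex_eq_iff)
    moreover have "1 / (Re \<mu> + 2 * c) * inner (X \<mu>) (X \<nu>) = 1 / (Re \<nu> + 2 * c) * inner (X \<mu>) (X \<nu>)"
      using K.sym[of "X \<mu>" "X \<nu>"] X(3)[OF that(1)] X(3)[OF that(2)] by simp
    ultimately show ?thesis using X(2)[OF that(1)] X(2)[OF that(2)] by (auto simp: field_simps)
  qed
  have inj: "inj_on X A"
  proof (rule inj_onI, rule ccontr)
    fix \<mu> \<nu> assume *: "\<mu> \<in> A" "\<nu> \<in> A" "X \<mu> = X \<nu>" "\<mu> \<noteq> \<nu>"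
    then have "inner (X \<mu>) (X \<mu>) = 0" using orth by fastforce
    then show False using X(1)[OF *(1)] by simp
  qed
  have "finite (X ` A)"
  proof (cases "A = {}")
    case False
    then obtain \<mu>0 where "\<mu>0 \<in> A" by blast
    then have R: "R + 2 * c > 0" using X(2) by (force simp: A_def)
    show ?thesis
    proof (rule K.finite_orthonormal_eigenvectors[of "1 / (R + 2 * c)"])
      show "pairwise (\<lambda>x y. inner x y = 0) (X ` A)" unfolding pairwise_def using orth by blast
      fix e assume "e \<in> X ` A"
      then obtain \<mu> where \<mu>: "\<mu> \<in> A" "e = X \<mu>" by blast
      have "1 / (R + 2 * c) \<le> 1 / (Re \<mu> + 2 * c)" using X(2)[OF \<mu>(1)] \<mu>(1) R
        by (intro divide_left_mono) (auto simp: A_def)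
      then have "1 / (R + 2 * c) \<le> \<bar>1 / (Re \<mu> + 2 * c)\<bar>" by linarith
      then show "norm e = 1 \<and> (\<exists>\<nu>. \<bar>\<nu>\<bar> \<ge> 1 / (R + 2 * c) \<and> K e = \<nu> *\<^sub>R e)" using X[OF \<mu>(1)] \<mu>(2) by blast
    qed (use R in simp)
  qed simp
  then have "finite A" using inj finite_imageD by blast
  moreover have "{\<mu> \<in> E. Re \<mu> \<le> R} \<subseteq> insert (of_real (- 2 * c)) A" by (auto simp: A_def)
  ultimately show ?thesis using finite_subset by blast
qed

lemma K_phi: "K (emb I cphi) = 0"
proof -
  have "Q cphi = Q (\<lambda>x. 0 * of_real (\<phi> x))"
  proof
    show "Q cphi x = Q (\<lambda>x. 0 * of_real (\<phi> x)) x" for x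
      using norm_phi_pos by (simp only: Q_cmult) (simp add: Q_def phi_coeff_def F_phi)
  qed
  then have "N cphi = N (\<lambda>x. 0 * of_real (\<phi> x))" by (simp only: N_def)
  then have "N cphi x = 0" if "x \<in> I" for x using N_cmult[OF phi_L2 that, of 0] by simp
  then have "AE x in M. N cphi x = 0" by (auto intro: AE_I2)
  then show ?thesis by (simp add: K_emb[OF phi_L2] emb_eq_0_iff[OF I_lebesgue N_L2[OF phi_L2]])
qed

lemma F_phi_coeff: "F h a = phi_coeff h * of_real (norm_phi\<^sup>2)"
  using norm_phi_pos by (simp add: phi_coeff_def)

section \<open>Resolvent and discreteness of the spectrum\<close>

text \<open>The component along \<open>\<phi>\<close> is fixed by the solvability condition,
  \<open>phi_coeff g + z * \<beta> = 0\<close>. The rest of \<open>T u - \<mu> u = g\<close> becomes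
  an equation for the identity minus \<open>z\<close> times the compact \<open>K\<close>.\<close>

lemma T_resolvent_equation:
  assumes T: "(u, f) \<in> T" and z: "z = \<mu> + 2 * of_real c" "z \<noteq> 0"
  defines "g \<equiv> \<lambda>x. f x - \<mu> * u x"
  shows "u \<in> L2 M" "g \<in> L2 M"
    "emb I u - cscale z (K (emb I u)) = cscale (- phi_coeff g / z) (emb I cphi) + K (emb I g)"
proof -
  have eq: "(\<lambda>x. f x + 2 * of_real c * u x) = (\<lambda>x. g x + z * u x)" by (simp add: g_def z algebra_simps)
  from T obtain \<beta> where u: "u \<in> L2 M" and f: "f \<in> L2 M" and 0: "F (\<lambda>x. g x + z * u x) a = 0"
    and b: "AE x in M. u x = \<beta> * of_real (\<phi> x) + N (\<lambda>x. g x + z * u x) x"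
    unfolding T_iff_N eq by blast
  have g: "g \<in> L2 M" unfolding g_def by (intro L2_diff f L2_cmult u)
  have zu: "(\<lambda>x. z * u x) \<in> L2 M" by (rule L2_cmult[OF u])
  have h: "(\<lambda>x. g x + z * u x) \<in> L2 M" by (rule L2_add[OF g zu])
  have "F u a = F (\<lambda>x. \<beta> * of_real (\<phi> x) + N (\<lambda>x. g x + z * u x) x) a"
    by (rule F_cong_AE[OF u L2_add[OF L2_cmult[OF phi_L2] N_L2[OF h]] b])
  then have Fu: "F u a = \<beta> * of_real (norm_phi\<^sup>2)" by (simp add: F_add_phi[OF N_L2[OF h]] F_N[OF h])
  have "(phi_coeff g + z * \<beta>) * of_real (norm_phi\<^sup>2) = 0"
    using 0 Fu F_phi_coeff[of g] by (simp add: F_add[OF g zu] F_cmult algebra_simps)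
  then have "phi_coeff g + z * \<beta> = 0" using norm_phi_pos by simp
  then have \<beta>: "\<beta> = - phi_coeff g / z" using z(2) by (simp add: field_simps eq_neg_iff_add_eq_0)
  have "emb I u = emb I (\<lambda>x. \<beta> * of_real (\<phi> x) + N (\<lambda>x. g x + z * u x) x)"
    using b by (simp add: emb_eq_iff[OF I_lebesgue u L2_add[OF L2_cmult[OF phi_L2] N_L2[OF h]]])
  also have "\<dots> = cscale \<beta> (emb I cphi) + K (emb I (\<lambda>x. g x + z * u x))"
    by (simp add: emb_add[OF I_lebesgue L2_cmult[OF phi_L2] N_L2[OF h]] emb_cmult[OF I_lebesgue phi_L2] K_emb[OF h])
  also have "K (emb I (\<lambda>x. g x + z * u x)) = K (emb I g) + cscale z (K (emb I u))"
    by (simp add: emb_add[OF I_lebesgue g zu] emb_cmult[OF I_lebesgue u] linear_add[OF K.linear_K] K_cscale)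
  finally show "emb I u - cscale z (K (emb I u)) = cscale (- phi_coeff g / z) (emb I cphi) + K (emb I g)"
    unfolding \<beta> by (metis add.assoc add_diff_cancel_right')
  show "u \<in> L2 M" "g \<in> L2 M" by fact+
qed

text \<open>The solution is defined by the right side of the equation, solved for \<open>X\<close>;
  this gives an actual function on \<open>I\<close>, vanishing off it after extension, whose class
  turns out to be \<open>X\<close>.\<close>

lemma resolvent_solution:
  assumes f: "f \<in> L2 M" and z: "z = \<mu> + 2 * of_real c" "z \<noteq> 0"
    and X: "X - cscale z (K X) = cscale (- phi_coeff f / z) (emb I cphi) + K (emb I f)"
  shows "\<exists>u. (u, \<lambda>x. f x + \<mu> * u x) \<in> T"
proof -
  define \<beta> where "\<beta> = - phi_coeff f / z"
  define u where "u x = (\<beta> * of_real (\<phi> x) + N f x) + z * N (rep_l2 X) x" for x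
  have b: "(\<lambda>x. \<beta> * of_real (\<phi> x)) \<in> L2 M" by (rule L2_cmult[OF phi_L2])
  have bN: "(\<lambda>x. \<beta> * of_real (\<phi> x) + N f x) \<in> L2 M" by (rule L2_add[OF b N_L2[OF f]])
  have zN: "(\<lambda>x. z * N (rep_l2 X) x) \<in> L2 M" by (rule L2_cmult[OF N_L2[OF rep_L2]])
  have u: "u \<in> L2 M" unfolding u_def[abs_def] by (rule L2_add[OF bN zN])
  have "emb I u = cscale \<beta> (emb I cphi) + K (emb I f) + cscale z (K X)"
    unfolding u_def[abs_def]
    by (simp add: emb_add[OF I_lebesgue bN zN] emb_add[OF I_lebesgue b N_L2[OF f]] emb_cmult[OF I_lebesgue phi_L2]
        emb_cmult[OF I_lebesgue N_L2[OF rep_L2]] K_emb[OF f] K_def[of X])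
  also have "\<dots> = X" using X by (simp add: \<beta>_def algebra_simps)
  finally have uX: "emb I u = X" .
  have "AE x in M. rep_l2 X x = u x" using emb_rep_emb[OF I_lebesgue u] unfolding uX .
  then have NX: "N (rep_l2 X) = N u" by (rule N_cong_AE[OF rep_L2 u])
  have zu: "(\<lambda>x. z * u x) \<in> L2 M" by (rule L2_cmult[OF u])
  define h where "h x = f x + z * u x" for x
  have heq: "(\<lambda>x. (f x + \<mu> * u x) + 2 * of_real c * u x) = h" by (simp add: h_def z algebra_simps fun_eq_iff)
  have "F u a = \<beta> * of_real (norm_phi\<^sup>2)"
    unfolding u_def[abs_def]
    by (simp add: F_add[OF bN zN] F_add_phi[OF N_L2[OF f]] F_N[OF f] F_cmult F_N[OF rep_L2])
  then have Fh: "F h a = 0"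
    unfolding h_def[abs_def] F_add[OF f zu] F_cmult using z(2) by (simp add: \<beta>_def F_phi_coeff[of f])
  have "AE x in M. u x = \<beta> * of_real (\<phi> x) + N h x"
    unfolding h_def[abs_def] using N_add[OF f zu] N_cmult[OF u, of _ z] by (intro AE_I2) (simp add: u_def NX)
  then have "(u, \<lambda>x. f x + \<mu> * u x) \<in> T"
    unfolding T_iff_N heq using u Fh L2_add[OF f L2_cmult[OF u]] by blast
  then show ?thesis by blast
qed

text \<open>Injectivity of the identity minus \<open>z K\<close> means that \<mu> is not an
  eigenvalue, and the Fredholm bound gives the resolvent estimate. For solvability it is enough to
  reach the class of \<open>\<phi>\<close> and \<open>K (emb I f)\<close>; the latter lies in the
  closed range because the range contains all eigenvectors of \<open>K\<close> for nonzero
  eigenvalues.\<close>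

lemma resolvent:
  assumes "\<mu> \<notin> E"
  shows "\<mu> \<in> resolvent_set M T"
proof -
  define z where "z = \<mu> + 2 * of_real c"
  have z: "z \<noteq> 0"
  proof
    assume "z = 0"
    then have "\<mu> = of_real (- 2 * c)" by (simp add: z_def eq_neg_iff_add_eq_0)
    then show False using assms ground_eigenfunction by (auto simp: eigenvalues_def)
  qed
  note Z = bounded_linear_cscale[of z]
  have inj: "X = 0" if X: "X = cscale z (K X)" for X
  proof -
    obtain u where u: "u \<in> eigenspace T (z - 2 * of_real c)" "X = emb I u" by (rule fixed_point_eigen[OF X z])
    then have "AE x in M. u x = 0" using assms by (auto simp: z_def eigenvalues_def eigenfunction_def)
    then show ?thesis using u eigenspace_L2[OF u(1)] by (simp add: emb_eq_0_iff[OF I_lebesgue])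
  qed
  obtain C where C: "C > 0" "\<And>X. norm X \<le> C * norm (X - cscale z (K X))"
    using K.fredholm_bounded_below[OF Z inj] by blast
  obtain B where B: "\<And>X. norm (K X) \<le> B * norm X" using K.norm_bound by blast
  define D where "D = C * (CF / norm_phi\<^sup>2 / cmod z * norm_phi + B)"
  have "L2_norm M u \<le> D * L2_norm M (\<lambda>x. g x - \<mu> * u x)" if "(u, g) \<in> T" for u g
  proof -
    define f where "f = (\<lambda>x. g x - \<mu> * u x)"
    note r = T_resolvent_equation[OF that z_def z, folded f_def]
    have "cmod (F f a) \<le> CF * L2_norm M f" using F_le[OF r(2), of a] a_pos by simp
    then have phi_coeff: "cmod (phi_coeff f) \<le> CF / norm_phi\<^sup>2 * L2_norm M f"
      using norm_phi_pos by (simp add: phi_coeff_def norm_divide divide_right_mono flip: of_real_power)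
    have "norm (cscale (- phi_coeff f / z) (emb I cphi)) = cmod (phi_coeff f) / cmod z * norm_phi"
      by (simp add: norm_cscale norm_divide norm_emb[OF I_lebesgue phi_L2] norm_phi_def)
    also have "\<dots> \<le> CF / norm_phi\<^sup>2 * L2_norm M f / cmod z * norm_phi"
      using norm_phi_pos by (intro mult_right_mono divide_right_mono phi_coeff) auto
    finally have 1: "norm (cscale (- phi_coeff f / z) (emb I cphi)) \<le> (CF / norm_phi\<^sup>2 / cmod z * norm_phi) * L2_norm M f"
      by (simp add: mult_ac)
    have 2: "norm (K (emb I f)) \<le> B * L2_norm M f" using B[of "emb I f"] by (simp add: norm_emb[OF I_lebesgue r(2)])
    have "L2_norm M u \<le> C * norm (cscale (- phi_coeff f / z) (emb I cphi) + K (emb I f))"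
      using C(2)[of "emb I u"] unfolding r(3) by (simp add: norm_emb[OF I_lebesgue r(1)])
    also have "\<dots> \<le> C * ((CF / norm_phi\<^sup>2 / cmod z * norm_phi) * L2_norm M f + B * L2_norm M f)"
      using C(1) norm_triangle_mono[OF 1 2] by (intro mult_left_mono) auto
    also have "\<dots> = D * L2_norm M f" by (simp add: D_def algebra_simps)
    finally show ?thesis by (simp add: f_def)
  qed
  moreover have "\<exists>(u, g) \<in> T. AE x in M. g x - \<mu> * u x = f x" if f: "f \<in> L2 M" for f
  proof -
    let ?A = "\<lambda>X. X - cscale z (K X)"
    have linA: "linear ?A"
      by (intro linear_compose_sub linear_ident linear_compose[OF K.linear_K, unfolded o_def] bounded_linear.linear[OF Z])
    then have sub: "subspace (range ?A)" by (intro linear_subspace_image) auto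
    \<comment> \<open>On an eigenvector the operator is multiplication by the complex number
      \<open>1 - z * of_real \<nu>\<close>. If this is 0, injectivity gives \<open>e = 0\<close>;
      otherwise one divides by it.\<close>
    have "e \<in> range ?A" if nu: "\<nu> \<noteq> 0" "K e = \<nu> *\<^sub>R e" for e \<nu>
    proof -
      have "cscale 1 e = cscale (1 - z * of_real \<nu>) e + cscale (z * of_real \<nu>) e"
        using cscale_add_left[of "1 - z * of_real \<nu>" "z * of_real \<nu>" e] by simp
      moreover have "cscale z (K e) = cscale (z * of_real \<nu>) e"
        using nu(2) by (simp add: cscale_cscale flip: cscale_of_real)
      ultimately have Ae: "?A e = cscale (1 - z * of_real \<nu>) e" by (metis add_diff_cancel_right' cscale_1)
      show ?thesis
      proof (cases "1 - z * of_real \<nu> = 0")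
        case True
        then have "?A e = 0" using Ae cscale_of_real[of 0 e] by simp
        then have "e = 0" by (intro inj) simp
        then show ?thesis using sub subspace_0 by blast
      next
        case False
        have "?A (cscale (1 / (1 - z * of_real \<nu>)) e) = cscale (1 / (1 - z * of_real \<nu>)) (?A e)"
          by (simp add: K_cscale cscale_cscale mult.commute linear_diff[OF bounded_linear.linear[OF bounded_linear_cscale]])
        also have "\<dots> = e" unfolding Ae using False by (simp add: cscale_cscale cscale_1)
        finally have "?A (cscale (1 / (1 - z * of_real \<nu>)) e) = e" .
        then show ?thesis by (rule range_eqI[OF sym])
      qed
    qed
    then have "span {e. \<exists>\<nu>. \<nu> \<noteq> 0 \<and> K e = \<nu> *\<^sub>R e} \<subseteq> range ?A"
      by (intro span_minimal sub) auto
    then have "K (emb I f) \<in> closure (range ?A)"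
      using K.range_in_closure_span_eigenvectors[of "emb I f"] closure_mono by blast
    then obtain Y where Y: "K (emb I f) = ?A Y" using K.fredholm_closed_range[OF Z inj] by blast
    have P: "?A (cscale (- phi_coeff f / z) (emb I cphi)) = cscale (- phi_coeff f / z) (emb I cphi)"
      using linear_0[OF bounded_linear.linear[OF bounded_linear_cscale]] by (simp add: K_cscale K_phi)
    have "?A (cscale (- phi_coeff f / z) (emb I cphi) + Y) = cscale (- phi_coeff f / z) (emb I cphi) + K (emb I f)"
      unfolding linear_add[OF linA] P Y ..
    from resolvent_solution[OF f z_def z this] obtain u where "(u, \<lambda>x. f x + \<mu> * u x) \<in> T" by blast
    then show ?thesis by (intro bexI[of _ "(u, \<lambda>x. f x + \<mu> * u x)"]) auto
  qed
  ultimately show ?thesis unfolding resolvent_set_def by blast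
qed

theorem discrete_spectrum: "has_discrete_spectrum M T"
  unfolding has_discrete_spectrum_def
proof (intro ballI conjI)
  fix \<mu> assume \<mu>: "\<mu> \<in> op_spectrum M T"
  have sub: "op_spectrum M T \<subseteq> E" unfolding op_spectrum_def using resolvent by blast
  then show "\<mu> \<in> E" using \<mu> by blast
  \<comment> \<open>Every spectral point in the unit ball around \<mu> belongs to this finite set,
    so removing its other members leaves an open neighbourhood that isolates \<mu>.\<close>
  define A where "A = {\<nu> \<in> E. Re \<nu> \<le> Re \<mu> + 1}"
  have "open (ball \<mu> 1 - (A - {\<mu>}))"
    by (intro open_Diff open_ball finite_imp_closed finite_Diff) (simp add: A_def eigenvalues_finite)
  moreover have "(ball \<mu> 1 - (A - {\<mu>})) \<inter> op_spectrum M T = {\<mu>}"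
  proof
    show "(ball \<mu> 1 - (A - {\<mu>})) \<inter> op_spectrum M T \<subseteq> {\<mu>}"
    proof
      fix \<nu> assume \<nu>: "\<nu> \<in> (ball \<mu> 1 - (A - {\<mu>})) \<inter> op_spectrum M T"
      then have "\<bar>Re (\<nu> - \<mu>)\<bar> < 1" using abs_Re_le_cmod[of "\<nu> - \<mu>"] by (auto simp: dist_norm norm_minus_commute)
      then have "\<nu> \<in> A" using \<nu> sub by (auto simp: A_def)
      then show "\<nu> \<in> {\<mu>}" using \<nu> by blast
    qed
  qed (use \<mu> in auto)
  ultimately show "\<mu> isolated_in op_spectrum M T" unfolding isolated_in_def using \<mu> by blast
  obtain u where "eigenfunction M T \<mu> u" using \<open>\<mu> \<in> E\<close> by (rule eigenvalueE)
  from eigenfunction_simple[OF this]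
  have "{u} \<subseteq> eigenspace T \<mu> \<and> (\<forall>v\<in>eigenspace T \<mu>. \<exists>a. AE x in M. v x = (\<Sum>b\<in>{u}. a b * b x))"
    unfolding simple_eigenfunction_def eigenfunction_def by fastforce
  then show "finite_multiplicity M T \<mu>" unfolding finite_multiplicity_def by blast
qed

section \<open>Orthogonality and completeness of the eigenfunctions\<close>

text \<open>\<open>F h\<close> and the negative flux of \<open>v\<close> have the same derivative
  and both vanish on the left of the supports. Hence they agree, \<open>F h\<close> vanishes at
  \<open>a\<close>, and the double primitive recovers \<open>v\<close> up to the constant
  \<open>v 0\<close>.\<close>

lemma test_in_domain:
  assumes "w \<in> test_functions I"
  shows "\<exists>f. (w, f) \<in> T"
proof -
  obtain v where v: "v \<in> test_functions I" and w: "w = (\<lambda>x. of_real (\<phi> x) * v x)" by (rule test_phi_factor[OF assms])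
  define p where "p x = (complex_of_real (\<psi> x))\<^sup>2 * vderiv v x" for x
  have p: "p \<in> test_functions I" unfolding p_def[abs_def] by (rule psi_vderiv_test[OF v])
  have flux_deriv: "flux_deriv v = vderiv p" by (simp add: flux_deriv_def p_def[abs_def])
  define h where "h x = - 1 * (1 / of_real (\<phi> x) * flux_deriv v x)" for x
  have ht: "h \<in> test_functions I" unfolding h_def[abs_def] by (rule test_cmult[OF flux_deriv_phi_test[OF v]])
  have hL: "h \<in> L2 M" by (rule test_L2[OF ht])
  have hc: "continuous_on I h" by (rule continuous_on_subset[OF test_continuous[OF ht]]) simp
  have Fd: "(F h has_vector_derivative - flux_deriv v x) (at x)" if "x \<in> I" for x
    using F_deriv[OF hL hc that] phi_nonzero[OF that] by (simp add: h_def)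
  have pd: "((\<lambda>x. - p x) has_vector_derivative - flux_deriv v x) (at x)" for x
    unfolding flux_deriv by (intro has_vector_derivative_minus test_hvd[OF p])
  obtain b1 where b1: "0 < b1" "b1 < a" "\<And>x. b1 \<le> \<bar>x\<bar> \<Longrightarrow> p x = 0" using p unfolding test_iff by blast
  obtain b2 where b2: "0 < b2" "b2 < a" "\<And>x. b2 \<le> \<bar>x\<bar> \<Longrightarrow> h x = 0" using ht unfolding test_iff by blast
  define b where "b = max b1 b2"
  have b: "0 < b" "b < a" "\<And>x. b \<le> \<bar>x\<bar> \<Longrightarrow> p x = 0" "\<And>x. b \<le> \<bar>x\<bar> \<Longrightarrow> h x = 0"
    using b1 b2 by (auto simp: b_def)
  have bI: "- b \<in> I" "b \<in> I" using b by (auto simp: I_def)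
  have "F h (- b) = (LINT t|M. 0)" unfolding F_def
    by (rule Bochner_Integration.integral_cong) (use b in \<open>auto simp: indicator_def\<close>)
  then have Fb: "F h (- b) = 0" by simp
  have Fp: "F h x = - p x" if x: "x \<in> I" for x
    using derivative_eq_imp_const[OF Fd pd x bI(1)] Fb b(3)[of "- b"] b(1) by (simp add: add_eq_0_iff2)
  have "F h a = F h b" unfolding F_def
    by (rule Bochner_Integration.integral_cong) (use b in \<open>auto simp: indicator_def I_def\<close>)
  also have "\<dots> = 0" using Fp[OF bI(2)] b by simp
  finally have Fa: "F h a = 0" .
  have Jv: "J h x = - (v x - v 0)" if x: "x \<in> I" for x
  proof -
    have "- (v x - v 0) = J h x" unfolding J_def
    proof (rule prim_unique[OF F_quotient_continuous[OF hL] _ _ x])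
      fix y assume y: "y \<in> I"
      have "((\<lambda>x. - (v x - v 0)) has_vector_derivative - (vderiv v y - 0)) (at y)"
        by (intro has_vector_derivative_minus has_vector_derivative_diff has_vector_derivative_const test_hvd[OF v])
      then show "((\<lambda>x. - (v x - v 0)) has_vector_derivative F h y / (of_real (\<psi> y))\<^sup>2) (at y)"
        using psi_nonzero[OF y] by (simp add: Fp[OF y] p_def)
    qed simp
    then show ?thesis by simp
  qed
  have wL: "w \<in> L2 M" by (rule test_L2[OF assms])
  define f where "f x = h x - 2 * of_real c * w x" for x
  have heq: "(\<lambda>x. f x + 2 * of_real c * w x) = h" by (simp add: f_def fun_eq_iff)
  have "AE x in M. w x = of_real (\<phi> x) * (v 0 - J h x)"
    by (rule AE_I2) (simp add: w Jv)
  then have "canonical w f" unfolding canonical_def heq using wL hL Fa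
    by (auto simp: f_def[abs_def] intro!: L2_diff L2_cmult)
  then show ?thesis unfolding T_iff[symmetric] by blast
qed

lemma eigenfunctions_orthogonal:
  assumes u: "eigenfunction M T \<mu> u" and v: "eigenfunction M T \<nu> v" and ne: "\<mu> \<noteq> \<nu>"
  shows "L2_inner M u v = 0"
proof -
  have uL: "u \<in> L2 M" and vL: "v \<in> L2 M" using u v eigenfunction_emb by blast+
  have gr: "L2_inner M u' v' = 0" if u': "eigenfunction M T \<mu>' u'" "\<mu>' \<noteq> of_real (- 2 * c)"
    and v': "eigenfunction M T (of_real (- 2 * c)) v'" for u' v' \<mu>'
  proof -
    have L: "u' \<in> L2 M" "v' \<in> L2 M" using u' v' eigenfunction_emb by blast+
    obtain \<beta> where b: "AE x in M. v' x = \<beta> * of_real (\<phi> x)"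
      using v' unfolding eigenfunction_def eigen_ground_iff by blast
    have z: "\<mu>' + 2 * of_real c \<noteq> 0" using u'(2) by (simp add: eq_neg_iff_add_eq_0)
    have "AE x in M. u' x = (\<mu>' + 2 * of_real c) * N u' x"
      using u'(1) unfolding eigenfunction_def eigen_iff[OF z] by blast
    then have "F u' a = F (\<lambda>x. (\<mu>' + 2 * of_real c) * N u' x) a"
      by (rule F_cong_AE[OF L(1) L2_cmult[OF N_L2[OF L(1)]]])
    then have "F u' a = 0" by (simp add: F_cmult F_N[OF L(1)])
    moreover have "L2_inner M u' v' = L2_inner M u' (\<lambda>x. \<beta> * of_real (\<phi> x))"
      by (rule L2_inner_cong_AE[OF L L(1) L2_cmult[OF phi_L2] _ b]) simp
    ultimately show ?thesis by (simp add: L2_inner_cmult_right F_total)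
  qed
  consider "\<nu> = of_real (- 2 * c)" | "\<mu> = of_real (- 2 * c)" | "\<mu> \<noteq> of_real (- 2 * c)" "\<nu> \<noteq> of_real (- 2 * c)" by blast
  then show ?thesis
  proof cases
    case 1
    then show ?thesis using gr[OF u] v ne by blast
  next
    case 2
    then have "L2_inner M v u = 0" using gr[OF v] u ne by blast
    then show ?thesis using L2_inner_cnj[of M v u] by simp
  next
    case 3
    have z: "\<mu> + 2 * of_real c \<noteq> 0" "\<nu> + 2 * of_real c \<noteq> 0" using 3 by (simp_all add: eq_neg_iff_add_eq_0)
    have ae: "AE x in M. u x = (\<mu> + 2 * of_real c) * N u x" "AE x in M. v x = (\<nu> + 2 * of_real c) * N v x"
      using u v unfolding eigenfunction_def eigen_iff[OF z(1)] eigen_iff[OF z(2)] by blast+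
    have "L2_inner M u v = (\<mu> + 2 * of_real c) * L2_inner M (N u) v"
      unfolding L2_inner_cmult_left[symmetric]
      by (rule L2_inner_cong_AE[OF uL vL L2_cmult[OF N_L2[OF uL]] vL ae(1)]) simp
    moreover have "L2_inner M u v = cnj (\<nu> + 2 * of_real c) * L2_inner M u (N v)"
      unfolding L2_inner_cmult_right[symmetric]
      by (rule L2_inner_cong_AE[OF uL vL uL L2_cmult[OF N_L2[OF vL]] _ ae(2)]) simp
    moreover have "cnj (\<nu> + 2 * of_real c) = \<nu> + 2 * of_real c"
      using eigenfunction_real(1)[OF v] by (simp add: Reals_cnj_iff)
    ultimately have *: "L2_inner M u v = (\<mu> + 2 * of_real c) * L2_inner M (N u) v"
      and "(\<mu> + 2 * of_real c) * L2_inner M (N u) v = (\<nu> + 2 * of_real c) * L2_inner M (N u) v"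
      by (simp_all only: N_symmetric[OF uL vL])
    then have "L2_inner M (N u) v = 0" using ne by (metis add_right_cancel mult_right_cancel)
    then show ?thesis using * by simp
  qed
qed

text \<open>The multiples of \<open>\<phi>\<close> together with the range of \<open>N\<close> thus
  contain a dense set, so completeness reduces to the closure of the span of eigenvectors of
  \<open>K\<close>.\<close>

lemma test_decomposition:
  assumes w: "w \<in> test_functions I"
  obtains \<beta> h where "h \<in> L2 M" "AE x in M. w x = \<beta> * of_real (\<phi> x) + N h x"
proof -
  obtain g where g: "(w, g) \<in> T" using test_in_domain[OF w] by blast
  then have "(\<lambda>x. g x + 2 * of_real c * w x) \<in> L2 M"
    unfolding T_iff_N by (intro L2_add L2_cmult) auto
  moreover obtain \<beta> where "AE x in M. w x = \<beta> * of_real (\<phi> x) + N (\<lambda>x. g x + 2 * of_real c * w x) x"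
    using g unfolding T_iff_N by blast
  ultimately show ?thesis by (rule that)
qed

text \<open>By simplicity one eigenfunction for each eigenvalue suffices, and orthogonality holds
  between different eigenvalues. Density combines the decomposition of test functions with the
  spectral theorem for \<open>K\<close>.\<close>

theorem eigenfunction_basis:
  "\<exists>B. orthogonal_basis M B \<and> (\<forall>e\<in>B. \<exists>\<mu>. simple_eigenfunction M T \<mu> e)"
proof -
  define ef where "ef \<mu> = (SOME u. eigenfunction M T \<mu> u)" for \<mu>
  have ef: "eigenfunction M T \<mu> (ef \<mu>)" if "\<mu> \<in> E" for \<mu>
  proof -
    have "\<exists>u. eigenfunction M T \<mu> u" using that by (simp add: eigenvalues_def)
    then show ?thesis unfolding ef_def by (rule someI_ex)
  qed
  define B where "B = ef ` E"
  have BL: "e \<in> L2 M" if "e \<in> B" for e using that ef eigenfunction_emb(1) by (auto simp: B_def)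
  have embs: "emb I (\<lambda>x. \<Sum>e\<in>S. r e * e x) = (\<Sum>e\<in>S. cscale (r e) (emb I e))" if "S \<subseteq> B" for S r
  proof -
    have "emb I (\<lambda>x. \<Sum>e\<in>S. r e * e x) = (\<Sum>e\<in>S. emb I (\<lambda>x. r e * e x))"
      by (rule emb_sum[OF I_lebesgue]) (use that BL in \<open>auto intro: L2_cmult\<close>)
    also have "\<dots> = (\<Sum>e\<in>S. cscale (r e) (emb I e))"
      by (rule sum.cong[OF refl]) (use that BL in \<open>auto intro: emb_cmult\<close>)
    finally show ?thesis .
  qed
  \<comment> \<open>The span is real, so all complex multiples of the embedded eigenfunctions are
    taken as generators.\<close>
  define D where "D = span (\<Union>e\<in>B. range (\<lambda>z. cscale z (emb I e)))"
  have Dform: "\<exists>S r. finite S \<and> S \<subseteq> B \<and> X = emb I (\<lambda>x. \<Sum>e\<in>S. r e * e x)" if "X \<in> D" for X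
    using that unfolding D_def
  proof (induction rule: span_induct_alt)
    case base
    have "emb I (\<lambda>x. \<Sum>e\<in>{}. (0::complex) * e x) = 0" by (subst embs) auto
    then show ?case by (intro exI[of _ "{}"] exI[of _ "\<lambda>_. 0"]) auto
  next
    case (step t Y X)
    from step obtain S r where S: "finite S" "S \<subseteq> B" "X = emb I (\<lambda>x. \<Sum>e\<in>S. r e * e x)" by blast
    obtain e z where e: "e \<in> B" "Y = cscale z (emb I e)" using step by blast
    \<comment> \<open>The new generator may belong to an eigenfunction that already occurs in
      \<open>S\<close>; its coefficient is then added to the old one.\<close>
    define r' where "r' e' = (if e' \<in> S then r e' else 0) + (if e' = e then of_real t * z else 0)" for e'
    have "(\<Sum>e'\<in>insert e S. cscale (r' e') (emb I e'))
        = (\<Sum>e'\<in>insert e S. cscale (if e' \<in> S then r e' else 0) (emb I e')) + (\<Sum>e'\<in>insert e S. cscale (if e' = e then of_real t * z else 0) (emb I e'))"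
      unfolding r'_def cscale_add_left by (rule sum.distrib)
    also have "(\<Sum>e'\<in>insert e S. cscale (if e' \<in> S then r e' else 0) (emb I e')) = X"
    proof -
      have "(\<Sum>e'\<in>insert e S. cscale (if e' \<in> S then r e' else 0) (emb I e')) = (\<Sum>e'\<in>S. cscale (r e') (emb I e'))"
        using S(1) cscale_of_real[of 0] by (intro sum.mono_neutral_cong_right) auto
      then show ?thesis using embs[OF S(2)] S(3) by simp
    qed
    also have "(\<Sum>e'\<in>insert e S. cscale (if e' = e then of_real t * z else 0) (emb I e')) = t *\<^sub>R Y"
    proof -
      have "(\<Sum>e'\<in>insert e S. cscale (if e' = e then of_real t * z else 0) (emb I e')) = (\<Sum>e'\<in>{e}. cscale (of_real t * z) (emb I e'))"
        using S(1) cscale_of_real[of 0] by (intro sum.mono_neutral_cong_right) auto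
      then show ?thesis by (simp add: e(2) cscale_cscale flip: cscale_of_real)
    qed
    finally have "t *\<^sub>R Y + X = emb I (\<lambda>x. \<Sum>e'\<in>insert e S. r' e' * e' x)"
      using embs[of "insert e S" r'] S(2) e(1) by (simp add: add.commute)
    then show ?case using S e(1) by (intro exI[of _ "insert e S"] exI[of _ r']) auto
  qed
  have Dsub: "subspace D" unfolding D_def by (rule subspace_span)
  have Deig: "cscale z (emb I u) \<in> D" if u: "u \<in> eigenspace T \<mu>" for u \<mu> z
  proof (cases "AE x in M. u x = 0")
    case True
    then have "emb I u = 0" using eigenspace_L2[OF u] by (simp add: emb_eq_0_iff[OF I_lebesgue])
    then show ?thesis using linear_0[OF bounded_linear.linear[OF bounded_linear_cscale]] subspace_0[OF Dsub] by simp
  next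
    case False
    then have \<mu>: "\<mu> \<in> E" using u by (auto simp: eigenvalues_def eigenfunction_def)
    from eigenfunction_simple[OF ef[OF this]] obtain k where k: "AE x in M. u x = k * ef \<mu> x"
      using u unfolding simple_eigenfunction_def by blast
    have efL: "ef \<mu> \<in> L2 M" by (rule eigenfunction_emb(1)[OF ef[OF \<mu>]])
    have "emb I u = emb I (\<lambda>x. k * ef \<mu> x)"
      using k by (simp add: emb_eq_iff[OF I_lebesgue eigenspace_L2[OF u] L2_cmult[OF efL]])
    then have "cscale z (emb I u) = cscale (z * k) (emb I (ef \<mu>))"
      by (simp add: emb_cmult[OF I_lebesgue efL] cscale_cscale)
    then show ?thesis unfolding D_def B_def using \<mu> by (auto intro!: span_base)
  qed
  have "e \<in> D" if nu: "\<nu> \<noteq> 0" "K e = \<nu> *\<^sub>R e" for e \<nu>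
  proof -
    have "e = cscale (of_real (1 / \<nu>)) (K e)" using nu by (simp only: cscale_of_real) simp
    from fixed_point_eigen[OF this] nu(1) obtain u where "u \<in> eigenspace T (of_real (1 / \<nu>) - 2 * of_real c)" "e = emb I u"
      by auto
    then show ?thesis using Deig[of u _ 1] by (simp add: cscale_1)
  qed
  then have "span {e. \<exists>\<nu>. \<nu> \<noteq> 0 \<and> K e = \<nu> *\<^sub>R e} \<subseteq> D" by (intro span_minimal Dsub) auto
  then have KD: "K X \<in> closure D" for X
    using K.range_in_closure_span_eigenvectors[of X] closure_mono by blast
  have dense: "\<exists>S r. finite S \<and> S \<subseteq> B \<and> L2_norm M (\<lambda>x. f x - (\<Sum>e\<in>S. r e * e x)) < \<epsilon>"
    if f: "f \<in> L2 M" and \<epsilon>: "\<epsilon> > 0" for f \<epsilon>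
  proof -
    obtain w where w: "w \<in> test_functions I" "L2_norm M (\<lambda>x. f x - w x) < \<epsilon> / 2"
      using test_functions_dense[OF f, of "\<epsilon> / 2"] \<epsilon> by auto
    have wL: "w \<in> L2 M" by (rule test_L2[OF w(1)])
    obtain \<beta> h where hL: "h \<in> L2 M" and ae: "AE x in M. w x = \<beta> * of_real (\<phi> x) + N h x"
      by (rule test_decomposition[OF w(1)])
    have "emb I w = emb I (\<lambda>x. \<beta> * of_real (\<phi> x) + N h x)"
      using ae by (simp add: emb_eq_iff[OF I_lebesgue wL L2_add[OF L2_cmult[OF phi_L2] N_L2[OF hL]]])
    then have wK: "emb I w = cscale \<beta> (emb I cphi) + K (emb I h)"
      by (simp add: emb_add[OF I_lebesgue L2_cmult[OF phi_L2] N_L2[OF hL]] emb_cmult[OF I_lebesgue phi_L2] K_emb[OF hL])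
    obtain Y where Y: "Y \<in> D" "dist Y (K (emb I h)) < \<epsilon> / 2"
      using KD[of "emb I h"] \<epsilon> unfolding closure_approachable by (meson half_gt_zero)
    have "cphi \<in> eigenspace T (of_real (- 2 * c))" using ground_eigenfunction by (simp add: eigenfunction_def)
    then have "cscale \<beta> (emb I cphi) + Y \<in> D" by (intro subspace_add[OF Dsub] Deig Y(1))
    then obtain S r where S: "finite S" "S \<subseteq> B" and eq: "cscale \<beta> (emb I cphi) + Y = emb I (\<lambda>x. \<Sum>e\<in>S. r e * e x)"
      using Dform by blast
    have sL: "(\<lambda>x. \<Sum>e\<in>S. r e * e x) \<in> L2 M" using S BL by (intro L2_sum L2_cmult) auto
    have "L2_norm M (\<lambda>x. f x - (\<Sum>e\<in>S. r e * e x)) = norm (emb I f - (cscale \<beta> (emb I cphi) + Y))"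
      unfolding eq by (simp add: emb_diff[OF I_lebesgue f sL, symmetric] norm_emb[OF I_lebesgue L2_diff[OF f sL]])
    also have "emb I f - (cscale \<beta> (emb I cphi) + Y) = (emb I f - emb I w) + (K (emb I h) - Y)" by (simp add: wK)
    also have "norm \<dots> \<le> norm (emb I f - emb I w) + norm (K (emb I h) - Y)" by (rule norm_triangle_ineq)
    also have "\<dots> < \<epsilon> / 2 + \<epsilon> / 2"
      using w(2) Y(2) by (intro add_strict_mono)
        (simp_all add: emb_diff[OF I_lebesgue f wL, symmetric] norm_emb[OF I_lebesgue L2_diff[OF f wL]] dist_norm norm_minus_commute)
    finally show ?thesis using S by (intro exI[of _ S] exI[of _ r]) simp
  qed
  have "orthogonal_basis M B"
    unfolding orthogonal_basis_def
  proof (intro conjI ballI impI allI)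
    show "B \<subseteq> L2 M" using BL by blast
    show "\<not> (AE x in M. e x = 0)" if "e \<in> B" for e
      using that ef by (auto simp: B_def eigenfunction_def)
    show "L2_inner M e e' = 0" if "e \<in> B" "e' \<in> B" "e \<noteq> e'" for e e'
    proof -
      obtain \<mu> \<nu> where "\<mu> \<in> E" "\<nu> \<in> E" "e = ef \<mu>" "e' = ef \<nu>" using \<open>e \<in> B\<close> \<open>e' \<in> B\<close> by (auto simp: B_def)
      then show ?thesis using that(3) eigenfunctions_orthogonal[OF ef ef] by metis
    qed
  qed (use dense in blast)
  moreover have "\<exists>\<mu>. simple_eigenfunction M T \<mu> e" if "e \<in> B" for e
    using that ef eigenfunction_simple by (auto simp: B_def)
  ultimately show ?thesis by blast
qed

section \<open>Ground state and first excited state\<close>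

theorem ground_state:
  "is_lowest E (- 2 * c)" "simple_eigenfunction M T (of_real (- 2 * c)) cphi"
proof -
  show "simple_eigenfunction M T (of_real (- 2 * c)) cphi"
    by (rule eigenfunction_simple[OF ground_eigenfunction])
  have "of_real (- 2 * c) \<in> E" unfolding eigenvalues_def using ground_eigenfunction by blast
  moreover have "z \<in> \<real> \<and> - 2 * c \<le> Re z" if "z \<in> E" for z using that eigenfunction_real by (auto elim: eigenvalueE)
  ultimately show "is_lowest E (- 2 * c)" by (simp add: is_lowest_def)
qed

text \<open>Otherwise \<open>K\<close> has no nonzero eigenvalue and is 0, so by the decomposition
  every test function is a multiple of \<open>\<phi>\<close> almost everywhere. A bump supported in
  the right half of \<open>I\<close> contradicts this.\<close>

lemma excited_eigenvalue_exists: "E - {of_real (- 2 * c)} \<noteq> {}"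
proof
  assume none: "E - {of_real (- 2 * c)} = {}"
  have "e = 0" if nu: "\<nu> \<noteq> 0" "K e = \<nu> *\<^sub>R e" for e \<nu>
  proof (rule ccontr)
    assume "e \<noteq> 0"
    have "e = cscale (of_real (1 / \<nu>)) (K e)" using nu by (simp only: cscale_of_real) simp
    from fixed_point_eigen[OF this] nu(1) obtain u where u: "u \<in> eigenspace T (of_real (1 / \<nu>) - 2 * of_real c)" "e = emb I u"
      by auto
    then have "\<not> (AE x in M. u x = 0)" using \<open>e \<noteq> 0\<close> eigenspace_L2[OF u(1)] by (simp add: emb_eq_0_iff[OF I_lebesgue])
    then have "of_real (1 / \<nu>) - 2 * of_real c \<in> E" using u(1) by (auto simp: eigenvalues_def eigenfunction_def)
    then have "of_real (1 / \<nu>) - 2 * of_real c = complex_of_real (- 2 * c)" using none by blast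
    then show False using nu(1) by simp
  qed
  then have "{e. \<exists>\<nu>. \<nu> \<noteq> 0 \<and> K e = \<nu> *\<^sub>R e} \<subseteq> {0}" by blast
  then have "span {e. \<exists>\<nu>. \<nu> \<noteq> 0 \<and> K e = \<nu> *\<^sub>R e} \<subseteq> {0}" by (intro span_minimal) auto
  then have "closure (span {e. \<exists>\<nu>. \<nu> \<noteq> 0 \<and> K e = \<nu> *\<^sub>R e}) \<subseteq> closure {0}" by (rule closure_mono)
  then have K0: "K X = 0" for X using K.range_in_closure_span_eigenvectors[of X] by auto
  define w where "w = bump 1 0 (a / 2)"
  have w: "w \<in> test_functions I" unfolding w_def by (rule bump_test) (use a_pos in auto)
  obtain \<beta> h where h: "h \<in> L2 M" and ae: "AE x in M. w x = \<beta> * of_real (\<phi> x) + N h x"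
    by (rule test_decomposition[OF w])
  have "AE x in M. N h x = 0" using K0[of "emb I h"] by (simp add: K_emb[OF h] emb_eq_0_iff[OF I_lebesgue N_L2[OF h]])
  with ae have ae: "AE x in M. w x = \<beta> * of_real (\<phi> x)" by eventually_elim simp
  obtain x where "x \<in> I" "x < 0" "w x = \<beta> * of_real (\<phi> x)"
    using AE_M_witness[OF ae, of "- a" 0] a_pos by auto
  then have "\<beta> = 0" using phi_nonzero[of x] by (simp add: w_def bump_zero)
  moreover obtain y where "0 < y" "y < a / 2" "w y = \<beta> * of_real (\<phi> y)"
    using AE_M_witness[OF ae, of 0 "a / 2"] a_pos by auto
  ultimately show False using bump_pos[of 1 0 y "a / 2"] by (simp add: w_def)
qed

theorem excited_state:
  assumes api: "sqrt 2 * a < pi"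
  shows "\<exists>\<mu>1. is_lowest (E - {of_real (- 2 * c)}) \<mu>1 \<and> - 2 * c < \<mu>1 \<and> 0 < \<mu>1"
proof -
  obtain \<nu> where \<nu>: "\<nu> \<in> E - {of_real (- 2 * c)}" using excited_eigenvalue_exists by blast
  \<comment> \<open>Only finitely many eigenvalues lie below the excited eigenvalue \<nu>, so a
    lowest one exists; eigenvalues outside this set are larger still.\<close>
  define A where "A = {\<mu> \<in> E. Re \<mu> \<le> Re \<nu>} - {of_real (- 2 * c)}"
  have "finite A" "A \<noteq> {}" using eigenvalues_finite \<nu> by (auto simp: A_def)
  then obtain \<mu> where \<mu>: "\<mu> \<in> A" "\<And>x. x \<in> A \<Longrightarrow> Re \<mu> \<le> Re x"
    using arg_min_if_finite(1)[of A Re] arg_min_least[of A _ Re] by blast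
  then obtain u where u: "eigenfunction M T \<mu> u" by (auto simp: A_def elim: eigenvalueE)
  have ne: "\<mu> \<noteq> of_real (- 2 * c)" using \<mu>(1) by (simp add: A_def)
  have r: "\<mu> = of_real (Re \<mu>)" using eigenfunction_real(1)[OF u] by (simp add: complex_is_Real_iff complex_eq_iff)
  have pos: "Re \<mu> + 2 * c > 0" by (rule eigenfunction_emb(3)[OF u ne])
  have "is_lowest (E - {of_real (- 2 * c)}) (Re \<mu>)" unfolding is_lowest_def
  proof (intro conjI ballI)
    show "of_real (Re \<mu>) \<in> E - {of_real (- 2 * c)}" using \<mu>(1) r by (auto simp: A_def)
    fix z assume z: "z \<in> E - {of_real (- 2 * c)}"
    then show "z \<in> \<real>" using eigenfunction_real by (auto elim: eigenvalueE)
    show "Re \<mu> \<le> Re z"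
    proof (cases "Re z \<le> Re \<nu>")
      case True
      then show ?thesis using \<mu>(2)[of z] z by (simp add: A_def)
    next
      case False
      then show ?thesis using \<mu>(1) by (simp add: A_def)
    qed
  qed
  moreover have "Re \<mu> > 0"
  proof -
    have "(u, \<lambda>x. \<mu> * u x) \<in> T" using u by (simp add: eigenfunction_def eigenspace_def)
    then obtain v G where s: "solution (\<mu> + 2 * of_real c) v G" and uv: "AE x in M. u x = of_real (\<phi> x) * v x"
      by (rule eigenfunction_solution)
    obtain x0 where x0: "x0 \<in> I" "v x0 \<noteq> 0" by (rule eigenfunction_factor_nonzero[OF u uv])
    show ?thesis by (rule eigenvalue_pos[where v = v and G = G, OF api _ pos x0]) (use s r in simp)
  qed
  ultimately show ?thesis using pos by (intro exI[of _ "Re \<mu>"]) auto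
qed

end

subsection \<open>The limit point property and the profile\<close>

lemma inverse_distance_not_integrable:
  fixes a :: real
  assumes "x1 < a"
  shows "\<not> set_integrable lebesgue {x1<..<a} (\<lambda>x. 1 / (a - x))"
proof -
  have "\<not> integrable (lebesgue_on {x1<..<a}) (\<lambda>x. (a - x) * (cmod (of_real (1 / (a - x))))\<^sup>2)"
  proof (rule blowup_not_integrable[where v = "\<lambda>x. of_real (1 / (a - x))" and v' = "\<lambda>x. of_real (1 / (a - x)\<^sup>2)" and l = 1 and \<kappa> = 1, OF assms])
    fix x assume x: "x1 < x" "x < a"
    have "((\<lambda>x. 1 / (a - x)) has_real_derivative 1 / (a - x)\<^sup>2) (at x)"
      using x by (auto intro!: derivative_eq_intros simp: power2_eq_square)
    then show "((\<lambda>x. complex_of_real (1 / (a - x))) has_vector_derivative of_real (1 / (a - x)\<^sup>2)) (at x)"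
      by (rule has_vector_derivative_of_real)
    show "1 / (a - x)\<^sup>2 \<le> Re (1 * of_real (1 / (a - x)\<^sup>2))" by (simp only: mult_1 Re_complex_of_real)
  qed simp
  moreover have "(a - x) * (cmod (of_real (1 / (a - x))))\<^sup>2 = 1 / (a - x)" for x
    unfolding norm_of_real power2_abs by (simp add: power2_eq_square)
  ultimately show ?thesis by (simp add: set_integrable_def integrable_restrict_space)
qed

context profile
begin

text \<open>Multiplied by \<open>\<phi>\<close>, the function becomes \<psi>', and differentiating
  \<open>\<psi>'' = 2 c - 2 \<psi>\<close> shows that \<open>\<partial>\<^sub>x\<^sup>2 + 2\<close>
  annihilates \<psi>'. The spectral parameter 0 thus has an explicit solution that is singular at
  the endpoints.\<close>

lemma SL_solution_quotient: "SL_solution \<phi> I 0 (\<lambda>x. 1 / of_real (\<phi> x) * of_real (\<psi>' x))"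
proof -
  define u where "u x = 1 / complex_of_real (\<phi> x) * of_real (\<psi>' x)" for x
  have "smooth_in I u" unfolding u_def[abs_def]
    by (rule smooth_in_mult[OF I_open inverse_phi_smooth psi'_smooth_I])
  then have sm: "(vderiv ^^ n) u differentiable (at x)" if "x \<in> I" for n x
    using that unfolding smooth_in_iff by blast
  have "SL_expr \<phi> u x = 0 * u x" if x: "x \<in> I" for x
  proof -
    have eq: "of_real (\<phi> y) * u y = of_real (\<psi>' y)" if "y \<in> I" for y
      using phi_nonzero[OF that] by (simp add: u_def)
    have d1: "vderiv (\<lambda>y. of_real (\<phi> y) * u y) y = 2 * of_real c + (- 2) * of_real (\<psi> y)" if y: "y \<in> I" for y
      by (rule vderiv_eq, rule has_vector_derivative_transform_within_open[OF psi'_hvd I_open y]) (simp only: eq)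
    have "((\<lambda>y. 2 * of_real c + (- 2) * complex_of_real (\<psi> y)) has_vector_derivative 0 + (- 2) * of_real (\<psi>' x)) (at x)"
      by (intro has_vector_derivative_add has_vector_derivative_const has_vector_derivative_mult_right psi_hvd)
    then have "(vderiv (\<lambda>y. of_real (\<phi> y) * u y) has_vector_derivative 0 + (- 2) * of_real (\<psi>' x)) (at x)"
      by (rule has_vector_derivative_transform_within_open[OF _ I_open x]) (simp only: d1)
    from vderiv_eq[OF this] show ?thesis by (simp add: SL_expr_def eq[OF x])
  qed
  then show ?thesis using sm[of _ 0] sm[of _ 1] by (simp add: SL_solution_def u_def[abs_def])
qed

text \<open>The squared modulus of the explicit solution is \<open>\<psi>'^2 / \<psi>\<close>. As
  \<psi>' is nonzero at the endpoint and \<psi> vanishes linearly, it dominates a multiple of the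
  inverse distance. The substitution \<open>x \<mapsto> s * x\<close> reduces both endpoints to the
  right one.\<close>

lemma limit_point:
  assumes s: "s = 1 \<or> s = - 1" and nz: "\<psi>' (s * a) \<noteq> 0"
  shows "limit_point_at \<phi> I (s * a)"
proof -
  define u where "u x = 1 / complex_of_real (\<phi> x) * of_real (\<psi>' x)" for x
  have "\<not> square_integrable_near I (s * a) u"
  proof
    assume "square_integrable_near I (s * a) u"
    then obtain \<delta> where \<delta>: "\<delta> > 0" and L: "u \<in> L2 (lebesgue_on (I \<inter> ball (s * a) \<delta>))"
      unfolding square_integrable_near_def by blast
    define A where "A = I \<inter> ball (s * a) \<delta>"
    \<comment> \<open>By continuity the modulus of \<psi>' stays above half of its value at the
      endpoint, which gives a positive numerator throughout a neighbourhood.\<close>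
    define q where "q = \<bar>\<psi>' (s * a)\<bar> / 2"
    have q: "q > 0" using nz by (simp add: q_def)
    have "isCont (\<lambda>x. \<bar>\<psi>' x\<bar>) (s * a)" using DERIV_isCont[OF psi'_deriv] by (intro continuous_intros)
    then have "((\<lambda>x. \<bar>\<psi>' x\<bar>) \<longlongrightarrow> \<bar>\<psi>' (s * a)\<bar>) (at (s * a))" by (simp add: isCont_def)
    moreover have "q < \<bar>\<psi>' (s * a)\<bar>" using nz by (simp add: q_def)
    ultimately have "\<forall>\<^sub>F x in at (s * a). q < \<bar>\<psi>' x\<bar>" by (rule order_tendstoD(1))
    then obtain d where d: "d > 0" "\<And>x. x \<noteq> s * a \<Longrightarrow> dist x (s * a) < d \<Longrightarrow> q < \<bar>\<psi>' x\<bar>"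
      unfolding eventually_at by auto
    define x1 where "x1 = a - min (min \<delta> d) a"
    have x1: "0 \<le> x1" "x1 < a" "a - x1 \<le> \<delta>" "a - x1 \<le> d" using \<delta> d(1) a_pos by (auto simp: x1_def)
    have "set_integrable lebesgue A (\<lambda>x. (cmod (u x))\<^sup>2)"
      using L2_integrable[OF L] unfolding A_def by (simp add: set_integrable_def integrable_restrict_space)
    then obtain i where "has_bochner_integral lebesgue (\<lambda>x. indicator A x *\<^sub>R (cmod (u x))\<^sup>2) i"
      unfolding set_integrable_def by (auto simp: integrable.simps)
    then have "has_bochner_integral lebesgue (\<lambda>x. indicator A (0 + s * x) *\<^sub>R (cmod (u (0 + s * x)))\<^sup>2) (i /\<^sub>R \<bar>s\<bar>)"
      using has_bochner_integral_lebesgue_real_affine_iff[of s "\<lambda>x. indicator A x *\<^sub>R (cmod (u x))\<^sup>2" i 0] s by auto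
    then have f: "integrable lebesgue (\<lambda>x. indicator A (s * x) *\<^sub>R (cmod (u (s * x)))\<^sup>2)"
      by (auto simp: integrable.simps)
    have "set_integrable lebesgue {x1<..<a} (\<lambda>x. 1 / (a - x))"
      unfolding set_integrable_def
    proof (rule Bochner_Integration.integrable_bound)
      show "integrable lebesgue (\<lambda>x. (2 * a * k / q\<^sup>2) * (indicator A (s * x) *\<^sub>R (cmod (u (s * x)))\<^sup>2))"
        by (intro integrable_mult_right f)
      show "(\<lambda>x. indicat_real {x1<..<a} x *\<^sub>R (1 / (a - x))) \<in> borel_measurable lebesgue"
        by (intro measurable_completion) measurable
      show "AE x in lebesgue. norm (indicat_real {x1<..<a} x *\<^sub>R (1 / (a - x)))
          \<le> norm ((2 * a * k / q\<^sup>2) * (indicator A (s * x) *\<^sub>R (cmod (u (s * x)))\<^sup>2))"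
      proof (rule AE_I2)
        fix x
        show "norm (indicat_real {x1<..<a} x *\<^sub>R (1 / (a - x)))
          \<le> norm ((2 * a * k / q\<^sup>2) * (indicator A (s * x) *\<^sub>R (cmod (u (s * x)))\<^sup>2))"
        proof (cases "x \<in> {x1<..<a}")
          case True
          then have x: "x1 < x" "x < a" by auto
          have sx: "s * x \<in> I" using s x x1 by (auto simp: I_iff)
          have dist: "dist (s * x) (s * a) = a - x" using s x by (auto simp: dist_real_def)
          then have "s * x \<in> A" using sx x x1(3) by (simp add: A_def dist_commute)
          moreover have "q < \<bar>\<psi>' (s * x)\<bar>" by (rule d(2)) (use dist x x1(4) in auto)
          then have "q\<^sup>2 \<le> (\<psi>' (s * x))\<^sup>2" using q by (simp add: abs_le_square_iff[symmetric])
          moreover have "(cmod (u (s * x)))\<^sup>2 = (\<psi>' (s * x))\<^sup>2 / \<psi> (s * x)"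
            using phi_sq[OF sx] by (simp add: u_def norm_divide power_divide power2_eq_square)
          moreover have "\<psi> (s * x) \<le> k * (2 * a) * (a - x)"
          proof -
            have "\<psi> (s * x) \<le> k * ((a - x) * (a + x))"
              using psi_bounds(2)[OF sx] s by (auto simp: tau_factor mult.commute)
            also have "\<dots> \<le> k * ((a - x) * (2 * a))" using k_pos x by (intro mult_left_mono) auto
            finally show ?thesis by (simp add: mult_ac)
          qed
          moreover have "1 / (a - x) \<le> (2 * a * k / q\<^sup>2) * ((\<psi>' (s * x))\<^sup>2 / \<psi> (s * x))"
          proof -
            have "q\<^sup>2 * \<psi> (s * x) \<le> (\<psi>' (s * x))\<^sup>2 * (k * (2 * a) * (a - x))"
              using calculation psi_pos[OF sx] by (intro mult_mono) auto
            then show ?thesis using q x psi_pos[OF sx] by (simp add: field_simps)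
          qed
          ultimately have "1 / (a - x) \<le> (2 * a * k / q\<^sup>2) * (indicator A (s * x) *\<^sub>R (cmod (u (s * x)))\<^sup>2)" by simp
          moreover have "norm (indicat_real {x1<..<a} x *\<^sub>R (1 / (a - x))) = 1 / (a - x)" using True by simp
          ultimately show ?thesis unfolding real_norm_def by linarith
        qed simp
      qed
    qed
    then show False using inverse_distance_not_integrable[OF x1(2)] by blast
  qed
  then show ?thesis using SL_solution_quotient unfolding limit_point_at_def u_def[abs_def] by blast
qed

end

text \<open>Sine is concave on \<open>[0, pi]\<close> and therefore lies above its chord from 0 to
  \<open>t\<close>.\<close>

lemma sin_ge_chord:
  assumes "0 \<le> y" "y \<le> t" "t < pi" "0 < t"
  shows "sin t / t * y \<le> sin y"
proof -
  have "convex_on {0..pi} (\<lambda>x. - sin x)"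
  proof (rule f''_ge0_imp_convex)
    show "((\<lambda>x. - sin x) has_real_derivative - cos x) (at x)" for x
      by (auto intro!: derivative_eq_intros)
    show "((\<lambda>x. - cos x) has_real_derivative sin x) (at x)" for x
      by (auto intro!: derivative_eq_intros)
  qed (auto intro: sin_ge_zero)
  from convex_onD[OF this, of "y / t" 0 t] show ?thesis using assms by (simp add: field_simps)
qed

lemma x_end_bounds: "0 < sqrt 2 * x_end c" "sqrt 2 * x_end c < pi" "cos (sqrt 2 * x_end c) = - c / sqrt (1 + c\<^sup>2)"
proof -
  let ?r = "- c / sqrt (1 + c\<^sup>2)"
  have "\<bar>c\<bar> < sqrt (1 + c\<^sup>2)" by (rule real_less_rsqrt) simp
  moreover have "0 < sqrt (1 + c\<^sup>2)" by (simp add: add_pos_nonneg)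
  ultimately have r: "-1 < ?r" "?r < 1" by (auto simp: pos_divide_less_eq pos_less_divide_eq)
  have e: "sqrt 2 * x_end c = arccos ?r" by (simp add: x_end_eq)
  show "0 < sqrt 2 * x_end c" "sqrt 2 * x_end c < pi" "cos (sqrt 2 * x_end c) = - c / sqrt (1 + c\<^sup>2)"
    unfolding e using arccos_lt_bounded[OF r] r by (simp_all add: cos_arccos)
qed

theorem proposition4p7:
  fixes c :: real
  assumes "c \<in> {-1, 0, 1}"
  shows "let I = I_phi c; \<phi> = phi c; M = lebesgue_on I; L = SL_friedrichs \<phi> I; \<mu>\<^sub>0 = - 2 * c in
      (limit_point_at \<phi> I (x_end c) \<and> limit_point_at \<phi> I (- x_end c)) \<and>
      (has_discrete_spectrum M L \<and>
       (\<exists>B. orthogonal_basis M B \<and> (\<forall>e \<in> B. \<exists>\<mu>. simple_eigenfunction M L \<mu> e))) \<and>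
      (is_lowest (eigenvalues M L) \<mu>\<^sub>0 \<and>
       simple_eigenfunction M L (of_real \<mu>\<^sub>0) (\<lambda>x. of_real (\<phi> x))) \<and>
      (\<exists>\<mu>\<^sub>1. is_lowest (eigenvalues M L - {of_real \<mu>\<^sub>0}) \<mu>\<^sub>1 \<and> \<mu>\<^sub>0 < \<mu>\<^sub>1 \<and> 0 < \<mu>\<^sub>1)"
proof -
  define a t s where "a = x_end c" and "t = sqrt 2 * a" and "s = sqrt (1 + c\<^sup>2)"
  have s: "s > 0" by (simp add: s_def add_pos_nonneg)
  have t: "0 < t" "t < pi" "cos t = - c / s" using x_end_bounds[of c] by (simp_all add: t_def a_def s_def)
  have a: "a > 0" using t(1) by (simp add: t_def zero_less_mult_iff)
  have sint: "sin t > 0" using t by (intro sin_gt_zero)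
  have c: "c = - s * cos t" using t(3) s by simp
  define \<psi> where "\<psi> x = c + s * cos (sqrt 2 * x)" for x
  define \<psi>' where "\<psi>' x = - (sqrt 2 * s * sin (sqrt 2 * x))" for x
  \<comment> \<open>Since \<open>c = - s * cos t\<close>, the profile is a difference of cosines;
    the product formula exhibits one sine factor for each endpoint, and the product of their
    arguments is \<open>(a\<^sup>2 - x\<^sup>2) / 2\<close>.\<close>
  have fac: "\<psi> x = 2 * s * (sin ((t + sqrt 2 * x) / 2) * sin ((t - sqrt 2 * x) / 2))" for x
    using cos_diff_cos[of "sqrt 2 * x" t] by (simp add: \<psi>_def c algebra_simps)
  have prod: "(t + sqrt 2 * x) / 2 * ((t - sqrt 2 * x) / 2) = (a\<^sup>2 - x\<^sup>2) / 2" for x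
    by (simp add: t_def power2_eq_square field_simps)
  have range: "0 \<le> (t + sqrt 2 * x) / 2" "(t + sqrt 2 * x) / 2 \<le> t" "0 \<le> (t - sqrt 2 * x) / 2" "(t - sqrt 2 * x) / 2 \<le> t"
    if "\<bar>x\<bar> < a" for x
  proof -
    have "\<bar>sqrt 2 * x\<bar> \<le> t" unfolding t_def abs_mult using that by (intro mult_mono) auto
    then show "0 \<le> (t + sqrt 2 * x) / 2" "(t + sqrt 2 * x) / 2 \<le> t" "0 \<le> (t - sqrt 2 * x) / 2" "(t - sqrt 2 * x) / 2 \<le> t"
      by (auto simp: abs_le_iff)
  qed
  \<comment> \<open>Each sine factor lies between its chord of slope \<open>sin t / t\<close> and
    its tangent at 0; multiplying the two factors gives the constants
    \<open>m = s * (sin t / t)\<^sup>2\<close> and \<open>k = s\<close>.\<close>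
  interpret profile a c "s * (sin t / t)\<^sup>2" s \<psi> \<psi>'
  proof
    show "a > 0" by (rule a)
    show "s * (sin t / t)\<^sup>2 > 0" using s sint t by simp
    fix x :: real
    show "(\<psi> has_real_derivative \<psi>' x) (at x)"
      unfolding \<psi>_def[abs_def] \<psi>'_def by (auto intro!: derivative_eq_intros)
    show "(\<psi>' has_real_derivative 2 * c - 2 * \<psi> x) (at x)"
      unfolding \<psi>_def \<psi>'_def[abs_def] by (auto intro!: derivative_eq_intros simp: algebra_simps)
    assume x: "\<bar>x\<bar> < a"
    note r = range[OF x]
    define p q where "p = (t + sqrt 2 * x) / 2" and "q = (t - sqrt 2 * x) / 2"
    have pq: "0 \<le> p" "p \<le> t" "0 \<le> q" "q \<le> t" "p * q = (a\<^sup>2 - x\<^sup>2) / 2" using r prod by (simp_all add: p_def q_def)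
    have psi: "\<psi> x = 2 * s * (sin p * sin q)" by (simp add: fac p_def q_def)
    have "(sin t / t * p) * (sin t / t * q) \<le> sin p * sin q"
      using pq t sint by (intro mult_mono sin_ge_chord) (auto intro!: sin_ge_zero)
    then have "2 * s * ((sin t / t * p) * (sin t / t * q)) \<le> \<psi> x" unfolding psi using s by (intro mult_left_mono) auto
    also have "2 * s * ((sin t / t * p) * (sin t / t * q)) = 2 * s * ((sin t / t)\<^sup>2 * (p * q))"
      by (simp add: power2_eq_square)
    finally show "s * (sin t / t)\<^sup>2 * (a\<^sup>2 - x\<^sup>2) \<le> \<psi> x" unfolding pq by simp
    have "sin p * sin q \<le> p * q"
      using pq t by (intro mult_mono sin_x_le_x sin_ge_zero) auto
    then have "\<psi> x \<le> 2 * s * (p * q)" unfolding psi using s by (intro mult_left_mono) auto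
    then show "\<psi> x \<le> s * (a\<^sup>2 - x\<^sup>2)" unfolding pq by simp
  qed
  have phi: "\<phi> = phi c" by (simp add: fun_eq_iff \<phi>_def phi_def \<psi>_def s_def)
  have I: "I = I_phi c" unfolding I_phi_def a_def[symmetric] by (rule I_def)
  have T: "T = SL_friedrichs (phi c) (I_phi c)" by (simp add: T_def phi I)
  have nz: "\<psi>' (1 * a) \<noteq> 0" "\<psi>' (- 1 * a) \<noteq> 0" using sint s by (simp_all add: \<psi>'_def t_def)
  have lp: "limit_point_at (phi c) (I_phi c) (x_end c)" "limit_point_at (phi c) (I_phi c) (- x_end c)"
    using limit_point[OF _ nz(1), unfolded phi I] limit_point[OF _ nz(2), unfolded phi I] by (simp_all add: a_def)
  have api: "sqrt 2 * a < pi" using t by (simp add: t_def)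
  show ?thesis
    unfolding Let_def
    using lp discrete_spectrum eigenfunction_basis ground_state excited_state[OF api]
    unfolding T I phi by blast
qed

end
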